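(* Let $(B,\|\cdot\|)$ be a real separable Banach space, let $X, X_1, X_2, \ldots$ be i.i.d. $B$-valued random variables and $S_n=\sum_{i=1}^n X_i$. Let $h\in\mathcal{H}$, $\Psi(x)=\sqrt{xh(x)}$ for $x\ge 0$, and $a_n=\Psi(n)$. Then $$\limsup_{n\to\infty}\frac{\|S_n\|}{a_n}<\infty \quad\text{a.s.}$$ if and only if all of the following hold: (i) $\mathbb{E}X=0$ and $\mathbb{E}\,\Psi^{-1}(\|X\|)<\infty$; (ii) the sequence $\{S_n/a_n;\ n\ge 1\}$ is bounded in probability; (iii) there exists $c\in[0,\infty)$ such that $$\sum_{n=1}^\infty \frac1n\exp\left\{-\frac{c^2h(n)}{2H(a_n)}\right\}<\infty.$$
   Context: $\mathcal{H}$ denotes the set of all continuous, non-decreasing functions $h:[0,\infty)\to(0,\infty)$ that are slowly varying at infinity; $\Psi^{-1}$ is the inverse function of $\Psi$. $B^*$ is the topological dual of $B$ and $B_1^*$ its closed unit ball. The function $H:[0,\infty)\to[0,\infty)$ is defined by $H(t)=\sup_{f\in B_1^*}\mathbb{E} f^2(X)I\{\|X\|\le t\}$. *)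

theory Defs
  imports "HOL-Probability.Probability"
begin

definition slowly_varying :: "(real \<Rightarrow> real) \<Rightarrow> bool" where
  "slowly_varying h \<longleftrightarrow>
     (\<forall>c::real. c > 0 \<longrightarrow> ((\<lambda>x. h (c * x) / h x) \<longlongrightarrow> 1) at_top)"

definition class_H :: "(real \<Rightarrow> real) set" where
  "class_H = {h. continuous_on {0..} h \<and> mono_on {0..} h \<and> (\<forall>x\<ge>0. h x > 0)
                  \<and> slowly_varying h}"

definition Psi :: "(real \<Rightarrow> real) \<Rightarrow> real \<Rightarrow> real" where
  "Psi h x = sqrt (x * h x)"

text \<open>Inverse of Psi on [0,inf) (Psi is a bijection of [0,inf) when h is in class_H).\<close>
definition Psi_inv :: "(real \<Rightarrow> real) \<Rightarrow> real \<Rightarrow> real" where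
  "Psi_inv h = inv_into {0..} (Psi h)"

definition H_fun :: "'a measure \<Rightarrow> ('a \<Rightarrow> 'b::real_normed_vector) \<Rightarrow> real \<Rightarrow> real" where
  "H_fun M X t = (SUP f \<in> {f :: 'b \<Rightarrow>\<^sub>L real. norm f \<le> 1}.
      integral\<^sup>L M (\<lambda>\<omega>. (blinfun_apply f (X \<omega>))\<^sup>2 * indicator {\<omega>'. norm (X \<omega>') \<le> t} \<omega>))"

text \<open>Summand of condition (iii); convention exp(-infinity) = 0 when H(a_n) = 0.\<close>
definition series_term :: "'a measure \<Rightarrow> ('a \<Rightarrow> 'b::real_normed_vector) \<Rightarrow> (real \<Rightarrow> real)
     \<Rightarrow> real \<Rightarrow> nat \<Rightarrow> real" where
  "series_term M X h c n =
     (let Hn = H_fun M X (Psi h (real n)) in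
      if Hn = 0 then 0 else (1 / real n) * exp (- (c\<^sup>2 * h (real n)) / (2 * Hn)))"

end

theory Submission imports Defs begin

text \<open>
Everything is read along n = 2^k, with Y the symmetrization of X and a = a_n.

Sufficiency. Ottaviani and Borel-Cantelli reduce the claim to the summability over k of the tails of
norm S_n at a multiple of a. Let b = beta_k be, up to a term 1/n, the moment
n E (norm Y / a)^(9/4) 1(norm Y \<le> a); it is summable over k because E Psi_inv (norm X) is finite,
which also disposes of the summands with norm Y > a. On b^2 a < norm Y \<le> a the Efron-Stein bound for
the variance only gives a tail of order sqrt b, which one Hoffmann-Joergensen step squares to b. On
norm Y \<le> b^2 a, condition on the norms and use Maurey's convexity inequality for random signs: the
Rademacher sum exceeds its mean with a Gaussian tail governed by the empirical weak variance. The mean is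
a self-bounding function of the summands, so Efron-Stein controls it. The empirical weak variance is
controlled by symmetrization and contraction, at the price of a summable error and of H(a_n) n plus a
small multiple of a^2. Comparing the Gaussian tail with (iii) finishes the argument.

Necessity. A product of probabilities of independent events that stays positive replaces the second
Borel-Cantelli lemma and gives the summability of the tails. For (iii), choose a functional that nearly
attains H(a_n), apply the Paley-Zygmund inequality to a block sum, and multiply over 2^j independent
blocks: this bounds the tail of norm S_n below by a Gaussian one, up to errors summable by the same moment.
\<close>

section \<open>Norming functionals\<close>

text \<open>The conditions ask only for some constants, so constants are wasted freely; what must
  survive is summability over k, hence every error has to be of first order in b. With summands of
  norm at most r and a tolerance w for the empirical weak variance, symmetrization and contraction
  cost a probability of order r a / w. The tolerance w = b a^2 is harmless in a Gaussian tail,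
  because exp (- C / b) is at most b / C; then r = b^2 a leaves an error of order b, whence the
  level b^2 a. Above it the excess 1/4 of the exponent over 2 is worth a factor (b^2) powr (1/4) =
  sqrt b, which bounds the normalized variance by sqrt b, just what one squaring returns to b. Weak
  quantities are taken over finite sets of functionals, where maxima are attained and measurable,
  before passing to the norm. Signs are averages over a finite cube and independent copies are other
  terms of the same sequence, so the probability space never changes. In the lower bound,
  symmetrization could destroy the weak variance if the truncated mean of the functional were large;
  the mean 0, derived from boundedness, and a positive lower bound for H exclude this.\<close>

definition sublinear :: "('b::real_normed_vector \<Rightarrow> real) \<Rightarrow> bool" where
  "sublinear q \<longleftrightarrow> (\<forall>x y. q (x + y) \<le> q x + q y) \<and> (\<forall>t x. 0 \<le> t \<longrightarrow> q (t *\<^sub>R x) = t * q x)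
     \<and> (\<forall>x. q x \<le> norm x)"

lemma sublinear_lower: assumes "sublinear q" shows "- norm x \<le> q x"
proof -
  have "0 = q (0 *\<^sub>R x)" using assms unfolding sublinear_def by (metis order_refl mult_zero_left)
  also have "\<dots> = q (x + - x)" by simp
  also have "\<dots> \<le> q x + q (- x)" using assms unfolding sublinear_def by blast
  also have "q (- x) \<le> norm x" using assms unfolding sublinear_def by (metis norm_minus_cancel)
  finally show ?thesis by simp
qed

text \<open>The largest sublinear functional below q whose value at \<open>- z\<close> is at most
  \<open>- q z\<close>; it is the device that forces linearity of minimal functionals.\<close>

definition sublinear_cut :: "('b::real_normed_vector \<Rightarrow> real) \<Rightarrow> 'b \<Rightarrow> 'b \<Rightarrow> real" where
  "sublinear_cut q z y = (INF t\<in>{0..}. q (y + t *\<^sub>R z) - t * q z)"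

text \<open>Infima are compared one parameter at a time: for a sum of two points the parameters s
  and t combine to s + t, and scaling the point by c scales the parameter to c t. The bound
  \<open>- q (- y)\<close> keeps the infimum finite.\<close>

lemma
  assumes q: "sublinear q"
  shows sublinear_cut: "sublinear (sublinear_cut q z)"
    and sublinear_cut_le: "0 \<le> t \<Longrightarrow> sublinear_cut q z y \<le> q (y + t *\<^sub>R z) - t * q z"
proof -
  have add: "q (x + y) \<le> q x + q y" and hom: "0 \<le> t \<Longrightarrow> q (t *\<^sub>R x) = t * q x"
    and le: "q x \<le> norm x" for x y t
    using q unfolding sublinear_def by auto
  have low: "- q (- y) \<le> q (y + t *\<^sub>R z) - t * q z" if "0 \<le> t" for y t
    using add[of "y + t *\<^sub>R z" "- y"] hom[OF that, of z] by simp
  have bdd: "bdd_below ((\<lambda>t. q (y + t *\<^sub>R z) - t * q z) ` {0..})" for y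
    using low by (intro bdd_belowI2[where m = "- q (- y)"]) auto
  show cut_le: "sublinear_cut q z y \<le> q (y + t *\<^sub>R z) - t * q z" if "0 \<le> t" for t y
    unfolding sublinear_cut_def using bdd that by (intro cINF_lower) auto
  have cut_ge: "c \<le> sublinear_cut q z y" if "\<And>t. 0 \<le> t \<Longrightarrow> c \<le> q (y + t *\<^sub>R z) - t * q z" for c y
    unfolding sublinear_cut_def by (rule cINF_greatest) (auto intro: that)
  have 1: "sublinear_cut q z (x + y) \<le> sublinear_cut q z x + sublinear_cut q z y" for x y
  proof -
    have "sublinear_cut q z (x + y) - (q (x + s *\<^sub>R z) - s * q z) \<le> sublinear_cut q z y" if s: "0 \<le> s" for s
    proof (rule cut_ge)
      fix t :: real assume t: "0 \<le> t"
      have "sublinear_cut q z (x + y) \<le> q ((x + y) + (s + t) *\<^sub>R z) - (s + t) * q z"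
        using s t by (intro cut_le) auto
      also have "(x + y) + (s + t) *\<^sub>R z = (x + s *\<^sub>R z) + (y + t *\<^sub>R z)"
        by (simp add: algebra_simps)
      also have "q \<dots> \<le> q (x + s *\<^sub>R z) + q (y + t *\<^sub>R z)" by (rule add)
      finally show "sublinear_cut q z (x + y) - (q (x + s *\<^sub>R z) - s * q z) \<le> q (y + t *\<^sub>R z) - t * q z"
        by (simp add: algebra_simps)
    qed
    then have "sublinear_cut q z (x + y) - sublinear_cut q z y \<le> sublinear_cut q z x"
      by (intro cut_ge) (simp add: algebra_simps)
    then show ?thesis by simp
  qed
  have 2: "sublinear_cut q z (c *\<^sub>R x) \<le> c * sublinear_cut q z x" if c: "0 < c" for c x
  proof -
    have "sublinear_cut q z (c *\<^sub>R x) / c \<le> sublinear_cut q z x"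
    proof (rule cut_ge)
      fix t :: real assume t: "0 \<le> t"
      have "sublinear_cut q z (c *\<^sub>R x) \<le> q (c *\<^sub>R x + (c * t) *\<^sub>R z) - (c * t) * q z"
        using c t by (intro cut_le) auto
      also have "c *\<^sub>R x + (c * t) *\<^sub>R z = c *\<^sub>R (x + t *\<^sub>R z)" by (simp add: algebra_simps)
      finally have "sublinear_cut q z (c *\<^sub>R x) \<le> c * (q (x + t *\<^sub>R z) - t * q z)"
        using hom[of c "x + t *\<^sub>R z"] c by (simp add: right_diff_distrib)
      then show "sublinear_cut q z (c *\<^sub>R x) / c \<le> q (x + t *\<^sub>R z) - t * q z"
        using c by (simp add: field_simps)
    qed
    then show ?thesis using c by (simp add: field_simps)
  qed
  have 3: "sublinear_cut q z (c *\<^sub>R x) = c * sublinear_cut q z x" if c: "0 \<le> c" for c x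
  proof (cases "c = 0")
    case True
    have "sublinear_cut q z 0 \<le> 0" using cut_le[of 0 0] hom[of 0 0] by simp
    moreover have "0 \<le> sublinear_cut q z 0" using hom by (intro cut_ge) auto
    ultimately show ?thesis using True by simp
  next
    case False
    then have "0 < c" using c by simp
    then have "sublinear_cut q z x \<le> 1/c * sublinear_cut q z (c *\<^sub>R x)"
      using 2[of "1/c" "c *\<^sub>R x"] by simp
    with 2[OF \<open>0 < c\<close>, of x] \<open>0 < c\<close> show ?thesis by (simp add: field_simps)
  qed
  show "sublinear (sublinear_cut q z)"
    unfolding sublinear_def
    using 1 3 order_trans[OF cut_le[of 0, simplified] le] by auto
qed

lemma sublinear_norm: "sublinear norm"
  by (auto simp: sublinear_def norm_triangle_ineq)

text \<open>Minimality forces q to coincide with its own cut along y; reading that cut at t = 1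
  gives the reverse of subadditivity.\<close>

lemma minimal_sublinear_additive:
  assumes q: "sublinear q" and min: "\<And>r. sublinear r \<Longrightarrow> r \<le> q \<Longrightarrow> r = q"
  shows "q (x + y) = q x + q y"
proof (rule antisym)
  show "q (x + y) \<le> q x + q y" using q unfolding sublinear_def by blast
  have "sublinear_cut q y \<le> q"
    using sublinear_cut_le[OF q, of 0 y] by (auto simp: le_fun_def)
  from min[OF sublinear_cut[OF q] this] show "q x + q y \<le> q (x + y)"
    using sublinear_cut_le[OF q, of 1 y x] by simp
qed

text \<open>Zorn's lemma for the reversed order \<open>R\<close>, whose maximal elements are minimal
  functionals. A chain is bounded by its pointwise infimum; this is subadditive because the two
  functionals used at x and at y can both be replaced by the smaller of them.\<close>

lemma exists_minimal_sublinear: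
  fixes q0 :: "'b::real_normed_vector \<Rightarrow> real"
  assumes "sublinear q0"
  shows "\<exists>q. sublinear q \<and> q \<le> q0 \<and> (\<forall>r. sublinear r \<longrightarrow> r \<le> q \<longrightarrow> r = q)"
proof -
  define A where "A = {q. sublinear q \<and> q \<le> q0}"
  define R where "R = {(q, r). q \<in> A \<and> r \<in> A \<and> r \<le> q}"
  have "\<exists>m\<in>Field R. \<forall>a\<in>Field R. (m, a) \<in> R \<longrightarrow> a = m"
  proof (rule Zorns_po_lemma)
    have "Field R = A" unfolding R_def Field_def by (auto simp: Domain_iff Range_iff)
    show "Partial_order R"
      unfolding partial_order_on_def preorder_on_def refl_on_def trans_def antisym_def \<open>Field R = A\<close>
      by (auto simp: R_def)
    fix C assume C: "C \<in> Chains R"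
    have CA: "C \<subseteq> A" using C unfolding Chains_def R_def by auto
    have CC: "q \<le> r \<or> r \<le> q" if "q \<in> C" "r \<in> C" for q r :: "'b \<Rightarrow> real"
      using C that unfolding Chains_def R_def by auto
    show "\<exists>u\<in>Field R. \<forall>a\<in>C. (a, u) \<in> R"
    proof (cases "C = {}")
      case True
      then show ?thesis using assms unfolding \<open>Field R = A\<close> A_def by auto
    next
      case False
      define u where "u y = (INF q\<in>C. q y)" for y
      have bdd: "bdd_below ((\<lambda>q. q y) ` C)" for y
        using CA sublinear_lower unfolding A_def by (intro bdd_belowI2[where m = "- norm y"]) auto
      have u_le: "u y \<le> q y" if "q \<in> C" for q y
        unfolding u_def using bdd that by (intro cINF_lower)
      have u_ge: "c \<le> u y" if "\<And>q. q \<in> C \<Longrightarrow> c \<le> q y" for c y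
        unfolding u_def using False by (intro cINF_greatest that)
      have Cs: "q \<in> C \<Longrightarrow> sublinear q" for q using CA unfolding A_def by auto
      have 1: "u (x + y) \<le> u x + u y" for x y
      proof -
        have "u (x + y) - q x \<le> r y" if qr: "q \<in> C" "r \<in> C" for q r :: "'b \<Rightarrow> real"
        proof -
          obtain s where s: "s \<in> C" "s \<le> q" "s \<le> r" using CC[OF qr] qr order_refl by blast
          have "u (x + y) \<le> s (x + y)" by (rule u_le[OF s(1)])
          also have "\<dots> \<le> s x + s y" using Cs[OF s(1)] unfolding sublinear_def by blast
          also have "\<dots> \<le> q x + r y" using s by (intro add_mono) (auto simp: le_fun_def)
          finally show ?thesis by simp
        qed
        then have "u (x + y) - q x \<le> u y" if "q \<in> C" for q using that by (intro u_ge)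
        then have "u (x + y) - u y \<le> u x" by (intro u_ge) (simp add: algebra_simps)
        then show ?thesis by simp
      qed
      have 2: "u (t *\<^sub>R x) = t * u x" if "0 \<le> t" for t x
      proof (cases "t = 0")
        case True
        have "q 0 = 0" if "q \<in> C" for q
          using Cs[OF that] unfolding sublinear_def by (metis mult_zero_left order_refl scaleR_zero_left)
        then have "u 0 = (INF q\<in>C. 0)" unfolding u_def by (intro INF_cong) auto
        with True False show ?thesis by simp
      next
        case nz: False
        then have t: "0 < t" using that by simp
        have h: "q (t *\<^sub>R x) = t * q x" if "q \<in> C" for q
          using Cs[OF that] t unfolding sublinear_def by auto
        have "t * u x \<le> u (t *\<^sub>R x)"
        proof (rule u_ge)
          fix q assume "q \<in> C"
          then show "t * u x \<le> q (t *\<^sub>R x)" using h[of q] u_le[of q x] t by simp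
        qed
        moreover have "u (t *\<^sub>R x) / t \<le> u x"
          using h u_le[of _ "t *\<^sub>R x"] t by (intro u_ge) (simp add: divide_le_eq mult.commute)
        ultimately show ?thesis using t by (simp add: field_simps)
      qed
      obtain c where c: "c \<in> C" using False by auto
      have "sublinear u" unfolding sublinear_def
        using 1 2 u_le[OF c] Cs[OF c] unfolding sublinear_def by (meson order_trans)
      moreover have "u \<le> q0" using u_le[OF c] CA c unfolding A_def le_fun_def by (auto intro: order_trans)
      ultimately have "u \<in> A" unfolding A_def by simp
      then show ?thesis using CA u_le \<open>Field R = A\<close> by (intro bexI[of _ u]) (auto simp: R_def le_fun_def)
    qed
  qed
  then obtain m where "m \<in> Field R" "\<And>a. a \<in> Field R \<Longrightarrow> (m, a) \<in> R \<Longrightarrow> a = m" by blast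
  moreover have "Field R = A" unfolding R_def Field_def by (auto simp: Domain_iff Range_iff)
  ultimately show ?thesis unfolding A_def R_def by (intro exI[of _ m]) (auto intro: order_trans)
qed

text \<open>Hahn-Banach for a single vector. Cutting the norm along x pushes the value at - x down
  to - norm x. A minimal sublinear functional below this cut is additive, hence linear, and its
  value at - x forces norm x at x.\<close>

lemma norming_functional:
  fixes x :: "'b::real_normed_vector"
  shows "\<exists>f :: 'b \<Rightarrow>\<^sub>L real. norm f \<le> 1 \<and> blinfun_apply f x = norm x"
proof -
  obtain q where q: "sublinear q" and le: "q \<le> sublinear_cut norm x"
    and min: "\<And>r. sublinear r \<Longrightarrow> r \<le> q \<Longrightarrow> r = q"
    using exists_minimal_sublinear[OF sublinear_cut[OF sublinear_norm]] by blast
  have add: "q (y + z) = q y + q z" for y z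
    by (rule minimal_sublinear_additive[OF q min])
  have hom: "0 \<le> t \<Longrightarrow> q (t *\<^sub>R y) = t * q y" for t y using q unfolding sublinear_def by auto
  have q0: "q 0 = 0" using hom[of 0 0] by simp
  have minus: "q (- y) = - q y" for y using add[of y "- y"] q0 by simp
  have scale: "q (t *\<^sub>R y) = t * q y" for t y
    using hom[of t y] hom[of "- t" y] minus[of "t *\<^sub>R y"] by (cases "0 \<le> t") auto
  have abs: "\<bar>q y\<bar> \<le> norm y" for y
    using sublinear_lower[OF q, of y] q unfolding sublinear_def by (simp add: abs_le_iff minus)
  have bl: "bounded_linear q"
    by (rule bounded_linear_intro[where K = 1]) (use add scale abs in auto)
  define f where "f = Blinfun q"
  have f: "blinfun_apply f = q" unfolding f_def by (rule bounded_linear_Blinfun_apply[OF bl])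
  have "q (- x) \<le> sublinear_cut norm x (- x)" using le by (auto simp: le_fun_def)
  also have "\<dots> \<le> norm (- x + 1 *\<^sub>R x) - 1 * norm x" by (rule sublinear_cut_le[OF sublinear_norm]) simp
  finally have "norm x \<le> q x" by (simp add: minus)
  moreover have "q x \<le> norm x" using abs[of x] by simp
  moreover have "norm f \<le> 1" by (rule norm_blinfun_bound) (use abs f in auto)
  ultimately show ?thesis using f by (intro exI[of _ f]) auto
qed

lemma blinfun_apply_le_norm:
  assumes "norm (f :: 'b::real_normed_vector \<Rightarrow>\<^sub>L real) \<le> 1" shows "\<bar>blinfun_apply f x\<bar> \<le> norm x"
proof -
  have "\<bar>blinfun_apply f x\<bar> \<le> norm f * norm x" using norm_blinfun[of f x] by simp
  also have "\<dots> \<le> 1 * norm x" using assms by (intro mult_right_mono) auto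
  finally show ?thesis by simp
qed

text \<open>Functionals norming a countable dense set nearly norm every vector, so the norm is a
  countable supremum and can be reached through finite sets of functionals. The zero functional
  comes first to make every finite maximum over an initial segment nonnegative.\<close>

lemma countable_norming_sequence:
  obtains fs :: "nat \<Rightarrow> 'b::{real_normed_vector, second_countable_topology} \<Rightarrow>\<^sub>L real"
  where "fs 0 = 0" and "\<And>j. norm (fs j) \<le> 1" and "\<And>x c. 0 \<le> c \<Longrightarrow> c < norm x \<Longrightarrow> \<exists>j. c < blinfun_apply (fs j) x"
proof -
  obtain D :: "'b set" where D: "countable D" and dense: "\<And>X. open X \<Longrightarrow> X \<noteq> {} \<Longrightarrow> \<exists>d\<in>D. d \<in> X"
    using countable_dense_setE[where 'a='b] by metis
  obtain g where g: "\<And>x::'b. norm (g x :: 'b \<Rightarrow>\<^sub>L real) \<le> 1" "\<And>x. blinfun_apply (g x) x = norm x"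
    using norming_functional by metis
  define fs where "fs j = (case j of 0 \<Rightarrow> 0 | Suc i \<Rightarrow> g (from_nat_into D i))" for j
  have "\<exists>j. c < blinfun_apply (fs j) x" if "0 \<le> c" "c < norm x" for x c
  proof -
    have "ball x ((norm x - c)/2) \<noteq> {}" using that by simp
    then obtain d where d: "d \<in> D" "dist x d < (norm x - c)/2"
      using dense[of "ball x ((norm x - c)/2)"] by auto
    have "\<bar>blinfun_apply (g d) (x - d)\<bar> \<le> norm (x - d)" by (rule blinfun_apply_le_norm[OF g(1)])
    then have "norm d - norm (x - d) \<le> blinfun_apply (g d) x"
      using g(2)[of d] by (simp add: blinfun.diff_right)
    moreover have "norm x \<le> norm d + norm (x - d)" using norm_triangle_ineq[of d "x - d"] by simp
    ultimately have "c < blinfun_apply (g d) x" using d(2) by (simp add: dist_norm)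
    moreover have "fs (Suc (to_nat_on D d)) = g d" unfolding fs_def using d D by simp
    ultimately show ?thesis by metis
  qed
  moreover have "norm (fs j) \<le> 1" for j unfolding fs_def using g by (cases j) auto
  moreover have "fs 0 = 0" unfolding fs_def by simp
  ultimately show ?thesis using that by blast
qed

section \<open>Random signs\<close>

text \<open>Entries from n on are 0, so that each pattern of n signs is represented exactly once and
  the set is finite.\<close>

definition signs :: "nat \<Rightarrow> (nat \<Rightarrow> real) set" where
  "signs n = {e. (\<forall>i<n. e i = 1 \<or> e i = -1) \<and> (\<forall>i\<ge>n. e i = 0)}"

definition sign_avg :: "nat \<Rightarrow> ((nat \<Rightarrow> real) \<Rightarrow> real) \<Rightarrow> real" where
  "sign_avg n G = (\<Sum>e\<in>signs n. G e) / 2 ^ n"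

lemma signs_0: "signs 0 = {\<lambda>_. 0}"
  by (auto simp: signs_def)

lemma signs_upd: "e \<in> signs n \<Longrightarrow> s = 1 \<or> s = -1 \<Longrightarrow> e(n := s) \<in> signs (Suc n)"
  by (auto simp: signs_def less_Suc_eq)

lemma signs_Suc: "signs (Suc n) = (\<lambda>e. e(n := 1)) ` signs n \<union> (\<lambda>e. e(n := -1)) ` signs n"
proof (intro equalityI subsetI)
  fix e assume e: "e \<in> signs (Suc n)"
  then have "e(n := 0) \<in> signs n" by (auto simp: signs_def)
  moreover have "e = (e(n := 0))(n := 1) \<or> e = (e(n := 0))(n := -1)"
    using e by (auto simp: signs_def fun_eq_iff)
  ultimately show "e \<in> (\<lambda>e. e(n := 1)) ` signs n \<union> (\<lambda>e. e(n := -1)) ` signs n" by blast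
qed (auto simp: signs_upd)

lemma finite_signs [simp]: "finite (signs n)"
  by (induction n) (simp_all add: signs_0 signs_Suc)

lemma sum_signs_Suc:
  "(\<Sum>e\<in>signs (Suc n). G e) = (\<Sum>e\<in>signs n. G (e(n := 1))) + (\<Sum>e\<in>signs n. G (e(n := -1)) :: real)"
proof -
  have z: "e n = 0" if "e \<in> signs n" for e using that by (auto simp: signs_def)
  have inj: "inj_on (\<lambda>e. e(n := s)) (signs n)" for s
  proof (rule inj_onI)
    fix e e' assume a: "e \<in> signs n" "e' \<in> signs n" "e(n := s) = e'(n := s)"
    then have "e i = e' i" if "i \<noteq> n" for i using that by (metis fun_upd_other)
    with z[OF a(1)] z[OF a(2)] show "e = e'" by (metis ext)
  qed
  have "(\<lambda>e. e(n := 1::real)) ` signs n \<inter> (\<lambda>e. e(n := -1)) ` signs n = {}"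
    by (auto dest: fun_cong[where x = n])
  then show ?thesis unfolding signs_Suc
    by (subst sum.union_disjoint) (simp_all add: sum.reindex[OF inj])
qed

lemma sign_avg_0 [simp]: "sign_avg 0 G = G (\<lambda>_. 0)"
  by (simp add: sign_avg_def signs_0)

lemma sign_avg_Suc:
  "sign_avg (Suc n) G = (sign_avg n (\<lambda>e. G (e(n := 1))) + sign_avg n (\<lambda>e. G (e(n := -1)))) / 2"
  by (simp add: sign_avg_def sum_signs_Suc add_divide_distrib)

lemma sign_avg_const [simp]: "sign_avg n (\<lambda>_. c) = c"
  by (induction n) (simp_all add: sign_avg_Suc)

lemma sign_avg_add: "sign_avg n (\<lambda>e. F e + G e) = sign_avg n F + sign_avg n G"
  by (simp add: sign_avg_def sum.distrib add_divide_distrib)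

lemma sign_avg_diff: "sign_avg n (\<lambda>e. F e - G e) = sign_avg n F - sign_avg n G"
  by (simp add: sign_avg_def sum_subtractf diff_divide_distrib)

lemma sign_avg_cmult: "sign_avg n (\<lambda>e. c * G e) = c * sign_avg n G"
  by (simp add: sign_avg_def sum_distrib_left)

lemma sign_avg_sum: "sign_avg n (\<lambda>e. \<Sum>i\<in>I. G i e) = (\<Sum>i\<in>I. sign_avg n (G i))"
  by (induction I rule: infinite_finite_induct) (simp_all add: sign_avg_add)

lemma sign_avg_mono: "(\<And>e. e \<in> signs n \<Longrightarrow> F e \<le> G e) \<Longrightarrow> sign_avg n F \<le> sign_avg n G"
  by (simp add: sign_avg_def divide_right_mono sum_mono)

lemma sign_avg_cong: "(\<And>e. e \<in> signs n \<Longrightarrow> F e = G e) \<Longrightarrow> sign_avg n F = sign_avg n G"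
  by (simp add: sign_avg_def)

lemma sign_avg_flip: assumes "i < n" shows "sign_avg n (\<lambda>e. G (e(i := - e i))) = sign_avg n G"
proof -
  have "(\<Sum>e\<in>signs n. G (e(i := - e i))) = (\<Sum>e\<in>signs n. G e)"
    by (rule sum.reindex_bij_witness[where i = "\<lambda>e. e(i := - e i)" and j = "\<lambda>e. e(i := - e i)"])
       (use assms in \<open>auto simp: signs_def\<close>)
  then show ?thesis by (simp add: sign_avg_def)
qed

lemma sign_avg_uminus: "sign_avg n (\<lambda>e. G (\<lambda>i. - e i)) = sign_avg n G"
proof -
  have "(\<Sum>e\<in>signs n. G (\<lambda>i. - e i)) = (\<Sum>e\<in>signs n. G e)"
    by (rule sum.reindex_bij_witness[where i = "\<lambda>e i. - e i" and j = "\<lambda>e i. - e i"])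
       (auto simp: signs_def)
  then show ?thesis by (simp add: sign_avg_def)
qed

section \<open>Exponential averages over signs and Maurey's convexity inequality\<close>

lemma sign_avg_exp_ge: "exp (sign_avg n G) \<le> sign_avg n (\<lambda>e. exp (G e))"
proof -
  define m where "m = sign_avg n G"
  \<comment> \<open>Jensen's inequality through the tangent of exp at the mean m, whose linear part
    averages to 0.\<close>
  have "exp m * (1 + (G e - m)) \<le> exp (G e)" for e
  proof -
    have "exp m * (1 + (G e - m)) \<le> exp m * exp (G e - m)" by (intro mult_left_mono exp_ge_add_one_self) auto
    then show ?thesis by (simp add: exp_diff)
  qed
  then have "sign_avg n (\<lambda>e. exp m * (1 + (G e - m))) \<le> sign_avg n (\<lambda>e. exp (G e))"
    by (intro sign_avg_mono)
  also have "sign_avg n (\<lambda>e. exp m * (1 + (G e - m))) = exp m"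
    by (simp add: sign_avg_cmult sign_avg_add sign_avg_diff m_def)
  finally show ?thesis by (simp add: m_def)
qed

lemma sign_avg_exp_pos: "0 < sign_avg n (\<lambda>e. exp (G e))"
  using sign_avg_exp_ge[of n G] exp_gt_zero[of "sign_avg n G"] by linarith

text \<open>Hoelder's inequality in logarithmic form: once a and b are subtracted from the
  exponents, it is the average of the convexity inequality for exp.\<close>

lemma sign_avg_Hoelder:
  assumes l: "0 \<le> l" "l \<le> 1" and A: "sign_avg n (\<lambda>e. exp (A e)) \<le> exp a"
    and B: "sign_avg n (\<lambda>e. exp (B e)) \<le> exp b"
  shows "sign_avg n (\<lambda>e. exp ((1 - l) * A e + l * B e)) \<le> exp ((1 - l) * a + l * b)"
proof -
  have cv: "exp ((1 - l) * x + l * y) \<le> (1 - l) * exp x + l * exp y" for x y :: real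
  proof -
    have "exp ((1 - l) *\<^sub>R x + l *\<^sub>R y) \<le> (1 - l) * exp x + l * exp y"
      by (rule convex_onD[OF exp_convex]) (use l in auto)
    then show ?thesis by simp
  qed
  define c where "c = (1 - l) * a + l * b"
  have "sign_avg n (\<lambda>e. exp ((1 - l) * A e + l * B e)) =
        sign_avg n (\<lambda>e. exp c * exp ((1 - l) * (A e - a) + l * (B e - b)))"
    by (rule sign_avg_cong) (simp add: c_def exp_add[symmetric] algebra_simps)
  also have "\<dots> \<le> sign_avg n (\<lambda>e. exp c * ((1 - l) * exp (A e - a) + l * exp (B e - b)))"
    by (intro sign_avg_mono mult_left_mono cv) auto
  also have "\<dots> = exp c * ((1 - l) * (exp (-a) * sign_avg n (\<lambda>e. exp (A e)))
       + l * (exp (-b) * sign_avg n (\<lambda>e. exp (B e))))"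
    unfolding sign_avg_cmult[symmetric] sign_avg_add[symmetric]
    by (rule sign_avg_cong) (simp add: exp_diff exp_minus field_simps)
  also have "\<dots> \<le> exp c * ((1 - l) * (exp (-a) * exp a) + l * (exp (-b) * exp b))"
    by (intro mult_left_mono add_mono A B) (use l in auto)
  also have "\<dots> = exp c" by (simp add: exp_minus)
  finally show ?thesis by (simp add: c_def)
qed

text \<open>In the inductive step of Maurey's inequality the mixing weight l = 1 - r replaces the optimal
  min 1 (- ln r), where r is the ratio of the two conditional exponential averages.\<close>
lemma maurey_numeric_ln:
  fixes r :: real assumes r: "0 < r" "r \<le> 1"
  shows "(1 - r)^2 / 2 - r * ln r \<le> ln ((3 - r) / (1 + r))"
proof -
  \<comment> \<open>The number \<open>1 - r\<close> separates the two sides. In both comparisons the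
    difference vanishes at r = 1 and is non-increasing on (0, 1].\<close>
  have a: "(1 - r)^2 / 2 - r * ln r \<le> 1 - r"
  proof -
    define g where "g r = 1 - r - (1 - r)^2 / 2 + r * ln r" for r :: real
    have "g 1 \<le> g r"
    proof (rule DERIV_nonpos_imp_nonincreasing[OF r(2)])
      fix x assume x: "r \<le> x" "x \<le> 1"
      then have "(g has_real_derivative (- 1 + (1 - x) + (ln x + 1))) (at x)"
        unfolding g_def using r by (auto intro!: derivative_eq_intros simp: field_simps)
      moreover have "- 1 + (1 - x) + (ln x + 1) \<le> 0" using ln_le_minus_one[of x] x r by simp
      ultimately show "\<exists>y. (g has_real_derivative y) (at x) \<and> y \<le> 0" by blast
    qed
    then show ?thesis by (simp add: g_def)
  qed
  have b: "1 - r \<le> ln ((3 - r) / (1 + r))"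
  proof -
    define g where "g r = ln (3 - r) - ln (1 + r) - (1 - r)" for r :: real
    have "g 1 \<le> g r"
    proof (rule DERIV_nonpos_imp_nonincreasing[OF r(2)])
      fix x assume x: "r \<le> x" "x \<le> 1"
      then have "(g has_real_derivative (- 1 / (3 - x) - 1 / (1 + x) + 1)) (at x)"
        unfolding g_def using r by (auto intro!: derivative_eq_intros)
      moreover have "- 1 / (3 - x) - 1 / (1 + x) + 1 \<le> 0"
      proof -
        have "(3 - x) * (1 + x) \<le> 4" using zero_le_power2[of "1 - x"] by (simp add: power2_eq_square algebra_simps)
        moreover have p: "0 < (3 - x) * (1 + x)" using x r by simp
        ultimately have "1 \<le> 4 / ((3 - x) * (1 + x))" by simp
        also have "4 / ((3 - x) * (1 + x)) = 1 / (3 - x) + 1 / (1 + x)"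
          using x r by (simp add: divide_simps)
        finally show ?thesis by simp
      qed
      ultimately show "\<exists>y. (g has_real_derivative y) (at x) \<and> y \<le> 0" by blast
    qed
    then show ?thesis using r by (simp add: g_def ln_div)
  qed
  from a b show ?thesis by simp
qed

text \<open>The larger of the two averages, p, allows l = 0 in the bound for \<open>A1\<close>; the
  bound for \<open>A2\<close> is used at l = 1 - q / p. The value 4 matches the two factors 1/2 that
  arise when each of the two exponential averages is split along its last sign.\<close>

lemma maurey_numeric_aux:
  fixes A1 A2 p q :: real
  assumes pq: "0 < q" "q \<le> p"
    and A1: "\<And>l. 0 \<le> l \<Longrightarrow> l \<le> 1 \<Longrightarrow> A1 \<le> exp (l^2/2 - (1 - l) * ln p - l * ln q)"
    and A2: "\<And>l. 0 \<le> l \<Longrightarrow> l \<le> 1 \<Longrightarrow> A2 \<le> exp (l^2/2 - (1 - l) * ln q - l * ln p)"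
  shows "(A1 + A2) * (p + q) \<le> 4"
proof -
  define r where "r = q / p"
  have r: "0 < r" "r \<le> 1" and p: "0 < p" using pq by (auto simp: r_def)
  have "A1 \<le> 1 / p" using A1[of 0] p by (simp add: exp_minus inverse_eq_divide)
  moreover have "A2 \<le> (1 / p) * ((3 - r) / (1 + r))"
  proof -
    have "A2 \<le> exp ((1 - r)^2/2 - r * ln q - (1 - r) * ln p)" using A2[of "1 - r"] r by simp
    also have "(1 - r)^2/2 - r * ln q - (1 - r) * ln p = (1 - r)^2/2 - r * ln r - ln p"
      using pq p by (simp add: r_def ln_div algebra_simps)
    also have "\<dots> \<le> ln ((3 - r) / (1 + r)) - ln p" using maurey_numeric_ln[OF r] by simp
    finally have "A2 \<le> exp (ln ((3 - r) / (1 + r)) - ln p)" by simp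
    then show ?thesis using r p by (simp add: exp_diff mult.commute)
  qed
  ultimately have "A1 + A2 \<le> 1 / p + (1 / p) * ((3 - r) / (1 + r))" by (rule add_mono)
  also have "\<dots> = (1 / p) * (4 / (1 + r))" using r p by (simp add: divide_simps)
  finally have "A1 + A2 \<le> (1 / p) * (4 / (1 + r))" .
  then have "(A1 + A2) * (p + q) \<le> (1 / p) * (4 / (1 + r)) * (p + q)"
    using pq by (intro mult_right_mono) auto
  also have "\<dots> = 4"
  proof -
    have "p + q = p * (1 + r)" using p by (simp add: r_def field_simps)
    then show ?thesis using r p by simp
  qed
  finally show ?thesis .
qed

lemma maurey_numeric:
  fixes A1 A2 p q :: real
  assumes "0 < p" "0 < q"
    and "\<And>l. 0 \<le> l \<Longrightarrow> l \<le> 1 \<Longrightarrow> A1 \<le> exp (l^2/2 - (1 - l) * ln p - l * ln q)"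
    and "\<And>l. 0 \<le> l \<Longrightarrow> l \<le> 1 \<Longrightarrow> A2 \<le> exp (l^2/2 - (1 - l) * ln q - l * ln p)"
  shows "(A1 + A2) * (p + q) \<le> 4"
proof (cases "q \<le> p")
  case True
  then show ?thesis by (intro maurey_numeric_aux assms)
next
  case False
  then have "(A2 + A1) * (q + p) \<le> 4" by (intro maurey_numeric_aux assms) auto
  then show ?thesis by (simp add: add.commute)
qed

text \<open>The infimal convolution of f with a quadratic cost, y ranging over all real points and
  not only over the cube. The constant 1/8 fits the cube: opposite signs differ by 2, so going a
  fraction l of the way costs (2 l)^2 / 8 = l^2 / 2.\<close>

definition infconv :: "nat \<Rightarrow> ((nat \<Rightarrow> real) \<Rightarrow> real) \<Rightarrow> (nat \<Rightarrow> real) \<Rightarrow> real" where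
  "infconv n f x = (INF y. f y + (\<Sum>i<n. (x i - y i)\<^sup>2) / 8)"

definition convex_fun :: "((nat \<Rightarrow> real) \<Rightarrow> real) \<Rightarrow> bool" where
  "convex_fun f \<longleftrightarrow> (\<forall>y z l. 0 \<le> l \<longrightarrow> l \<le> 1 \<longrightarrow> f (\<lambda>i. (1 - l) * y i + l * z i) \<le> (1 - l) * f y + l * f z)"

lemma infconv_le:
  assumes "\<And>y. 0 \<le> f y" shows "infconv n f x \<le> f y + (\<Sum>i<n. (x i - y i)\<^sup>2) / 8"
  unfolding infconv_def
  by (rule cINF_lower) (auto intro!: bdd_belowI2[where m = 0] add_nonneg_nonneg sum_nonneg assms)

lemma infconv_ge:
  assumes "\<And>y. c \<le> f y + (\<Sum>i<n. (x i - y i)\<^sup>2) / 8" shows "c \<le> infconv n f x"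
  unfolding infconv_def by (rule cINF_greatest) (use assms in auto)

lemma convex_fun_upd: "convex_fun f \<Longrightarrow> convex_fun (\<lambda>y. f (y(n := s)))"
  unfolding convex_fun_def
proof (intro allI impI)
  fix y z :: "nat \<Rightarrow> real" and l :: real
  assume cv: "\<forall>y z l. 0 \<le> l \<longrightarrow> l \<le> 1 \<longrightarrow> f (\<lambda>i. (1 - l) * y i + l * z i) \<le> (1 - l) * f y + l * f z"
    and l: "0 \<le> l" "l \<le> 1"
  have eq: "(\<lambda>i. (1 - l) * y i + l * z i)(n := s) = (\<lambda>i. (1 - l) * (y(n := s)) i + l * (z(n := s)) i)"
    by (auto simp: fun_eq_iff algebra_simps)
  show "f ((\<lambda>i. (1 - l) * y i + l * z i)(n := s)) \<le> (1 - l) * f (y(n := s)) + l * f (z(n := s))"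
    unfolding eq by (rule cv[rule_format, OF l])
qed

text \<open>The infimum is tested at the convex combination of a point with last entry s and a point
  with last entry t. Convexity takes care of f and of the first n coordinates; the last coordinate
  moves by 2 l and costs l^2 / 2.\<close>

lemma infconv_step:
  assumes f: "convex_fun f" and pos: "\<And>y. 0 \<le> f y" and l: "0 \<le> l" "l \<le> 1"
    and s: "s = 1 \<and> t = -1 \<or> s = -1 \<and> t = (1::real)"
  shows "infconv (Suc n) f (e(n := s)) \<le> l^2/2 + ((1 - l) * infconv n (\<lambda>y. f (y(n := s))) e
           + l * infconv n (\<lambda>y. f (y(n := t))) e)"
proof -
  let ?L = "infconv (Suc n) f (e(n := s))"
  let ?P = "\<lambda>s y. f (y(n := s)) + (\<Sum>i<n. (e i - y i)\<^sup>2) / 8"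
  have key: "?L \<le> l^2/2 + ((1 - l) * ?P s y + l * ?P t z)" for y z
  proof -
    define w where "w = (\<lambda>i. (1 - l) * (y(n := s)) i + l * (z(n := t)) i)"
    have "?L \<le> f w + (\<Sum>i<Suc n. ((e(n := s)) i - w i)\<^sup>2) / 8"
      by (rule infconv_le) (rule pos)
    also have "f w \<le> (1 - l) * f (y(n := s)) + l * f (z(n := t))"
      using f l unfolding convex_fun_def w_def by blast
    also have "(\<Sum>i<Suc n. ((e(n := s)) i - w i)\<^sup>2) \<le>
        ((1 - l) * (\<Sum>i<n. (e i - y i)\<^sup>2) + l * (\<Sum>i<n. (e i - z i)\<^sup>2)) + 4 * l^2"
    proof -
      have "(s - w n)\<^sup>2 = 4 * l\<^sup>2" using s by (auto simp: w_def power2_eq_square algebra_simps)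
      moreover have "(\<Sum>i<n. (e i - w i)\<^sup>2) \<le> (\<Sum>i<n. (1 - l) * (e i - y i)\<^sup>2 + l * (e i - z i)\<^sup>2)"
      proof (rule sum_mono)
        fix i assume "i \<in> {..<n}"
        then have "e i - w i = (1 - l) * (e i - y i) + l * (e i - z i)"
          by (simp add: w_def algebra_simps)
        moreover have "((1 - l) * a + l * b)\<^sup>2 \<le> (1 - l) * a\<^sup>2 + l * b\<^sup>2" for a b :: real
        proof -
          have "(1 - l) * a\<^sup>2 + l * b\<^sup>2 - ((1 - l) * a + l * b)\<^sup>2 = (l * (1 - l)) * (a - b)\<^sup>2"
            by (simp add: power2_eq_square algebra_simps)
          moreover have "0 \<le> (l * (1 - l)) * (a - b)\<^sup>2" using l by auto
          ultimately show ?thesis by linarith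
        qed
        ultimately show "(e i - w i)\<^sup>2 \<le> (1 - l) * (e i - y i)\<^sup>2 + l * (e i - z i)\<^sup>2" by simp
      qed
      ultimately show ?thesis by (simp add: sum.distrib sum_distrib_left)
    qed
    finally show ?thesis by (simp del: fun_upd_apply add: field_simps)
  qed
  \<comment> \<open>The infima over z and over y are taken one after the other, dividing by l and by
    1 - l; the weights 0 and 1 need separate treatment.\<close>
  have 1: "?L - l^2/2 - (1 - l) * ?P s y \<le> l * infconv n (\<lambda>y. f (y(n := t))) e" for y
  proof (cases "l = 0")
    case True
    then show ?thesis using key[of y undefined] by simp
  next
    case False
    then have lp: "0 < l" using l by simp
    have "(?L - l^2/2 - (1 - l) * ?P s y) / l \<le> ?P t z" for z
      using key[of y z] unfolding pos_divide_le_eq[OF lp] mult.commute[of _ l] by linarith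
    then have "(?L - l^2/2 - (1 - l) * ?P s y) / l \<le> infconv n (\<lambda>y. f (y(n := t))) e"
      by (rule infconv_ge)
    then show ?thesis unfolding pos_divide_le_eq[OF lp] mult.commute[of _ l] .
  qed
  have "?L - l^2/2 - l * infconv n (\<lambda>y. f (y(n := t))) e \<le> (1 - l) * infconv n (\<lambda>y. f (y(n := s))) e"
  proof (cases "l = 1")
    case True
    then show ?thesis using 1[of undefined] by simp
  next
    case False
    then have lp: "0 < 1 - l" using l by simp
    have "(?L - l^2/2 - l * infconv n (\<lambda>y. f (y(n := t))) e) / (1 - l) \<le> ?P s y" for y
      using 1[of y] unfolding pos_divide_le_eq[OF lp] mult.commute[of _ "1 - l"] by linarith
    then have "(?L - l^2/2 - l * infconv n (\<lambda>y. f (y(n := t))) e) / (1 - l) \<le> infconv n (\<lambda>y. f (y(n := s))) e"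
      by (rule infconv_ge)
    then show ?thesis unfolding pos_divide_le_eq[OF lp] mult.commute[of _ "1 - l"] by linarith
  qed
  then show ?thesis by simp
qed

text \<open>Induction on the number of signs. Both slices of f with fixed last entry are convex and
  satisfy the claim; Hoelder's inequality mixes them with a weight l, and the elementary two-point
  inequality holds for a suitable l depending on the ratio of the slice averages.\<close>

theorem maurey_signs:
  assumes "convex_fun f" "\<And>y. 0 \<le> f y"
  shows "sign_avg n (\<lambda>e. exp (infconv n f e)) * sign_avg n (\<lambda>e. exp (- f e)) \<le> 1"
  using assms
proof (induction n arbitrary: f)
  case 0
  have "infconv 0 f (\<lambda>_. 0) \<le> f (\<lambda>_. 0)" using infconv_le[of f 0 "\<lambda>_. 0" "\<lambda>_. 0"] 0 by simp
  then show ?case by (simp add: exp_add[symmetric])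
next
  case (Suc n)
  define fs where "fs s = (\<lambda>y. f (y(n := s)))" for s :: real
  define P where "P s = sign_avg n (\<lambda>e. exp (- fs s e))" for s
  have P: "0 < P s" for s unfolding P_def by (rule sign_avg_exp_pos)
  have IH: "sign_avg n (\<lambda>e. exp (infconv n (fs s) e)) \<le> exp (- ln (P s))" for s
  proof -
    have "sign_avg n (\<lambda>e. exp (infconv n (fs s) e)) * P s \<le> 1"
      unfolding P_def by (rule Suc.IH) (use Suc.prems convex_fun_upd in \<open>auto simp: fs_def\<close>)
    then show ?thesis using P[of s] by (simp add: exp_minus field_simps)
  qed
  have A: "sign_avg n (\<lambda>e. exp (infconv (Suc n) f (e(n := s)))) \<le> exp (l^2/2 - (1 - l) * ln (P s) - l * ln (P t))"
    if l: "0 \<le> l" "l \<le> 1" and st: "s = 1 \<and> t = -1 \<or> s = -1 \<and> t = (1::real)" for l s t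
  proof -
    have "sign_avg n (\<lambda>e. exp (infconv (Suc n) f (e(n := s)))) \<le>
       sign_avg n (\<lambda>e. exp (l^2/2) * exp ((1 - l) * infconv n (fs s) e + l * infconv n (fs t) e))"
      unfolding exp_add[symmetric] fs_def
      using infconv_step[OF Suc.prems l st] by (intro sign_avg_mono) (simp only: exp_le_cancel_iff)
    also have "\<dots> \<le> exp (l^2/2) * exp ((1 - l) * (- ln (P s)) + l * (- ln (P t)))"
      unfolding sign_avg_cmult by (intro mult_left_mono sign_avg_Hoelder l IH) auto
    also have "\<dots> = exp (l^2/2 - (1 - l) * ln (P s) - l * ln (P t))"
      by (simp add: exp_add[symmetric] algebra_simps)
    finally show ?thesis .
  qed
  have "(sign_avg n (\<lambda>e. exp (infconv (Suc n) f (e(n := 1)))) + sign_avg n (\<lambda>e. exp (infconv (Suc n) f (e(n := -1)))))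
     * (P 1 + P (-1)) \<le> 4"
    by (rule maurey_numeric) (use P A in auto)
  then show ?case by (simp add: sign_avg_Suc P_def fs_def field_simps)
qed

section \<open>Maxima of finitely many functionals: concentration, contraction,
  self-bounding\<close>

definition max_fun :: "('b::real_normed_vector \<Rightarrow>\<^sub>L real) set \<Rightarrow> 'b \<Rightarrow> real" where
  "max_fun F x = Max ((\<lambda>f. blinfun_apply f x) ` F)"

lemma max_fun_ge: "finite F \<Longrightarrow> f \<in> F \<Longrightarrow> blinfun_apply f x \<le> max_fun F x"
  unfolding max_fun_def by (intro Max_ge) auto

lemma max_fun_attained:
  assumes "finite F" "F \<noteq> {}" obtains f where "f \<in> F" "max_fun F x = blinfun_apply f x"
proof -
  have "Max ((\<lambda>f. blinfun_apply f x) ` F) \<in> (\<lambda>f. blinfun_apply f x) ` F" using assms by (intro Max_in) auto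
  then show ?thesis using that unfolding max_fun_def by auto
qed

lemma max_fun_nonneg: "finite F \<Longrightarrow> 0 \<in> F \<Longrightarrow> 0 \<le> max_fun F x"
  using max_fun_ge[of F 0 x] by simp

lemma max_fun_combination:
  assumes F: "finite F" "F \<noteq> {}" and "0 \<le> a" "0 \<le> b"
  shows "max_fun F (a *\<^sub>R x + b *\<^sub>R y) \<le> a * max_fun F x + b * max_fun F y"
proof -
  obtain f where f: "f \<in> F" "max_fun F (a *\<^sub>R x + b *\<^sub>R y) = blinfun_apply f (a *\<^sub>R x + b *\<^sub>R y)"
    using max_fun_attained[OF F] by blast
  have "blinfun_apply f (a *\<^sub>R x + b *\<^sub>R y) = a * blinfun_apply f x + b * blinfun_apply f y"
    by (simp add: blinfun.add_right blinfun.scaleR_right)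
  also have "\<dots> \<le> a * max_fun F x + b * max_fun F y"
    using assms f by (intro add_mono mult_left_mono max_fun_ge) auto
  finally show ?thesis using f by simp
qed

text \<open>The multiple \<open>\<theta> * Z\<close> is convex in the signs, and along a maximizing
  functional its infimal convolution loses at most \<open>2 * \<theta>\<^sup>2 * W\<close>. Maurey's
  inequality, with Jensen's inequality for the second factor, then bounds an exponential moment
  centred at the mean itself, and Markov's inequality gives the tail.\<close>

lemma rademacher_concentration:
  fixes u :: "nat \<Rightarrow> 'b::real_normed_vector"
  assumes F: "finite F" "0 \<in> F" and W: "0 < W" "\<And>f. f \<in> F \<Longrightarrow> (\<Sum>i<n. (blinfun_apply f (u i))\<^sup>2) \<le> W"
    and t: "0 \<le> t"
  defines "Z \<equiv> \<lambda>e. max_fun F (\<Sum>i<n. e i *\<^sub>R u i)"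
  shows "sign_avg n (\<lambda>e. if sign_avg n Z + t < Z e then 1 else 0) \<le> exp (- t\<^sup>2 / (8 * W))"
proof -
  have F': "F \<noteq> {}" using F by auto
  \<comment> \<open>This value minimizes the final exponent
    \<open>2 * \<theta>\<^sup>2 * W - \<theta> * t\<close>.\<close>
  define \<theta> where "\<theta> = t / (4 * W)"
  have \<theta>: "0 \<le> \<theta>" using t W by (simp add: \<theta>_def)
  define f where "f y = \<theta> * Z y" for y
  have pos: "0 \<le> f y" for y unfolding f_def Z_def using \<theta> F by (simp add: max_fun_nonneg)
  have "convex_fun f" unfolding convex_fun_def
  proof (intro allI impI)
    fix y z :: "nat \<Rightarrow> real" and l :: real assume l: "0 \<le> l" "l \<le> 1"
    have "(\<Sum>i<n. ((1 - l) * y i + l * z i) *\<^sub>R u i) = (1 - l) *\<^sub>R (\<Sum>i<n. y i *\<^sub>R u i) + l *\<^sub>R (\<Sum>i<n. z i *\<^sub>R u i)"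
      by (simp only: scaleR_left_distrib sum.distrib scaleR_scaleR[symmetric] scaleR_sum_right[symmetric])
    then have "Z (\<lambda>i. (1 - l) * y i + l * z i) \<le> (1 - l) * Z y + l * Z z"
      unfolding Z_def using l by (simp only:) (rule max_fun_combination[OF F(1) F'], auto)
    then show "f (\<lambda>i. (1 - l) * y i + l * z i) \<le> (1 - l) * f y + l * f z"
      unfolding f_def using mult_left_mono[OF _ \<theta>] by (fastforce simp: algebra_simps)
  qed
  have Q: "\<theta> * Z e - 2 * \<theta>\<^sup>2 * W \<le> infconv n f e" for e
  proof (rule infconv_ge)
    fix y
    define d where "d = (\<Sum>i<n. (e i - y i)\<^sup>2)"
    have d: "0 \<le> d" unfolding d_def by (intro sum_nonneg) auto
    obtain g where g: "g \<in> F" "Z e = blinfun_apply g (\<Sum>i<n. e i *\<^sub>R u i)"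
      using max_fun_attained[OF F(1) F'] unfolding Z_def by blast
    have "Z e - Z y \<le> blinfun_apply g (\<Sum>i<n. e i *\<^sub>R u i) - blinfun_apply g (\<Sum>i<n. y i *\<^sub>R u i)"
      unfolding g(2) unfolding Z_def by (intro diff_mono max_fun_ge F g) auto
    also have "\<dots> = (\<Sum>i<n. (e i - y i) * blinfun_apply g (u i))"
      by (simp add: blinfun.sum_right blinfun.scaleR_right sum_subtractf[symmetric] left_diff_distrib)
    finally have "\<theta> * (Z e - Z y) \<le> \<theta> * (\<Sum>i<n. (e i - y i) * blinfun_apply g (u i))"
      by (rule mult_left_mono[OF _ \<theta>])
    also have "\<dots> = (\<Sum>i<n. (e i - y i) * (\<theta> * blinfun_apply g (u i)))"
      by (simp add: sum_distrib_left mult_ac)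
    also have "\<dots> \<le> (\<Sum>i<n. (e i - y i)\<^sup>2 / 8 + 2 * (\<theta> * blinfun_apply g (u i))\<^sup>2)"
    proof (rule sum_mono)
      fix i
      have "0 \<le> ((e i - y i) - 4 * (\<theta> * blinfun_apply g (u i)))\<^sup>2 / 8" by simp
      then show "(e i - y i) * (\<theta> * blinfun_apply g (u i)) \<le> (e i - y i)\<^sup>2 / 8 + 2 * (\<theta> * blinfun_apply g (u i))\<^sup>2"
        by (simp add: power2_eq_square field_simps)
    qed
    also have "\<dots> = d / 8 + 2 * \<theta>\<^sup>2 * (\<Sum>i<n. (blinfun_apply g (u i))\<^sup>2)"
      by (simp add: sum.distrib d_def sum_divide_distrib sum_distrib_left power_mult_distrib mult_ac)
    also have "\<dots> \<le> d / 8 + 2 * \<theta>\<^sup>2 * W"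
      using W(2)[OF g(1)] by (intro add_left_mono mult_left_mono) auto
    finally show "\<theta> * Z e - 2 * \<theta>\<^sup>2 * W \<le> f y + (\<Sum>i<n. (e i - y i)\<^sup>2) / 8"
      unfolding f_def d_def by (simp add: algebra_simps)
  qed
  define N where "N = sign_avg n Z"
  let ?c = "2 * \<theta>\<^sup>2 * W"
  have "sign_avg n (\<lambda>e. exp (\<theta> * Z e - ?c)) * exp (- \<theta> * N) \<le>
     sign_avg n (\<lambda>e. exp (infconv n f e)) * sign_avg n (\<lambda>e. exp (- f e))"
  proof (intro mult_mono)
    show "sign_avg n (\<lambda>e. exp (\<theta> * Z e - ?c)) \<le> sign_avg n (\<lambda>e. exp (infconv n f e))"
      using Q by (intro sign_avg_mono) simp
    have "- \<theta> * N = sign_avg n (\<lambda>e. - f e)"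
      unfolding N_def f_def sign_avg_cmult[symmetric] by simp
    then show "exp (- \<theta> * N) \<le> sign_avg n (\<lambda>e. exp (- f e))"
      using sign_avg_exp_ge[of n "\<lambda>e. - f e"] by simp
  qed (use sign_avg_exp_pos less_imp_le in blast, simp)
  also have "\<dots> \<le> 1" by (rule maurey_signs[OF \<open>convex_fun f\<close> pos])
  finally have main: "sign_avg n (\<lambda>e. exp (\<theta> * Z e - ?c)) * exp (- \<theta> * N) \<le> 1" .
  have "sign_avg n (\<lambda>e. if N + t < Z e then 1 else 0) \<le>
        sign_avg n (\<lambda>e. exp (?c - \<theta> * t - \<theta> * N) * exp (\<theta> * Z e - ?c))"
  proof (rule sign_avg_mono)
    fix e
    show "(if N + t < Z e then 1 else 0) \<le> exp (?c - \<theta> * t - \<theta> * N) * exp (\<theta> * Z e - ?c)"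
    proof (cases "N + t < Z e")
      case True
      then have "\<theta> * (N + t) \<le> \<theta> * Z e" by (intro mult_left_mono \<theta>) auto
      then show ?thesis using True by (simp add: exp_add[symmetric] algebra_simps)
    qed simp
  qed
  also have "\<dots> = exp (?c - \<theta> * t) * (sign_avg n (\<lambda>e. exp (\<theta> * Z e - ?c)) * exp (- \<theta> * N))"
  proof -
    have "exp (?c - \<theta> * t - \<theta> * N) = exp (?c - \<theta> * t) * exp (- \<theta> * N)"
      by (simp add: exp_add[symmetric])
    then show ?thesis by (simp only: sign_avg_cmult mult_ac)
  qed
  also have "\<dots> \<le> exp (?c - \<theta> * t) * 1" by (intro mult_left_mono main) auto
  also have "?c - \<theta> * t = - t\<^sup>2 / (8 * W)"
    using W(1) by (simp add: \<theta>_def power2_eq_square field_simps)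
  finally show ?thesis by (simp add: N_def)
qed

text \<open>The left side is evaluated at its two maximizers f and f'. The gain
  \<open>g f - g f'\<close> is at most L times the distance of \<open>k f\<close> and
  \<open>k f'\<close>, and the larger of these two values decides which maximizer is inserted into
  the maximum with the plus sign.\<close>

lemma contraction_two_point:
  fixes A g k :: "'f \<Rightarrow> real"
  assumes F: "finite F" "F \<noteq> {}" and L: "\<And>f f'. f \<in> F \<Longrightarrow> f' \<in> F \<Longrightarrow> \<bar>g f - g f'\<bar> \<le> L * \<bar>k f - k f'\<bar>"
  shows "Max ((\<lambda>f. A f + g f) ` F) + Max ((\<lambda>f. A f - g f) ` F) \<le>
         Max ((\<lambda>f. A f + L * k f) ` F) + Max ((\<lambda>f. A f - L * k f) ` F)"
proof -
  have "Max ((\<lambda>f. A f + g f) ` F) \<in> (\<lambda>f. A f + g f) ` F" using F by (intro Max_in) auto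
  then obtain f where f: "f \<in> F" "Max ((\<lambda>f. A f + g f) ` F) = A f + g f" by auto
  have "Max ((\<lambda>f. A f - g f) ` F) \<in> (\<lambda>f. A f - g f) ` F" using F by (intro Max_in) auto
  then obtain f' where f': "f' \<in> F" "Max ((\<lambda>f. A f - g f) ` F) = A f' - g f'" by auto
  have 1: "A h + L * k h \<le> Max ((\<lambda>f. A f + L * k f) ` F)" "A h - L * k h \<le> Max ((\<lambda>f. A f - L * k f) ` F)"
    if "h \<in> F" for h using F that by (auto intro!: Max_ge)
  have "g f - g f' \<le> L * \<bar>k f - k f'\<bar>" using L[OF f(1) f'(1)] by simp
  then show ?thesis using f f' 1[OF f(1)] 1[OF f'(1)]
    by (cases "k f' \<le> k f") (auto simp: algebra_simps)
qed

text \<open>The Lipschitz images are replaced by multiples of k one sign at a time. The arbitrary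
  offset A absorbs the term already replaced, which is why the induction runs over all A.\<close>

lemma rademacher_contraction:
  fixes g k :: "nat \<Rightarrow> 'f \<Rightarrow> real"
  assumes F: "finite F" "F \<noteq> {}"
    and L: "\<And>i f f'. i < n \<Longrightarrow> f \<in> F \<Longrightarrow> f' \<in> F \<Longrightarrow> \<bar>g i f - g i f'\<bar> \<le> L * \<bar>k i f - k i f'\<bar>"
  shows "sign_avg n (\<lambda>e. Max ((\<lambda>f. A f + (\<Sum>i<n. e i * g i f)) ` F)) \<le>
         sign_avg n (\<lambda>e. Max ((\<lambda>f. A f + L * (\<Sum>i<n. e i * k i f)) ` F))"
  using L
proof (induction n arbitrary: A)
  case 0
  show ?case by simp
next
  case (Suc n)
  have up: "(\<Sum>i<n. (e(n := s)) i * g i f) = (\<Sum>i<n. e i * g i f)" for e s f and g :: "nat \<Rightarrow> 'f \<Rightarrow> real"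
    by (intro sum.cong) auto
  let ?G = "\<lambda>s e. Max ((\<lambda>f. A f + ((\<Sum>i<n. e i * g i f) + s * g n f)) ` F)"
  let ?K = "\<lambda>s e. Max ((\<lambda>f. (A f + s * L * k n f) + (\<Sum>i<n. e i * g i f)) ` F)"
  let ?H = "\<lambda>s e. Max ((\<lambda>f. (A f + s * L * k n f) + L * (\<Sum>i<n. e i * k i f)) ` F)"
  have "sign_avg (Suc n) (\<lambda>e. Max ((\<lambda>f. A f + (\<Sum>i<Suc n. e i * g i f)) ` F)) =
      sign_avg n (\<lambda>e. ?G 1 e + ?G (-1) e) / 2"
    by (simp add: sign_avg_Suc sign_avg_add up)
  also have "\<dots> \<le> sign_avg n (\<lambda>e. ?K 1 e + ?K (-1) e) / 2"
  proof (intro divide_right_mono sign_avg_mono)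
    fix e
    have "Max ((\<lambda>f. (A f + (\<Sum>i<n. e i * g i f)) + g n f) ` F) + Max ((\<lambda>f. (A f + (\<Sum>i<n. e i * g i f)) - g n f) ` F) \<le>
         Max ((\<lambda>f. (A f + (\<Sum>i<n. e i * g i f)) + L * k n f) ` F) + Max ((\<lambda>f. (A f + (\<Sum>i<n. e i * g i f)) - L * k n f) ` F)"
      using Suc.prems by (intro contraction_two_point F) auto
    then show "?G 1 e + ?G (-1) e \<le> ?K 1 e + ?K (-1) e" by (simp add: algebra_simps)
  qed auto
  also have "\<dots> \<le> (sign_avg n (?H 1) + sign_avg n (?H (-1))) / 2"
    unfolding sign_avg_add by (intro divide_right_mono add_mono Suc.IH Suc.prems) auto
  also have "\<dots> = sign_avg (Suc n) (\<lambda>e. Max ((\<lambda>f. A f + L * (\<Sum>i<Suc n. e i * k i f)) ` F))"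
  proof -
    have "(A f + s * L * k n f) + L * (\<Sum>i<n. e i * k i f) = A f + L * ((\<Sum>i<n. e i * k i f) + s * k n f)" for s e f
      by (simp only: distrib_left mult.assoc mult.left_commute add.assoc add.commute)
    then show ?thesis by (simp only: sign_avg_Suc up sum.lessThan_Suc fun_upd_same)
  qed
  finally show ?case .
qed

text \<open>The conditional mean of the maximum when the vectors u are fixed and only their signs
  are random.\<close>

definition rad_mean :: "('b::real_normed_vector \<Rightarrow>\<^sub>L real) set \<Rightarrow> nat \<Rightarrow> (nat \<Rightarrow> 'b) \<Rightarrow> real" where
  "rad_mean F n u = sign_avg n (\<lambda>e. max_fun F (\<Sum>i<n. e i *\<^sub>R u i))"

text \<open>Deleting the i-th vector lowers the mean by an amount between 0 and \<open>G i\<close>,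
  its average contribution under the maximizing functionals. Each \<open>G i\<close> is at most b
  and together they make up the mean, so the squares add up to at most b times the mean.\<close>

lemma rad_mean_self_bounding:
  fixes u :: "nat \<Rightarrow> 'b::real_normed_vector"
  assumes F: "finite F" "F \<noteq> {}" and F1: "\<And>f. f \<in> F \<Longrightarrow> norm f \<le> 1" and b: "\<And>i. i < n \<Longrightarrow> norm (u i) \<le> b"
  shows "(\<Sum>i<n. (rad_mean F n u - rad_mean F n (u(i := 0)))\<^sup>2) \<le> b * rad_mean F n u"
proof -
  let ?S = "\<lambda>e. \<Sum>i<n. e i *\<^sub>R u i"
  let ?Si = "\<lambda>i e. \<Sum>j<n. e j *\<^sub>R (u(i := 0)) j"
  have "\<forall>e. \<exists>f. f \<in> F \<and> max_fun F (?S e) = blinfun_apply f (?S e)"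
    using max_fun_attained[OF F] by blast
  from choice[OF this] obtain g where g: "\<And>e. g e \<in> F" "\<And>e. max_fun F (?S e) = blinfun_apply (g e) (?S e)"
    by blast
  have Si: "?Si i e = ?S e - e i *\<^sub>R u i" if "i < n" for i e
  proof -
    have "?Si i e = (\<Sum>j\<in>{..<n} - {i}. e j *\<^sub>R u j)"
      using that by (subst sum.remove[of _ i]) (auto intro!: sum.cong)
    then show ?thesis using that by (simp add: sum_diff1)
  qed
  define G where "G i = sign_avg n (\<lambda>e. e i * blinfun_apply (g e) (u i))" for i
  \<comment> \<open>Deletion is the midpoint of the two choices of the i-th sign, so convexity of
    the maximum makes the mean drop.\<close>
  have low: "rad_mean F n (u(i := 0)) \<le> rad_mean F n u" if i: "i < n" for i
  proof -
    have "rad_mean F n (u(i := 0)) \<le> sign_avg n (\<lambda>e. (1/2) * max_fun F (?S e) + (1/2) * max_fun F (?S (e(i := - e i))))"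
      unfolding rad_mean_def
    proof (rule sign_avg_mono)
      fix e
      have "?S (e(i := - e i)) = ?Si i (e(i := - e i)) - e i *\<^sub>R u i" using Si[OF i] by simp
      also have "?Si i (e(i := - e i)) = ?Si i e" by (intro sum.cong) auto
      finally have 1: "?S (e(i := - e i)) = ?Si i e - e i *\<^sub>R u i" .
      have 2: "?S e = ?Si i e + e i *\<^sub>R u i" using Si[OF i, of e] by simp
      have "x = (1/2) *\<^sub>R (x + v) + (1/2) *\<^sub>R (x - v)" for x v :: 'b
        by (simp only: scaleR_right_distrib[symmetric]) simp
      then have "?Si i e = (1/2) *\<^sub>R ?S e + (1/2) *\<^sub>R ?S (e(i := - e i))"
        unfolding 1 2 .
      then show "max_fun F (?Si i e) \<le> (1/2) * max_fun F (?S e) + (1/2) * max_fun F (?S (e(i := - e i)))"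
        using max_fun_combination[OF F, of "1/2" "1/2"] by simp
    qed
    also have "\<dots> = (1/2) * rad_mean F n u + (1/2) * rad_mean F n u"
      unfolding sign_avg_add sign_avg_cmult
      using sign_avg_flip[OF i, of "\<lambda>e. max_fun F (?S e)"] by (simp add: rad_mean_def)
    finally show ?thesis by simp
  qed
  have up: "rad_mean F n u - rad_mean F n (u(i := 0)) \<le> G i" if i: "i < n" for i
  proof -
    have "rad_mean F n u - rad_mean F n (u(i := 0)) =
        sign_avg n (\<lambda>e. max_fun F (?S e) - max_fun F (?Si i e))"
      by (simp add: rad_mean_def sign_avg_diff)
    also have "\<dots> \<le> G i" unfolding G_def
    proof (rule sign_avg_mono)
      fix e
      have "max_fun F (?S e) - max_fun F (?Si i e) \<le> blinfun_apply (g e) (?S e) - blinfun_apply (g e) (?Si i e)"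
        unfolding g(2) by (intro diff_left_mono max_fun_ge F g)
      also have "\<dots> = e i * blinfun_apply (g e) (u i)"
        unfolding Si[OF i] by (simp add: blinfun.diff_right blinfun.scaleR_right)
      finally show "max_fun F (?S e) - max_fun F (?Si i e) \<le> e i * blinfun_apply (g e) (u i)" .
    qed
    finally show ?thesis .
  qed
  have Gb: "G i \<le> b" if i: "i < n" for i
  proof -
    have "G i \<le> sign_avg n (\<lambda>_. b)" unfolding G_def
    proof (rule sign_avg_mono)
      fix e assume e: "e \<in> signs n"
      have "e i * blinfun_apply (g e) (u i) \<le> \<bar>e i * blinfun_apply (g e) (u i)\<bar>" by simp
      also have "\<dots> = \<bar>blinfun_apply (g e) (u i)\<bar>" using e i by (auto simp: signs_def abs_mult)
      also have "\<dots> \<le> norm (u i)" by (rule blinfun_apply_le_norm[OF F1[OF g(1)]])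
      also have "\<dots> \<le> b" by (rule b[OF i])
      finally show "e i * blinfun_apply (g e) (u i) \<le> b" .
    qed
    then show ?thesis by simp
  qed
  have Gs: "(\<Sum>i<n. G i) = rad_mean F n u"
    unfolding G_def rad_mean_def sign_avg_sum[symmetric]
    by (intro sign_avg_cong) (simp add: g(2) blinfun.sum_right blinfun.scaleR_right)
  have "(\<Sum>i<n. (rad_mean F n u - rad_mean F n (u(i := 0)))\<^sup>2) \<le> (\<Sum>i<n. b * G i)"
  proof (rule sum_mono)
    fix i assume "i \<in> {..<n}"
    then have i: "i < n" by simp
    have "(rad_mean F n u - rad_mean F n (u(i := 0)))\<^sup>2 \<le> (G i)\<^sup>2"
      using low[OF i] up[OF i] by (intro power_mono) auto
    also have "\<dots> \<le> b * G i"
      using Gb[OF i] low[OF i] up[OF i] by (simp add: power2_eq_square mult_right_mono)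
    finally show "(rad_mean F n u - rad_mean F n (u(i := 0)))\<^sup>2 \<le> b * G i" .
  qed
  also have "\<dots> = b * rad_mean F n u" by (simp add: sum_distrib_left[symmetric] Gs)
  finally show ?thesis .
qed

section \<open>Partial sums of i.i.d. sequences\<close>

abbreviation seq_space :: "(nat \<Rightarrow> 'b::topological_space) measure" where
  "seq_space \<equiv> PiM UNIV (\<lambda>_. borel)"

lemma seq_measurable:
  assumes "\<And>i. Z i \<in> borel_measurable M" shows "(\<lambda>\<omega> i. Z i \<omega>) \<in> measurable M seq_space"
  by (rule measurable_PiM_single') (use assms in auto)

lemma pred_seq:
  assumes "Measurable.pred seq_space P" "\<And>i. Z i \<in> borel_measurable M"
  shows "Measurable.pred M (\<lambda>\<omega>. P (\<lambda>i. Z i \<omega>))"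
  by (rule measurable_compose[OF seq_measurable assms(1)]) (rule assms(2))

lemma Collect_pred_seq: "Measurable.pred seq_space P \<Longrightarrow> {u. P u} \<in> sets seq_space"
  by (simp add: pred_def space_PiM)

locale iid_seq = prob_space M for M :: "'a measure" +
  fixes Y :: "nat \<Rightarrow> 'a \<Rightarrow> 'b::{real_normed_vector, second_countable_topology}"
  assumes indep: "indep_vars (\<lambda>_. borel) Y UNIV"
    and same_law: "\<And>i. distr M borel (Y i) = distr M borel (Y 0)"
begin

lemma Y_measurable [measurable]: "Y i \<in> borel_measurable M"
  using indep by (auto simp: indep_vars_def)

lemma indep_reindex: assumes "inj \<pi>" shows "indep_vars (\<lambda>_. borel) (\<lambda>i. Y (\<pi> i)) (UNIV :: nat set)"
proof -
  have "indep_vars (\<lambda>j. PiM {\<pi> j} (\<lambda>_. borel)) (\<lambda>j \<omega>. restrict (\<lambda>i. Y i \<omega>) {\<pi> j}) UNIV"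
    by (rule indep_vars_restrict[OF indep]) (use assms in \<open>auto simp: disjoint_family_on_def inj_eq\<close>)
  then have "indep_vars (\<lambda>_. borel) (\<lambda>j x. (restrict (\<lambda>i. Y i x) {\<pi> j}) (\<pi> j)) UNIV"
    by (rule indep_vars_compose2[where Y = "\<lambda>j v. v (\<pi> j)"]) simp
  then show ?thesis by simp
qed

text \<open>Independence and the marginal laws determine the law of the whole sequence. Every later
  change of indices, signs or copies rests on this fact.\<close>

lemma seq_law:
  assumes Z: "indep_vars (\<lambda>_. borel) Z (UNIV :: nat set)" "\<And>i. distr M borel (Z i) = distr M borel (Y i)"
  shows "distr M seq_space (\<lambda>\<omega> i. Z i \<omega>) = distr M seq_space (\<lambda>\<omega> i. Y i \<omega>)"
proof -
  have m: "Z i \<in> borel_measurable M" for i using Z(1) by (auto simp: indep_vars_def)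
  have "distr M seq_space (\<lambda>\<omega>. \<lambda>i\<in>UNIV. Z i \<omega>) = PiM UNIV (\<lambda>i. distr M borel (Z i))"
    using Z(1) m by (subst (asm) indep_vars_iff_distr_eq_PiM) auto
  moreover have "distr M seq_space (\<lambda>\<omega>. \<lambda>i\<in>UNIV. Y i \<omega>) = PiM UNIV (\<lambda>i. distr M borel (Y i))"
    using indep by (subst (asm) indep_vars_iff_distr_eq_PiM) auto
  ultimately show ?thesis using Z(2) by (simp add: restrict_def)
qed

lemma prob_seq_law:
  assumes Z: "indep_vars (\<lambda>_. borel) Z (UNIV :: nat set)" "\<And>i. distr M borel (Z i) = distr M borel (Y i)"
    and P: "Measurable.pred seq_space P"
  shows "prob {\<omega>\<in>space M. P (\<lambda>i. Z i \<omega>)} = prob {\<omega>\<in>space M. P (\<lambda>i. Y i \<omega>)}"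
proof -
  have m: "Z i \<in> borel_measurable M" for i using Z(1) by (auto simp: indep_vars_def)
  have "prob {\<omega>\<in>space M. P (\<lambda>i. Z i \<omega>)} = measure (distr M seq_space (\<lambda>\<omega> i. Z i \<omega>)) {u. P u}"
    by (subst measure_distr[OF seq_measurable[OF m] Collect_pred_seq[OF P]])
       (auto intro!: arg_cong[where f = prob])
  also have "\<dots> = prob {\<omega>\<in>space M. P (\<lambda>i. Y i \<omega>)}"
    unfolding seq_law[OF Z]
    by (subst measure_distr[OF seq_measurable[OF Y_measurable] Collect_pred_seq[OF P]])
       (auto intro!: arg_cong[where f = prob])
  finally show ?thesis .
qed

lemma integral_seq_law:
  fixes G :: "(nat \<Rightarrow> 'b) \<Rightarrow> real"
  assumes Z: "indep_vars (\<lambda>_. borel) Z (UNIV :: nat set)" "\<And>i. distr M borel (Z i) = distr M borel (Y i)"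
    and [measurable]: "G \<in> borel_measurable seq_space"
  shows "(\<integral>\<omega>. G (\<lambda>i. Z i \<omega>) \<partial>M) = (\<integral>\<omega>. G (\<lambda>i. Y i \<omega>) \<partial>M)"
proof -
  have [measurable]: "Z i \<in> borel_measurable M" for i using Z(1) by (auto simp: indep_vars_def)
  have "(\<integral>\<omega>. G (\<lambda>i. Z i \<omega>) \<partial>M) = (\<integral>u. G u \<partial>distr M seq_space (\<lambda>\<omega> i. Z i \<omega>))"
    by (subst integral_distr[OF seq_measurable]) auto
  also have "\<dots> = (\<integral>\<omega>. G (\<lambda>i. Y i \<omega>) \<partial>M)"
    unfolding seq_law[OF Z] by (subst integral_distr[OF seq_measurable]) auto
  finally show ?thesis .
qed

lemma law_reindex: "distr M borel (Y (\<pi> i)) = distr M borel (Y i)"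
  using same_law by metis

lemma prob_reindex:
  assumes "inj \<pi>" "Measurable.pred seq_space P"
  shows "prob {\<omega>\<in>space M. P (\<lambda>i. Y (\<pi> i) \<omega>)} = prob {\<omega>\<in>space M. P (\<lambda>i. Y i \<omega>)}"
  by (rule prob_seq_law[OF indep_reindex law_reindex]) (use assms in auto)

lemma iid_compose:
  assumes "g \<in> borel_measurable borel" shows "iid_seq M (\<lambda>i \<omega>. g (Y i \<omega>))"
proof
  show "indep_vars (\<lambda>_. borel) (\<lambda>i \<omega>. g (Y i \<omega>)) UNIV"
    by (rule indep_vars_compose2[OF indep]) (rule assms)
  have "distr M borel (\<lambda>\<omega>. g (Y i \<omega>)) = distr (distr M borel (Y i)) borel g" for i
    using assms by (subst distr_distr) (auto simp: comp_def)
  then show "distr M borel (\<lambda>\<omega>. g (Y i \<omega>)) = distr M borel (\<lambda>\<omega>. g (Y 0 \<omega>))" for i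
    using same_law[of i] by simp
qed

text \<open>Past and future are independent, and the future has the law of the whole sequence. The
  past is padded with zeros so that both events are predicates on infinite sequences.\<close>

lemma prob_split:
  assumes P [measurable]: "Measurable.pred seq_space P" and Q [measurable]: "Measurable.pred seq_space Q"
  shows "prob {\<omega>\<in>space M. P (\<lambda>i. if i < j then Y i \<omega> else 0) \<and> Q (\<lambda>i. Y (j + i) \<omega>)} =
    prob {\<omega>\<in>space M. P (\<lambda>i. if i < j then Y i \<omega> else 0)} * prob {\<omega>\<in>space M. Q (\<lambda>i. Y i \<omega>)}"
proof -
  have ind: "indep_var (PiM {..<j} (\<lambda>_. borel)) (\<lambda>\<omega>. restrict (\<lambda>i. Y i \<omega>) {..<j})
      (PiM {j..} (\<lambda>_. borel)) (\<lambda>\<omega>. restrict (\<lambda>i. Y i \<omega>) {j..})"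
    by (rule indep_var_restrict[OF indep]) auto
  have m1: "(\<lambda>u i. if i < j then u i else 0) \<in> measurable (PiM {..<j} (\<lambda>_. borel)) (seq_space :: (nat \<Rightarrow> 'b) measure)"
  proof (rule measurable_PiM_single')
    fix i show "(\<lambda>u. if i < j then u i else 0) \<in> borel_measurable (PiM {..<j} (\<lambda>_. borel :: 'b measure))"
      by (cases "i < j") simp_all
  qed auto
  have m2: "(\<lambda>u i. u (j + i)) \<in> measurable (PiM {j..} (\<lambda>_. borel)) (seq_space :: (nat \<Rightarrow> 'b) measure)"
    by (rule measurable_PiM_single') auto
  have "indep_var seq_space ((\<lambda>u i. if i < j then u i else 0) \<circ> (\<lambda>\<omega>. restrict (\<lambda>i. Y i \<omega>) {..<j}))
      seq_space ((\<lambda>u i. u (j + i)) \<circ> (\<lambda>\<omega>. restrict (\<lambda>i. Y i \<omega>) {j..}))"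
    by (rule indep_var_compose[OF ind m1 m2])
  moreover have "((\<lambda>u i. if i < j then u i else 0) \<circ> (\<lambda>\<omega>. restrict (\<lambda>i. Y i \<omega>) {..<j})) = (\<lambda>\<omega> i. if i < j then Y i \<omega> else 0)"
    by (auto simp: fun_eq_iff)
  moreover have "((\<lambda>u i. u (j + i)) \<circ> (\<lambda>\<omega>. restrict (\<lambda>i. Y i \<omega>) {j..})) = (\<lambda>\<omega> i. Y (j + i) \<omega>)"
    by (auto simp: fun_eq_iff)
  ultimately have "indep_var seq_space (\<lambda>\<omega> i. if i < j then Y i \<omega> else 0) seq_space (\<lambda>\<omega> i. Y (j + i) \<omega>)" by simp
  from prob_indep_random_variable[OF this Collect_pred_seq[OF P] Collect_pred_seq[OF Q]]
  have "prob {\<omega>\<in>space M. P (\<lambda>i. if i < j then Y i \<omega> else 0) \<and> Q (\<lambda>i. Y (j + i) \<omega>)} =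
    prob {\<omega>\<in>space M. P (\<lambda>i. if i < j then Y i \<omega> else 0)} * prob {\<omega>\<in>space M. Q (\<lambda>i. Y (j + i) \<omega>)}"
    by simp
  also have "prob {\<omega>\<in>space M. Q (\<lambda>i. Y (j + i) \<omega>)} = prob {\<omega>\<in>space M. Q (\<lambda>i. Y i \<omega>)}"
    by (rule prob_reindex) (auto simp: inj_def)
  finally show ?thesis .
qed

definition psum :: "nat \<Rightarrow> 'a \<Rightarrow> 'b" where "psum n \<omega> = (\<Sum>i<n. Y i \<omega>)"

lemma psum_measurable [measurable]: "psum n \<in> borel_measurable M"
  unfolding psum_def[abs_def] by measurable

definition tail :: "nat \<Rightarrow> real \<Rightarrow> real" where
  "tail n v = prob {\<omega>\<in>space M. v < norm (psum n \<omega>)}"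

definition max_tail :: "nat \<Rightarrow> real \<Rightarrow> real" where
  "max_tail n v = prob {\<omega>\<in>space M. \<exists>j\<le>n. v < norm (psum j \<omega>)}"

lemma tail_le_max_tail: "m \<le> n \<Longrightarrow> tail m v \<le> max_tail n v"
  unfolding tail_def max_tail_def by (rule finite_measure_mono) auto

lemma tail_antimono: "u \<le> v \<Longrightarrow> tail n v \<le> tail n u"
  unfolding tail_def by (rule finite_measure_mono) auto

definition first_passage :: "real \<Rightarrow> nat \<Rightarrow> 'a \<Rightarrow> bool" where
  "first_passage v j \<omega> \<longleftrightarrow> v < norm (psum j \<omega>) \<and> (\<forall>i<j. norm (psum i \<omega>) \<le> v)"

lemma first_passage_measurable [measurable]: "Measurable.pred M (first_passage v j)"
  unfolding first_passage_def[abs_def] by measurable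

lemma first_passage_exists:
  assumes "j \<le> n" "v < norm (psum j \<omega>)" shows "\<exists>j\<le>n. first_passage v j \<omega>"
proof -
  define k where "k = (LEAST k. v < norm (psum k \<omega>))"
  have "v < norm (psum k \<omega>)" unfolding k_def using assms(2) by (rule LeastI)
  moreover have "k \<le> j" unfolding k_def using assms(2) by (rule Least_le)
  moreover have "norm (psum i \<omega>) \<le> v" if "i < k" for i
    using not_less_Least[of i "\<lambda>k. v < norm (psum k \<omega>)"] that unfolding k_def by auto
  ultimately show ?thesis using assms(1) unfolding first_passage_def by (intro exI[of _ k]) auto
qed

lemma first_passage_disjoint: "disjoint_family_on (\<lambda>j. {\<omega>\<in>space M. first_passage v j \<omega> \<and> B j \<omega>}) J"
  unfolding disjoint_family_on_def
proof (intro ballI impI)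
  fix i j :: nat assume "i \<noteq> j"
  then show "{\<omega>\<in>space M. first_passage v i \<omega> \<and> B i \<omega>} \<inter> {\<omega>\<in>space M. first_passage v j \<omega> \<and> B j \<omega>} = {}"
    unfolding first_passage_def by (cases i j rule: linorder_cases) (auto simp: not_less[symmetric])
qed

lemma max_tail_eq_sum: "max_tail n v = (\<Sum>j\<le>n. prob {\<omega>\<in>space M. first_passage v j \<omega>})"
proof -
  have "{\<omega>\<in>space M. \<exists>j\<le>n. v < norm (psum j \<omega>)} = (\<Union>j\<in>{..n}. {\<omega>\<in>space M. first_passage v j \<omega> \<and> True})"
    using first_passage_exists[where n = n and v = v] by (fastforce simp: first_passage_def)
  then have "max_tail n v = (\<Sum>j\<le>n. prob {\<omega>\<in>space M. first_passage v j \<omega> \<and> True})"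
    unfolding max_tail_def using first_passage_disjoint[of v "\<lambda>_ _. True"]
    by (subst finite_measure_finite_Union[symmetric]) auto
  then show ?thesis by simp
qed

text \<open>The first passage index is determined by the summands seen so far, hence independent of the
  increments after it.\<close>
lemma prob_first_passage_split:
  assumes Q [measurable]: "\<And>j. Measurable.pred seq_space (Q j)"
  shows "prob {\<omega>\<in>space M. \<exists>j\<le>n. first_passage v j \<omega> \<and> Q j (\<lambda>i. Y (j + i) \<omega>)} =
    (\<Sum>j\<le>n. prob {\<omega>\<in>space M. first_passage v j \<omega>} * prob {\<omega>\<in>space M. Q j (\<lambda>i. Y i \<omega>)})"
proof -
  have [measurable]: "Measurable.pred M (\<lambda>\<omega>. Q j (\<lambda>i. Y (j + i) \<omega>))" for j
    by (rule pred_seq[OF Q]) measurable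
  have measurable_ev: "Measurable.pred M (\<lambda>\<omega>. first_passage v j \<omega> \<and> Q j (\<lambda>i. Y (j + i) \<omega>))" for j
    by measurable
  have "{\<omega>\<in>space M. \<exists>j\<le>n. first_passage v j \<omega> \<and> Q j (\<lambda>i. Y (j + i) \<omega>)} =
      (\<Union>j\<in>{..n}. {\<omega>\<in>space M. first_passage v j \<omega> \<and> Q j (\<lambda>i. Y (j + i) \<omega>)})" by auto
  then have "prob {\<omega>\<in>space M. \<exists>j\<le>n. first_passage v j \<omega> \<and> Q j (\<lambda>i. Y (j + i) \<omega>)} =
     (\<Sum>j\<le>n. prob {\<omega>\<in>space M. first_passage v j \<omega> \<and> Q j (\<lambda>i. Y (j + i) \<omega>)})"
    using first_passage_disjoint[of v "\<lambda>j \<omega>. Q j (\<lambda>i. Y (j + i) \<omega>)"]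
    by (simp only:) (subst finite_measure_finite_Union[symmetric], auto intro!: measurable_ev[unfolded pred_def])
  also have "\<dots> = (\<Sum>j\<le>n. prob {\<omega>\<in>space M. first_passage v j \<omega>} * prob {\<omega>\<in>space M. Q j (\<lambda>i. Y i \<omega>)})"
  proof (rule sum.cong)
    fix j
    define P where "P u \<longleftrightarrow> v < norm (\<Sum>i<j. u i) \<and> (\<forall>k<j. norm (\<Sum>i<k. u i) \<le> v)" for u :: "nat \<Rightarrow> 'b"
    have [measurable]: "Measurable.pred seq_space P" unfolding P_def[abs_def] by measurable
    have "first_passage v j \<omega> \<longleftrightarrow> P (\<lambda>i. if i < j then Y i \<omega> else 0)" for \<omega>
    proof -
      have "psum k \<omega> = (\<Sum>i<k. if i < j then Y i \<omega> else 0)" if "k \<le> j" for k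
        unfolding psum_def using that by (intro sum.cong) auto
      then show ?thesis unfolding first_passage_def P_def by auto
    qed
    then show "prob {\<omega>\<in>space M. first_passage v j \<omega> \<and> Q j (\<lambda>i. Y (j + i) \<omega>)} =
      prob {\<omega>\<in>space M. first_passage v j \<omega>} * prob {\<omega>\<in>space M. Q j (\<lambda>i. Y i \<omega>)}"
      using prob_split[of P "Q j" j] by simp
  qed simp
  finally show ?thesis .
qed

lemma psum_add: "psum (j + k) \<omega> = psum j \<omega> + (\<Sum>i<k. Y (j + i) \<omega>)"
  unfolding psum_def by (induction k) (simp_all add: add.assoc)

section \<open>Maximal inequalities through the first passage index\<close>

theorem ottaviani:
  assumes q: "\<And>m. m \<le> n \<Longrightarrow> tail m v \<le> q"
  shows "(1 - q) * max_tail n (u + v) \<le> tail n u"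
proof -
  define Q where "Q j w \<longleftrightarrow> norm (\<Sum>i<n - j. w i) \<le> v" for j and w :: "nat \<Rightarrow> 'b"
  have [measurable]: "Measurable.pred seq_space (Q j)" for j unfolding Q_def[abs_def] by measurable
  \<comment> \<open>The increment from j to n has the law of a sum of n - j terms. If the passage
    over u + v occurs at j and this increment stays within v, the final sum still exceeds u.\<close>
  have c: "1 - q \<le> prob {\<omega>\<in>space M. Q j (\<lambda>i. Y i \<omega>)}" for j
  proof -
    have "{\<omega>\<in>space M. Q j (\<lambda>i. Y i \<omega>)} = space M - {\<omega>\<in>space M. v < norm (psum (n - j) \<omega>)}"
      unfolding Q_def psum_def by auto
    then have "prob {\<omega>\<in>space M. Q j (\<lambda>i. Y i \<omega>)} = 1 - tail (n - j) v"
      unfolding tail_def by (simp add: prob_compl)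
    then show ?thesis using q[of "n - j"] by simp
  qed
  have "(1 - q) * max_tail n (u + v) = (\<Sum>j\<le>n. prob {\<omega>\<in>space M. first_passage (u + v) j \<omega>} * (1 - q))"
    unfolding max_tail_eq_sum by (simp add: sum_distrib_left mult.commute)
  also have "\<dots> \<le> (\<Sum>j\<le>n. prob {\<omega>\<in>space M. first_passage (u + v) j \<omega>} * prob {\<omega>\<in>space M. Q j (\<lambda>i. Y i \<omega>)})"
    by (intro sum_mono mult_left_mono c) auto
  also have "\<dots> = prob {\<omega>\<in>space M. \<exists>j\<le>n. first_passage (u + v) j \<omega> \<and> Q j (\<lambda>i. Y (j + i) \<omega>)}"
    by (rule prob_first_passage_split[symmetric]) measurable
  also have "\<dots> \<le> tail n u" unfolding tail_def
  proof (rule finite_measure_mono, safe)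
    fix \<omega> j assume a: "\<omega> \<in> space M" "j \<le> n" "first_passage (u + v) j \<omega>" "Q j (\<lambda>i. Y (j + i) \<omega>)"
    have "psum j \<omega> = psum n \<omega> - (\<Sum>i<n - j. Y (j + i) \<omega>)" using psum_add[of j "n - j" \<omega>] a(2) by simp
    then have "norm (psum j \<omega>) \<le> norm (psum n \<omega>) + norm (\<Sum>i<n - j. Y (j + i) \<omega>)"
      by (simp add: norm_triangle_ineq4)
    then show "u < norm (psum n \<omega>)" using a(3,4) unfolding first_passage_def Q_def by linarith
  qed measurable
  finally show ?thesis .
qed

text \<open>At the first passage over v the sum has overshot by at most one summand, so it is at
  most v + b, and the increments that follow must exceed u on their own. Having maxima over j in all
  three tails makes the inequality iterable.\<close>

theorem hoffmann_jorgensen: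
  assumes v: "0 \<le> v" and u: "0 \<le> u" and b: "\<And>i \<omega>. \<omega> \<in> space M \<Longrightarrow> norm (Y i \<omega>) \<le> b"
  shows "max_tail n (v + u + b) \<le> max_tail n v * max_tail n u"
proof -
  define Q where "Q j w \<longleftrightarrow> (\<exists>l\<le>n - j. u < norm (\<Sum>i<l. w i))" for j and w :: "nat \<Rightarrow> 'b"
  have [measurable]: "Measurable.pred seq_space (Q j)" for j unfolding Q_def[abs_def] by measurable
  have Qm [measurable]: "Measurable.pred M (\<lambda>\<omega>. Q j (\<lambda>i. Y (j + i) \<omega>))" for j
    by (rule pred_seq) measurable
  have c: "prob {\<omega>\<in>space M. Q j (\<lambda>i. Y i \<omega>)} \<le> max_tail n u" for j
    unfolding max_tail_def Q_def psum_def by (rule finite_measure_mono) (auto intro: diff_le_self order_trans)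
  have "max_tail n (v + u + b) \<le> prob {\<omega>\<in>space M. \<exists>j\<le>n. first_passage v j \<omega> \<and> Q j (\<lambda>i. Y (j + i) \<omega>)}"
    unfolding max_tail_def
  proof (rule finite_measure_mono, safe)
    fix \<omega> l assume \<omega>: "\<omega> \<in> space M" and l: "l \<le> n" "v + u + b < norm (psum l \<omega>)"
    show "\<exists>j\<le>n. first_passage v j \<omega> \<and> Q j (\<lambda>i. Y (j + i) \<omega>)"
    proof (cases "v < norm (psum l \<omega>)")
      case True
      then obtain j where j: "j \<le> l" "first_passage v j \<omega>" using first_passage_exists[of l l v \<omega>] by blast
      have "j \<noteq> 0" using j(2) v unfolding first_passage_def psum_def by (auto intro!: Nat.gr0I)
      then obtain i where i: "j = Suc i" by (cases j) auto
      have "norm (psum j \<omega>) \<le> norm (psum i \<omega>) + norm (Y i \<omega>)"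
        unfolding i psum_def by (simp add: norm_triangle_ineq)
      also have "\<dots> \<le> v + b" using j(2) b[OF \<omega>] unfolding first_passage_def i by (intro add_mono) auto
      finally have "norm (psum j \<omega>) \<le> v + b" .
      moreover have "norm (psum l \<omega>) \<le> norm (psum j \<omega>) + norm (\<Sum>i<l - j. Y (j + i) \<omega>)"
        using psum_add[of j "l - j" \<omega>] j(1) by (simp add: norm_triangle_ineq)
      ultimately have "u < norm (\<Sum>i<l - j. Y (j + i) \<omega>)" using l(2) by linarith
      then have "Q j (\<lambda>i. Y (j + i) \<omega>)" unfolding Q_def using l(1) by (intro exI[of _ "l - j"]) auto
      then show ?thesis using j l(1) by (intro exI[of _ j]) auto
    next
      case False
      moreover have "0 \<le> b" using b[OF \<omega>, of 0] norm_ge_zero order_trans by blast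
      ultimately show ?thesis using l(2) u by linarith
    qed
  qed measurable
  also have "\<dots> = (\<Sum>j\<le>n. prob {\<omega>\<in>space M. first_passage v j \<omega>} * prob {\<omega>\<in>space M. Q j (\<lambda>i. Y i \<omega>)})"
    by (rule prob_first_passage_split) measurable
  also have "\<dots> \<le> (\<Sum>j\<le>n. prob {\<omega>\<in>space M. first_passage v j \<omega>} * max_tail n u)"
    by (intro sum_mono mult_left_mono c) auto
  also have "\<dots> = max_tail n v * max_tail n u"
    unfolding max_tail_eq_sum by (simp add: sum_distrib_right)
  finally show ?thesis .
qed

end

section \<open>The Efron-Stein inequality\<close>

lemma (in prob_space) square_integral_le:
  fixes V :: "'a \<Rightarrow> real"
  assumes "V \<in> borel_measurable M" "\<And>x. \<bar>V x\<bar> \<le> B"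
  shows "(\<integral>x. V x \<partial>M)\<^sup>2 \<le> (\<integral>x. (V x)\<^sup>2 \<partial>M)"
    and "(\<integral>x. (V x)\<^sup>2 \<partial>M) - (\<integral>x. V x \<partial>M)\<^sup>2 \<le> (\<integral>x. (V x - d)\<^sup>2 \<partial>M)"
proof -
  have i: "integrable M V" by (rule integrable_const_bound[of _ B]) (use assms in auto)
  have i2: "integrable M (\<lambda>x. (V x)\<^sup>2)"
    by (rule integrable_const_bound[of _ "B\<^sup>2"]) (use assms(1) power_mono[OF assms(2), of _ 2] in auto)
  have e: "(\<integral>x. (V x - c)\<^sup>2 \<partial>M) = (\<integral>x. (V x)\<^sup>2 \<partial>M) - 2 * c * (\<integral>x. V x \<partial>M) + c\<^sup>2" for c
    using i i2 by (simp add: power2_diff prob_space mult.commute mult.left_commute)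
  have "0 \<le> (\<integral>x. (V x - (\<integral>x. V x \<partial>M))\<^sup>2 \<partial>M)" by simp
  then show 1: "(\<integral>x. V x \<partial>M)\<^sup>2 \<le> (\<integral>x. (V x)\<^sup>2 \<partial>M)" unfolding e by (simp add: power2_eq_square algebra_simps)
  have "0 \<le> ((\<integral>x. V x \<partial>M) - d)\<^sup>2" by simp
  then show "(\<integral>x. (V x)\<^sup>2 \<partial>M) - (\<integral>x. V x \<partial>M)\<^sup>2 \<le> (\<integral>x. (V x - d)\<^sup>2 \<partial>M)"
    unfolding e by (simp add: power2_eq_square algebra_simps)
qed

lemma measurable_PiM_fun_upd:
  assumes "c \<in> space N" "i \<in> I" shows "(\<lambda>u. u(i := c)) \<in> measurable (PiM I (\<lambda>_. N)) (PiM I (\<lambda>_. N))"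
proof (rule measurable_PiM_single')
  fix k assume "k \<in> I"
  then show "(\<lambda>u. (u(i := c)) k) \<in> measurable (PiM I (\<lambda>_. N)) N"
    using assms by (cases "k = i") auto
qed (use assms in \<open>auto simp: space_PiM PiE_def extensional_def\<close>)

text \<open>Replacing a coordinate by a fixed point c suffices because the variance is the least
  mean square deviation from a constant. The induction splits off one coordinate j: its conditional
  variance is bounded directly, while the partial mean \<open>m\<close> is treated by the induction
  hypothesis, its increments being dominated by those of Z through Jensen's inequality.\<close>

theorem efron_stein_PiM:
  fixes N :: "'b measure" and Z :: "('i \<Rightarrow> 'b) \<Rightarrow> real"
  assumes N: "prob_space N" and c: "c \<in> space N" and I: "finite I"
    and Z: "Z \<in> borel_measurable (PiM I (\<lambda>_. N))" "\<And>u. \<bar>Z u\<bar> \<le> B"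
  shows "(\<integral>u. (Z u)\<^sup>2 \<partial>PiM I (\<lambda>_. N)) - (\<integral>u. Z u \<partial>PiM I (\<lambda>_. N))\<^sup>2 \<le>
     (\<Sum>i\<in>I. \<integral>u. (Z u - Z (u(i := c)))\<^sup>2 \<partial>PiM I (\<lambda>_. N))"
  using I Z
proof (induction I arbitrary: Z rule: finite_induct)
  case empty
  interpret P: prob_space "PiM {} (\<lambda>_. N)" by (intro prob_space_PiM N)
  have "(\<integral>u. (Z u)\<^sup>2 \<partial>PiM {} (\<lambda>_. N)) = (Z (\<lambda>_. undefined))\<^sup>2" "(\<integral>u. Z u \<partial>PiM {} (\<lambda>_. N)) = Z (\<lambda>_. undefined)"
    by (simp_all add: PiM_empty lebesgue_integral_count_space_finite)
  then show ?case by simp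
next
  case (insert j I)
  note fun_upd_apply [simp del]
  interpret N: prob_space N by (rule N)
  interpret product_sigma_finite "\<lambda>_. N" by unfold_locales
  let ?P = "PiM I (\<lambda>_. N)" and ?P' = "PiM (insert j I) (\<lambda>_. N)"
  interpret P: prob_space ?P by (intro prob_space_PiM N)
  interpret P': prob_space ?P' by (intro prob_space_PiM N)
  note Zm [measurable] = insert.prems(1) and B = insert.prems(2)
  have [measurable]: "(\<lambda>u. u(i := c)) \<in> measurable ?P' ?P'" if "i \<in> insert j I" for i
    using that c by (rule measurable_PiM_fun_upd[rotated])
  have [measurable]: "(\<lambda>u. u(i := c)) \<in> measurable ?P ?P" if "i \<in> I" for i
    using that c by (rule measurable_PiM_fun_upd[rotated])
  have bd2: "\<bar>(Z u - Z v)\<^sup>2\<bar> \<le> (2 * B)\<^sup>2" for u v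
  proof -
    have "\<bar>Z u - Z v\<bar> \<le> 2 * B" using B[of u] B[of v] by linarith
    then have "\<bar>Z u - Z v\<bar>\<^sup>2 \<le> (2 * B)\<^sup>2" by (intro power_mono) auto
    then show ?thesis by simp
  qed
  have bd1: "\<bar>(Z u)\<^sup>2\<bar> \<le> B\<^sup>2" for u using power_mono[OF B[of u], of 2] by simp
  have fub: "(\<integral>u. W u \<partial>?P') = (\<integral>u. (\<integral>y. W (u(j := y)) \<partial>N) \<partial>?P)"
    if "W \<in> borel_measurable ?P'" "\<And>u. \<bar>W u\<bar> \<le> K" for W :: "('i \<Rightarrow> 'b) \<Rightarrow> real" and K
  proof (rule product_integral_insert[OF insert.hyps])
    show "integrable ?P' W" by (rule P'.integrable_const_bound[of _ K]) (use that in auto)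
  qed
  have updm: "(\<lambda>(u, y). W (u(j := y))) \<in> borel_measurable (?P \<Otimes>\<^sub>M N)"
    if [measurable]: "W \<in> borel_measurable ?P'" for W :: "('i \<Rightarrow> 'b) \<Rightarrow> real"
    using measurable_compose[OF measurable_add_dim[of j I "\<lambda>_. N"] that] by (simp add: case_prod_unfold)
  have im: "(\<lambda>u. \<integral>y. W (u(j := y)) \<partial>N) \<in> borel_measurable ?P"
    if "W \<in> borel_measurable ?P'" for W :: "('i \<Rightarrow> 'b) \<Rightarrow> real"
    by (rule N.borel_measurable_lebesgue_integral) (use updm[OF that] in simp)
  have sm: "(\<lambda>y. W (u(j := y))) \<in> borel_measurable N"
    if "W \<in> borel_measurable ?P'" "u \<in> space ?P" for W :: "('i \<Rightarrow> 'b) \<Rightarrow> real" and u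
    using measurable_compose[OF measurable_Pair1'[OF that(2)] updm[OF that(1)]] by simp
  have ib: "\<bar>\<integral>y. W (u(j := y)) \<partial>N\<bar> \<le> K" if "W \<in> borel_measurable ?P'" "\<And>u. \<bar>W u\<bar> \<le> K"
    for W :: "('i \<Rightarrow> 'b) \<Rightarrow> real" and K u
  proof -
    have K: "0 \<le> K" using that(2)[of undefined] by linarith
    show ?thesis
    proof (cases "integrable N (\<lambda>y. W (u(j := y)))")
      case True
      have "\<bar>\<integral>y. W (u(j := y)) \<partial>N\<bar> \<le> (\<integral>y. \<bar>W (u(j := y))\<bar> \<partial>N)" by (rule integral_abs_bound)
      also have "\<dots> \<le> (\<integral>y. K \<partial>N)" by (intro integral_mono) (use True that in auto)
      finally show ?thesis by (simp add: N.prob_space)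
    qed (simp add: not_integrable_integral_eq K)
  qed
  define m where "m u = (\<integral>y. Z (u(j := y)) \<partial>N)" for u
  have mm [measurable]: "m \<in> borel_measurable ?P" unfolding m_def[abs_def] by (rule im[OF Zm])
  have mB: "\<bar>m u\<bar> \<le> B" for u unfolding m_def by (rule ib[OF Zm B])
  have bm2: "\<bar>(m u - m v)\<^sup>2\<bar> \<le> (2 * B)\<^sup>2" for u v
  proof -
    have "\<bar>m u - m v\<bar> \<le> 2 * B" using mB[of u] mB[of v] by linarith
    then have "\<bar>m u - m v\<bar>\<^sup>2 \<le> (2 * B)\<^sup>2" by (intro power_mono) auto
    then show ?thesis by simp
  qed
  have bm1: "\<bar>(m u)\<^sup>2\<bar> \<le> B\<^sup>2" for u using power_mono[OF mB[of u], of 2] by simp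
  have intm: "integrable ?P (\<lambda>u. (m u)\<^sup>2)" by (rule P.integrable_const_bound[of _ "B\<^sup>2"]) (use bm1 in auto)
  have new: "(\<integral>u. (Z u)\<^sup>2 \<partial>?P') - (\<integral>u. (m u)\<^sup>2 \<partial>?P) \<le> (\<integral>u. (Z u - Z (u(j := c)))\<^sup>2 \<partial>?P')"
  proof -
    have Z2m: "(\<lambda>u. (Z u)\<^sup>2) \<in> borel_measurable ?P'" by measurable
    have Zdm: "(\<lambda>u. (Z u - Z (u(j := c)))\<^sup>2) \<in> borel_measurable ?P'" by measurable
    have intZ2: "integrable ?P (\<lambda>u. \<integral>y. (Z (u(j := y)))\<^sup>2 \<partial>N)"
      by (rule P.integrable_const_bound[of _ "B\<^sup>2"]) (use im[OF Z2m] ib[OF Z2m bd1] in auto)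
    have "(\<integral>u. (Z u)\<^sup>2 \<partial>?P') - (\<integral>u. (m u)\<^sup>2 \<partial>?P) = (\<integral>u. (\<integral>y. (Z (u(j := y)))\<^sup>2 \<partial>N) - (m u)\<^sup>2 \<partial>?P)"
      unfolding fub[OF Z2m bd1]
      by (rule Bochner_Integration.integral_diff[OF intZ2 intm, symmetric])
    also have "\<dots> \<le> (\<integral>u. (\<integral>y. (Z (u(j := y)) - Z ((u(j := y))(j := c)))\<^sup>2 \<partial>N) \<partial>?P)"
    proof (rule integral_mono)
      show "integrable ?P (\<lambda>u. (\<integral>y. (Z (u(j := y)))\<^sup>2 \<partial>N) - (m u)\<^sup>2)"
        by (rule Bochner_Integration.integrable_diff[OF intZ2 intm])
      show "integrable ?P (\<lambda>u. \<integral>y. (Z (u(j := y)) - Z ((u(j := y))(j := c)))\<^sup>2 \<partial>N)"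
        by (rule P.integrable_const_bound[of _ "(2 * B)\<^sup>2"]) (use im[OF Zdm] ib[OF Zdm bd2] in auto)
      fix u assume u: "u \<in> space ?P"
      show "(\<integral>y. (Z (u(j := y)))\<^sup>2 \<partial>N) - (m u)\<^sup>2 \<le> (\<integral>y. (Z (u(j := y)) - Z ((u(j := y))(j := c)))\<^sup>2 \<partial>N)"
        unfolding m_def using N.square_integral_le(2)[OF sm[OF Zm u] B, of "Z (u(j := c))"] by (simp del: fun_upd_apply)
    qed
    also have "\<dots> = (\<integral>u. (Z u - Z (u(j := c)))\<^sup>2 \<partial>?P')"
      by (rule fub[OF Zdm bd2, symmetric])
    finally show ?thesis .
  qed
  have "(\<integral>u. Z u \<partial>?P') = (\<integral>u. m u \<partial>?P)" unfolding m_def by (rule fub[OF Zm B])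
  then have "(\<integral>u. (m u)\<^sup>2 \<partial>?P) - (\<integral>u. Z u \<partial>?P')\<^sup>2 \<le> (\<Sum>i\<in>I. \<integral>u. (m u - m (u(i := c)))\<^sup>2 \<partial>?P)"
    using insert.IH[OF mm mB] by (simp del: fun_upd_apply)
  also have "\<dots> \<le> (\<Sum>i\<in>I. \<integral>u. (Z u - Z (u(i := c)))\<^sup>2 \<partial>?P')"
  proof (rule sum_mono)
    fix i assume i: "i \<in> I"
    have [measurable]: "(\<lambda>u. u(i := c)) \<in> measurable ?P' ?P'" by (rule measurable_PiM_fun_upd) (use i c in auto)
    have [measurable]: "(\<lambda>u. u(i := c)) \<in> measurable ?P ?P" by (rule measurable_PiM_fun_upd) (use i c in auto)
    have Zdm1: "(\<lambda>u. Z u - Z (u(i := c))) \<in> borel_measurable ?P'" by measurable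
    have Zdm: "(\<lambda>u. (Z u - Z (u(i := c)))\<^sup>2) \<in> borel_measurable ?P'" by measurable
    have Zum: "(\<lambda>u. Z (u(i := c))) \<in> borel_measurable ?P'" by measurable
    have "(\<integral>u. (m u - m (u(i := c)))\<^sup>2 \<partial>?P) \<le> (\<integral>u. (\<integral>y. (Z (u(j := y)) - Z ((u(j := y))(i := c)))\<^sup>2 \<partial>N) \<partial>?P)"
    proof (rule integral_mono)
      show "integrable ?P (\<lambda>u. (m u - m (u(i := c)))\<^sup>2)"
        by (rule P.integrable_const_bound[of _ "(2 * B)\<^sup>2"]) (use bm2 in auto)
      show "integrable ?P (\<lambda>u. \<integral>y. (Z (u(j := y)) - Z ((u(j := y))(i := c)))\<^sup>2 \<partial>N)"
        by (rule P.integrable_const_bound[of _ "(2 * B)\<^sup>2"]) (use im[OF Zdm] ib[OF Zdm bd2] in auto)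
      fix u assume u: "u \<in> space ?P"
      have ij: "(u(i := c))(j := y) = (u(j := y))(i := c)" for y using i insert.hyps by (auto simp: fun_eq_iff fun_upd_apply)
      have i1: "integrable N (\<lambda>y. Z (u(j := y)))" by (rule N.integrable_const_bound[of _ B]) (use sm[OF Zm u] B in auto)
      have i2: "integrable N (\<lambda>y. Z ((u(j := y))(i := c)))" by (rule N.integrable_const_bound[of _ B]) (use sm[OF Zum u] B in auto)
      have "m u - m (u(i := c)) = (\<integral>y. Z (u(j := y)) - Z ((u(j := y))(i := c)) \<partial>N)"
        unfolding m_def ij using i1 i2 by simp
      moreover have "\<bar>Z v - Z w\<bar> \<le> 2 * B" for v w using B[of v] B[of w] by linarith
      ultimately show "(m u - m (u(i := c)))\<^sup>2 \<le> (\<integral>y. (Z (u(j := y)) - Z ((u(j := y))(i := c)))\<^sup>2 \<partial>N)"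
        using N.square_integral_le(1)[OF sm[OF Zdm1 u], of "2 * B"] by simp
    qed
    also have "\<dots> = (\<integral>u. (Z u - Z (u(i := c)))\<^sup>2 \<partial>?P')" by (rule fub[OF Zdm bd2, symmetric])
    finally show "(\<integral>u. (m u - m (u(i := c)))\<^sup>2 \<partial>?P) \<le> (\<integral>u. (Z u - Z (u(i := c)))\<^sup>2 \<partial>?P')" .
  qed
  finally show ?case using new insert.hyps by (simp del: fun_upd_apply)
qed

context iid_seq begin

text \<open>Zero padding turns the deletion of the i-th summand into an update with 0, which is the
  fixed point used in the Efron-Stein inequality.\<close>

definition initial :: "nat \<Rightarrow> 'a \<Rightarrow> nat \<Rightarrow> 'b" where
  "initial n \<omega> = (\<lambda>i. if i < n then Y i \<omega> else 0)"

lemma initial_measurable [measurable]: "initial n \<in> measurable M seq_space"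
  unfolding initial_def[abs_def] by (rule seq_measurable) simp

theorem efron_stein:
  assumes Phi: "\<Phi> \<in> borel_measurable seq_space" "\<And>u. \<bar>\<Phi> u\<bar> \<le> (B::real)"
  shows "(\<integral>\<omega>. (\<Phi> (initial n \<omega>))\<^sup>2 \<partial>M) - (\<integral>\<omega>. \<Phi> (initial n \<omega>) \<partial>M)\<^sup>2 \<le>
    (\<Sum>i<n. \<integral>\<omega>. (\<Phi> (initial n \<omega>) - \<Phi> ((initial n \<omega>)(i := 0)))\<^sup>2 \<partial>M)"
\<comment> \<open>The empty sum is treated apart, since the joint law is identified with a product
  measure over a nonempty index set.\<close>
proof (cases "n = 0")
  case True
  then show ?thesis by (simp add: initial_def prob_space)
next
  case False
  define N where "N = distr M borel (Y 0)"
  have N: "prob_space N" unfolding N_def by (rule prob_space_distr) simp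
  have ind: "indep_vars (\<lambda>_. borel) Y {..<n}" by (rule indep_vars_subset[OF indep]) simp
  have law: "distr M (PiM {..<n} (\<lambda>_. borel)) (\<lambda>\<omega>. \<lambda>i\<in>{..<n}. Y i \<omega>) = PiM {..<n} (\<lambda>_. N)"
  proof -
    have "PiM {..<n} (\<lambda>i. distr M borel (Y i)) = PiM {..<n} (\<lambda>_. distr M borel (Y 0))"
      by (intro PiM_cong refl same_law)
    then show ?thesis unfolding N_def using ind False by (subst (asm) indep_vars_iff_distr_eq_PiM') auto
  qed
  have setsN: "sets (PiM {..<n} (\<lambda>_. N)) = sets (PiM {..<n} (\<lambda>_. borel))"
    by (intro sets_PiM_cong) (simp_all add: N_def)
  define ext where "ext u = (\<lambda>i. if i < n then u i else 0)" for u :: "nat \<Rightarrow> 'b"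
  have ext [measurable]: "ext \<in> measurable (PiM {..<n} (\<lambda>_. borel)) seq_space"
    unfolding ext_def[abs_def]
  proof (rule seq_measurable)
    fix i show "(\<lambda>u. if i < n then u i else 0) \<in> borel_measurable (PiM {..<n} (\<lambda>_. borel :: 'b measure))"
      by (cases "i < n") simp_all
  qed
  define Z where "Z u = \<Phi> (ext u)" for u
  have Zm [measurable]: "Z \<in> borel_measurable (PiM {..<n} (\<lambda>_. borel))"
    unfolding Z_def[abs_def] using Phi(1) by measurable
  have rm [measurable]: "(\<lambda>\<omega>. \<lambda>i\<in>{..<n}. Y i \<omega>) \<in> measurable M (PiM {..<n} (\<lambda>_. borel))" by measurable
  have tr: "(\<integral>u. W u \<partial>PiM {..<n} (\<lambda>_. N)) = (\<integral>\<omega>. W (\<lambda>i\<in>{..<n}. Y i \<omega>) \<partial>M)"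
    if "W \<in> borel_measurable (PiM {..<n} (\<lambda>_. borel))" for W :: "(nat \<Rightarrow> 'b) \<Rightarrow> real"
    unfolding law[symmetric] using that by (subst integral_distr) auto
  have up [measurable]: "(\<lambda>u. u(i := 0)) \<in> measurable (PiM {..<n} (\<lambda>_. borel)) (PiM {..<n} (\<lambda>_. borel :: 'b measure))"
    if "i \<in> {..<n}" for i by (rule measurable_PiM_fun_upd) (use that in auto)
  have e1: "ext (\<lambda>i\<in>{..<n}. Y i \<omega>) = initial n \<omega>" for \<omega>
    by (auto simp: ext_def initial_def fun_eq_iff)
  have e2: "ext ((\<lambda>i\<in>{..<n}. Y i \<omega>)(k := 0)) = (initial n \<omega>)(k := 0)" for \<omega> k
    by (auto simp: ext_def initial_def fun_eq_iff)
  note fun_upd_apply [simp del]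
  have "(\<integral>u. (Z u)\<^sup>2 \<partial>PiM {..<n} (\<lambda>_. N)) - (\<integral>u. Z u \<partial>PiM {..<n} (\<lambda>_. N))\<^sup>2 \<le>
     (\<Sum>i\<in>{..<n}. \<integral>u. (Z u - Z (u(i := 0)))\<^sup>2 \<partial>PiM {..<n} (\<lambda>_. N))"
  proof (rule efron_stein_PiM[OF N])
    show "0 \<in> space N" by (simp add: N_def)
    show "Z \<in> borel_measurable (PiM {..<n} (\<lambda>_. N))"
      using Zm unfolding measurable_cong_sets[OF setsN refl] .
    show "\<bar>Z u\<bar> \<le> B" for u unfolding Z_def by (rule Phi)
  qed simp
  also have "\<dots> = (\<Sum>i\<in>{..<n}. \<integral>\<omega>. (\<Phi> (initial n \<omega>) - \<Phi> ((initial n \<omega>)(i := 0)))\<^sup>2 \<partial>M)"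
  proof (rule sum.cong)
    fix i assume i: "i \<in> {..<n}"
    have [measurable]: "(\<lambda>u. Z (u(i := 0))) \<in> borel_measurable (PiM {..<n} (\<lambda>_. borel))"
      by (rule measurable_compose[OF up[OF i] Zm])
    show "(\<integral>u. (Z u - Z (u(i := 0)))\<^sup>2 \<partial>PiM {..<n} (\<lambda>_. N)) = (\<integral>\<omega>. (\<Phi> (initial n \<omega>) - \<Phi> ((initial n \<omega>)(i := 0)))\<^sup>2 \<partial>M)"
    proof -
      have m: "(\<lambda>u. (Z u - Z (u(i := 0)))\<^sup>2) \<in> borel_measurable (PiM {..<n} (\<lambda>_. borel))" by measurable
      show ?thesis unfolding tr[OF m] unfolding Z_def e1 e2 ..
    qed
  qed simp
  finally have main: "(\<integral>u. (Z u)\<^sup>2 \<partial>PiM {..<n} (\<lambda>_. N)) - (\<integral>u. Z u \<partial>PiM {..<n} (\<lambda>_. N))\<^sup>2 \<le>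
     (\<Sum>i\<in>{..<n}. \<integral>\<omega>. (\<Phi> (initial n \<omega>) - \<Phi> ((initial n \<omega>)(i := 0)))\<^sup>2 \<partial>M)" .
  have m: "(\<lambda>u. (Z u)\<^sup>2) \<in> borel_measurable (PiM {..<n} (\<lambda>_. borel))" by measurable
  show ?thesis using main unfolding tr[OF m] tr[OF Zm] unfolding Z_def e1 .
qed

lemma efron_stein_tail:
  assumes Phi: "\<Phi> \<in> borel_measurable seq_space" "\<And>u. \<bar>\<Phi> u\<bar> \<le> (B::real)"
    and V: "(\<Sum>i<n. \<integral>\<omega>. (\<Phi> (initial n \<omega>) - \<Phi> ((initial n \<omega>)(i := 0)))\<^sup>2 \<partial>M) \<le> V" and t: "0 < t"
  shows "prob {\<omega>\<in>space M. (\<integral>\<omega>. \<Phi> (initial n \<omega>) \<partial>M) + t < \<Phi> (initial n \<omega>)} \<le> V / t\<^sup>2"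
proof -
  let ?Z = "\<lambda>\<omega>. \<Phi> (initial n \<omega>)"
  have [measurable]: "?Z \<in> borel_measurable M" using Phi(1) by measurable
  have i: "integrable M ?Z" by (rule integrable_const_bound[of _ B]) (use Phi in auto)
  have i2: "integrable M (\<lambda>x. (?Z x)\<^sup>2)"
    by (rule integrable_const_bound[of _ "B\<^sup>2"]) (use power_mono[OF Phi(2), of _ 2] in auto)
  have "prob {\<omega>\<in>space M. expectation ?Z + t < ?Z \<omega>} \<le> prob {\<omega>\<in>space M. t \<le> \<bar>?Z \<omega> - expectation ?Z\<bar>}"
    by (rule finite_measure_mono) auto
  also have "\<dots> \<le> variance ?Z / t\<^sup>2" by (rule Chebyshev_inequality) (use i2 t in auto)
  also have "\<dots> \<le> V / t\<^sup>2"
    unfolding variance_eq[OF i i2] using efron_stein[OF Phi, of n] V by (intro divide_right_mono) auto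
  finally show ?thesis .
qed

text \<open>The Hoffmann-Joergensen step is iterated with the same second level u: each round raises
  the level by u + b and halves the probability.\<close>

lemma max_tail_geometric:
  assumes u: "0 \<le> u" and b: "\<And>i \<omega>. \<omega> \<in> space M \<Longrightarrow> norm (Y i \<omega>) \<le> b" and half: "max_tail n u \<le> 1/2"
    and b0: "0 \<le> b"
  shows "max_tail n (real k * (u + b)) \<le> (1/2) ^ k"
proof (induction k)
  case 0
  show ?case unfolding max_tail_def by simp
next
  case (Suc k)
  have "max_tail n (real (Suc k) * (u + b)) = max_tail n (real k * (u + b) + u + b)"
    by (simp add: algebra_simps)
  also have "\<dots> \<le> max_tail n (real k * (u + b)) * max_tail n u"
    by (rule hoffmann_jorgensen[OF _ u b]) (use u b0 in auto)
  also have "\<dots> \<le> (1/2) ^ k * (1/2)"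
    using Suc half by (intro mult_mono) (auto simp: max_tail_def)
  finally show ?case by simp
qed

lemma norm_psum_le: "(\<And>i. norm (Y i \<omega>) \<le> b) \<Longrightarrow> norm (psum m \<omega>) \<le> real m * b"
  unfolding psum_def using sum_norm_le[of "{..<m}" "\<lambda>i. Y i \<omega>" "\<lambda>_. b"] by simp

text \<open>Layer-cake summation at the multiples of u + b. The tails there are at most (1/2)^k, and
  the geometric series sums to 2.\<close>

theorem expectation_norm_psum_le:
  assumes u: "0 \<le> u" and b: "\<And>i \<omega>. \<omega> \<in> space M \<Longrightarrow> norm (Y i \<omega>) \<le> b" and half: "max_tail n u \<le> 1/2"
    and w: "0 < u + b" and m: "m \<le> n"
  shows "(\<integral>\<omega>. norm (psum m \<omega>) \<partial>M) \<le> 2 * (u + b)"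
proof -
  obtain \<omega>0 where "\<omega>0 \<in> space M" using not_empty by auto
  then have b0: "0 \<le> b" using b[of \<omega>0 0] norm_ge_zero order_trans by blast
  define w where "w = u + b"
  \<comment> \<open>The sum is bounded by m b, so \<open>K\<close> levels suffice and only finite
    sums have to be integrated.\<close>
  define K where "K = nat \<lceil>real m * b / w\<rceil>"
  define A where "A k = {\<omega>\<in>space M. real k * w < norm (psum m \<omega>)}" for k
  have [measurable]: "A k \<in> sets M" for k unfolding A_def by measurable
  have "(\<integral>\<omega>. norm (psum m \<omega>) \<partial>M) \<le> (\<integral>\<omega>. w * (\<Sum>k<K. indicator (A k) \<omega>) \<partial>M)"
  proof (rule integral_mono)
    show "integrable M (\<lambda>\<omega>. norm (psum m \<omega>))"
      by (rule integrable_const_bound[of _ "real m * b"]) (use norm_psum_le b in auto)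
    show "integrable M (\<lambda>\<omega>. w * (\<Sum>k<K. indicator (A k) \<omega>))"
      by (intro integrable_mult_right Bochner_Integration.integrable_sum) (auto intro: integrable_real_indicator simp: less_top[symmetric])
    fix \<omega> assume \<omega>: "\<omega> \<in> space M"
    define x where "x = norm (psum m \<omega>)"
    define k0 where "k0 = nat \<lceil>x / w\<rceil>"
    have x: "0 \<le> x" "x \<le> real m * b" using norm_psum_le[of \<omega> b m] b[OF \<omega>] by (auto simp: x_def)
    have wp: "0 < w" using w by (simp add: w_def)
    have "x / w \<le> real m * b / w" using x(2) wp by (intro divide_right_mono) auto
    then have k0K: "k0 \<le> K" unfolding k0_def K_def by (intro nat_mono ceiling_mono)
    have "\<omega> \<in> A k" if "k < k0" for k
    proof -
      have "real k < x / w" using that unfolding k0_def by linarith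
      then show ?thesis unfolding A_def using \<omega> wp by (simp add: field_simps x_def)
    qed
    then have "real k0 = (\<Sum>k<k0. indicator (A k) \<omega>)" by simp
    also have "\<dots> \<le> (\<Sum>k<K. indicator (A k) \<omega>)" using k0K by (intro sum_mono2) auto
    finally have "real k0 \<le> (\<Sum>k<K. indicator (A k) \<omega>)" .
    moreover have "x / w \<le> real k0" unfolding k0_def by (rule real_nat_ceiling_ge)
    ultimately have "x / w \<le> (\<Sum>k<K. indicator (A k) \<omega>)" by linarith
    then show "norm (psum m \<omega>) \<le> w * (\<Sum>k<K. indicator (A k) \<omega>)"
      unfolding x_def[symmetric] using wp by (simp add: field_simps)
  qed
  also have "\<dots> = w * (\<Sum>k<K. prob (A k))"
    by (subst integral_mult_right_zero, subst Bochner_Integration.integral_sum)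
       (auto intro: integrable_real_indicator simp: less_top[symmetric])
  also have "\<dots> \<le> w * (\<Sum>k<K. (1/2) ^ k)"
  proof (intro mult_left_mono sum_mono)
    fix k
    have "prob (A k) \<le> max_tail n (real k * w)" using tail_le_max_tail[OF m] unfolding A_def tail_def .
    also have "\<dots> \<le> (1/2) ^ k" unfolding w_def by (rule max_tail_geometric[OF u b half b0])
    finally show "prob (A k) \<le> (1/2) ^ k" .
  qed (use w w_def in auto)
  also have "\<dots> \<le> w * 2"
  proof (intro mult_left_mono)
    have "(\<Sum>k<K. (1/2::real) ^ k) \<le> (\<Sum>k. (1/2) ^ k)" by (intro sum_le_suminf) auto
    then show "(\<Sum>k<K. (1/2::real) ^ k) \<le> 2" by (simp add: suminf_geometric)
  qed (use w w_def in auto)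
  finally show ?thesis by (simp add: w_def mult.commute)
qed

end

section \<open>Symmetric sequences\<close>

locale iid_sym = iid_seq +
  assumes sym: "distr M borel (\<lambda>\<omega>. - Y 0 \<omega>) = distr M borel (Y 0)"
begin

lemma law_uminus: "distr M borel (\<lambda>\<omega>. - Y i \<omega>) = distr M borel (Y i)"
proof -
  have "distr M borel (\<lambda>\<omega>. - Y i \<omega>) = distr (distr M borel (Y i)) borel uminus"
    by (subst distr_distr) (auto simp: comp_def)
  also have "\<dots> = distr (distr M borel (Y 0)) borel uminus" using same_law by metis
  also have "\<dots> = distr M borel (\<lambda>\<omega>. - Y 0 \<omega>)" by (subst distr_distr) (auto simp: comp_def)
  finally show ?thesis using sym same_law by metis
qed

lemma sym_compose:
  assumes g [measurable]: "g \<in> borel_measurable borel" and odd: "\<And>y. g (- y) = - g y"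
  shows "iid_sym M (\<lambda>i \<omega>. g (Y i \<omega>))"
proof -
  interpret G: iid_seq M "\<lambda>i \<omega>. g (Y i \<omega>)" by (rule iid_compose[OF g])
  show ?thesis
  proof
    have "distr M borel (\<lambda>\<omega>. - g (Y 0 \<omega>)) = distr (distr M borel (\<lambda>\<omega>. - Y 0 \<omega>)) borel g"
      by (subst distr_distr) (auto simp: comp_def odd)
    also have "\<dots> = distr M borel (\<lambda>\<omega>. g (Y 0 \<omega>))"
      unfolding law_uminus by (subst distr_distr) (auto simp: comp_def)
    finally show "distr M borel (\<lambda>\<omega>. - g (Y 0 \<omega>)) = distr M borel (\<lambda>\<omega>. g (Y 0 \<omega>))" .
  qed
qed

lemma signs_iid:
  assumes "\<And>i. e i = 1 \<or> e i = (-1::real)"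
  shows "indep_vars (\<lambda>_. borel) (\<lambda>i \<omega>. e i *\<^sub>R Y i \<omega>) UNIV"
    and "distr M borel (\<lambda>\<omega>. e i *\<^sub>R Y i \<omega>) = distr M borel (Y i)"
proof -
  show "indep_vars (\<lambda>_. borel) (\<lambda>i \<omega>. e i *\<^sub>R Y i \<omega>) UNIV"
    by (rule indep_vars_compose2[OF indep, where Y = "\<lambda>i y. e i *\<^sub>R y"]) simp
  show "distr M borel (\<lambda>\<omega>. e i *\<^sub>R Y i \<omega>) = distr M borel (Y i)"
    using assms[of i] law_uminus[of i] by auto
qed

text \<open>Fixed signs do not change the joint law. A pattern in \<open>signs n\<close> is 0 from n
  on, so it is first extended by 1 to genuine signs, and the sequence is cut at n
  afterwards.\<close>

lemma
  assumes e: "e \<in> signs n"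
  shows prob_signs: "Measurable.pred seq_space P \<Longrightarrow>
      prob {\<omega>\<in>space M. P (\<lambda>i. e i *\<^sub>R Y i \<omega>)} = prob {\<omega>\<in>space M. P (initial n \<omega>)}"
    and integral_signs: "G \<in> borel_measurable seq_space \<Longrightarrow>
      (\<integral>\<omega>. G (\<lambda>i. e i *\<^sub>R Y i \<omega>) \<partial>M) = (\<integral>\<omega>. (G (initial n \<omega>)::real) \<partial>M)"
proof -
  define e' where "e' i = (if i < n then e i else 1)" for i
  have e': "e' i = 1 \<or> e' i = -1" for i using e by (auto simp: e'_def signs_def)
  define cut where "cut u = (\<lambda>i. if i < n then u i else 0)" for u :: "nat \<Rightarrow> 'b"
  have [measurable]: "cut \<in> measurable seq_space seq_space"
    unfolding cut_def[abs_def] by (rule seq_measurable) simp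
  have eq: "(\<lambda>i. e i *\<^sub>R Y i \<omega>) = cut (\<lambda>i. e' i *\<^sub>R Y i \<omega>)" "initial n \<omega> = cut (\<lambda>i. Y i \<omega>)" for \<omega>
    using e by (auto simp: fun_eq_iff cut_def e'_def initial_def signs_def)
  show "prob {\<omega>\<in>space M. P (\<lambda>i. e i *\<^sub>R Y i \<omega>)} = prob {\<omega>\<in>space M. P (initial n \<omega>)}"
    if [measurable]: "Measurable.pred seq_space P" for P
    unfolding eq by (rule prob_seq_law[OF signs_iid[OF e'], where P = "\<lambda>u. P (cut u)"]) measurable
  show "(\<integral>\<omega>. G (\<lambda>i. e i *\<^sub>R Y i \<omega>) \<partial>M) = (\<integral>\<omega>. G (initial n \<omega>) \<partial>M)"
    if [measurable]: "G \<in> borel_measurable seq_space" for G :: "(nat \<Rightarrow> 'b) \<Rightarrow> real"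
    unfolding eq by (rule integral_seq_law[OF signs_iid[OF e'], where G = "\<lambda>u. G (cut u)"]) measurable
qed

text \<open>The law of Y is invariant under flipping its sign on a symmetric set, and the restricted
  variable is the mean of Y and the flipped one.\<close>
lemma tail_restrict_le:
  assumes A [measurable]: "A \<in> sets borel" and A_sym: "\<And>y. - y \<in> A \<longleftrightarrow> y \<in> A"
  shows "prob {\<omega>\<in>space M. u < norm (\<Sum>i<n. indicator A (Y i \<omega>) *\<^sub>R Y i \<omega>)} \<le> 2 * tail n u"
proof -
  define fl where "fl y = (if y \<in> A then y else - y)" for y :: 'b
  have [measurable]: "fl \<in> borel_measurable borel" unfolding fl_def[abs_def] by measurable
  have ind: "indep_vars (\<lambda>_. borel) (\<lambda>i \<omega>. fl (Y i \<omega>)) UNIV"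
    by (rule indep_vars_compose2[OF indep]) measurable
  have law: "distr M borel (\<lambda>\<omega>. fl (Y i \<omega>)) = distr M borel (Y i)" for i
  proof (rule measure_eqI)
    fix B assume "B \<in> sets (distr M borel (\<lambda>\<omega>. fl (Y i \<omega>)))"
    then have B [measurable]: "B \<in> sets borel" by simp
    have "prob {\<omega>\<in>space M. fl (Y i \<omega>) \<in> B} = prob ({\<omega>\<in>space M. Y i \<omega> \<in> A \<and> Y i \<omega> \<in> B} \<union> {\<omega>\<in>space M. Y i \<omega> \<notin> A \<and> - Y i \<omega> \<in> B})"
      by (intro arg_cong[where f = prob]) (auto simp: fl_def)
    also have "\<dots> = prob {\<omega>\<in>space M. Y i \<omega> \<in> A \<and> Y i \<omega> \<in> B} + prob {\<omega>\<in>space M. Y i \<omega> \<notin> A \<and> - Y i \<omega> \<in> B}"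
      by (rule finite_measure_Union) auto
    also have "prob {\<omega>\<in>space M. Y i \<omega> \<notin> A \<and> - Y i \<omega> \<in> B} = measure (distr M borel (\<lambda>\<omega>. - Y i \<omega>)) (B - A)"
      by (subst measure_distr) (auto intro!: arg_cong[where f = prob] simp: A_sym)
    also have "\<dots> = prob {\<omega>\<in>space M. Y i \<omega> \<notin> A \<and> Y i \<omega> \<in> B}"
      unfolding law_uminus by (subst measure_distr) (auto intro!: arg_cong[where f = prob])
    also have "prob {\<omega>\<in>space M. Y i \<omega> \<in> A \<and> Y i \<omega> \<in> B} + \<dots> = prob ({\<omega>\<in>space M. Y i \<omega> \<in> A \<and> Y i \<omega> \<in> B} \<union> {\<omega>\<in>space M. Y i \<omega> \<notin> A \<and> Y i \<omega> \<in> B})"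
      by (rule finite_measure_Union[symmetric]) auto
    also have "\<dots> = prob {\<omega>\<in>space M. Y i \<omega> \<in> B}" by (intro arg_cong[where f = prob]) auto
    finally have "prob {\<omega>\<in>space M. fl (Y i \<omega>) \<in> B} = prob {\<omega>\<in>space M. Y i \<omega> \<in> B}" .
    then show "emeasure (distr M borel (\<lambda>\<omega>. fl (Y i \<omega>))) B = emeasure (distr M borel (Y i)) B"
      by (simp add: emeasure_distr emeasure_eq_measure vimage_def Int_def conj_commute)
  qed simp
  have "prob {\<omega>\<in>space M. u < norm (\<Sum>i<n. indicator A (Y i \<omega>) *\<^sub>R Y i \<omega>)} \<le>
     prob ({\<omega>\<in>space M. u < norm (psum n \<omega>)} \<union> {\<omega>\<in>space M. u < norm (\<Sum>i<n. fl (Y i \<omega>))})"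
  proof (rule finite_measure_mono, safe)
    fix \<omega> assume a: "u < norm (\<Sum>i<n. indicator A (Y i \<omega>) *\<^sub>R Y i \<omega>)" "\<not> u < norm (\<Sum>i<n. fl (Y i \<omega>))"
    have "indicator A y *\<^sub>R y = (1/2) *\<^sub>R (y + fl y)" for y :: 'b
      by (auto simp: fl_def simp flip: scaleR_2)
    then have "(\<Sum>i<n. indicator A (Y i \<omega>) *\<^sub>R Y i \<omega>) = (1/2) *\<^sub>R (psum n \<omega> + (\<Sum>i<n. fl (Y i \<omega>)))"
      by (simp add: psum_def sum.distrib[symmetric] scaleR_sum_right[symmetric])
    then have "2 * norm (\<Sum>i<n. indicator A (Y i \<omega>) *\<^sub>R Y i \<omega>) \<le> norm (psum n \<omega>) + norm (\<Sum>i<n. fl (Y i \<omega>))"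
      by (simp add: norm_triangle_ineq)
    then show "u < norm (psum n \<omega>)" using a by linarith
  qed measurable
  also have "\<dots> \<le> prob {\<omega>\<in>space M. u < norm (psum n \<omega>)} + prob {\<omega>\<in>space M. u < norm (\<Sum>i<n. fl (Y i \<omega>))}"
    by (rule measure_Un_le) measurable
  also have "prob {\<omega>\<in>space M. u < norm (\<Sum>i<n. fl (Y i \<omega>))} = tail n u"
    unfolding tail_def psum_def by (rule prob_seq_law[OF ind law]) measurable
  finally show ?thesis by (simp add: tail_def)
qed

end

lemma max_fun_measurable [measurable]:
  fixes F :: "('b::{real_normed_vector, second_countable_topology} \<Rightarrow>\<^sub>L real) set"
  assumes "finite F" "F \<noteq> {}" shows "max_fun F \<in> borel_measurable borel"
proof (rule borel_measurableI_greater)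
  fix c
  have "{x. c < max_fun F x} = (\<Union>f\<in>F. {x. c < blinfun_apply f x})"
    unfolding max_fun_def using assms by (auto simp: Max_gr_iff)
  also have "open \<dots>" by (intro open_UN ballI open_Collect_less) (auto intro!: continuous_intros)
  finally have "open {x. c < max_fun F x}" .
  then show "{x \<in> space borel. c < max_fun F x} \<in> sets borel" by simp
qed

lemma blinfun_apply_borel [measurable]:
  "blinfun_apply (f :: 'b::{real_normed_vector, second_countable_topology} \<Rightarrow>\<^sub>L real) \<in> borel_measurable borel"
  by (intro borel_measurable_continuous_onI continuous_intros)

lemma max_fun_le_norm:
  assumes "finite F" "F \<noteq> {}" "\<And>f. f \<in> F \<Longrightarrow> norm f \<le> 1" shows "max_fun F x \<le> norm x"
proof -
  obtain f where "f \<in> F" "max_fun F x = blinfun_apply f x" by (rule max_fun_attained[OF assms(1,2)])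
  then show ?thesis using blinfun_apply_le_norm[OF assms(3), of f x] by simp
qed

lemma rad_mean_measurable [measurable]:
  fixes F :: "('b::{real_normed_vector, second_countable_topology} \<Rightarrow>\<^sub>L real) set"
  assumes [simp]: "finite F" "F \<noteq> {}" shows "rad_mean F n \<in> borel_measurable seq_space"
  unfolding rad_mean_def[abs_def] sign_avg_def by measurable

section \<open>Tails of finite maxima for bounded symmetric summands\<close>

context iid_sym begin

context
  fixes n :: nat and b E V w t :: real and F :: "('b \<Rightarrow>\<^sub>L real) set"
  assumes b: "\<And>i \<omega>. \<omega> \<in> space M \<Longrightarrow> norm (Y i \<omega>) \<le> b" and b0: "0 \<le> b"
    and F: "finite F" "0 \<in> F" and F1: "\<And>f. f \<in> F \<Longrightarrow> norm f \<le> 1"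
    and E: "(\<integral>\<omega>. norm (psum n \<omega>) \<partial>M) \<le> E"
    and V: "\<And>f. f \<in> F \<Longrightarrow> real n * (\<integral>\<omega>. (blinfun_apply f (Y 0 \<omega>))\<^sup>2 \<partial>M) \<le> V" and V0: "0 < V"
    and w: "0 < w" and t: "0 < t"
begin

lemma F_nonempty: "F \<noteq> {}" using F by auto

lemma rad_mean_bound: "(\<And>i. i < n \<Longrightarrow> norm (u i) \<le> b) \<Longrightarrow> \<bar>rad_mean F n u\<bar> \<le> real n * b"
proof -
  assume u: "\<And>i. i < n \<Longrightarrow> norm (u i) \<le> b"
  have "0 \<le> rad_mean F n u"
    using sign_avg_mono[of n "\<lambda>_. 0" "\<lambda>e. max_fun F (\<Sum>i<n. e i *\<^sub>R u i)"] max_fun_nonneg[OF F]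
    by (simp add: rad_mean_def)
  moreover have "rad_mean F n u \<le> sign_avg n (\<lambda>_. real n * b)"
    unfolding rad_mean_def
  proof (rule sign_avg_mono)
    fix e assume e: "e \<in> signs n"
    have "max_fun F (\<Sum>i<n. e i *\<^sub>R u i) \<le> norm (\<Sum>i<n. e i *\<^sub>R u i)"
      by (rule max_fun_le_norm[OF F(1) F_nonempty F1])
    also have "\<dots> \<le> (\<Sum>i<n. b)"
      by (rule sum_norm_le) (use e u in \<open>auto simp: signs_def\<close>)
    finally show "max_fun F (\<Sum>i<n. e i *\<^sub>R u i) \<le> real n * b" by simp
  qed
  ultimately show ?thesis by simp
qed

text \<open>Each fixed choice of signs leaves the law of the sum unchanged, so the mean of the
  conditional mean is the mean of the maximum itself, which the norm dominates.\<close>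

lemma expectation_rad_mean: "(\<integral>\<omega>. rad_mean F n (initial n \<omega>) \<partial>M) \<le> E"
proof -
  define G where "G u = max_fun F (\<Sum>i<n. u i)" for u :: "nat \<Rightarrow> 'b"
  have Gm [measurable]: "G \<in> borel_measurable seq_space"
    unfolding G_def[abs_def] using max_fun_measurable[OF F(1) F_nonempty] by measurable
  have G0: "0 \<le> G u" for u unfolding G_def by (rule max_fun_nonneg[OF F])
  have Gn: "G u \<le> norm (\<Sum>i<n. u i)" for u unfolding G_def by (rule max_fun_le_norm[OF F(1) F_nonempty F1])
  have Gb: "G (\<lambda>i. e i *\<^sub>R Y i \<omega>) \<le> real n * b" if "e \<in> signs n" "\<omega> \<in> space M" for e \<omega>
  proof -
    have "norm (\<Sum>i<n. e i *\<^sub>R Y i \<omega>) \<le> (\<Sum>i<n. b)"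
      by (rule sum_norm_le) (use that b in \<open>auto simp: signs_def\<close>)
    then show ?thesis using Gn[of "\<lambda>i. e i *\<^sub>R Y i \<omega>"] by simp
  qed
  have int: "integrable M (\<lambda>\<omega>. G (\<lambda>i. e i *\<^sub>R Y i \<omega>))" if "e \<in> signs n" for e
  proof (rule integrable_const_bound[of _ "real n * b"])
    show "(\<lambda>\<omega>. G (\<lambda>i. e i *\<^sub>R Y i \<omega>)) \<in> borel_measurable M"
      by (rule measurable_compose[OF seq_measurable Gm]) measurable
  qed (use Gb[OF that] G0 in auto)
  have eq: "rad_mean F n (initial n \<omega>) = sign_avg n (\<lambda>e. G (\<lambda>i. e i *\<^sub>R Y i \<omega>))" for \<omega>
    unfolding rad_mean_def G_def by (intro sign_avg_cong arg_cong[where f = "max_fun F"] sum.cong) (auto simp: initial_def)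
  have "(\<integral>\<omega>. rad_mean F n (initial n \<omega>) \<partial>M) = sign_avg n (\<lambda>e. \<integral>\<omega>. G (\<lambda>i. e i *\<^sub>R Y i \<omega>) \<partial>M)"
    unfolding eq sign_avg_def using int by (simp add: Bochner_Integration.integral_sum)
  also have "\<dots> = sign_avg n (\<lambda>e. \<integral>\<omega>. G (initial n \<omega>) \<partial>M)"
    by (intro sign_avg_cong integral_signs) measurable
  also have "\<dots> = (\<integral>\<omega>. G (initial n \<omega>) \<partial>M)" by simp
  also have "\<dots> \<le> (\<integral>\<omega>. norm (psum n \<omega>) \<partial>M)"
  proof (rule integral_mono)
    have s: "norm (\<Sum>i<n. initial n \<omega> i) = norm (psum n \<omega>)" for \<omega>
      unfolding psum_def by (intro arg_cong[where f = norm] sum.cong) (auto simp: initial_def)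
    have le: "norm (psum n \<omega>) \<le> real n * b" if "\<omega> \<in> space M" for \<omega>
      using norm_psum_le[of \<omega> b n] b[OF that] by simp
    show "integrable M (\<lambda>\<omega>. norm (psum n \<omega>))"
      by (rule integrable_const_bound[of _ "real n * b"]) (use le in auto)
    show "integrable M (\<lambda>\<omega>. G (initial n \<omega>))"
      by (rule integrable_const_bound[of _ "real n * b"]) (use order_trans[OF Gn[of "initial n _", unfolded s] le] G0 in auto)
    show "G (initial n \<omega>) \<le> norm (psum n \<omega>)" for \<omega> using Gn[of "initial n \<omega>"] s by simp
  qed
  finally show ?thesis using E by simp
qed

text \<open>By the self-bounding property the Efron-Stein bound for the variance is b times the
  mean, hence at most b E; Chebyshev's inequality does the rest.\<close>

lemma rad_mean_tail:
  "prob {\<omega>\<in>space M. E + t < rad_mean F n (initial n \<omega>)} \<le> b * E / t\<^sup>2"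
proof -
  \<comment> \<open>The cut at norm b changes nothing on the probability space, but makes the
    functional bounded on all sequences, as the Efron-Stein inequality requires.\<close>
  define \<tau> where "\<tau> y = (if norm y \<le> b then y else 0)" for y :: 'b
  have [measurable]: "\<tau> \<in> borel_measurable borel" unfolding \<tau>_def[abs_def] by measurable
  define \<Phi> where "\<Phi> u = rad_mean F n (\<lambda>i. \<tau> (u i))" for u
  have rm [measurable]: "rad_mean F n \<in> borel_measurable seq_space" by (rule rad_mean_measurable[OF F(1) F_nonempty])
  have cm: "(\<lambda>u i. \<tau> (u i)) \<in> measurable seq_space seq_space" by (rule seq_measurable) measurable
  have Pm: "\<Phi> \<in> borel_measurable seq_space"
    unfolding \<Phi>_def[abs_def] by (rule measurable_compose[OF cm rm])
  have Pb: "\<bar>\<Phi> u\<bar> \<le> real n * b" for u unfolding \<Phi>_def by (rule rad_mean_bound) (simp add: \<tau>_def b0)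
  have tau0: "(\<lambda>k. \<tau> ((u(i := 0)) k)) = (\<lambda>k. \<tau> (u k))(i := 0)" for u i by (auto simp: \<tau>_def fun_eq_iff)
  have sb: "(\<Sum>i<n. (\<Phi> u - \<Phi> (u(i := 0)))\<^sup>2) \<le> b * \<Phi> u" for u
    unfolding \<Phi>_def tau0 by (rule rad_mean_self_bounding[OF F(1) F_nonempty F1]) (auto simp: \<tau>_def b0)
  have in_eq: "\<Phi> (initial n \<omega>) = rad_mean F n (initial n \<omega>)" if "\<omega> \<in> space M" for \<omega>
  proof -
    have "(\<lambda>i. \<tau> (initial n \<omega> i)) = initial n \<omega>"
      using b[OF that] by (auto simp: \<tau>_def initial_def fun_eq_iff)
    then show ?thesis by (simp add: \<Phi>_def)
  qed
  have int_eq: "(\<integral>\<omega>. \<Phi> (initial n \<omega>) \<partial>M) = (\<integral>\<omega>. rad_mean F n (initial n \<omega>) \<partial>M)"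
    by (rule Bochner_Integration.integral_cong) (auto simp: in_eq)
  have upm: "(\<lambda>u. u(i := 0)) \<in> measurable seq_space (seq_space :: (nat \<Rightarrow> 'b) measure)" for i :: nat
    by (rule measurable_PiM_fun_upd) auto
  have Pum: "(\<lambda>\<omega>. \<Phi> ((initial n \<omega>)(i := 0))) \<in> borel_measurable M" for i
    by (rule measurable_compose[OF measurable_compose[OF initial_measurable upm] Pm])
  have Pim: "(\<lambda>\<omega>. \<Phi> (initial n \<omega>)) \<in> borel_measurable M"
    by (rule measurable_compose[OF initial_measurable Pm])
  have d2: "\<bar>(\<Phi> u - \<Phi> v)\<^sup>2\<bar> \<le> (2 * (real n * b))\<^sup>2" for u v
  proof -
    have "\<bar>\<Phi> u - \<Phi> v\<bar> \<le> 2 * (real n * b)" using Pb[of u] Pb[of v] by linarith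
    then have "\<bar>\<Phi> u - \<Phi> v\<bar>\<^sup>2 \<le> (2 * (real n * b))\<^sup>2" by (intro power_mono) auto
    then show ?thesis by simp
  qed
  have di: "integrable M (\<lambda>\<omega>. (\<Phi> (initial n \<omega>) - \<Phi> ((initial n \<omega>)(i := 0)))\<^sup>2)" for i
    by (rule integrable_const_bound[of _ "(2 * (real n * b))\<^sup>2"]) (use d2 Pum[of i] Pim in \<open>auto simp del: fun_upd_apply\<close>)
  have Pi: "integrable M (\<lambda>\<omega>. \<Phi> (initial n \<omega>))"
    by (rule integrable_const_bound[of _ "real n * b"]) (use Pb Pim in auto)
  have "(\<Sum>i<n. \<integral>\<omega>. (\<Phi> (initial n \<omega>) - \<Phi> ((initial n \<omega>)(i := 0)))\<^sup>2 \<partial>M) =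
      (\<integral>\<omega>. (\<Sum>i<n. (\<Phi> (initial n \<omega>) - \<Phi> ((initial n \<omega>)(i := 0)))\<^sup>2) \<partial>M)"
    by (rule Bochner_Integration.integral_sum[symmetric]) (rule di)
  also have "\<dots> \<le> (\<integral>\<omega>. b * \<Phi> (initial n \<omega>) \<partial>M)"
    by (rule integral_mono) (use di Pi sb in auto)
  also have "\<dots> = b * (\<integral>\<omega>. \<Phi> (initial n \<omega>) \<partial>M)" by simp
  also have "\<dots> \<le> b * E" using expectation_rad_mean b0 unfolding int_eq by (intro mult_left_mono)
  finally have "prob {\<omega>\<in>space M. (\<integral>\<omega>. \<Phi> (initial n \<omega>) \<partial>M) + t < \<Phi> (initial n \<omega>)} \<le> b * E / t\<^sup>2"
    by (rule efron_stein_tail[OF Pm Pb _ t])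
  moreover have "prob {\<omega>\<in>space M. E + t < rad_mean F n (initial n \<omega>)} \<le>
      prob {\<omega>\<in>space M. (\<integral>\<omega>. \<Phi> (initial n \<omega>) \<partial>M) + t < \<Phi> (initial n \<omega>)}"
  proof (rule finite_measure_mono, safe)
    fix \<omega> assume "\<omega> \<in> space M" "E + t < rad_mean F n (initial n \<omega>)"
    then show "(\<integral>\<omega>. \<Phi> (initial n \<omega>) \<partial>M) + t < \<Phi> (initial n \<omega>)"
      using expectation_rad_mean int_eq in_eq by simp
  qed (use Pim in measurable)
  ultimately show ?thesis by simp
qed

lemma integrable_sq: "f \<in> F \<Longrightarrow> integrable M (\<lambda>\<omega>. (blinfun_apply f (Y i \<omega>))\<^sup>2)"
proof (rule integrable_const_bound[of _ "b\<^sup>2"])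
  assume f: "f \<in> F"
  have "\<bar>blinfun_apply f (Y i \<omega>)\<bar>\<^sup>2 \<le> b\<^sup>2" if "\<omega> \<in> space M" for \<omega>
    using blinfun_apply_le_norm[OF F1[OF f], of "Y i \<omega>"] b[OF that, of i] by (intro power_mono) auto
  then show "AE \<omega> in M. norm ((blinfun_apply f (Y i \<omega>))\<^sup>2) \<le> b\<^sup>2" by auto
qed measurable

text \<open>Markov's inequality at twice the bound V for the mean. This lower bound 1/2 is the
  origin of the factor 2 in the symmetrization of the weak variance.\<close>

lemma weak_variance_half:
  assumes f: "f \<in> F" shows "1/2 \<le> prob {\<omega>\<in>space M. (\<Sum>i<n. (blinfun_apply f (Y i \<omega>))\<^sup>2) \<le> 2 * V}"
proof -
  let ?S = "\<lambda>\<omega>. \<Sum>i<n. (blinfun_apply f (Y i \<omega>))\<^sup>2"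
  have same: "(\<integral>\<omega>. (blinfun_apply f (Y i \<omega>))\<^sup>2 \<partial>M) = (\<integral>\<omega>. (blinfun_apply f (Y 0 \<omega>))\<^sup>2 \<partial>M)" for i
  proof -
    have "(\<integral>\<omega>. (blinfun_apply f (Y i \<omega>))\<^sup>2 \<partial>M) = (\<integral>y. (blinfun_apply f y)\<^sup>2 \<partial>distr M borel (Y i))" for i
      by (subst integral_distr) auto
    then show ?thesis using same_law[of i] by simp
  qed
  have i: "integrable M ?S" using integrable_sq[OF f] by simp
  have "(\<integral>\<omega>. ?S \<omega> \<partial>M) = (\<Sum>i<n. \<integral>\<omega>. (blinfun_apply f (Y i \<omega>))\<^sup>2 \<partial>M)"
    by (rule Bochner_Integration.integral_sum) (rule integrable_sq[OF f])
  also have "\<dots> = (\<Sum>i<n. \<integral>\<omega>. (blinfun_apply f (Y 0 \<omega>))\<^sup>2 \<partial>M)"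
    by (intro sum.cong refl same)
  finally have "(\<integral>\<omega>. ?S \<omega> \<partial>M) = real n * (\<integral>\<omega>. (blinfun_apply f (Y 0 \<omega>))\<^sup>2 \<partial>M)" by simp
  then have ES: "(\<integral>\<omega>. ?S \<omega> \<partial>M) \<le> V" using V[OF f] by simp
  have "prob {\<omega>\<in>space M. 2 * V \<le> ?S \<omega>} \<le> (\<integral>\<omega>. ?S \<omega> \<partial>M) / (2 * V)"
    by (rule integral_Markov_inequality_measure[where A = "{}"]) (use i V0 in \<open>auto intro!: sum_nonneg\<close>)
  also have "\<dots> \<le> V / (2 * V)" using ES V0 by (intro divide_right_mono) auto
  also have "\<dots> = 1/2" using V0 by simp
  finally have m: "prob {\<omega>\<in>space M. 2 * V \<le> ?S \<omega>} \<le> 1/2" .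
  have "1 - prob {\<omega>\<in>space M. 2 * V < ?S \<omega>} = prob (space M - {\<omega>\<in>space M. 2 * V < ?S \<omega>})"
    by (rule prob_compl[symmetric]) measurable
  also have "space M - {\<omega>\<in>space M. 2 * V < ?S \<omega>} = {\<omega>\<in>space M. ?S \<omega> \<le> 2 * V}" by auto
  finally have "prob {\<omega>\<in>space M. ?S \<omega> \<le> 2 * V} = 1 - prob {\<omega>\<in>space M. 2 * V < ?S \<omega>}" by simp
  moreover have "prob {\<omega>\<in>space M. 2 * V < ?S \<omega>} \<le> prob {\<omega>\<in>space M. 2 * V \<le> ?S \<omega>}"
    by (rule finite_measure_mono) (auto, measurable)
  ultimately show ?thesis using m by simp
qed

text \<open>The independent copy consists of the terms \<open>Y (n + i)\<close>. With F enumerated,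
  the first functional whose sum of squares is too large depends on the first n terms only; for that
  functional the copy stays below 2 V with probability at least 1/2, and then the difference exceeds
  w.\<close>

lemma weak_variance_symmetrize:
  "prob {\<omega>\<in>space M. \<exists>f\<in>F. 2 * V + w < (\<Sum>i<n. (blinfun_apply f (Y i \<omega>))\<^sup>2)} \<le>
    2 * prob {\<omega>\<in>space M. \<exists>f\<in>F. w < (\<Sum>i<n. (blinfun_apply f (Y i \<omega>))\<^sup>2 - (blinfun_apply f (Y (n + i) \<omega>))\<^sup>2)}"
proof -
  obtain fs and m :: nat where fs: "F = fs ` {..<m}"
    using finite_imp_nat_seg_image_inj_on[OF F(1)] unfolding lessThan_def by metis
  define S where "S j u = (\<Sum>i<n. (blinfun_apply (fs j) (u i))\<^sup>2)" for j and u :: "nat \<Rightarrow> 'b"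
  have [measurable]: "S j \<in> borel_measurable seq_space" for j unfolding S_def[abs_def] by measurable
  define P where "P j u \<longleftrightarrow> 2 * V + w < S j u \<and> (\<forall>k<j. S k u \<le> 2 * V + w)" for j u
  define Q where "Q j u \<longleftrightarrow> S j u \<le> 2 * V" for j u
  have Pm: "Measurable.pred seq_space (P j)" for j unfolding P_def[abs_def] by measurable
  have Qm: "Measurable.pred seq_space (Q j)" for j unfolding Q_def[abs_def] by measurable
  have Sin: "S j (\<lambda>i. if i < n then Y i \<omega> else 0) = (\<Sum>i<n. (blinfun_apply (fs j) (Y i \<omega>))\<^sup>2)" for j \<omega>
    unfolding S_def by (intro sum.cong) auto
  define A where "A j = {\<omega>\<in>space M. P j (\<lambda>i. if i < n then Y i \<omega> else 0)}" for j
  define B where "B j = {\<omega>\<in>space M. P j (\<lambda>i. if i < n then Y i \<omega> else 0) \<and> Q j (\<lambda>i. Y (n + i) \<omega>)}" for j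
  have PM: "Measurable.pred M (\<lambda>\<omega>. P j (\<lambda>i. if i < n then Y i \<omega> else 0))" for j
    by (rule pred_seq[OF Pm]) measurable
  have QM: "Measurable.pred M (\<lambda>\<omega>. Q j (\<lambda>i. Y (n + i) \<omega>))" for j
    by (rule pred_seq[OF Qm]) measurable
  have [measurable]: "A j \<in> sets M" "B j \<in> sets M" for j
    unfolding A_def B_def using PM QM by measurable
  have disj: "P i u \<Longrightarrow> P j u \<Longrightarrow> i = j" for i j u
    unfolding P_def by (cases i j rule: linorder_cases) (auto simp: not_less[symmetric])
  have dB: "disjoint_family_on B {..<m}"
    by (auto simp: disjoint_family_on_def B_def dest: disj)
  have AB: "prob (A j) * (1/2) \<le> prob (B j)" if "j < m" for j
  proof -
    have "1/2 \<le> prob {\<omega>\<in>space M. Q j (\<lambda>i. Y i \<omega>)}"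
      unfolding Q_def S_def by (rule weak_variance_half) (use fs that in auto)
    then have "prob (A j) * (1/2) \<le> prob (A j) * prob {\<omega>\<in>space M. Q j (\<lambda>i. Y i \<omega>)}"
      by (intro mult_left_mono) auto
    also have "\<dots> = prob (B j)" unfolding A_def B_def by (rule prob_split[OF Pm Qm, symmetric])
    finally show ?thesis .
  qed
  have "prob {\<omega>\<in>space M. \<exists>f\<in>F. 2 * V + w < (\<Sum>i<n. (blinfun_apply f (Y i \<omega>))\<^sup>2)} \<le> prob (\<Union>j\<in>{..<m}. A j)"
  proof (rule finite_measure_mono, safe)
    fix \<omega> f assume \<omega>: "\<omega> \<in> space M" and f: "f \<in> F" "2 * V + w < (\<Sum>i<n. (blinfun_apply f (Y i \<omega>))\<^sup>2)"
    let ?u = "\<lambda>i. if i < n then Y i \<omega> else 0"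
    obtain j where j: "j < m" "f = fs j" using f(1) fs by auto
    define k where "k = (LEAST k. 2 * V + w < S k ?u)"
    have ex: "2 * V + w < S j ?u" using f(2) j(2) Sin by simp
    have "2 * V + w < S k ?u" unfolding k_def using ex by (rule LeastI)
    moreover have "k \<le> j" unfolding k_def using ex by (rule Least_le)
    moreover have "S i ?u \<le> 2 * V + w" if "i < k" for i
      using not_less_Least[of i "\<lambda>k. 2 * V + w < S k ?u"] that unfolding k_def by auto
    ultimately show "\<omega> \<in> (\<Union>j\<in>{..<m}. A j)" using \<omega> j(1) unfolding A_def P_def by auto
  qed measurable
  also have "\<dots> \<le> (\<Sum>j<m. prob (A j))" by (rule finite_measure_subadditive_finite) auto
  also have "\<dots> \<le> (\<Sum>j<m. 2 * prob (B j))" using AB by (intro sum_mono) fastforce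
  also have "\<dots> = 2 * prob (\<Union>j\<in>{..<m}. B j)"
    unfolding sum_distrib_left[symmetric]
    by (subst finite_measure_finite_Union) (use dB in auto)
  also have "prob (\<Union>j\<in>{..<m}. B j) \<le> prob {\<omega>\<in>space M. \<exists>f\<in>F. w < (\<Sum>i<n. (blinfun_apply f (Y i \<omega>))\<^sup>2 - (blinfun_apply f (Y (n + i) \<omega>))\<^sup>2)}"
  proof (rule finite_measure_mono, safe)
    fix \<omega> j assume "j < m" "\<omega> \<in> B j"
    then have "2 * V + w < (\<Sum>i<n. (blinfun_apply (fs j) (Y i \<omega>))\<^sup>2)" "(\<Sum>i<n. (blinfun_apply (fs j) (Y (n + i) \<omega>))\<^sup>2) \<le> 2 * V"
      unfolding B_def P_def Q_def Sin by (auto simp: S_def)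
    then have "w < (\<Sum>i<n. (blinfun_apply (fs j) (Y i \<omega>))\<^sup>2 - (blinfun_apply (fs j) (Y (n + i) \<omega>))\<^sup>2)"
      by (simp add: sum_subtractf)
    then show "\<exists>f\<in>F. w < (\<Sum>i<n. (blinfun_apply f (Y i \<omega>))\<^sup>2 - (blinfun_apply f (Y (n + i) \<omega>))\<^sup>2)"
      using fs \<open>j < m\<close> by auto
  next
    fix \<omega> j assume "\<omega> \<in> B j" then show "\<omega> \<in> space M" unfolding B_def by simp
  next
    show "{\<omega>\<in>space M. \<exists>f\<in>F. w < (\<Sum>i<n. (blinfun_apply f (Y i \<omega>))\<^sup>2 - (blinfun_apply f (Y (n + i) \<omega>))\<^sup>2)} \<in> sets M"
      using F(1) by measurable
  qed
  finally show ?thesis by simp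
qed

text \<open>Exchanging the i-th summand with its copy randomizes the sign, and contraction replaces the squares
  by linear functionals.\<close>
lemma weak_variance_rademacher:
  "prob {\<omega>\<in>space M. \<exists>f\<in>F. w < (\<Sum>i<n. (blinfun_apply f (Y i \<omega>))\<^sup>2 - (blinfun_apply f (Y (n + i) \<omega>))\<^sup>2)} \<le> 4 * b * E / w"
proof -
  let ?D = "prob {\<omega>\<in>space M. \<exists>f\<in>F. w < (\<Sum>i<n. (blinfun_apply f (Y i \<omega>))\<^sup>2 - (blinfun_apply f (Y (n + i) \<omega>))\<^sup>2)}"
  define A where "A e u = Max ((\<lambda>f. 0 + (\<Sum>i<n. e i * (blinfun_apply f (u i))\<^sup>2)) ` F)" for e and u :: "nat \<Rightarrow> 'b"
  have A_ge: "(\<Sum>i<n. e i * (blinfun_apply f (u i))\<^sup>2) \<le> A e u" if "f \<in> F" for f e u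
    unfolding A_def using F(1) that by (intro Max_ge) auto
  have A0: "0 \<le> A e u" for e u using A_ge[OF F(2), of e u] by simp
  have A_in: "\<exists>f\<in>F. A e u = (\<Sum>i<n. e i * (blinfun_apply f (u i))\<^sup>2)" for e u
  proof -
    have "A e u \<in> (\<lambda>f. 0 + (\<Sum>i<n. e i * (blinfun_apply f (u i))\<^sup>2)) ` F"
      unfolding A_def using F(1) F_nonempty by (intro Max_in) auto
    then show ?thesis by auto
  qed
  have Am [measurable]: "A e \<in> borel_measurable seq_space" for e
  proof (rule borel_measurableI_greater)
    fix c
    have "{u. c < A e u} = (\<Union>f\<in>F. {u. c < (\<Sum>i<n. e i * (blinfun_apply f (u i))\<^sup>2)})"
      unfolding A_def using F(1) F_nonempty by (auto simp: Max_gr_iff)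
    also have "\<dots> \<in> sets seq_space"
    proof (intro sets.finite_UN F(1))
      fix f
      have "{u \<in> space seq_space. c < (\<Sum>i<n. e i * (blinfun_apply f (u i))\<^sup>2)} \<in> sets (seq_space :: (nat \<Rightarrow> 'b) measure)"
        by measurable
      then show "{u. c < (\<Sum>i<n. e i * (blinfun_apply f (u i))\<^sup>2)} \<in> sets (seq_space :: (nat \<Rightarrow> 'b) measure)"
        by (simp add: space_PiM)
    qed
    finally show "{u \<in> space seq_space. c < A e u} \<in> sets seq_space" by (simp add: space_PiM)
  qed
  have Am1: "(\<lambda>\<omega>. A e (\<lambda>i. Y (k + i) \<omega>)) \<in> borel_measurable M" for e k
    by (rule measurable_compose[OF seq_measurable Am]) measurable
  have sq: "(blinfun_apply f (Y i \<omega>))\<^sup>2 \<le> b\<^sup>2" if "f \<in> F" "\<omega> \<in> space M" for f i \<omega>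
  proof -
    have "\<bar>blinfun_apply f (Y i \<omega>)\<bar>\<^sup>2 \<le> b\<^sup>2"
      using blinfun_apply_le_norm[OF F1[OF that(1)], of "Y i \<omega>"] b[OF that(2), of i] by (intro power_mono) auto
    then show ?thesis by simp
  qed
  have Ab: "A e (\<lambda>i. Y (k + i) \<omega>) \<le> real n * b\<^sup>2" if e: "\<And>i. i < n \<Longrightarrow> \<bar>e i\<bar> = 1" and \<omega>: "\<omega> \<in> space M" for e k \<omega>
  proof -
    obtain f where f: "f \<in> F" "A e (\<lambda>i. Y (k + i) \<omega>) = (\<Sum>i<n. e i * (blinfun_apply f (Y (k + i) \<omega>))\<^sup>2)"
      using A_in by blast
    have "(\<Sum>i<n. e i * (blinfun_apply f (Y (k + i) \<omega>))\<^sup>2) \<le> (\<Sum>i<n. b\<^sup>2)"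
    proof (rule sum_mono)
      fix i assume "i \<in> {..<n}"
      then have "e i * (blinfun_apply f (Y (k + i) \<omega>))\<^sup>2 \<le> 1 * (blinfun_apply f (Y (k + i) \<omega>))\<^sup>2"
        using e[of i] by (intro mult_right_mono) auto
      then show "e i * (blinfun_apply f (Y (k + i) \<omega>))\<^sup>2 \<le> b\<^sup>2" using sq[OF f(1) \<omega>, of "k + i"] by simp
    qed
    then show ?thesis using f by simp
  qed
  have Ai: "integrable M (\<lambda>\<omega>. A e (\<lambda>i. Y (k + i) \<omega>))" if "\<And>i. i < n \<Longrightarrow> \<bar>e i\<bar> = 1" for e k
    by (rule integrable_const_bound[of _ "real n * b\<^sup>2"]) (use Am1 Ab[OF that] A0 in auto)
  define EA where "EA e = (\<integral>\<omega>. A e (\<lambda>i. Y i \<omega>) \<partial>M)" for e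
  have shift: "(\<integral>\<omega>. A e (\<lambda>i. Y (n + i) \<omega>) \<partial>M) = EA e" for e
    unfolding EA_def by (rule integral_seq_law[OF indep_reindex law_reindex]) (auto simp: inj_def)
  have step: "?D \<le> (1 / w) * (EA e + EA (\<lambda>i. - e i))" if e: "e \<in> signs n" for e
  proof -
    have e1: "e i = 1 \<or> e i = -1" if "i < n" for i using e that by (auto simp: signs_def)
    \<comment> \<open>The indices i and n + i are exchanged exactly where the sign is -1. This
      involution preserves the law and multiplies the i-th difference of squares by
      \<open>e i\<close>.\<close>
    define \<pi> where "\<pi> i = (if i < n then (if e i = 1 then i else n + i) else
       if i < n + n then (if e (i - n) = 1 then i else i - n) else i)" for i
    have pp: "\<pi> (\<pi> i) = i" for i unfolding \<pi>_def by auto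
    then have "inj \<pi>" by (metis injI)
    define D where "D u \<longleftrightarrow> (\<exists>f\<in>F. w < (\<Sum>i<n. (blinfun_apply f (u i))\<^sup>2 - (blinfun_apply f (u (n + i)))\<^sup>2))" for u :: "nat \<Rightarrow> 'b"
    have Dm: "Measurable.pred seq_space D" unfolding D_def[abs_def] using F(1) by measurable
    have "?D = prob {\<omega>\<in>space M. D (\<lambda>i. Y (\<pi> i) \<omega>)}"
      using prob_reindex[OF \<open>inj \<pi>\<close> Dm] unfolding D_def by simp
    also have "\<dots> \<le> prob {\<omega>\<in>space M. w \<le> A e (\<lambda>i. Y (0 + i) \<omega>) + A (\<lambda>i. - e i) (\<lambda>i. Y (n + i) \<omega>)}"
    proof (rule finite_measure_mono, safe)
      fix \<omega> assume "D (\<lambda>i. Y (\<pi> i) \<omega>)"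
      then obtain f where f: "f \<in> F" "w < (\<Sum>i<n. (blinfun_apply f (Y (\<pi> i) \<omega>))\<^sup>2 - (blinfun_apply f (Y (\<pi> (n + i)) \<omega>))\<^sup>2)"
        unfolding D_def by auto
      have "(\<Sum>i<n. (blinfun_apply f (Y (\<pi> i) \<omega>))\<^sup>2 - (blinfun_apply f (Y (\<pi> (n + i)) \<omega>))\<^sup>2) =
         (\<Sum>i<n. e i * (blinfun_apply f (Y i \<omega>))\<^sup>2 + - e i * (blinfun_apply f (Y (n + i) \<omega>))\<^sup>2)"
      proof (rule sum.cong)
        fix i assume "i \<in> {..<n}"
        then show "(blinfun_apply f (Y (\<pi> i) \<omega>))\<^sup>2 - (blinfun_apply f (Y (\<pi> (n + i)) \<omega>))\<^sup>2 =
            e i * (blinfun_apply f (Y i \<omega>))\<^sup>2 + - e i * (blinfun_apply f (Y (n + i) \<omega>))\<^sup>2"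
          using e1[of i] by (auto simp: \<pi>_def)
      qed simp
      also have "\<dots> = (\<Sum>i<n. e i * (blinfun_apply f (Y i \<omega>))\<^sup>2) + (\<Sum>i<n. - e i * (blinfun_apply f (Y (n + i) \<omega>))\<^sup>2)"
        by (rule sum.distrib)
      also have "\<dots> \<le> A e (\<lambda>i. Y i \<omega>) + A (\<lambda>i. - e i) (\<lambda>i. Y (n + i) \<omega>)"
        using A_ge[OF f(1), of e "\<lambda>i. Y i \<omega>"] A_ge[OF f(1), of "\<lambda>i. - e i" "\<lambda>i. Y (n + i) \<omega>"] by (rule add_mono)
      finally show "w \<le> A e (\<lambda>i. Y (0 + i) \<omega>) + A (\<lambda>i. - e i) (\<lambda>i. Y (n + i) \<omega>)" using f(2) by simp
    qed (use Am1[of e 0] Am1[of "\<lambda>i. - e i" n] in measurable)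
    also have "\<dots> \<le> (\<integral>\<omega>. A e (\<lambda>i. Y (0 + i) \<omega>) + A (\<lambda>i. - e i) (\<lambda>i. Y (n + i) \<omega>) \<partial>M) / w"
    proof (rule integral_Markov_inequality_measure[where A = "{}"])
      show "integrable M (\<lambda>\<omega>. A e (\<lambda>i. Y (0 + i) \<omega>) + A (\<lambda>i. - e i) (\<lambda>i. Y (n + i) \<omega>))"
        by (intro Bochner_Integration.integrable_add Ai) (use e1 in force)+
    qed (use A0 w in auto)
    also have "\<dots> = (EA e + EA (\<lambda>i. - e i)) / w"
      by (subst Bochner_Integration.integral_add[OF Ai Ai]) (use e1 shift in \<open>force simp: EA_def\<close>)+
    finally show ?thesis by simp
  qed
  \<comment> \<open>Squaring is Lipschitz with constant 2 b on the interval from - b to b, so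
    contraction replaces the squares by the functionals themselves.\<close>
  have cb: "sign_avg n (\<lambda>e. A e (\<lambda>i. Y i \<omega>)) \<le> 2 * b * rad_mean F n (initial n \<omega>)" if \<omega>: "\<omega> \<in> space M" for \<omega>
  proof -
    have "sign_avg n (\<lambda>e. A e (\<lambda>i. Y i \<omega>)) \<le>
        sign_avg n (\<lambda>e. Max ((\<lambda>f. 0 + 2 * b * (\<Sum>i<n. e i * blinfun_apply f (Y i \<omega>))) ` F))"
      unfolding A_def
    proof (rule rademacher_contraction[OF F(1) F_nonempty])
      fix i f f' assume ff: "f \<in> F" "f' \<in> F"
      let ?x = "blinfun_apply f (Y i \<omega>)" and ?y = "blinfun_apply f' (Y i \<omega>)"
      have "\<bar>?x\<bar> \<le> b" "\<bar>?y\<bar> \<le> b"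
        using blinfun_apply_le_norm[OF F1[OF ff(1)], of "Y i \<omega>"] blinfun_apply_le_norm[OF F1[OF ff(2)], of "Y i \<omega>"] b[OF \<omega>, of i] by auto
      then have "\<bar>?x + ?y\<bar> \<le> 2 * b" by linarith
      then have "\<bar>?x + ?y\<bar> * \<bar>?x - ?y\<bar> \<le> 2 * b * \<bar>?x - ?y\<bar>" by (intro mult_right_mono) auto
      moreover have "?x\<^sup>2 - ?y\<^sup>2 = (?x + ?y) * (?x - ?y)" by (simp add: power2_eq_square algebra_simps)
      ultimately show "\<bar>?x\<^sup>2 - ?y\<^sup>2\<bar> \<le> 2 * b * \<bar>?x - ?y\<bar>" by (simp add: abs_mult)
    qed
    also have "\<dots> \<le> sign_avg n (\<lambda>e. 2 * b * max_fun F (\<Sum>i<n. e i *\<^sub>R initial n \<omega> i))"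
    proof (rule sign_avg_mono)
      fix e
      have s: "(\<Sum>i<n. e i *\<^sub>R initial n \<omega> i) = (\<Sum>i<n. e i *\<^sub>R Y i \<omega>)"
        by (intro sum.cong) (auto simp: initial_def)
      have "(\<Sum>i<n. e i * blinfun_apply f (Y i \<omega>)) \<le> max_fun F (\<Sum>i<n. e i *\<^sub>R Y i \<omega>)" if "f \<in> F" for f
        using max_fun_ge[OF F(1) that, of "\<Sum>i<n. e i *\<^sub>R Y i \<omega>"] by (simp add: blinfun.sum_right blinfun.scaleR_right)
      then show "Max ((\<lambda>f. 0 + 2 * b * (\<Sum>i<n. e i * blinfun_apply f (Y i \<omega>))) ` F) \<le> 2 * b * max_fun F (\<Sum>i<n. e i *\<^sub>R initial n \<omega> i)"
        unfolding s using F(1) F_nonempty b0 by (auto intro!: mult_left_mono)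
    qed
    also have "\<dots> = 2 * b * rad_mean F n (initial n \<omega>)" unfolding rad_mean_def by (rule sign_avg_cmult)
    finally show ?thesis .
  qed
  have ri: "integrable M (\<lambda>\<omega>. rad_mean F n (initial n \<omega>))"
  proof (rule integrable_const_bound[of _ "real n * b"])
    show "(\<lambda>\<omega>. rad_mean F n (initial n \<omega>)) \<in> borel_measurable M"
      by (rule measurable_compose[OF initial_measurable rad_mean_measurable[OF F(1) F_nonempty]])
  qed (auto intro!: AE_I2 rad_mean_bound simp: initial_def b)
  have Ai0: "integrable M (\<lambda>\<omega>. A e (\<lambda>i. Y i \<omega>))" if "e \<in> signs n" for e
  proof -
    have "\<bar>e i\<bar> = 1" if "i < n" for i using \<open>e \<in> signs n\<close> that by (auto simp: signs_def)
    then show ?thesis using Ai[of e 0] by simp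
  qed
  have "sign_avg n EA = (\<integral>\<omega>. sign_avg n (\<lambda>e. A e (\<lambda>i. Y i \<omega>)) \<partial>M)"
    unfolding EA_def sign_avg_def using Ai0 by (simp add: Bochner_Integration.integral_sum)
  also have "\<dots> \<le> (\<integral>\<omega>. 2 * b * rad_mean F n (initial n \<omega>) \<partial>M)"
  proof (rule integral_mono)
    show "integrable M (\<lambda>\<omega>. sign_avg n (\<lambda>e. A e (\<lambda>i. Y i \<omega>)))"
      unfolding sign_avg_def using Ai0 by auto
  qed (use ri cb in auto)
  also have "\<dots> = 2 * b * (\<integral>\<omega>. rad_mean F n (initial n \<omega>) \<partial>M)" by simp
  also have "\<dots> \<le> 2 * b * E" using expectation_rad_mean b0 by (intro mult_left_mono) auto
  finally have EA: "sign_avg n EA \<le> 2 * b * E" .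
  have "?D = sign_avg n (\<lambda>_. ?D)" by simp
  also have "\<dots> \<le> sign_avg n (\<lambda>e. (1 / w) * (EA e + EA (\<lambda>i. - e i)))" by (rule sign_avg_mono) (rule step)
  also have "\<dots> = (1 / w) * (sign_avg n EA + sign_avg n EA)"
    unfolding sign_avg_cmult sign_avg_add sign_avg_uminus ..
  also have "\<dots> \<le> (1 / w) * (2 * b * E + 2 * b * E)" by (intro mult_left_mono add_mono EA) (use w in auto)
  finally show ?thesis by (simp add: mult_ac)
qed

text \<open>The average over signs is moved inside the integral. Off \<open>Bad\<close> the
  conditional mean is at most E + t and the sums of squares are at most 2 V + w, so concentration
  for signs applies at the point; the probability of \<open>Bad\<close> accounts for the last two
  terms.\<close>

theorem max_fun_tail:
  assumes s: "0 \<le> s"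
  shows "prob {\<omega>\<in>space M. E + t + s < max_fun F (psum n \<omega>)} \<le>
    exp (- s\<^sup>2 / (8 * (2 * V + w))) + b * E / t\<^sup>2 + 8 * b * E / w"
proof -
  define P where "P u \<longleftrightarrow> E + t + s < max_fun F (\<Sum>i<n. u i)" for u :: "nat \<Rightarrow> 'b"
  have Pm: "Measurable.pred seq_space P"
    unfolding P_def[abs_def] using max_fun_measurable[OF F(1) F_nonempty] by measurable
  define Bad where "Bad = {\<omega>\<in>space M. E + t < rad_mean F n (initial n \<omega>)} \<union>
     {\<omega>\<in>space M. \<exists>f\<in>F. 2 * V + w < (\<Sum>i<n. (blinfun_apply f (Y i \<omega>))\<^sup>2)}"
  have rm: "(\<lambda>\<omega>. rad_mean F n (initial n \<omega>)) \<in> borel_measurable M"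
    by (rule measurable_compose[OF initial_measurable rad_mean_measurable[OF F(1) F_nonempty]])
  have m1: "{\<omega>\<in>space M. E + t < rad_mean F n (initial n \<omega>)} \<in> sets M" using rm by measurable
  have m2: "{\<omega>\<in>space M. \<exists>f\<in>F. 2 * V + w < (\<Sum>i<n. (blinfun_apply f (Y i \<omega>))\<^sup>2)} \<in> sets M" using F(1) by measurable
  have [measurable]: "Bad \<in> sets M" unfolding Bad_def using m1 m2 by auto
  have "prob Bad \<le> b * E / t\<^sup>2 + 2 * (4 * b * E / w)"
    unfolding Bad_def
    using measure_Un_le[OF m1 m2] rad_mean_tail weak_variance_symmetrize weak_variance_rademacher by linarith
  let ?x = "exp (- s\<^sup>2 / (8 * (2 * V + w)))"
  let ?I = "\<lambda>e \<omega>. if P (\<lambda>i. e i *\<^sub>R Y i \<omega>) then 1 else 0 :: real"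
  have PM: "Measurable.pred M (\<lambda>\<omega>. P (\<lambda>i. e i *\<^sub>R Y i \<omega>))" for e
    by (rule pred_seq[OF Pm]) measurable
  have Ii: "integrable M (?I e)" for e
    by (rule integrable_const_bound[of _ 1]) (use PM[of e] in auto)
  have prob_I: "prob {\<omega>\<in>space M. P (\<lambda>i. e i *\<^sub>R Y i \<omega>)} = (\<integral>\<omega>. ?I e \<omega> \<partial>M)" for e
  proof -
    have "(\<integral>\<omega>. ?I e \<omega> \<partial>M) = (\<integral>\<omega>. indicator {\<omega>\<in>space M. P (\<lambda>i. e i *\<^sub>R Y i \<omega>)} \<omega> \<partial>M)"
      by (rule Bochner_Integration.integral_cong) auto
    also have "\<dots> = prob {\<omega>\<in>space M. P (\<lambda>i. e i *\<^sub>R Y i \<omega>)}" using PM[of e] by simp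
    finally show ?thesis by simp
  qed
  have "prob {\<omega>\<in>space M. E + t + s < max_fun F (psum n \<omega>)} = prob {\<omega>\<in>space M. P (initial n \<omega>)}"
    unfolding P_def psum_def by (intro arg_cong[where f = prob] Collect_cong conj_cong refl arg_cong2[where f = "(<)"] arg_cong[where f = "max_fun F"] sum.cong) (auto simp: initial_def)
  also have "\<dots> = sign_avg n (\<lambda>e. prob {\<omega>\<in>space M. P (initial n \<omega>)})" by simp
  also have "\<dots> = sign_avg n (\<lambda>e. \<integral>\<omega>. ?I e \<omega> \<partial>M)"
    using prob_signs[OF _ Pm] prob_I by (intro sign_avg_cong) simp
  also have "\<dots> = (\<integral>\<omega>. sign_avg n (\<lambda>e. ?I e \<omega>) \<partial>M)"
    unfolding sign_avg_def using Ii by (simp add: Bochner_Integration.integral_sum)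
  also have "\<dots> \<le> (\<integral>\<omega>. ?x + indicator Bad \<omega> \<partial>M)"
  proof (rule integral_mono)
    show "integrable M (\<lambda>\<omega>. sign_avg n (\<lambda>e. ?I e \<omega>))" unfolding sign_avg_def using Ii by auto
    show "integrable M (\<lambda>\<omega>. ?x + indicator Bad \<omega>)" by (auto intro!: integrable_real_indicator simp: less_top[symmetric])
    fix \<omega> assume \<omega>: "\<omega> \<in> space M"
    show "sign_avg n (\<lambda>e. ?I e \<omega>) \<le> ?x + indicator Bad \<omega>"
    proof (cases "\<omega> \<in> Bad")
      case True
      have "sign_avg n (\<lambda>e. ?I e \<omega>) \<le> sign_avg n (\<lambda>e. 1)" by (rule sign_avg_mono) auto
      also have "\<dots> \<le> ?x + indicator Bad \<omega>" using True by simp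
      finally show ?thesis .
    next
      case False
      let ?Z = "\<lambda>e. max_fun F (\<Sum>i<n. e i *\<^sub>R initial n \<omega> i)"
      have Zeq: "?Z e = max_fun F (\<Sum>i<n. e i *\<^sub>R Y i \<omega>)" for e
        by (intro arg_cong[where f = "max_fun F"] sum.cong) (auto simp: initial_def)
      have N: "sign_avg n ?Z \<le> E + t" using False \<omega> unfolding Bad_def rad_mean_def by auto
      have W: "(\<Sum>i<n. (blinfun_apply f (initial n \<omega> i))\<^sup>2) \<le> 2 * V + w" if "f \<in> F" for f
      proof -
        have "(\<Sum>i<n. (blinfun_apply f (initial n \<omega> i))\<^sup>2) = (\<Sum>i<n. (blinfun_apply f (Y i \<omega>))\<^sup>2)"
          by (intro sum.cong) (auto simp: initial_def)
        then show ?thesis using False \<omega> that unfolding Bad_def by (auto simp: not_less)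
      qed
      have "sign_avg n (\<lambda>e. ?I e \<omega>) \<le> sign_avg n (\<lambda>e. if sign_avg n ?Z + s < ?Z e then 1 else 0)"
        by (rule sign_avg_mono) (use N in \<open>auto simp: P_def Zeq\<close>)
      also have "\<dots> \<le> ?x"
        by (rule rademacher_concentration[OF F _ W s]) (use V0 w in auto)
      finally show ?thesis using False by simp
    qed
  qed
  also have "\<dots> = ?x + prob Bad" by (subst Bochner_Integration.integral_add) (auto intro!: integrable_real_indicator simp: less_top[symmetric] prob_space)
  finally show ?thesis using \<open>prob Bad \<le> _\<close> by simp
qed

end

end

section \<open>The normalizing function\<close>

text \<open>The powers of two below z add up to less than 2 z. The second bound 2^K is what the
  induction needs when the next power is still below z.\<close>

lemma dyadic_indicator_sum:
  fixes z :: real assumes "0 \<le> z"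
  shows "(\<Sum>k<K. 2 ^ k * (if 2 ^ k < z then 1 else 0)) \<le> min (2 * z) (2 ^ K)"
  using assms by (induction K) auto

text \<open>The terms \<open>d k\<close> form a geometric sequence with ratio q, and only those not
  exceeding 1 are counted; \<open>(1 - d K) / (1 - q)\<close> is the invariant that telescopes. The
  exponent 1/8 is half of 9/4, diminished by 1.\<close>

lemma dyadic_geometric_sum:
  fixes z :: real assumes z: "0 \<le> z"
  defines "q \<equiv> 2 powr (- (1/8))" and "d \<equiv> \<lambda>k::nat. (z / 2 ^ k) powr (1/8)"
  shows "(\<Sum>k<K. if d k \<le> 1 then d k else 0) \<le> (if d K \<le> 1 then (1 - d K) / (1 - q) else 0)"
proof (induction K)
  case 0
  have "q < 1" unfolding q_def by (simp add: powr_less_one)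
  then show ?case by simp
next
  case (Suc K)
  have q: "q < 1" "0 < q" unfolding q_def by (simp_all add: powr_less_one)
  have dS: "d (Suc K) = q * d K"
  proof -
    have "z / 2 ^ Suc K = (1/2) * (z / 2 ^ K)" by simp
    then show ?thesis unfolding d_def q_def using z
      by (simp only: powr_mult) (simp add: powr_minus powr_divide field_simps)
  qed
  have d0: "0 \<le> d K" unfolding d_def by simp
  have dle: "d (Suc K) \<le> d K" unfolding dS using q d0 mult_right_mono[of q 1 "d K"] by simp
  show ?case
  proof (cases "d K \<le> 1")
    case True
    then have "(\<Sum>k<Suc K. if d k \<le> 1 then d k else 0) \<le> (1 - d K) / (1 - q) + d K" using Suc by simp
    also have "\<dots> = (1 - d (Suc K)) / (1 - q)" unfolding dS using q by (simp add: field_simps)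
    finally show ?thesis using True dle by simp
  next
    case False
    then have "(\<Sum>k<Suc K. if d k \<le> 1 then d k else 0) \<le> 0" using Suc by simp
    also have "\<dots> \<le> (if d (Suc K) \<le> 1 then (1 - d (Suc K)) / (1 - q) else 0)" using q by simp
    finally show ?thesis .
  qed
qed

context
  fixes h :: "real \<Rightarrow> real"
  assumes h: "h \<in> class_H"
begin

lemma h_pos: "0 \<le> x \<Longrightarrow> 0 < h x"
  using h by (auto simp: class_H_def)

lemma h_mono: "0 \<le> x \<Longrightarrow> x \<le> y \<Longrightarrow> h x \<le> h y"
  using h by (auto simp: class_H_def mono_on_def)

lemma Psi_0 [simp]: "Psi h 0 = 0" by (simp add: Psi_def)

lemma Psi_nonneg [simp]: "0 \<le> x \<Longrightarrow> 0 \<le> Psi h x"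
  using h_pos[of x] by (simp add: Psi_def)

lemma Psi_square: "0 \<le> x \<Longrightarrow> (Psi h x)\<^sup>2 = x * h x"
  using h_pos[of x] by (simp add: Psi_def)

lemma Psi_strict_mono: assumes "0 \<le> x" "x < y" shows "Psi h x < Psi h y"
proof -
  have "x * h x \<le> x * h y" using assms h_mono[of x y] by (intro mult_left_mono) auto
  also have "\<dots> < y * h y" using assms h_pos[of y] by (intro mult_strict_right_mono) auto
  finally show ?thesis by (simp add: Psi_def)
qed

lemma Psi_pos: "0 < x \<Longrightarrow> 0 < Psi h x" using Psi_strict_mono[of 0 x] by simp

lemma Psi_mono: "0 \<le> x \<Longrightarrow> x \<le> y \<Longrightarrow> Psi h x \<le> Psi h y"
  using Psi_strict_mono[of x y] by (cases "x = y") auto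

text \<open>Since h is non-decreasing, Psi grows at least as fast as the square root.\<close>

lemma Psi_scale: assumes "1 \<le> K" "0 \<le> x" shows "K * Psi h x \<le> Psi h (K\<^sup>2 * x)"
proof -
  have "1 \<le> K\<^sup>2" using assms by simp
  then have "x \<le> K\<^sup>2 * x" using assms mult_right_mono[of 1 "K\<^sup>2" x] by simp
  then have "K\<^sup>2 * (x * h x) \<le> K\<^sup>2 * x * h (K\<^sup>2 * x)"
    using h_mono[of x "K\<^sup>2 * x"] assms by (simp add: mult.assoc mult_left_mono)
  then have "sqrt (K\<^sup>2 * (x * h x)) \<le> Psi h (K\<^sup>2 * x)" unfolding Psi_def by simp
  then show ?thesis using assms by (simp add: real_sqrt_mult Psi_def)
qed

lemma Psi_continuous: "continuous_on {0..} (Psi h)"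
proof -
  have "continuous_on {0..} h" using h by (simp add: class_H_def)
  then show ?thesis unfolding Psi_def[abs_def] by (intro continuous_intros)
qed

text \<open>The positive lower bound \<open>h 0\<close> of h makes Psi unbounded, and the
  intermediate value theorem applies.\<close>

lemma Psi_surj: assumes "0 \<le> y" shows "\<exists>x\<ge>0. Psi h x = y"
proof -
  define x1 where "x1 = y\<^sup>2 / h 0"
  have h0: "0 < h 0" by (simp add: h_pos)
  have x1: "0 \<le> x1" using h0 by (simp add: x1_def)
  have "y\<^sup>2 = x1 * h 0" using h0 by (simp add: x1_def)
  also have "\<dots> \<le> x1 * h x1" using x1 h_mono[of 0 x1] by (intro mult_left_mono) auto
  finally have "y \<le> Psi h x1" unfolding Psi_def by (rule real_le_rsqrt)
  moreover have "continuous_on {0..x1} (Psi h)" by (rule continuous_on_subset[OF Psi_continuous]) auto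
  ultimately show ?thesis using IVT'[of "Psi h" 0 y x1] assms x1 by auto
qed

lemma Psi_Psi_inv: "0 \<le> y \<Longrightarrow> Psi h (Psi_inv h y) = y"
  and Psi_inv_nonneg: "0 \<le> y \<Longrightarrow> 0 \<le> Psi_inv h y"
proof -
  assume "0 \<le> y"
  then have "y \<in> Psi h ` {0..}" using Psi_surj[of y] by force
  then show "Psi h (Psi_inv h y) = y" "0 \<le> Psi_inv h y"
    unfolding Psi_inv_def using f_inv_into_f[of y "Psi h" "{0..}"] inv_into_into[of y "Psi h" "{0..}"] by auto
qed

lemma less_Psi_inv_iff: assumes "0 \<le> x" "0 \<le> y" shows "x < Psi_inv h y \<longleftrightarrow> Psi h x < y"
  using Psi_strict_mono[of x "Psi_inv h y"] Psi_mono[of "Psi_inv h y" x] Psi_Psi_inv[of y] Psi_inv_nonneg[of y] assms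
  by (auto simp: not_less[symmetric])

lemma Psi_inv_mono: "0 \<le> x \<Longrightarrow> x \<le> y \<Longrightarrow> Psi_inv h x \<le> Psi_inv h y"
proof (rule ccontr)
  assume a: "0 \<le> x" "x \<le> y" "\<not> Psi_inv h x \<le> Psi_inv h y"
  then have "Psi h (Psi_inv h y) < x" using less_Psi_inv_iff[of "Psi_inv h y" x] Psi_inv_nonneg[of y] by simp
  then show False using a Psi_Psi_inv[of y] by simp
qed

lemma Psi_inv_scale: assumes "1 \<le> K" "0 \<le> y" shows "Psi_inv h (K * y) \<le> K\<^sup>2 * Psi_inv h y"
proof (rule ccontr)
  assume "\<not> ?thesis"
  then have "Psi h (K\<^sup>2 * Psi_inv h y) < K * y"
    using less_Psi_inv_iff[of "K\<^sup>2 * Psi_inv h y" "K * y"] Psi_inv_nonneg[of y] assms by simp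
  moreover have "K * y \<le> Psi h (K\<^sup>2 * Psi_inv h y)"
    using Psi_scale[of K "Psi_inv h y"] Psi_inv_nonneg[of y] Psi_Psi_inv[of y] assms by simp
  ultimately show False by simp
qed

lemma Psi_inv_measurable:
  assumes R: "R \<in> borel_measurable M" "\<And>\<omega>. 0 \<le> R \<omega>"
  shows "(\<lambda>\<omega>. Psi_inv h (R \<omega>)) \<in> borel_measurable M"
  unfolding borel_measurable_iff_greater
proof
  fix c
  show "{\<omega>\<in>space M. c < Psi_inv h (R \<omega>)} \<in> sets M"
  proof (cases "c < 0")
    case True
    then have "{\<omega>\<in>space M. c < Psi_inv h (R \<omega>)} = space M"
      using Psi_inv_nonneg[OF R(2)] by (auto intro: less_le_trans)
    then show ?thesis by simp
  next
    case False
    then have "{\<omega>\<in>space M. c < Psi_inv h (R \<omega>)} = {\<omega>\<in>space M. Psi h c < R \<omega>}"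
      using less_Psi_inv_iff[of c] R(2) by auto
    also have "\<dots> \<in> sets M" using R(1) by measurable
    finally show ?thesis .
  qed
qed

text \<open>Slow variation at the factor 2, read along powers of two. Growth by at most a factor 2
  per block is what allows a block to be represented by its end point.\<close>

lemma h_doubling:
  assumes c: "1 < c" obtains k0 :: nat where "\<And>k. k0 \<le> k \<Longrightarrow> h (2 ^ Suc k) \<le> c * h (2 ^ k)"
proof -
  have "((\<lambda>x. h (2 * x) / h x) \<longlongrightarrow> 1) at_top" using h by (auto simp: class_H_def slowly_varying_def)
  then have "eventually (\<lambda>x. h (2 * x) / h x < c) at_top" using c by (rule order_tendstoD)
  then obtain x0 where x0: "\<And>x. x0 \<le> x \<Longrightarrow> h (2 * x) / h x < c" by (auto simp: eventually_at_top_linorder)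
  obtain k0 :: nat where k0: "x0 < 2 ^ k0" using real_arch_pow[of 2 x0] by auto
  have "h (2 ^ Suc k) \<le> c * h (2 ^ k)" if "k0 \<le> k" for k
  proof -
    have "(2::real) ^ k0 \<le> 2 ^ k" using that by (intro power_increasing) auto
    then have "h (2 * 2 ^ k) / h (2 ^ k) < c" using k0 by (intro x0) linarith
    then show ?thesis using h_pos[of "2 ^ k"] by (simp add: field_simps)
  qed
  then show ?thesis using that by blast
qed

lemma Psi_doubling: obtains k0 :: nat where "\<And>k. k0 \<le> k \<Longrightarrow> Psi h (2 ^ Suc k) \<le> 2 * Psi h (2 ^ k)"
proof -
  obtain k0 where k0: "\<And>k. k0 \<le> k \<Longrightarrow> h (2 ^ Suc k) \<le> 2 * h (2 ^ k)" using h_doubling[of 2] by auto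
  have "Psi h (2 ^ Suc k) \<le> 2 * Psi h (2 ^ k)" if "k0 \<le> k" for k
  proof -
    have "sqrt (2 ^ Suc k * h (2 ^ Suc k)) \<le> sqrt (2\<^sup>2 * (2 ^ k * h (2 ^ k)))" using k0[OF that] by simp
    then show ?thesis unfolding Psi_def by (simp add: real_sqrt_mult)
  qed
  then show ?thesis using that by blast
qed

text \<open>Growth of h by at most 3/2 per doubling, against the factor 2 in the denominator, leaves
  a geometric decay with ratio 3/4.\<close>

lemma h_over_tendsto_0: "(\<lambda>k. h (2 ^ k) / 2 ^ k) \<longlonglongrightarrow> 0"
proof -
  obtain k0 where k0: "\<And>k. k0 \<le> k \<Longrightarrow> h (2 ^ Suc k) \<le> (3/2) * h (2 ^ k)" using h_doubling[of "3/2"] by auto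
  have b: "h (2 ^ (k0 + j)) / 2 ^ (k0 + j) \<le> (h (2 ^ k0) / 2 ^ k0) * (3/4) ^ j" for j
  proof (induction j)
    case (Suc j)
    have "h (2 ^ (k0 + Suc j)) / 2 ^ (k0 + Suc j) \<le> (3/2) * h (2 ^ (k0 + j)) / 2 ^ (k0 + Suc j)"
      using k0[of "k0 + j"] by (intro divide_right_mono) auto
    also have "\<dots> = (3/4) * (h (2 ^ (k0 + j)) / 2 ^ (k0 + j))" by simp
    also have "\<dots> \<le> (3/4) * ((h (2 ^ k0) / 2 ^ k0) * (3/4) ^ j)" using Suc by (intro mult_left_mono) auto
    finally show ?case by simp
  qed simp
  have lim: "(\<lambda>j. (h (2 ^ k0) / 2 ^ k0) * (3/4) ^ j) \<longlonglongrightarrow> (h (2 ^ k0) / 2 ^ k0) * 0"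
    by (intro tendsto_intros LIMSEQ_power_zero) auto
  have "(\<lambda>j. h (2 ^ (k0 + j)) / 2 ^ (k0 + j)) \<longlonglongrightarrow> 0"
  proof (rule tendsto_sandwich[OF _ _ tendsto_const lim[simplified mult_zero_right]])
    show "\<forall>\<^sub>F j in sequentially. 0 \<le> h (2 ^ (k0 + j)) / 2 ^ (k0 + j)"
      by (intro always_eventually allI divide_nonneg_pos less_imp_le[OF h_pos]) simp_all
    show "\<forall>\<^sub>F j in sequentially. h (2 ^ (k0 + j)) / 2 ^ (k0 + j) \<le> (h (2 ^ k0) / 2 ^ k0) * (3/4) ^ j"
      by (intro always_eventually allI b)
  qed
  then show ?thesis
    using LIMSEQ_offset[of "\<lambda>k. h (2 ^ k) / 2 ^ k" k0] by (simp add: add.commute)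
qed

lemma Psi_over_tendsto_0: "(\<lambda>k. Psi h (2 ^ k) / 2 ^ k) \<longlonglongrightarrow> 0"
proof -
  have "(\<lambda>k. sqrt (h (2 ^ k) / 2 ^ k)) \<longlonglongrightarrow> sqrt 0" by (intro tendsto_intros h_over_tendsto_0)
  moreover have "sqrt (h (2 ^ k) / 2 ^ k) = Psi h (2 ^ k) / 2 ^ k" for k :: nat
  proof -
    have "sqrt (h (2 ^ k) / 2 ^ k) = sqrt (2 ^ k * h (2 ^ k) / (2 ^ k)\<^sup>2)"
      by (simp add: power2_eq_square)
    also have "\<dots> = sqrt (2 ^ k * h (2 ^ k)) / sqrt ((2 ^ k)\<^sup>2)" by (rule real_sqrt_divide)
    finally show ?thesis by (simp add: Psi_def)
  qed
  ultimately show ?thesis by simp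
qed

text \<open>Psi is at most linear along powers of two, and rounding \<open>Psi_inv h y\<close> up to
  a power of two costs a factor 2. The bound turns integrability of \<open>Psi_inv\<close> of the
  norm into integrability of the norm.\<close>

lemma le_Psi_inv: obtains C where "0 < C" "\<And>y. 0 \<le> y \<Longrightarrow> y \<le> C * (1 + Psi_inv h y)"
proof -
  have "Bseq (\<lambda>k. Psi h (2 ^ k) / 2 ^ k)"
    using Psi_over_tendsto_0 by (intro convergent_imp_Bseq) (auto simp: convergent_def)
  then obtain B where B: "0 < B" "\<And>k. norm (Psi h (2 ^ k) / 2 ^ k) \<le> B" by (auto simp: Bseq_def)
  have "y \<le> 2 * B * (1 + Psi_inv h y)" if y: "0 \<le> y" for y
  proof -
    define z where "z = Psi_inv h y"
    have z: "0 \<le> z" unfolding z_def by (rule Psi_inv_nonneg[OF y])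
    define k where "k = (LEAST k. z \<le> 2 ^ k)"
    obtain k1 :: nat where "z < 2 ^ k1" using real_arch_pow[of 2 z] by auto
    then have k: "z \<le> 2 ^ k"
    using LeastI[of "\<lambda>k. z \<le> 2 ^ k" k1] unfolding k_def by simp
    have "2 ^ k \<le> 2 * (1 + z)"
    proof (cases k)
      case 0
      then show ?thesis using z by simp
    next
      case (Suc j)
      then have "\<not> z \<le> 2 ^ j" using not_less_Least[of j "\<lambda>k. z \<le> 2 ^ k"] unfolding k_def by auto
      then show ?thesis using Suc by simp
    qed
    moreover have "y \<le> Psi h (2 ^ k)" using Psi_mono[OF z k] Psi_Psi_inv[OF y] by (simp add: z_def)
    moreover have "Psi h (2 ^ k) \<le> B * 2 ^ k" using B(2)[of k] by (simp add: field_simps)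
    ultimately have "y \<le> B * 2 ^ k" by simp
    also have "\<dots> \<le> B * (2 * (1 + z))" using \<open>2 ^ k \<le> _\<close> B by (intro mult_left_mono) auto
    finally show ?thesis by (simp add: z_def algebra_simps)
  qed
  with B show ?thesis by (intro that[of "2 * B"]) auto
qed

text \<open>The exponent 9/4 exceeds 2, which makes the dyadic sum geometric.\<close>
lemma Psi_moment_sum:
  assumes y: "0 \<le> y"
  shows "(\<Sum>k<K. 2 ^ k * (if y \<le> Psi h (2 ^ k) then (y / Psi h (2 ^ k)) powr (9/4) else 0))
    \<le> Psi_inv h y / (1 - 2 powr (- (1/8)))"
proof -
  define z where "z = Psi_inv h y"
  have z: "0 \<le> z" "Psi h z = y" unfolding z_def using Psi_inv_nonneg Psi_Psi_inv y by auto
  define d where "d k = (z / 2 ^ k) powr (1/8)" for k :: nat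
  have t: "2 ^ k * (if y \<le> Psi h (2 ^ k) then (y / Psi h (2 ^ k)) powr (9/4) else 0) \<le> z * (if d k \<le> 1 then d k else 0)" for k
  proof (cases "y \<le> Psi h (2 ^ k) \<and> y \<noteq> 0")
    case True
    then have zpos: "0 < z" using z by (cases "z = 0") auto
    have zk: "z \<le> 2 ^ k" using True z less_Psi_inv_iff[of "2 ^ k" y] y by (auto simp: z_def not_less[symmetric])
    \<comment> \<open>With y = Psi z and L^2 z = 2^k, the square root growth of Psi gives y / Psi
      (2^k) \<le> 1 / L. Raised to the power 9/4 this is z / 2^k times the surplus factor
      \<open>d k\<close>, which is summable.\<close>
    define L where "L = sqrt (2 ^ k / z)"
    have L: "1 \<le> L" "L\<^sup>2 * z = 2 ^ k" using zpos zk by (auto simp: L_def)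
    have "L * y \<le> Psi h (2 ^ k)" using Psi_scale[OF L(1) z(1)] z(2) L(2) by simp
    then have "y / Psi h (2 ^ k) \<le> 1 / L" using L Psi_pos[of "2 ^ k"] by (simp add: field_simps)
    then have "(y / Psi h (2 ^ k)) powr (9/4) \<le> (1 / L) powr (9/4)"
      using y by (intro powr_mono2) auto
    also have "1 / L = (z / 2 ^ k) powr (1/2)"
      unfolding L_def using zpos by (simp add: powr_half_sqrt real_sqrt_divide)
    also have "((z / 2 ^ k) powr (1/2)) powr (9/4) = (z / 2 ^ k) powr (1 + 1/8)"
      by (simp add: powr_powr)
    also have "\<dots> = (z / 2 ^ k) * d k" using zpos unfolding d_def by (subst powr_add) simp
    finally have "2 ^ k * (y / Psi h (2 ^ k)) powr (9/4) \<le> z * d k" by (simp add: field_simps)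
    moreover have "d k \<le> 1" unfolding d_def using zk zpos by (intro powr_le1) auto
    ultimately show ?thesis using True by simp
  next
    case False
    then show ?thesis using z by (auto simp: d_def)
  qed
  have q: "2 powr (- (1/8)) < (1::real)" by (simp add: powr_less_one)
  have "(\<Sum>k<K. 2 ^ k * (if y \<le> Psi h (2 ^ k) then (y / Psi h (2 ^ k)) powr (9/4) else 0))
     \<le> z * (\<Sum>k<K. if d k \<le> 1 then d k else 0)"
    unfolding sum_distrib_left by (intro sum_mono t)
  also have "\<dots> \<le> z * (1 / (1 - 2 powr (- (1/8))))"
  proof (rule mult_left_mono[OF order_trans[OF dyadic_geometric_sum[OF z(1), of K, folded d_def]] z(1)])
    show "(if d K \<le> 1 then (1 - d K) / (1 - 2 powr (- (1/8))) else 0) \<le> 1 / (1 - 2 powr (- (1/8)))"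
      using q by (auto intro!: divide_right_mono simp: d_def)
  qed
  finally show ?thesis by (simp add: z_def)
qed

end

section \<open>Dyadic summability and integrability of Psi_inv\<close>

lemma (in prob_space) summable_integral_bounded:
  fixes g :: "nat \<Rightarrow> 'a \<Rightarrow> real"
  assumes g: "\<And>k. integrable M (g k)" "\<And>k \<omega>. 0 \<le> g k \<omega>" and G: "integrable M G"
    and le: "\<And>K \<omega>. (\<Sum>k<K. g k \<omega>) \<le> G \<omega>"
  shows "summable (\<lambda>k. \<integral>\<omega>. g k \<omega> \<partial>M)"
proof (rule summableI_nonneg_bounded)
  fix K
  have "(\<Sum>k<K. \<integral>\<omega>. g k \<omega> \<partial>M) = (\<integral>\<omega>. (\<Sum>k<K. g k \<omega>) \<partial>M)" using g by simp
  also have "\<dots> \<le> (\<integral>\<omega>. G \<omega> \<partial>M)" by (intro integral_mono) (use g G le in auto)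
  finally show "(\<Sum>k<K. \<integral>\<omega>. g k \<omega> \<partial>M) \<le> (\<integral>\<omega>. G \<omega> \<partial>M)" .
qed (use g in auto)

text \<open>For each point the dyadic sum is at most a constant multiple of
  \<open>Psi_inv h (R \<omega>)\<close>, so integration bounds all partial sums. The weight 2^k
  stands for the number of summands in a block.\<close>

lemma (in prob_space)
  assumes h: "h \<in> class_H" and R: "R \<in> borel_measurable M" "\<And>\<omega>. 0 \<le> R \<omega>"
    and int: "integrable M (\<lambda>\<omega>. Psi_inv h (R \<omega>))"
  shows summable_Psi_tail: "summable (\<lambda>k. 2 ^ k * prob {\<omega>\<in>space M. Psi h (2 ^ k) < R \<omega>})"
    and summable_Psi_moment: "summable (\<lambda>k. 2 ^ k *
      (\<integral>\<omega>. (if R \<omega> \<le> Psi h (2 ^ k) then (R \<omega> / Psi h (2 ^ k)) powr (9/4) else 0) \<partial>M))"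
proof -
  note [measurable] = R(1)
  let ?I = "\<lambda>k \<omega>. 2 ^ k * (if 2 ^ k < Psi_inv h (R \<omega>) then 1 else 0) :: real"
  have Psi_m [measurable]: "(\<lambda>\<omega>. Psi_inv h (R \<omega>)) \<in> borel_measurable M" by (rule Psi_inv_measurable[OF h R])
  have "summable (\<lambda>k. \<integral>\<omega>. ?I k \<omega> \<partial>M)"
  proof (rule summable_integral_bounded)
    show "integrable M (?I k)" for k by (rule integrable_const_bound[of _ "2 ^ k"]) auto
    show "integrable M (\<lambda>\<omega>. 2 * Psi_inv h (R \<omega>))" using int by simp
    show "(\<Sum>k<K. ?I k \<omega>) \<le> 2 * Psi_inv h (R \<omega>)" for K \<omega>
      using dyadic_indicator_sum[OF Psi_inv_nonneg[OF h R(2)[of \<omega>]], of K] by simp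
  qed simp
  moreover have "(\<integral>\<omega>. ?I k \<omega> \<partial>M) = 2 ^ k * prob {\<omega>\<in>space M. Psi h (2 ^ k) < R \<omega>}" for k
  proof -
    have "(\<integral>\<omega>. ?I k \<omega> \<partial>M) = (\<integral>\<omega>. 2 ^ k * indicator {\<omega>\<in>space M. Psi h (2 ^ k) < R \<omega>} \<omega> \<partial>M)"
      by (rule Bochner_Integration.integral_cong) (auto simp: less_Psi_inv_iff[OF h _ R(2)])
    then show ?thesis by simp
  qed
  ultimately show "summable (\<lambda>k. 2 ^ k * prob {\<omega>\<in>space M. Psi h (2 ^ k) < R \<omega>})" by simp
  let ?J = "\<lambda>k \<omega>. 2 ^ k * (if R \<omega> \<le> Psi h (2 ^ k) then (R \<omega> / Psi h (2 ^ k)) powr (9/4) else 0) :: real"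
  have "summable (\<lambda>k. \<integral>\<omega>. ?J k \<omega> \<partial>M)"
  proof (rule summable_integral_bounded)
    show "integrable M (?J k)" for k
    proof (rule integrable_const_bound[of _ "2 ^ k"])
      have "(R \<omega> / Psi h (2 ^ k)) powr (9/4) \<le> 1" if "R \<omega> \<le> Psi h (2 ^ k)" for \<omega>
        using that R(2)[of \<omega>] Psi_pos[OF h, of "2 ^ k"] by (intro powr_le1) auto
      then show "AE \<omega> in M. norm (?J k \<omega>) \<le> 2 ^ k" by auto
    qed measurable
    show "integrable M (\<lambda>\<omega>. Psi_inv h (R \<omega>) / (1 - 2 powr (- (1/8))))" using int by simp
    show "(\<Sum>k<K. ?J k \<omega>) \<le> Psi_inv h (R \<omega>) / (1 - 2 powr (- (1/8)))" for K \<omega>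
      by (rule Psi_moment_sum[OF h R(2)])
  qed simp
  then show "summable (\<lambda>k. 2 ^ k *
      (\<integral>\<omega>. (if R \<omega> \<le> Psi h (2 ^ k) then (R \<omega> / Psi h (2 ^ k)) powr (9/4) else 0) \<partial>M))" by simp
qed

text \<open>The number of n with \<open>K * Psi h (real n) < R \<omega>\<close> is at least the
  integer part of \<open>Psi_inv h (R \<omega> / K)\<close>; its mean is the given series, and
  removing the division by K costs a factor \<open>K\<^sup>2\<close>.\<close>

lemma (in prob_space) integrable_Psi_inv:
  assumes h: "h \<in> class_H" and R: "R \<in> borel_measurable M" "\<And>\<omega>. 0 \<le> R \<omega>" and K: "1 \<le> K"
    and sm: "summable (\<lambda>n. prob {\<omega>\<in>space M. K * Psi h (real n) < R \<omega>})"
  shows "integrable M (\<lambda>\<omega>. Psi_inv h (R \<omega>))"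
proof -
  note [measurable] = R(1)
  have m [measurable]: "(\<lambda>\<omega>. Psi_inv h (R \<omega>)) \<in> borel_measurable M" by (rule Psi_inv_measurable[OF h R])
  define A where "A n = {\<omega>\<in>space M. K * Psi h (real n) < R \<omega>}" for n :: nat
  have [measurable]: "A n \<in> sets M" for n unfolding A_def by measurable
  have pt: "ennreal (Psi_inv h (R \<omega>)) \<le> ennreal (K\<^sup>2) * (1 + (\<Sum>n. indicator (A n) \<omega>))" if \<omega>: "\<omega> \<in> space M" for \<omega>
  proof -
    define z where "z = Psi_inv h (R \<omega> / K)"
    have z0: "0 \<le> z" unfolding z_def using R(2)[of \<omega>] K by (intro Psi_inv_nonneg[OF h]) auto
    have "Psi_inv h (R \<omega>) \<le> K\<^sup>2 * z"
      using Psi_inv_scale[OF h K, of "R \<omega> / K"] R(2)[of \<omega>] K by (simp add: z_def)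
    moreover have "z \<le> 1 + real (nat \<lfloor>z\<rfloor>)" using z0 by linarith
    ultimately have 1: "Psi_inv h (R \<omega>) \<le> K\<^sup>2 * (1 + real (nat \<lfloor>z\<rfloor>))"
      using mult_left_mono[of z "1 + real (nat \<lfloor>z\<rfloor>)" "K\<^sup>2"] by simp
    have in_A: "\<omega> \<in> A n" if "n < nat \<lfloor>z\<rfloor>" for n
    proof -
      have "real n < z" using that by linarith
      then have "Psi h (real n) < R \<omega> / K"
        using less_Psi_inv_iff[OF h, of "real n" "R \<omega> / K"] R(2)[of \<omega>] K by (simp add: z_def)
      then show ?thesis unfolding A_def using \<omega> K by (simp add: field_simps)
    qed
    have "ennreal (real (nat \<lfloor>z\<rfloor>)) = (\<Sum>n<nat \<lfloor>z\<rfloor>. indicator (A n) \<omega>)"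
      using in_A by (simp add: ennreal_of_nat_eq_real_of_nat)
    also have "\<dots> \<le> (\<Sum>n. indicator (A n) \<omega>)" by (rule sum_le_suminf) auto
    finally have "1 + ennreal (real (nat \<lfloor>z\<rfloor>)) \<le> 1 + (\<Sum>n. indicator (A n) \<omega>)" by (rule add_left_mono)
    moreover have "ennreal (Psi_inv h (R \<omega>)) \<le> ennreal (K\<^sup>2) * (1 + ennreal (real (nat \<lfloor>z\<rfloor>)))"
    proof -
      have "ennreal (K\<^sup>2 * (1 + real (nat \<lfloor>z\<rfloor>))) = ennreal (K\<^sup>2) * (1 + ennreal (real (nat \<lfloor>z\<rfloor>)))"
        by (simp add: ennreal_mult)
      then show ?thesis using 1 by (metis ennreal_leI)
    qed
    ultimately show ?thesis by (meson mult_left_mono order_trans zero_le)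
  qed
  have "(\<integral>\<^sup>+\<omega>. ennreal (Psi_inv h (R \<omega>)) \<partial>M) \<le> (\<integral>\<^sup>+\<omega>. ennreal (K\<^sup>2) * (1 + (\<Sum>n. indicator (A n) \<omega>)) \<partial>M)"
    by (rule nn_integral_mono) (rule pt)
  also have "\<dots> = ennreal (K\<^sup>2) * (1 + (\<Sum>n. emeasure M (A n)))"
    by (simp add: nn_integral_cmult nn_integral_add nn_integral_suminf emeasure_space_1)
  also have "(\<Sum>n. emeasure M (A n)) = ennreal (\<Sum>n. prob (A n))"
    using sm unfolding A_def[symmetric] emeasure_eq_measure by (intro suminf_ennreal2) auto
  also have "ennreal (K\<^sup>2) * (1 + ennreal (\<Sum>n. prob (A n))) < \<infinity>" by (simp add: ennreal_mult_less_top)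
  finally have "(\<integral>\<^sup>+\<omega>. ennreal (Psi_inv h (R \<omega>)) \<partial>M) < \<infinity>" .
  then show ?thesis
    using Psi_inv_nonneg[OF h R(2)] by (intro integrableI_nonneg) auto
qed

section \<open>Upper bound along powers of two\<close>

context iid_sym begin

text \<open>The maxima over the first functionals of a norming sequence increase to the norm, and
  the bound for finite sets does not depend on their size.\<close>

lemma norm_tail_weak:
  assumes b: "\<And>i \<omega>. \<omega> \<in> space M \<Longrightarrow> norm (Y i \<omega>) \<le> b" and b0: "0 \<le> b"
    and E: "(\<integral>\<omega>. norm (psum n \<omega>) \<partial>M) \<le> E"
    and V: "\<And>f :: 'b \<Rightarrow>\<^sub>L real. norm f \<le> 1 \<Longrightarrow> real n * (\<integral>\<omega>. (blinfun_apply f (Y 0 \<omega>))\<^sup>2 \<partial>M) \<le> V" and V0: "0 < V"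
    and w: "0 < w" and t: "0 < t" and s: "0 \<le> s"
  shows "tail n (E + t + s) \<le> exp (- s\<^sup>2 / (8 * (2 * V + w))) + b * E / t\<^sup>2 + 8 * b * E / w"
proof -
  obtain fs :: "nat \<Rightarrow> 'b \<Rightarrow>\<^sub>L real" where fs: "fs 0 = 0" "\<And>j. norm (fs j) \<le> 1"
    "\<And>x c. 0 \<le> c \<Longrightarrow> c < norm x \<Longrightarrow> \<exists>j. c < blinfun_apply (fs j) x"
    by (rule countable_norming_sequence) blast
  have "0 \<le> (\<integral>\<omega>. norm (psum n \<omega>) \<partial>M)" by simp
  then have E0: "0 \<le> E" using E by linarith
  define c where "c = E + t + s"
  have c0: "0 \<le> c" using E0 t s by (simp add: c_def)
  define A where "A m = {\<omega>\<in>space M. c < max_fun (fs ` {..m}) (psum n \<omega>)}" for m :: nat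
  have A_iff: "\<omega> \<in> A m \<longleftrightarrow> \<omega> \<in> space M \<and> (\<exists>j\<le>m. c < blinfun_apply (fs j) (psum n \<omega>))" for \<omega> m
    unfolding A_def max_fun_def by (auto simp: Max_gr_iff)
  have [measurable]: "A m \<in> sets M" for m
  proof -
    have [measurable]: "max_fun (fs ` {..m}) \<in> borel_measurable borel" by (rule max_fun_measurable) auto
    show ?thesis unfolding A_def by measurable
  qed
  have "incseq A" by (auto simp: incseq_def A_iff) (meson order_trans)
  then have "(\<lambda>m. prob (A m)) \<longlonglongrightarrow> prob (\<Union>m. A m)" by (intro finite_Lim_measure_incseq) auto
  moreover have "(\<Union>m. A m) = {\<omega>\<in>space M. c < norm (psum n \<omega>)}"
  proof (intro equalityI subsetI)
    fix \<omega> assume "\<omega> \<in> (\<Union>m. A m)"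
    then obtain j where j: "\<omega> \<in> space M" "c < blinfun_apply (fs j) (psum n \<omega>)" by (auto simp: A_iff)
    then show "\<omega> \<in> {\<omega>\<in>space M. c < norm (psum n \<omega>)}"
      using blinfun_apply_le_norm[OF fs(2), of j "psum n \<omega>"] by auto
  next
    fix \<omega> assume \<omega>: "\<omega> \<in> {\<omega>\<in>space M. c < norm (psum n \<omega>)}"
    then obtain j where "c < blinfun_apply (fs j) (psum n \<omega>)" using fs(3)[OF c0] by blast
    then show "\<omega> \<in> (\<Union>m. A m)" using \<omega> by (auto simp: A_iff)
  qed
  ultimately have "(\<lambda>m. prob (A m)) \<longlonglongrightarrow> tail n c" by (simp add: tail_def)
  moreover have "prob (A m) \<le> exp (- s\<^sup>2 / (8 * (2 * V + w))) + b * E / t\<^sup>2 + 8 * b * E / w" for m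
    unfolding A_def c_def
    by (rule max_fun_tail[OF b b0 _ _ _ E _ V0 w t s]) (use fs V in \<open>auto simp: image_iff intro!: bexI[of _ 0]\<close>)
  ultimately have "tail n c \<le> exp (- s\<^sup>2 / (8 * (2 * V + w))) + b * E / t\<^sup>2 + 8 * b * E / w"
    by (intro LIMSEQ_le_const2) auto
  then show ?thesis by (simp add: c_def)
qed

end

text \<open>Deleting a summand changes the norm of the sum by at most the norm of that summand, so
  Efron-Stein bounds the variance of the norm by the second moments.\<close>

lemma (in iid_seq) norm_psum_tail_variance:
  assumes b: "\<And>i \<omega>. \<omega> \<in> space M \<Longrightarrow> norm (Y i \<omega>) \<le> b" and b0: "0 \<le> b"
    and E: "(\<integral>\<omega>. norm (psum n \<omega>) \<partial>M) \<le> E" and t: "0 < t"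
  shows "tail n (E + t) \<le> real n * (\<integral>\<omega>. (norm (Y 0 \<omega>))\<^sup>2 \<partial>M) / t\<^sup>2"
proof -
  define \<tau> where "\<tau> y = (if norm y \<le> b then y else 0)" for y :: 'b
  have [measurable]: "\<tau> \<in> borel_measurable borel" unfolding \<tau>_def[abs_def] by measurable
  define \<Phi> where "\<Phi> u = norm (\<Sum>i<n. \<tau> (u i))" for u
  have Pm [measurable]: "\<Phi> \<in> borel_measurable seq_space" unfolding \<Phi>_def[abs_def] by measurable
  have Pb: "\<bar>\<Phi> u\<bar> \<le> real n * b" for u
  proof -
    have "norm (\<Sum>i<n. \<tau> (u i)) \<le> (\<Sum>i<n. b)" by (rule sum_norm_le) (simp add: \<tau>_def b0)
    then show ?thesis by (simp add: \<Phi>_def)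
  qed
  have eq: "\<Phi> (initial n \<omega>) = norm (psum n \<omega>)" if "\<omega> \<in> space M" for \<omega>
    unfolding \<Phi>_def psum_def using b[OF that]
    by (intro arg_cong[where f = norm] sum.cong) (auto simp: initial_def \<tau>_def)
  have d: "\<bar>\<Phi> u - \<Phi> (u(i := 0))\<bar> \<le> norm (\<tau> (u i))" if i: "i < n" for u i
  proof -
    have "(\<Sum>k<n. \<tau> (u k)) = \<tau> (u i) + (\<Sum>k\<in>{..<n} - {i}. \<tau> (u k))"
      using i by (subst sum.remove[of _ i]) auto
    moreover have "(\<Sum>k<n. \<tau> ((u(i := 0)) k)) = (\<Sum>k\<in>{..<n} - {i}. \<tau> (u k))"
      using i by (subst sum.remove[of _ i]) (auto simp: \<tau>_def)
    ultimately have "(\<Sum>k<n. \<tau> (u k)) - (\<Sum>k<n. \<tau> ((u(i := 0)) k)) = \<tau> (u i)" by simp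
    then show ?thesis unfolding \<Phi>_def by (metis norm_triangle_ineq3)
  qed
  have upm: "(\<lambda>u. u(i := 0)) \<in> measurable seq_space (seq_space :: (nat \<Rightarrow> 'b) measure)" for i :: nat
    by (rule measurable_PiM_fun_upd) auto
  have Pum: "(\<lambda>\<omega>. \<Phi> ((initial n \<omega>)(i := 0))) \<in> borel_measurable M" for i
    by (rule measurable_compose[OF measurable_compose[OF initial_measurable upm] Pm])
  have Pim: "(\<lambda>\<omega>. \<Phi> (initial n \<omega>)) \<in> borel_measurable M"
    by (rule measurable_compose[OF initial_measurable Pm])
  have Y2: "integrable M (\<lambda>\<omega>. (norm (Y i \<omega>))\<^sup>2)" for i
    by (rule integrable_const_bound[of _ "b\<^sup>2"]) (use b in \<open>auto intro!: power_mono\<close>)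
  have same: "(\<integral>\<omega>. (norm (Y i \<omega>))\<^sup>2 \<partial>M) = (\<integral>\<omega>. (norm (Y 0 \<omega>))\<^sup>2 \<partial>M)" for i
  proof -
    have "(\<integral>\<omega>. (norm (Y i \<omega>))\<^sup>2 \<partial>M) = (\<integral>y. (norm y)\<^sup>2 \<partial>distr M borel (Y i))" for i
      by (subst integral_distr) auto
    then show ?thesis using same_law[of i] by simp
  qed
  have "(\<Sum>i<n. \<integral>\<omega>. (\<Phi> (initial n \<omega>) - \<Phi> ((initial n \<omega>)(i := 0)))\<^sup>2 \<partial>M) \<le> (\<Sum>i<n. \<integral>\<omega>. (norm (Y i \<omega>))\<^sup>2 \<partial>M)"
  proof (rule sum_mono)
    fix i assume i: "i \<in> {..<n}"
    have pt: "(\<Phi> (initial n \<omega>) - \<Phi> ((initial n \<omega>)(i := 0)))\<^sup>2 \<le> (norm (Y i \<omega>))\<^sup>2" if "\<omega> \<in> space M" for \<omega>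
    proof -
      have "\<bar>\<Phi> (initial n \<omega>) - \<Phi> ((initial n \<omega>)(i := 0))\<bar> \<le> norm (\<tau> (initial n \<omega> i))" using d i by blast
      also have "\<dots> = norm (Y i \<omega>)" using i b[OF that] by (simp add: initial_def \<tau>_def)
      finally have "\<bar>\<Phi> (initial n \<omega>) - \<Phi> ((initial n \<omega>)(i := 0))\<bar>\<^sup>2 \<le> (norm (Y i \<omega>))\<^sup>2"
        by (intro power_mono) auto
      then show ?thesis by simp
    qed
    show "(\<integral>\<omega>. (\<Phi> (initial n \<omega>) - \<Phi> ((initial n \<omega>)(i := 0)))\<^sup>2 \<partial>M) \<le> (\<integral>\<omega>. (norm (Y i \<omega>))\<^sup>2 \<partial>M)"
    proof (rule integral_mono[OF _ Y2 pt])
      show "integrable M (\<lambda>\<omega>. (\<Phi> (initial n \<omega>) - \<Phi> ((initial n \<omega>)(i := 0)))\<^sup>2)"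
      proof (rule Bochner_Integration.integrable_bound[OF Y2[of i]])
        show "AE \<omega> in M. norm ((\<Phi> (initial n \<omega>) - \<Phi> ((initial n \<omega>)(i := 0)))\<^sup>2) \<le> norm ((norm (Y i \<omega>))\<^sup>2)"
          using pt by (intro AE_I2) simp
      qed (use Pum[of i] Pim in \<open>simp del: fun_upd_apply\<close>)
    qed
  qed
  also have "\<dots> = (\<Sum>i<n. \<integral>\<omega>. (norm (Y 0 \<omega>))\<^sup>2 \<partial>M)" by (intro sum.cong refl same)
  finally have V: "(\<Sum>i<n. \<integral>\<omega>. (\<Phi> (initial n \<omega>) - \<Phi> ((initial n \<omega>)(i := 0)))\<^sup>2 \<partial>M) \<le> real n * (\<integral>\<omega>. (norm (Y 0 \<omega>))\<^sup>2 \<partial>M)"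
    by simp
  have Eeq: "(\<integral>\<omega>. \<Phi> (initial n \<omega>) \<partial>M) = (\<integral>\<omega>. norm (psum n \<omega>) \<partial>M)"
    by (rule Bochner_Integration.integral_cong) (auto simp: eq)
  have "tail n (E + t) \<le> prob {\<omega>\<in>space M. (\<integral>\<omega>. \<Phi> (initial n \<omega>) \<partial>M) + t < \<Phi> (initial n \<omega>)}"
    unfolding tail_def
  proof (rule finite_measure_mono, safe)
    fix \<omega> assume "\<omega> \<in> space M" "E + t < norm (psum n \<omega>)"
    then show "(\<integral>\<omega>. \<Phi> (initial n \<omega>) \<partial>M) + t < \<Phi> (initial n \<omega>)" using E eq Eeq by simp
  qed (use Pim in measurable)
  also have "\<dots> \<le> real n * (\<integral>\<omega>. (norm (Y 0 \<omega>))\<^sup>2 \<partial>M) / t\<^sup>2" by (rule efron_stein_tail[OF Pm Pb V t])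
  finally show ?thesis .
qed

context iid_sym begin

context
  fixes n :: nat and a K :: real
  assumes a: "0 < a" and K: "0 \<le> K" and tl: "\<And>m. m \<le> n \<Longrightarrow> tail m (K * a) \<le> 1/6"
begin

text \<open>Bounds, in units of a, the mean norm of every sum restricted to a symmetric set inside
  the ball of radius a: twice the sum of the level 2 K of the maxima and the size 1 of a
  summand.\<close>

abbreviation "C0 \<equiv> 2 * (2 * K + 1)"

lemma restricted_iid_sym:
  assumes A: "A \<in> sets borel" and A_sym: "\<And>y. - y \<in> A \<longleftrightarrow> y \<in> A"
  shows "iid_sym M (\<lambda>i \<omega>. indicator A (Y i \<omega>) *\<^sub>R Y i \<omega>)"
proof (rule sym_compose)
  show "(\<lambda>y. indicat_real A y *\<^sub>R y) \<in> borel_measurable borel" using A by measurable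
qed (simp add: A_sym indicator_def)

text \<open>Restriction to a symmetric set doubles the tail from 1/6 to 1/3; Ottaviani's inequality
  turns this into 1/2 for the maxima at twice the level, where the geometric decay of tails can
  start.\<close>

lemma restricted_expectation:
  assumes A: "A \<in> sets borel" and A_sym: "\<And>y. - y \<in> A \<longleftrightarrow> y \<in> A" and Aa: "\<And>y. y \<in> A \<Longrightarrow> norm y \<le> a"
    and m: "m \<le> n"
  shows "(\<integral>\<omega>. norm (\<Sum>i<m. indicator A (Y i \<omega>) *\<^sub>R Y i \<omega>) \<partial>M) \<le> C0 * a"
proof -
  interpret R: iid_sym M "\<lambda>i \<omega>. indicator A (Y i \<omega>) *\<^sub>R Y i \<omega>" by (rule restricted_iid_sym[OF A A_sym])
  have Rt: "R.tail m (K * a) \<le> 1/3" if "m \<le> n" for m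
    using tail_restrict_le[OF A A_sym, of "K * a" m] tl[OF that] unfolding R.tail_def R.psum_def by simp
  have "(1 - 1/3) * R.max_tail n (K * a + K * a) \<le> R.tail n (K * a)"
    by (rule R.ottaviani) (rule Rt)
  also have "\<dots> \<le> 1/3" by (rule Rt) simp
  finally have half: "R.max_tail n (2 * K * a) \<le> 1/2" by (simp add: algebra_simps)
  have "(\<integral>\<omega>. norm (R.psum m \<omega>) \<partial>M) \<le> 2 * (2 * K * a + a)"
    by (rule R.expectation_norm_psum_le[OF _ _ half _ m]) (use a K Aa in \<open>auto simp: indicator_def add_nonneg_pos\<close>)
  then show ?thesis unfolding R.psum_def by (simp add: algebra_simps)
qed

context
  fixes \<beta> :: real
  assumes b: "0 < \<beta>" "\<beta> \<le> 1"
    and mom: "real n * (\<integral>\<omega>. (if norm (Y 0 \<omega>) \<le> a then (norm (Y 0 \<omega>) / a) powr (9/4) else 0) \<partial>M) \<le> \<beta>"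
begin

definition "mid = {y::'b. \<beta>\<^sup>2 * a < norm y \<and> norm y \<le> a}"
definition "small = {y::'b. norm y \<le> \<beta>\<^sup>2 * a}"

lemma mid_sets [measurable]: "mid \<in> sets borel" and small_sets [measurable]: "small \<in> sets borel"
  unfolding mid_def small_def by measurable

text \<open>On \<open>mid\<close> the normalized norm exceeds \<beta>^2, so its power 1/4 is at
  least q = sqrt \<beta>, and the 9/4 moment bounds the normalized variance by q. The tails at level
  C0 + 1 are then at most q, the maxima at twice that level at most 2 q if q is at most 1/2, and
  squaring gives 4 \<beta>. The level 4 C0 + 5 is twice the latter plus one summand; for larger q
  the bound exceeds 1.\<close>

lemma middle_part_tail:
  "prob {\<omega>\<in>space M. (4 * C0 + 5) * a < norm (\<Sum>i<n. indicator mid (Y i \<omega>) *\<^sub>R Y i \<omega>)} \<le> 4 * \<beta>"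
proof -
  have mid_sym: "- y \<in> mid \<longleftrightarrow> y \<in> mid" for y unfolding mid_def by simp
  have mid_a: "y \<in> mid \<Longrightarrow> norm y \<le> a" for y unfolding mid_def by simp
  interpret R: iid_sym M "\<lambda>i \<omega>. indicator mid (Y i \<omega>) *\<^sub>R Y i \<omega>" by (rule restricted_iid_sym[OF mid_sets mid_sym])
  have bnd: "norm (indicator mid y *\<^sub>R y) \<le> a" for y using mid_a[of y] a by (auto simp: indicator_def)
  define q where "q = sqrt \<beta>"
  have q: "0 < q" "q\<^sup>2 = \<beta>" using b by (auto simp: q_def)
  let ?G = "\<lambda>y. if norm y \<le> a then (norm y / a) powr (9/4) else 0"
  have pt: "(norm (indicator mid y *\<^sub>R y))\<^sup>2 \<le> a\<^sup>2 / q * ?G y" for y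
  proof (cases "y \<in> mid")
    case True
    define x where "x = norm y / a"
    have x1: "\<beta>\<^sup>2 < x" "norm y = a * x" using True a b by (auto simp: x_def mid_def field_simps)
    have x: "\<beta>\<^sup>2 < x" "0 < x" "norm y = a * x" using x1 le_less_trans[OF zero_le_power2 x1(1)] by auto
    have "q = (\<beta>\<^sup>2) powr (1/4)" using b unfolding q_def by (simp add: powr_half_sqrt[symmetric] powr_powr flip: powr_numeral)
    also have "\<dots> \<le> x powr (1/4)" using x by (intro powr_mono2) auto
    finally have "x\<^sup>2 * q \<le> x\<^sup>2 * x powr (1/4)" by (intro mult_left_mono) auto
    also have "\<dots> = x powr (9/4)" using x by (simp add: powr_add[symmetric] flip: powr_numeral)
    finally have "x\<^sup>2 \<le> x powr (9/4) / q" using q by (simp add: field_simps)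
    then have "a\<^sup>2 * x\<^sup>2 \<le> a\<^sup>2 * (x powr (9/4) / q)" by (intro mult_left_mono) auto
    moreover have "(norm (indicator mid y *\<^sub>R y))\<^sup>2 = a\<^sup>2 * x\<^sup>2"
      unfolding power_mult_distrib[symmetric] x(3)[symmetric] using True by simp
    moreover have "?G y = x powr (9/4)" using mid_a[OF True] unfolding x_def by simp
    ultimately show ?thesis by (simp only: times_divide_eq_left times_divide_eq_right)
  qed (use q in simp)
  have iG: "integrable M (\<lambda>\<omega>. ?G (Y 0 \<omega>))"
  proof (rule integrable_const_bound[of _ 1])
    have "(norm y / a) powr (9/4) \<le> 1" if "norm y \<le> a" for y :: 'b using that a by (intro powr_le1) auto
    then show "AE \<omega> in M. norm (?G (Y 0 \<omega>)) \<le> 1" by auto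
  qed measurable
  have i2: "integrable M (\<lambda>\<omega>. (norm (indicator mid (Y 0 \<omega>) *\<^sub>R Y 0 \<omega>))\<^sup>2)"
    by (rule integrable_const_bound[of _ "a\<^sup>2"]) (use power_mono[OF bnd, of _ 2] in auto)
  have var: "real m * (\<integral>\<omega>. (norm (indicator mid (Y 0 \<omega>) *\<^sub>R Y 0 \<omega>))\<^sup>2 \<partial>M) / a\<^sup>2 \<le> q" if m: "m \<le> n" for m
  proof -
    have "(\<integral>\<omega>. (norm (indicator mid (Y 0 \<omega>) *\<^sub>R Y 0 \<omega>))\<^sup>2 \<partial>M) \<le> (\<integral>\<omega>. a\<^sup>2 / q * ?G (Y 0 \<omega>) \<partial>M)"
      by (rule integral_mono) (use iG i2 pt in auto)
    also have "\<dots> = a\<^sup>2 / q * (\<integral>\<omega>. ?G (Y 0 \<omega>) \<partial>M)" by simp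
    finally have "real m * (\<integral>\<omega>. (norm (indicator mid (Y 0 \<omega>) *\<^sub>R Y 0 \<omega>))\<^sup>2 \<partial>M) \<le> real n * (a\<^sup>2 / q * (\<integral>\<omega>. ?G (Y 0 \<omega>) \<partial>M))"
      using m by (intro mult_mono) auto
    also have "\<dots> = a\<^sup>2 / q * (real n * (\<integral>\<omega>. ?G (Y 0 \<omega>) \<partial>M))" by simp
    also have "\<dots> \<le> a\<^sup>2 / q * \<beta>" using mom q by (intro mult_left_mono) auto
    also have "\<dots> = a\<^sup>2 * q" using q by (simp add: power2_eq_square field_simps)
    finally show ?thesis using a by (simp add: field_simps)
  qed
  have Rt: "R.tail m ((C0 + 1) * a) \<le> q" if m: "m \<le> n" for m
  proof -
    have "R.tail m (C0 * a + a) \<le> real m * (\<integral>\<omega>. (norm (indicator mid (Y 0 \<omega>) *\<^sub>R Y 0 \<omega>))\<^sup>2 \<partial>M) / a\<^sup>2"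
      by (rule R.norm_psum_tail_variance[OF bnd]) (use a restricted_expectation[OF mid_sets mid_sym mid_a m] in \<open>auto simp: R.psum_def\<close>)
    also have "\<dots> \<le> q" by (rule var[OF m])
    finally show ?thesis by (simp add: algebra_simps)
  qed
  have "R.tail n ((4 * C0 + 5) * a) \<le> 4 * \<beta>"
  proof (cases "q \<le> 1/2")
    case True
    let ?u = "2 * ((C0 + 1) * a)"
    have u0: "0 \<le> ?u" using a K by simp
    have "(1 - q) * R.max_tail n ((C0 + 1) * a + (C0 + 1) * a) \<le> R.tail n ((C0 + 1) * a)"
      by (rule R.ottaviani) (rule Rt)
    also have "\<dots> \<le> q" by (rule Rt) simp
    finally have "(1 - q) * R.max_tail n ?u \<le> q" unfolding mult_2[of "(C0 + 1) * a", symmetric] .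
    moreover have "(1/2) * R.max_tail n ?u \<le> (1 - q) * R.max_tail n ?u"
      using True by (intro mult_right_mono) (auto simp: R.max_tail_def)
    ultimately have 2: "R.max_tail n ?u \<le> 2 * q" by linarith
    have "R.tail n ((4 * C0 + 5) * a) \<le> R.max_tail n (?u + ?u + a)"
      using R.tail_le_max_tail[of n n] by (simp add: algebra_simps)
    also have "\<dots> \<le> R.max_tail n ?u * R.max_tail n ?u"
      by (rule R.hoffmann_jorgensen[OF u0 u0]) (rule bnd)
    also have "\<dots> \<le> (2 * q) * (2 * q)" using 2 q by (intro mult_mono) (auto simp: R.max_tail_def)
    finally show ?thesis using q by (simp add: power2_eq_square)
  next
    case False
    then have "(1/2)\<^sup>2 \<le> q\<^sup>2" by (intro power_mono) auto
    then have "1 \<le> 4 * \<beta>" using q by (simp add: power2_eq_square)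
    then show ?thesis unfolding R.tail_def using prob_le_1 order_trans by blast
  qed
  then show ?thesis unfolding R.tail_def R.psum_def .
qed

text \<open>With summands of size \<beta>^2 a and tolerance a^2 \<beta> for the weak variance, the
  two error terms of the general bound become C0 \<beta>^2 and 8 C0 \<beta>, both of first order in
  \<beta> or better.\<close>

lemma small_part_tail:
  assumes V: "\<And>f :: 'b \<Rightarrow>\<^sub>L real. norm f \<le> 1 \<Longrightarrow> real n * (\<integral>\<omega>. (blinfun_apply f (indicator small (Y 0 \<omega>) *\<^sub>R Y 0 \<omega>))\<^sup>2 \<partial>M) \<le> V"
    and V0: "0 < V" and t: "0 \<le> t"
  shows "prob {\<omega>\<in>space M. (C0 + 1 + t) * a < norm (\<Sum>i<n. indicator small (Y i \<omega>) *\<^sub>R Y i \<omega>)} \<le>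
    exp (- (t * a)\<^sup>2 / (8 * (2 * V + a\<^sup>2 * \<beta>))) + 9 * C0 * \<beta>"
proof -
  have small_sym: "- y \<in> small \<longleftrightarrow> y \<in> small" for y unfolding small_def by simp
  have ba: "\<beta>\<^sup>2 * a \<le> a" using b a by (simp add: power_le_one)
  have small_a: "y \<in> small \<Longrightarrow> norm y \<le> a" for y unfolding small_def using ba by simp
  interpret R: iid_sym M "\<lambda>i \<omega>. indicator small (Y i \<omega>) *\<^sub>R Y i \<omega>" by (rule restricted_iid_sym[OF small_sets small_sym])
  have bnd: "norm (indicator small y *\<^sub>R y) \<le> \<beta>\<^sup>2 * a" for y using a b by (auto simp: indicator_def small_def)
  have "R.tail n (C0 * a + a + t * a) \<le> exp (- (t * a)\<^sup>2 / (8 * (2 * V + a\<^sup>2 * \<beta>)))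
     + (\<beta>\<^sup>2 * a) * (C0 * a) / a\<^sup>2 + 8 * (\<beta>\<^sup>2 * a) * (C0 * a) / (a\<^sup>2 * \<beta>)"
    by (rule R.norm_tail_weak[OF bnd])
       (use a b t V V0 restricted_expectation[OF small_sets small_sym small_a order_refl] in \<open>auto simp: R.psum_def\<close>)
  also have "(\<beta>\<^sup>2 * a) * (C0 * a) / a\<^sup>2 = C0 * \<beta>\<^sup>2" using a by (simp add: power2_eq_square)
  also have "8 * (\<beta>\<^sup>2 * a) * (C0 * a) / (a\<^sup>2 * \<beta>) = 8 * C0 * \<beta>" using a b by (simp add: power2_eq_square)
  also have "exp (- (t * a)\<^sup>2 / (8 * (2 * V + a\<^sup>2 * \<beta>))) + C0 * \<beta>\<^sup>2 + 8 * C0 * \<beta> \<le>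
     exp (- (t * a)\<^sup>2 / (8 * (2 * V + a\<^sup>2 * \<beta>))) + C0 * \<beta> + 8 * C0 * \<beta>"
  proof -
    have "\<beta>\<^sup>2 \<le> \<beta>" using b by (simp add: power2_eq_square mult_left_le)
    then have "C0 * \<beta>\<^sup>2 \<le> C0 * \<beta>" using K by (intro mult_left_mono) auto
    then show ?thesis by linarith
  qed
  finally show ?thesis unfolding R.tail_def R.psum_def by (simp add: algebra_simps)
qed

text \<open>Unless some summand has norm above a, the sum splits into its small and its middle part;
  the levels C0 + 1 + t and 4 C0 + 5 of the two parts add up.\<close>

theorem block_tail:
  assumes V: "\<And>f :: 'b \<Rightarrow>\<^sub>L real. norm f \<le> 1 \<Longrightarrow>
      real n * (\<integral>\<omega>. (blinfun_apply f (indicator {y. norm y \<le> \<beta>\<^sup>2 * a} (Y 0 \<omega>) *\<^sub>R Y 0 \<omega>))\<^sup>2 \<partial>M) \<le> V"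
    and V0: "0 < V" and t: "0 \<le> t"
  shows "tail n ((5 * C0 + 6 + t) * a) \<le> real n * prob {\<omega>\<in>space M. a < norm (Y 0 \<omega>)}
    + exp (- (t * a)\<^sup>2 / (8 * (2 * V + a\<^sup>2 * \<beta>))) + (9 * C0 + 4) * \<beta>"
proof -
  let ?B = "\<lambda>i. {\<omega>\<in>space M. a < norm (Y i \<omega>)}"
  let ?S = "{\<omega>\<in>space M. (C0 + 1 + t) * a < norm (\<Sum>i<n. indicator small (Y i \<omega>) *\<^sub>R Y i \<omega>)}"
  let ?Z = "{\<omega>\<in>space M. (4 * C0 + 5) * a < norm (\<Sum>i<n. indicator mid (Y i \<omega>) *\<^sub>R Y i \<omega>)}"
  have same: "prob (?B i) = prob (?B 0)" for i
  proof -
    have "prob (?B i) = measure (distr M borel (Y i)) {y. a < norm y}" for i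
      by (subst measure_distr) (auto intro!: arg_cong[where f = prob])
    then show ?thesis using same_law[of i] by simp
  qed
  have ba: "\<beta>\<^sup>2 * a \<le> a" using b a by (simp add: power_le_one)
  have "tail n ((5 * C0 + 6 + t) * a) \<le> prob (((\<Union>i\<in>{..<n}. ?B i) \<union> ?S) \<union> ?Z)"
    unfolding tail_def
  proof (rule finite_measure_mono, rule subsetI, rule ccontr)
    fix \<omega> assume "\<omega> \<in> {\<omega>\<in>space M. (5 * C0 + 6 + t) * a < norm (psum n \<omega>)}"
      and "\<omega> \<notin> ((\<Union>i\<in>{..<n}. ?B i) \<union> ?S) \<union> ?Z"
    then have \<omega>: "\<omega> \<in> space M" and big: "(5 * C0 + 6 + t) * a < norm (psum n \<omega>)"
      and nS: "\<not> (C0 + 1 + t) * a < norm (\<Sum>i<n. indicator small (Y i \<omega>) *\<^sub>R Y i \<omega>)"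
      and nZ: "\<not> (4 * C0 + 5) * a < norm (\<Sum>i<n. indicator mid (Y i \<omega>) *\<^sub>R Y i \<omega>)"
      and nB: "\<omega> \<notin> (\<Union>i\<in>{..<n}. ?B i)" by auto
    have "Y i \<omega> = indicator small (Y i \<omega>) *\<^sub>R Y i \<omega> + indicator mid (Y i \<omega>) *\<^sub>R Y i \<omega>" if "i < n" for i
    proof -
      have "norm (Y i \<omega>) \<le> a" using nB that \<omega> by (auto simp: not_less)
      then show ?thesis by (auto simp: indicator_def small_def mid_def)
    qed
    then have "psum n \<omega> = (\<Sum>i<n. indicator small (Y i \<omega>) *\<^sub>R Y i \<omega>) + (\<Sum>i<n. indicator mid (Y i \<omega>) *\<^sub>R Y i \<omega>)"
      unfolding psum_def sum.distrib[symmetric] by (intro sum.cong) auto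
    then have "norm (psum n \<omega>) \<le> norm (\<Sum>i<n. indicator small (Y i \<omega>) *\<^sub>R Y i \<omega>) + norm (\<Sum>i<n. indicator mid (Y i \<omega>) *\<^sub>R Y i \<omega>)"
      by (simp add: norm_triangle_ineq)
    moreover have "(5 * C0 + 6 + t) * a = (C0 + 1 + t) * a + (4 * C0 + 5) * a" by (simp add: algebra_simps)
    ultimately show False using big nS nZ by linarith
  qed measurable
  also have "\<dots> \<le> prob ((\<Union>i\<in>{..<n}. ?B i) \<union> ?S) + prob ?Z" by (rule measure_Un_le) measurable
  also have "prob ((\<Union>i\<in>{..<n}. ?B i) \<union> ?S) \<le> prob (\<Union>i\<in>{..<n}. ?B i) + prob ?S" by (rule measure_Un_le) measurable
  also have "prob (\<Union>i\<in>{..<n}. ?B i) \<le> (\<Sum>i<n. prob (?B i))" by (rule finite_measure_subadditive_finite) auto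
  also have "(\<Sum>i<n. prob (?B i)) = (\<Sum>i<n. prob (?B 0))" by (intro sum.cong refl same)
  finally show ?thesis
    using middle_part_tail small_part_tail[OF V[folded small_def] V0 t] by (simp add: algebra_simps)
qed

end

end

end

section \<open>Symmetrization by pairing terms of one sequence\<close>

context iid_seq begin

lemma distr_reindex:
  assumes \<pi>: "inj \<pi>" and G: "G \<in> measurable seq_space N"
  shows "distr M N (\<lambda>\<omega>. G (\<lambda>i. Y (\<pi> i) \<omega>)) = distr M N (\<lambda>\<omega>. G (\<lambda>i. Y i \<omega>))"
proof -
  have "distr M N (\<lambda>\<omega>. G (\<lambda>i. Y (\<pi> i) \<omega>)) = distr (distr M seq_space (\<lambda>\<omega> i. Y (\<pi> i) \<omega>)) N G"
    using G by (subst distr_distr[OF _ seq_measurable]) (auto simp: comp_def)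
  also have "\<dots> = distr (distr M seq_space (\<lambda>\<omega> i. Y i \<omega>)) N G"
    unfolding seq_law[OF indep_reindex[OF \<pi>] law_reindex[of \<pi>]] ..
  also have "\<dots> = distr M N (\<lambda>\<omega>. G (\<lambda>i. Y i \<omega>))"
    using G by (subst distr_distr[OF _ seq_measurable]) (auto simp: comp_def)
  finally show ?thesis .
qed

text \<open>Symmetrization inside the same sequence: terms with even and odd index are paired.\<close>
definition diffs :: "nat \<Rightarrow> 'a \<Rightarrow> 'b" where
  "diffs i \<omega> = (1/2) *\<^sub>R (Y (2 * i) \<omega> - Y (2 * i + 1) \<omega>)"

lemma diffs_measurable [measurable]: "diffs i \<in> borel_measurable M"
  unfolding diffs_def[abs_def] by measurable

lemma diffs_iid_sym: "iid_sym M diffs"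
proof
  have "indep_vars (\<lambda>j. PiM {2 * j, 2 * j + 1} (\<lambda>_. borel)) (\<lambda>j \<omega>. restrict (\<lambda>i. Y i \<omega>) {2 * j, 2 * j + 1}) UNIV"
    by (rule indep_vars_restrict[OF indep]) (auto simp: disjoint_family_on_def)
  then have "indep_vars (\<lambda>_. borel) (\<lambda>j x. (1/2) *\<^sub>R ((restrict (\<lambda>i. Y i x) {2 * j, 2 * j + 1}) (2 * j) - (restrict (\<lambda>i. Y i x) {2 * j, 2 * j + 1}) (2 * j + 1))) UNIV"
    by (rule indep_vars_compose2[where Y = "\<lambda>j v. (1/2) *\<^sub>R (v (2 * j) - v (2 * j + 1))"]) measurable
  then show "indep_vars (\<lambda>_. borel) diffs UNIV" unfolding diffs_def[abs_def] by simp
  let ?G = "\<lambda>u. (1/2) *\<^sub>R (u 0 - u 1) :: 'b"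
  have Gm: "?G \<in> borel_measurable seq_space" by measurable
  have "distr M borel (diffs i) = distr M borel (\<lambda>\<omega>. ?G (\<lambda>i. Y i \<omega>))" for i
    using distr_reindex[OF _ Gm, of "\<lambda>k. 2 * i + k"] unfolding diffs_def[abs_def] by (simp add: inj_def)
  then show "distr M borel (diffs i) = distr M borel (diffs 0)" for i by metis
  have "inj (\<lambda>k::nat. if k = 0 then 1 else if k = 1 then 0 else k)" by (auto simp: inj_def)
  from distr_reindex[OF this Gm]
  have "distr M borel (\<lambda>\<omega>. (1/2) *\<^sub>R (Y 1 \<omega> - Y 0 \<omega>)) = distr M borel (diffs 0)"
    unfolding diffs_def[abs_def] by simp
  moreover have "(\<lambda>\<omega>. (1/2) *\<^sub>R (Y 1 \<omega> - Y 0 \<omega>)) = (\<lambda>\<omega>. - diffs 0 \<omega>)"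
    unfolding diffs_def by (simp add: fun_eq_iff flip: scaleR_minus_right)
  ultimately show "distr M borel (\<lambda>\<omega>. - diffs 0 \<omega>) = distr M borel (diffs 0)" by simp
qed

text \<open>For a fixed n, a rearrangement of the indices carries the pairs 2 i, 2 i + 1 to i, n +
  i. Thus the sum of paired terms has the law of half the difference of two consecutive blocks of
  length n.\<close>

lemma diffs_sum_law:
  assumes P [measurable]: "Measurable.pred borel P"
  shows "prob {\<omega>\<in>space M. P (\<Sum>i<n. diffs i \<omega>)} = prob {\<omega>\<in>space M. P ((1/2) *\<^sub>R (psum n \<omega> - (\<Sum>i<n. Y (n + i) \<omega>)))}"
proof -
  define \<pi> where "\<pi> k = (if k < 2 * n then (if even k then k div 2 else n + k div 2) else k)" for k
  have "inj \<pi>"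
  proof (rule injI)
    fix x y assume "\<pi> x = \<pi> y"
    then show "x = y" unfolding \<pi>_def
      by (auto split: if_splits elim!: evenE oddE)
  qed
  have eq: "(\<Sum>i<n. (1/2) *\<^sub>R (Y (\<pi> (2 * i)) \<omega> - Y (\<pi> (2 * i + 1)) \<omega>)) = (1/2) *\<^sub>R (psum n \<omega> - (\<Sum>i<n. Y (n + i) \<omega>))" for \<omega>
  proof -
    have "(\<Sum>i<n. (1/2) *\<^sub>R (Y (\<pi> (2 * i)) \<omega> - Y (\<pi> (2 * i + 1)) \<omega>)) = (\<Sum>i<n. (1/2) *\<^sub>R (Y i \<omega> - Y (n + i) \<omega>))"
      by (intro sum.cong) (auto simp: \<pi>_def)
    then show ?thesis by (simp add: psum_def scaleR_sum_right[symmetric] sum_subtractf)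
  qed
  let ?P = "\<lambda>u. P (\<Sum>i<n. (1/2) *\<^sub>R (u (2 * i) - u (2 * i + 1)))"
  have Pm: "Measurable.pred seq_space ?P" by measurable
  have "prob {\<omega>\<in>space M. P (\<Sum>i<n. diffs i \<omega>)} = prob {\<omega>\<in>space M. ?P (\<lambda>i. Y i \<omega>)}"
    unfolding diffs_def ..
  also have "\<dots> = prob {\<omega>\<in>space M. ?P (\<lambda>i. Y (\<pi> i) \<omega>)}"
    by (rule prob_reindex[OF \<open>inj \<pi>\<close> Pm, symmetric])
  also have "\<dots> = prob {\<omega>\<in>space M. P ((1/2) *\<^sub>R (psum n \<omega> - (\<Sum>i<n. Y (n + i) \<omega>)))}"
    unfolding eq ..
  finally show ?thesis .
qed

lemma tail_shift: "prob {\<omega>\<in>space M. u < norm (\<Sum>i<n. Y (k + i) \<omega>)} = tail n u"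
  unfolding tail_def psum_def
  by (rule prob_reindex[where P = "\<lambda>w. u < norm (\<Sum>i<n. w i)"]) (auto simp: inj_def)

lemma diffs_tail_le: "prob {\<omega>\<in>space M. u < norm (\<Sum>i<n. diffs i \<omega>)} \<le> 2 * tail n u"
proof -
  have "prob {\<omega>\<in>space M. u < norm (\<Sum>i<n. diffs i \<omega>)} = prob {\<omega>\<in>space M. u < norm ((1/2) *\<^sub>R (psum n \<omega> - (\<Sum>i<n. Y (n + i) \<omega>)))}"
    by (rule diffs_sum_law) measurable
  also have "\<dots> \<le> prob ({\<omega>\<in>space M. u < norm (psum n \<omega>)} \<union> {\<omega>\<in>space M. u < norm (\<Sum>i<n. Y (n + i) \<omega>)})"
  proof (rule finite_measure_mono, rule subsetI, rule ccontr)
    fix \<omega> assume a: "\<omega> \<in> {\<omega>\<in>space M. u < norm ((1/2) *\<^sub>R (psum n \<omega> - (\<Sum>i<n. Y (n + i) \<omega>)))}"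
      "\<omega> \<notin> {\<omega>\<in>space M. u < norm (psum n \<omega>)} \<union> {\<omega>\<in>space M. u < norm (\<Sum>i<n. Y (n + i) \<omega>)}"
    have "norm (psum n \<omega> - (\<Sum>i<n. Y (n + i) \<omega>)) \<le> norm (psum n \<omega>) + norm (\<Sum>i<n. Y (n + i) \<omega>)"
      by (rule norm_triangle_ineq4)
    then show False using a by auto
  qed measurable
  also have "\<dots> \<le> prob {\<omega>\<in>space M. u < norm (psum n \<omega>)} + prob {\<omega>\<in>space M. u < norm (\<Sum>i<n. Y (n + i) \<omega>)}"
    by (rule measure_Un_le) measurable
  also have "\<dots> = 2 * tail n u" unfolding tail_shift by (simp add: tail_def)
  finally show ?thesis .
qed

text \<open>The second block is independent of the first and stays within v with probability at
  least 1/2; on that event half the difference still exceeds u.\<close>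

lemma desymmetrize:
  assumes v: "tail n v \<le> 1/2"
  shows "tail n (2 * u + v) \<le> 2 * prob {\<omega>\<in>space M. u < norm (\<Sum>i<n. diffs i \<omega>)}"
proof -
  let ?P = "\<lambda>w. 2 * u + v < norm (\<Sum>i<n. w i)" and ?Q = "\<lambda>w. norm (\<Sum>i<n. w i) \<le> v"
  have Pm: "Measurable.pred (seq_space :: (nat \<Rightarrow> 'b) measure) ?P" and Qm: "Measurable.pred (seq_space :: (nat \<Rightarrow> 'b) measure) ?Q" by measurable
  have ini: "(\<Sum>i<n. if i < n then Y i \<omega> else 0) = psum n \<omega>" for \<omega>
    unfolding psum_def by (intro sum.cong) auto
  have "{\<omega>\<in>space M. norm (psum n \<omega>) \<le> v} = space M - {\<omega>\<in>space M. v < norm (psum n \<omega>)}" by auto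
  then have "prob {\<omega>\<in>space M. norm (psum n \<omega>) \<le> v} = 1 - tail n v" unfolding tail_def by (simp add: prob_compl)
  then have "tail n (2 * u + v) * (1/2) \<le> tail n (2 * u + v) * prob {\<omega>\<in>space M. norm (psum n \<omega>) \<le> v}"
    using v by (intro mult_left_mono) (auto simp: tail_def)
  also have "\<dots> = prob {\<omega>\<in>space M. 2 * u + v < norm (psum n \<omega>) \<and> norm (\<Sum>i<n. Y (n + i) \<omega>) \<le> v}"
    using prob_split[OF Pm Qm, of n] unfolding ini by (simp add: tail_def psum_def)
  also have "\<dots> \<le> prob {\<omega>\<in>space M. u < norm ((1/2) *\<^sub>R (psum n \<omega> - (\<Sum>i<n. Y (n + i) \<omega>)))}"
  proof (rule finite_measure_mono, safe)
    fix \<omega> assume a: "2 * u + v < norm (psum n \<omega>)" "norm (\<Sum>i<n. Y (n + i) \<omega>) \<le> v"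
    have "norm (psum n \<omega>) - norm (\<Sum>i<n. Y (n + i) \<omega>) \<le> norm (psum n \<omega> - (\<Sum>i<n. Y (n + i) \<omega>))"
      by (rule norm_triangle_ineq2)
    then show "u < norm ((1/2) *\<^sub>R (psum n \<omega> - (\<Sum>i<n. Y (n + i) \<omega>)))" using a by simp
  qed measurable
  also have "\<dots> = prob {\<omega>\<in>space M. u < norm (\<Sum>i<n. diffs i \<omega>)}"
    by (rule diffs_sum_law[symmetric]) measurable
  finally show ?thesis by simp
qed

text \<open>The reason for the factor 1/2 in \<open>diffs\<close>: a paired term is large only if
  one of its two components is at least as large.\<close>

lemma norm_diffs_le: "norm (diffs 0 \<omega>) \<le> max (norm (Y 0 \<omega>)) (norm (Y 1 \<omega>))"
proof -
  have "norm (Y 0 \<omega> - Y 1 \<omega>) \<le> norm (Y 0 \<omega>) + norm (Y 1 \<omega>)" by (rule norm_triangle_ineq4)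
  then show ?thesis unfolding diffs_def by simp
qed

lemma prob_same_law: "Measurable.pred borel P \<Longrightarrow> prob {\<omega>\<in>space M. P (Y i \<omega>)} = prob {\<omega>\<in>space M. P (Y 0 \<omega>)}"
proof -
  assume [measurable]: "Measurable.pred borel P"
  have "prob {\<omega>\<in>space M. P (Y i \<omega>)} = measure (distr M borel (Y i)) {y. P y}" for i
    by (subst measure_distr) (auto intro!: arg_cong[where f = prob])
  then show ?thesis using same_law[of i] by simp
qed

lemma integrable_same_law:
  fixes g :: "'b \<Rightarrow> real"
  assumes [measurable]: "g \<in> borel_measurable borel"
  shows "integrable M (\<lambda>\<omega>. g (Y i \<omega>)) \<longleftrightarrow> integrable M (\<lambda>\<omega>. g (Y 0 \<omega>))"
    and "(\<integral>\<omega>. g (Y i \<omega>) \<partial>M) = (\<integral>\<omega>. g (Y 0 \<omega>) \<partial>M)"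
proof -
  have "integrable M (\<lambda>\<omega>. g (Y i \<omega>)) \<longleftrightarrow> integrable (distr M borel (Y i)) g" for i
    by (subst integrable_distr_eq) auto
  then show "integrable M (\<lambda>\<omega>. g (Y i \<omega>)) \<longleftrightarrow> integrable M (\<lambda>\<omega>. g (Y 0 \<omega>))" using same_law[of i] by simp
  have "(\<integral>\<omega>. g (Y i \<omega>) \<partial>M) = (\<integral>y. g y \<partial>distr M borel (Y i))" for i by (subst integral_distr) auto
  then show "(\<integral>\<omega>. g (Y i \<omega>) \<partial>M) = (\<integral>\<omega>. g (Y 0 \<omega>) \<partial>M)" using same_law[of i] by simp
qed

lemma diffs_large: "prob {\<omega>\<in>space M. a < norm (diffs 0 \<omega>)} \<le> 2 * prob {\<omega>\<in>space M. a < norm (Y 0 \<omega>)}"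
proof -
  have "prob {\<omega>\<in>space M. a < norm (diffs 0 \<omega>)} \<le> prob ({\<omega>\<in>space M. a < norm (Y 0 \<omega>)} \<union> {\<omega>\<in>space M. a < norm (Y 1 \<omega>)})"
  proof (rule finite_measure_mono, safe)
    fix \<omega> assume "a < norm (diffs 0 \<omega>)" "\<not> a < norm (Y 1 \<omega>)"
    then show "a < norm (Y 0 \<omega>)" using norm_diffs_le[of \<omega>] by (auto simp: max_def split: if_splits)
  qed measurable
  also have "\<dots> \<le> prob {\<omega>\<in>space M. a < norm (Y 0 \<omega>)} + prob {\<omega>\<in>space M. a < norm (Y 1 \<omega>)}"
    by (rule measure_Un_le) measurable
  also have "prob {\<omega>\<in>space M. a < norm (Y 1 \<omega>)} = prob {\<omega>\<in>space M. a < norm (Y 0 \<omega>)}"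
    by (rule prob_same_law) measurable
  finally show ?thesis by simp
qed

lemma diffs_integrable_Psi_inv:
  assumes h: "h \<in> class_H" and int: "integrable M (\<lambda>\<omega>. Psi_inv h (norm (Y 0 \<omega>)))"
  shows "integrable M (\<lambda>\<omega>. Psi_inv h (norm (diffs 0 \<omega>)))"
proof (rule Bochner_Integration.integrable_bound)
  have m: "(\<lambda>y::'b. Psi_inv h (norm y)) \<in> borel_measurable borel"
    by (rule Psi_inv_measurable[OF h]) auto
  have "integrable M (\<lambda>\<omega>. Psi_inv h (norm (Y 1 \<omega>)))" using integrable_same_law(1)[OF m, of 1] int by simp
  with int show "integrable M (\<lambda>\<omega>. Psi_inv h (norm (Y 0 \<omega>)) + Psi_inv h (norm (Y 1 \<omega>)))"
    by (rule Bochner_Integration.integrable_add)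
  show "(\<lambda>\<omega>. Psi_inv h (norm (diffs 0 \<omega>))) \<in> borel_measurable M"
    by (rule measurable_compose[OF diffs_measurable m])
  have "Psi_inv h (norm (diffs 0 \<omega>)) \<le> Psi_inv h (norm (Y 0 \<omega>)) + Psi_inv h (norm (Y 1 \<omega>))" for \<omega>
  proof -
    have "Psi_inv h (norm (diffs 0 \<omega>)) \<le> Psi_inv h (max (norm (Y 0 \<omega>)) (norm (Y 1 \<omega>)))"
      by (rule Psi_inv_mono[OF h _ norm_diffs_le]) simp
    also have "\<dots> \<le> Psi_inv h (norm (Y 0 \<omega>)) + Psi_inv h (norm (Y 1 \<omega>))"
      using Psi_inv_nonneg[OF h, of "norm (Y 0 \<omega>)"] Psi_inv_nonneg[OF h, of "norm (Y 1 \<omega>)"] by (auto simp: max_def)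
    finally show ?thesis .
  qed
  moreover have "0 \<le> Psi_inv h (norm y)" for y :: 'b by (rule Psi_inv_nonneg[OF h]) simp
  ultimately show "AE \<omega> in M. norm (Psi_inv h (norm (diffs 0 \<omega>))) \<le> norm (Psi_inv h (norm (Y 0 \<omega>)) + Psi_inv h (norm (Y 1 \<omega>)))"
    by (intro AE_I2) simp
qed

text \<open>If both components have norm at most a, then ((x - y) / 2)^2 is at most (x^2 + y^2) / 2,
  whose mean is controlled by H. Otherwise the restriction to norm at most b bounds the square by
  b^2, on an event of probability at most twice that of a large component.\<close>

lemma diffs_weak_variance:
  fixes f :: "'b \<Rightarrow>\<^sub>L real"
  assumes f: "norm f \<le> 1" and b: "0 \<le> b" and a: "0 \<le> a"
    and H: "(\<integral>\<omega>. (blinfun_apply f (Y 0 \<omega>))\<^sup>2 * indicator {\<omega>. norm (Y 0 \<omega>) \<le> a} \<omega> \<partial>M) \<le> H"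
  shows "(\<integral>\<omega>. (blinfun_apply f (indicator {y. norm y \<le> b} (diffs 0 \<omega>) *\<^sub>R diffs 0 \<omega>))\<^sup>2 \<partial>M)
    \<le> H + 2 * b\<^sup>2 * prob {\<omega>\<in>space M. a < norm (Y 0 \<omega>)}"
proof -
  let ?g = "\<lambda>y. if norm y \<le> a then (blinfun_apply f y)\<^sup>2 else 0"
  let ?r = "\<lambda>y. if a < norm y then 1 else 0 :: real"
  have gm: "?g \<in> borel_measurable borel" and rm: "(\<lambda>y::'b. ?r y) \<in> borel_measurable borel" by measurable
  have fb: "(blinfun_apply f y)\<^sup>2 \<le> c\<^sup>2" if "norm y \<le> c" for y c
  proof -
    have "\<bar>blinfun_apply f y\<bar>\<^sup>2 \<le> c\<^sup>2" using blinfun_apply_le_norm[OF f, of y] that by (intro power_mono) auto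
    then show ?thesis by simp
  qed
  have ig: "integrable M (\<lambda>\<omega>. ?g (Y i \<omega>))" for i
    by (rule integrable_const_bound[of _ "a\<^sup>2"]) (use fb in auto)
  have ir: "integrable M (\<lambda>\<omega>. ?r (Y i \<omega>))" for i
    by (rule integrable_const_bound[of _ 1]) auto
  have gH: "(\<integral>\<omega>. ?g (Y 0 \<omega>) \<partial>M) \<le> H"
  proof -
    have "(\<integral>\<omega>. ?g (Y 0 \<omega>) \<partial>M) = (\<integral>\<omega>. (blinfun_apply f (Y 0 \<omega>))\<^sup>2 * indicator {\<omega>. norm (Y 0 \<omega>) \<le> a} \<omega> \<partial>M)"
      by (rule Bochner_Integration.integral_cong) auto
    then show ?thesis using H by simp
  qed
  have rP: "(\<integral>\<omega>. ?r (Y 0 \<omega>) \<partial>M) = prob {\<omega>\<in>space M. a < norm (Y 0 \<omega>)}"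
  proof -
    have "(\<integral>\<omega>. ?r (Y 0 \<omega>) \<partial>M) = (\<integral>\<omega>. indicator {\<omega>\<in>space M. a < norm (Y 0 \<omega>)} \<omega> \<partial>M)"
      by (rule Bochner_Integration.integral_cong) auto
    then show ?thesis by simp
  qed
  let ?D = "\<lambda>\<omega>. (blinfun_apply f (indicator {y. norm y \<le> b} (diffs 0 \<omega>) *\<^sub>R diffs 0 \<omega>))\<^sup>2"
  let ?U = "\<lambda>\<omega>. (1/2) * (?g (Y 0 \<omega>) + ?g (Y 1 \<omega>)) + b\<^sup>2 * (?r (Y 0 \<omega>) + ?r (Y 1 \<omega>))"
  have Db: "?D \<omega> \<le> b\<^sup>2" for \<omega> by (rule fb) (use b in \<open>auto simp: indicator_def\<close>)
  have pt: "?D \<omega> \<le> ?U \<omega>" for \<omega>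
  proof (cases "norm (Y 0 \<omega>) \<le> a \<and> norm (Y 1 \<omega>) \<le> a")
    case True
    let ?x = "blinfun_apply f (Y 0 \<omega>)" and ?y = "blinfun_apply f (Y 1 \<omega>)"
    have "?D \<omega> \<le> ((1/2) * (?x - ?y))\<^sup>2"
      by (auto simp: indicator_def diffs_def blinfun.scaleR_right blinfun.diff_right)
    also have "\<dots> \<le> (1/2) * (?x\<^sup>2 + ?y\<^sup>2)"
    proof -
      have "0 \<le> (?x + ?y)\<^sup>2" "0 \<le> (?x - ?y)\<^sup>2" by simp_all
      then show ?thesis by (simp add: power2_eq_square algebra_simps)
    qed
    finally show ?thesis using True by simp
  next
    case False
    have "0 \<le> ?g (Y 0 \<omega>) + ?g (Y 1 \<omega>)" by simp
    moreover have "1 \<le> ?r (Y 0 \<omega>) + ?r (Y 1 \<omega>)" using False by auto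
    then have "b\<^sup>2 * 1 \<le> b\<^sup>2 * (?r (Y 0 \<omega>) + ?r (Y 1 \<omega>))" by (rule mult_left_mono) simp
    then have "?D \<omega> \<le> b\<^sup>2 * (?r (Y 0 \<omega>) + ?r (Y 1 \<omega>))" using Db[of \<omega>] by (simp only: mult_1_right)
    ultimately show ?thesis by (intro add_increasing mult_nonneg_nonneg) auto
  qed
  have "(\<integral>\<omega>. ?D \<omega> \<partial>M) \<le> (\<integral>\<omega>. ?U \<omega> \<partial>M)"
  proof (rule integral_mono)
    show "integrable M ?D" by (rule integrable_const_bound[of _ "b\<^sup>2"]) (use Db in auto)
    show "integrable M ?U" using ig ir by (intro Bochner_Integration.integrable_add integrable_mult_right)
  qed (rule pt)
  also have "\<dots> = (1/2) * ((\<integral>\<omega>. ?g (Y 0 \<omega>) \<partial>M) + (\<integral>\<omega>. ?g (Y 1 \<omega>) \<partial>M)) + b\<^sup>2 * ((\<integral>\<omega>. ?r (Y 0 \<omega>) \<partial>M) + (\<integral>\<omega>. ?r (Y 1 \<omega>) \<partial>M))"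
    using ig ir by (simp del: One_nat_def)
  also have "(\<integral>\<omega>. ?g (Y 1 \<omega>) \<partial>M) = (\<integral>\<omega>. ?g (Y 0 \<omega>) \<partial>M)" by (rule integrable_same_law(2)[OF gm])
  also have "(\<integral>\<omega>. ?r (Y 1 \<omega>) \<partial>M) = (\<integral>\<omega>. ?r (Y 0 \<omega>) \<partial>M)" by (rule integrable_same_law(2)[OF rm])
  also have "(1/2) * ((\<integral>\<omega>. ?g (Y 0 \<omega>) \<partial>M) + (\<integral>\<omega>. ?g (Y 0 \<omega>) \<partial>M)) + b\<^sup>2 * ((\<integral>\<omega>. ?r (Y 0 \<omega>) \<partial>M) + (\<integral>\<omega>. ?r (Y 0 \<omega>) \<partial>M))
     = (\<integral>\<omega>. ?g (Y 0 \<omega>) \<partial>M) + 2 * b\<^sup>2 * prob {\<omega>\<in>space M. a < norm (Y 0 \<omega>)}"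
    unfolding rP by simp
  finally show ?thesis using gH by linarith
qed

theorem dyadic_upper_bound:
  assumes h: "h \<in> class_H" and int: "integrable M (\<lambda>\<omega>. Psi_inv h (norm (Y 0 \<omega>)))"
    and K: "0 \<le> K" and bip: "\<And>n. 1 \<le> n \<Longrightarrow> tail n (K * Psi h (real n)) \<le> 1/12"
    and H0: "\<And>k. 0 \<le> H k"
    and H: "\<And>k (f :: 'b \<Rightarrow>\<^sub>L real). norm f \<le> 1 \<Longrightarrow>
      (\<integral>\<omega>. (blinfun_apply f (Y 0 \<omega>))\<^sup>2 * indicator {\<omega>. norm (Y 0 \<omega>) \<le> Psi h (2 ^ k)} \<omega> \<partial>M) \<le> H k"
    and c: "0 \<le> c" and sm: "summable (\<lambda>k. if H k = 0 then 0 else exp (- (c\<^sup>2 * h (2 ^ k) / H k)))"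
  shows "\<exists>C\<ge>0. AE \<omega> in M. \<exists>k0. \<forall>k\<ge>k0. \<forall>j\<le>2 ^ k. norm (psum j \<omega>) \<le> C * Psi h (2 ^ k)"
proof -
  interpret D: iid_sym M diffs by (rule diffs_iid_sym)
  define a where "a k = Psi h (2 ^ k)" for k :: nat
  have a0: "0 < a k" for k unfolding a_def by (rule Psi_pos[OF h]) simp
  have a2: "(a k)\<^sup>2 = 2 ^ k * h (2 ^ k)" for k unfolding a_def by (rule Psi_square[OF h]) simp
  define E where "E k = (if H k = 0 then 0 else exp (- (c\<^sup>2 * h (2 ^ k) / H k)))" for k
  have E0: "0 \<le> E k" for k unfolding E_def by simp
  let ?mom = "\<lambda>k. \<integral>\<omega>. (if norm (diffs 0 \<omega>) \<le> a k then (norm (diffs 0 \<omega>) / a k) powr (9/4) else 0) \<partial>M"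
  define p where "p k = prob {\<omega>\<in>space M. a k < norm (Y 0 \<omega>)}" for k
  \<comment> \<open>The moment is the essential term. The second term keeps \<open>\<beta> k\<close>
    positive, as the block bound divides by it; the third absorbs the pairs with a large
    component.\<close>
  define \<beta> where "\<beta> k = 2 ^ k * ?mom k + (1/2) ^ k + 2 ^ k * p k" for k
  have s1: "summable (\<lambda>k. 2 ^ k * ?mom k)"
    using summable_Psi_moment[OF h _ _ diffs_integrable_Psi_inv[OF h int]] unfolding a_def by simp
  have s2: "summable (\<lambda>k. 2 ^ k * p k)"
    using summable_Psi_tail[OF h _ _ int] unfolding p_def a_def by simp
  have sb: "summable \<beta>" unfolding \<beta>_def[abs_def] by (intro summable_add s1 s2 summable_geometric) simp
  have mom0: "0 \<le> ?mom k" for k by (intro integral_nonneg_AE) simp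
  have p0: "0 \<le> p k" for k unfolding p_def by simp
  have b0: "0 < \<beta> k" for k
  proof -
    have "0 \<le> 2 ^ k * ?mom k" "0 \<le> 2 ^ k * p k" using mom0 p0 by (intro mult_nonneg_nonneg; simp)+
    moreover have "0 < (1/2::real) ^ k" by simp
    ultimately show ?thesis unfolding \<beta>_def by linarith
  qed
  have b_mom: "2 ^ k * ?mom k \<le> \<beta> k" and b_p: "2 ^ k * p k \<le> \<beta> k" for k
  proof -
    have "0 \<le> 2 ^ k * ?mom k" "0 \<le> 2 ^ k * p k" using mom0 p0 by (intro mult_nonneg_nonneg; simp)+
    moreover have "0 < (1/2::real) ^ k" by simp
    ultimately show "2 ^ k * ?mom k \<le> \<beta> k" "2 ^ k * p k \<le> \<beta> k" unfolding \<beta>_def by linarith+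
  qed
  have tl: "tail m (K * a k) \<le> 1/12" if m: "m \<le> 2 ^ k" for m k
  proof (cases "m = 0")
    case True
    have "0 \<le> K * a k" using K less_imp_le[OF a0] by (rule mult_nonneg_nonneg)
    then have "\<not> K * a k < 0" by simp
    then have "tail m (K * a k) = 0" using True by (simp add: tail_def psum_def)
    then show ?thesis by simp
  next
    case False
    have "real m \<le> 2 ^ k" using m by (metis of_nat_le_iff of_nat_numeral of_nat_power)
    then have "K * Psi h (real m) \<le> K * a k" unfolding a_def using K Psi_mono[OF h, of "real m" "2 ^ k"] by (intro mult_left_mono) auto
    then have "tail m (K * a k) \<le> tail m (K * Psi h (real m))" by (rule tail_antimono)
    also have "\<dots> \<le> 1/12" using False by (intro bip) simp
    finally show ?thesis .
  qed
  \<comment> \<open>Chosen so that t^2 is at least 32 c^2, as the comparison of exponents requires,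
    while t stays at least 1 even for c = 0.\<close>
  define t where "t = 6 * c + 1"
  have t: "1 \<le> t" "32 * c\<^sup>2 \<le> t\<^sup>2" using c by (auto simp: t_def power2_eq_square algebra_simps)
  define C0 where "C0 = 2 * (2 * K + 1)"
  have C0: "0 \<le> C0" using K by (simp add: C0_def)
  define C1 where "C1 = 5 * C0 + 6 + t"
  \<comment> \<open>The denominator is 16 times \<open>2 ^ k * H k\<close> plus 40 times
    \<open>(a k)\<^sup>2 * \<beta> k\<close>. If the second part dominates, exp (- x) \<le> 1 / x
    bounds the term by 80 \<open>\<beta> k\<close>; if the first does, the exponent is at least that
    of the given series.\<close>
  have expb: "exp (- (t * a k)\<^sup>2 / (8 * (2 * (2 ^ k * H k + 2 * (a k)\<^sup>2 * \<beta> k) + (a k)\<^sup>2 * \<beta> k))) \<le> E k + 80 * \<beta> k" for k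
  proof (cases "2 * 2 ^ k * H k \<le> 5 * (a k)\<^sup>2 * \<beta> k")
    case True
    let ?d = "8 * (2 * (2 ^ k * H k + 2 * (a k)\<^sup>2 * \<beta> k) + (a k)\<^sup>2 * \<beta> k)"
    have d: "0 < ?d" using a0[of k] b0[of k] H0[of k] by (intro mult_pos_pos add_nonneg_pos mult_nonneg_nonneg add_nonneg_nonneg) auto
    have "?d \<le> 80 * ((a k)\<^sup>2 * \<beta> k)" using True by (simp add: mult_ac)
    moreover have "(a k)\<^sup>2 \<le> (t * a k)\<^sup>2" using t a0[of k] by (intro power_mono) auto
    ultimately have "(a k)\<^sup>2 / (80 * ((a k)\<^sup>2 * \<beta> k)) \<le> (t * a k)\<^sup>2 / ?d"
      using d by (intro frac_le) auto
    then have x: "1 / (80 * \<beta> k) \<le> (t * a k)\<^sup>2 / ?d" using a0[of k] by simp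
    define x where "x = (t * a k)\<^sup>2 / ?d"
    have xp: "0 < x" "1 / (80 * \<beta> k) \<le> x" using x b0[of k] unfolding x_def[symmetric] by (auto intro: less_le_trans[rotated])
    have "x \<le> exp x" using exp_ge_add_one_self[of x] by linarith
    then have "exp (- x) \<le> 1 / x" using xp by (simp add: exp_minus field_simps)
    also have "\<dots> \<le> 80 * \<beta> k" using xp b0[of k] by (simp add: field_simps)
    finally show ?thesis using E0[of k] unfolding x_def by simp
  next
    case False
    let ?d = "8 * (2 * (2 ^ k * H k + 2 * (a k)\<^sup>2 * \<beta> k) + (a k)\<^sup>2 * \<beta> k)"
    have d: "0 < ?d" using a0[of k] b0[of k] H0[of k] by (intro mult_pos_pos add_nonneg_pos mult_nonneg_nonneg add_nonneg_nonneg) auto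
    have "0 < 5 * (a k)\<^sup>2 * \<beta> k" using a0[of k] b0[of k] by simp
    then have "0 < 2 * 2 ^ k * H k" using False by linarith
    then have Hp: "0 < H k" by (simp add: zero_less_mult_iff)
    have dle: "?d \<le> 32 * (2 ^ k * H k)" using False by (simp add: mult_ac)
    have "c\<^sup>2 * h (2 ^ k) / H k = (32 * c\<^sup>2 * (a k)\<^sup>2) / (32 * (2 ^ k * H k))" unfolding a2 using Hp by simp
    also have "\<dots> \<le> (t * a k)\<^sup>2 / ?d"
      using d dle t(2) by (intro frac_le) (auto simp: power_mult_distrib intro!: mult_right_mono)
    finally have "exp (- (t * a k)\<^sup>2 / ?d) \<le> E k" using Hp unfolding E_def by simp
    then show ?thesis using b0[of k] by linarith
  qed
  \<comment> \<open>For \<open>\<beta> k\<close> above 1 the right side exceeds 1. Otherwise the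
    constant collects 9 C0 + 4 from the block bound, 2 from large summands and 80 from the
    exponential.\<close>
  have Dt: "D.tail (2 ^ k) (C1 * a k) \<le> E k + (9 * C0 + 86) * \<beta> k" for k
  proof (cases "\<beta> k \<le> 1")
    case True
    \<comment> \<open>Pairing doubles 1/12 to the 1/6 that the block bound assumes.\<close>
    have Dtl: "D.tail m (K * a k) \<le> 1/6" if "m \<le> 2 ^ k" for m
      using diffs_tail_le[of "K * a k" m] tl[OF that] unfolding D.tail_def D.psum_def by linarith
    have V: "real (2 ^ k) * (\<integral>\<omega>. (blinfun_apply f (indicator {y. norm y \<le> (\<beta> k)\<^sup>2 * a k} (diffs 0 \<omega>) *\<^sub>R diffs 0 \<omega>))\<^sup>2 \<partial>M)
       \<le> 2 ^ k * H k + 2 * (a k)\<^sup>2 * \<beta> k" if f: "norm f \<le> 1" for f :: "'b \<Rightarrow>\<^sub>L real"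
    proof -
      have "(\<integral>\<omega>. (blinfun_apply f (indicator {y. norm y \<le> (\<beta> k)\<^sup>2 * a k} (diffs 0 \<omega>) *\<^sub>R diffs 0 \<omega>))\<^sup>2 \<partial>M)
         \<le> H k + 2 * ((\<beta> k)\<^sup>2 * a k)\<^sup>2 * p k"
        unfolding p_def by (rule diffs_weak_variance[OF f _ _ H[OF f, folded a_def]]) (use a0[of k] in auto)
      then have "real (2 ^ k) * (\<integral>\<omega>. (blinfun_apply f (indicator {y. norm y \<le> (\<beta> k)\<^sup>2 * a k} (diffs 0 \<omega>) *\<^sub>R diffs 0 \<omega>))\<^sup>2 \<partial>M)
         \<le> 2 ^ k * (H k + 2 * ((\<beta> k)\<^sup>2 * a k)\<^sup>2 * p k)" by (simp add: mult_left_mono)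
      also have "\<dots> = 2 ^ k * H k + 2 * ((\<beta> k)\<^sup>2 * a k)\<^sup>2 * (2 ^ k * p k)" by (simp add: algebra_simps)
      also have "\<dots> \<le> 2 ^ k * H k + 2 * (a k)\<^sup>2 * \<beta> k"
      proof (intro add_left_mono mult_mono)
        have "(\<beta> k)\<^sup>2 * a k \<le> a k" using True b0[of k] a0[of k] by (simp add: power_le_one)
        then show "((\<beta> k)\<^sup>2 * a k)\<^sup>2 \<le> (a k)\<^sup>2" using a0[of k] by (intro power_mono) auto
      qed (use b_p p0 b0[of k] in auto)
      finally show ?thesis .
    qed
    have V0: "0 < 2 ^ k * H k + 2 * (a k)\<^sup>2 * \<beta> k"
      using H0[of k] a0[of k] b0[of k] by (intro add_nonneg_pos mult_nonneg_nonneg) auto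
    have "D.tail (2 ^ k) (C1 * a k) \<le> real (2 ^ k) * prob {\<omega>\<in>space M. a k < norm (diffs 0 \<omega>)}
       + exp (- (t * a k)\<^sup>2 / (8 * (2 * (2 ^ k * H k + 2 * (a k)\<^sup>2 * \<beta> k) + (a k)\<^sup>2 * \<beta> k))) + (9 * C0 + 4) * \<beta> k"
      unfolding C1_def C0_def
      by (rule D.block_tail[OF a0 K Dtl b0 True _ V V0]) (use b_mom[of k] t in auto)
    also have "real (2 ^ k) * prob {\<omega>\<in>space M. a k < norm (diffs 0 \<omega>)} \<le> 2 * \<beta> k"
    proof -
      have "real (2 ^ k) * prob {\<omega>\<in>space M. a k < norm (diffs 0 \<omega>)} \<le> 2 ^ k * (2 * p k)"
        unfolding p_def using diffs_large[of "a k"] by (simp add: mult_left_mono)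
      also have "\<dots> = 2 * (2 ^ k * p k)" by simp
      also have "\<dots> \<le> 2 * \<beta> k" by (intro mult_left_mono b_p) simp
      finally show ?thesis .
    qed
    finally show ?thesis using expb[of k] by (simp add: algebra_simps)
  next
    case False
    have "D.tail (2 ^ k) (C1 * a k) \<le> 1" unfolding D.tail_def by simp
    also have "\<dots> \<le> 86 * \<beta> k" using False by simp
    also have "\<dots> \<le> E k + (9 * C0 + 86) * \<beta> k" using E0[of k] C0 b0[of k] by (simp add: algebra_simps)
    finally show ?thesis .
  qed
  \<comment> \<open>The factor 2 and one K come from undoing the symmetrization, the other K from
    Ottaviani's inequality.\<close>
  define C where "C = 2 * C1 + K + K"
  have mt: "max_tail (2 ^ k) (C * a k) \<le> 4 * (E k + (9 * C0 + 86) * \<beta> k)" for k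
  proof -
    have "tail (2 ^ k) (2 * (C1 * a k) + K * a k) \<le> 2 * prob {\<omega>\<in>space M. C1 * a k < norm (\<Sum>i<2 ^ k. diffs i \<omega>)}"
      using tl[of "2 ^ k" k] by (intro desymmetrize) simp
    also have "\<dots> \<le> 2 * (E k + (9 * C0 + 86) * \<beta> k)" using Dt[of k] unfolding D.tail_def D.psum_def by simp
    finally have 1: "tail (2 ^ k) (2 * (C1 * a k) + K * a k) \<le> 2 * (E k + (9 * C0 + 86) * \<beta> k)" .
    have "(1 - 1/12) * max_tail (2 ^ k) ((2 * (C1 * a k) + K * a k) + K * a k) \<le> tail (2 ^ k) (2 * (C1 * a k) + K * a k)"
      by (rule ottaviani) (rule tl)
    moreover have "(2 * (C1 * a k) + K * a k) + K * a k = C * a k" by (simp add: C_def algebra_simps)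
    moreover have "0 \<le> max_tail (2 ^ k) (C * a k)" unfolding max_tail_def by simp
    ultimately show ?thesis using 1 by simp
  qed
  have C_nonneg: "0 \<le> C" using C0 K t by (simp add: C_def C1_def)
  define A where "A k = {\<omega>\<in>space M. \<exists>j\<le>2 ^ k. C * a k < norm (psum j \<omega>)}" for k
  have [measurable]: "A k \<in> sets M" for k unfolding A_def by measurable
  have "summable (\<lambda>k. prob (A k))"
  proof (rule summable_comparison_test')
    show "summable (\<lambda>k. 4 * (E k + (9 * C0 + 86) * \<beta> k))"
      using sm sb unfolding E_def[symmetric] by (intro summable_mult summable_add)
    show "norm (prob (A k)) \<le> 4 * (E k + (9 * C0 + 86) * \<beta> k)" for k
      using mt[of k] unfolding A_def max_tail_def by simp
  qed
  then have "AE \<omega> in M. \<forall>\<^sub>F k in sequentially. \<omega> \<in> space M - A k"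
    by (intro borel_cantelli_AE1) (auto simp: less_top[symmetric])
  then have "AE \<omega> in M. \<exists>k0. \<forall>k\<ge>k0. \<forall>j\<le>2 ^ k. norm (psum j \<omega>) \<le> C * Psi h (2 ^ k)"
  proof eventually_elim
    case (elim \<omega>)
    then obtain k0 where "\<And>k. k0 \<le> k \<Longrightarrow> \<omega> \<in> space M - A k" by (auto simp: eventually_sequentially)
    then show ?case unfolding A_def a_def by (intro exI[of _ k0]) (auto simp: not_less)
  qed
  with C_nonneg show ?thesis by blast
qed

end

section \<open>Lower bound along powers of two\<close>

text \<open>Every finite product of the factors 1 - p is at least \<delta>, and 1 - p \<le> exp (-
  p) then bounds all partial sums of p by - ln \<delta>.\<close>

lemma (in prob_space) indep_avoid_summable:
  assumes ind: "indep_vars N Z (UNIV :: nat set)" and B: "\<And>k. B k \<in> sets (N k)"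
    and d: "0 < \<delta>" "\<delta> \<le> prob {\<omega>\<in>space M. \<forall>k. Z k \<omega> \<notin> B k}"
  shows "summable (\<lambda>k. prob {\<omega>\<in>space M. Z k \<omega> \<in> B k})"
proof (rule summableI_nonneg_bounded)
  fix K :: nat
  let ?p = "\<lambda>k. prob {\<omega>\<in>space M. Z k \<omega> \<in> B k}"
  have Zm: "Z k \<in> measurable M (N k)" for k using ind by (auto simp: indep_vars_def)
  have Bm: "{\<omega>\<in>space M. Z k \<omega> \<in> B k} \<in> sets M" for k
    using measurable_sets[OF Zm B, of k] by (simp add: vimage_def Int_def conj_commute)
  have dexp: "\<delta> \<le> exp (- (\<Sum>k<K. ?p k))"
  proof (cases "K = 0")
    case True
    then show ?thesis using order_trans[OF d(2) prob_le_1] by simp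
  next
    case False
    have c: "prob (Z k -` (space (N k) - B k) \<inter> space M) = 1 - ?p k" for k
    proof -
      have "Z k -` (space (N k) - B k) \<inter> space M = space M - {\<omega>\<in>space M. Z k \<omega> \<in> B k}"
        using measurable_space[OF Zm] by auto
      then show ?thesis using Bm[of k] by (simp add: prob_compl)
    qed
    have "\<delta> \<le> prob (\<Inter>k\<in>{..<K}. Z k -` (space (N k) - B k) \<inter> space M)"
    proof (rule order_trans[OF d(2)], rule finite_measure_mono)
      show "{\<omega>\<in>space M. \<forall>k. Z k \<omega> \<notin> B k} \<subseteq> (\<Inter>k\<in>{..<K}. Z k -` (space (N k) - B k) \<inter> space M)"
        using measurable_space[OF Zm] by auto
      show "(\<Inter>k\<in>{..<K}. Z k -` (space (N k) - B k) \<inter> space M) \<in> sets M"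
        using False B Zm by (intro sets.finite_INT measurable_sets) auto
    qed
    also have "\<dots> = (\<Prod>k<K. 1 - ?p k)"
      unfolding c[symmetric] using False B by (intro indep_varsD[OF ind]) auto
    also have "\<dots> \<le> (\<Prod>k<K. exp (- ?p k))"
      by (intro prod_mono) (use exp_ge_add_one_self[of "- ?p _"] in auto)
    also have "\<dots> = exp (- (\<Sum>k<K. ?p k))" by (simp add: exp_sum sum_negf[symmetric])
    finally show ?thesis .
  qed
  have "ln \<delta> \<le> ln (exp (- (\<Sum>k<K. ?p k)))" using dexp d(1) by (subst ln_le_cancel_iff) auto
  then show "(\<Sum>k<K. ?p k) \<le> - ln \<delta>" by simp
qed simp

context iid_seq begin

lemma indep_var_split:
  assumes [measurable]: "P \<in> borel_measurable seq_space" "Q \<in> borel_measurable borel"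
  shows "indep_var borel (\<lambda>\<omega>. (P (\<lambda>i. if i < j then Y i \<omega> else 0) :: real)) borel (\<lambda>\<omega>. (Q (Y j \<omega>) :: real))"
proof -
  have ind: "indep_var (PiM {..<j} (\<lambda>_. borel)) (\<lambda>\<omega>. restrict (\<lambda>i. Y i \<omega>) {..<j})
      (PiM {j} (\<lambda>_. borel)) (\<lambda>\<omega>. restrict (\<lambda>i. Y i \<omega>) {j})"
    by (rule indep_var_restrict[OF indep]) auto
  have m1: "(\<lambda>u i. if i < j then u i else 0) \<in> measurable (PiM {..<j} (\<lambda>_. borel)) (seq_space :: (nat \<Rightarrow> 'b) measure)"
  proof (rule measurable_PiM_single')
    fix i show "(\<lambda>u. if i < j then u i else 0) \<in> borel_measurable (PiM {..<j} (\<lambda>_. borel :: 'b measure))"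
      by (cases "i < j") simp_all
  qed auto
  have m1': "(\<lambda>u. P (\<lambda>i. if i < j then u i else 0)) \<in> borel_measurable (PiM {..<j} (\<lambda>_. borel))"
    by (rule measurable_compose[OF m1 assms(1)])
  have m2: "(\<lambda>u. Q (u j)) \<in> borel_measurable (PiM {j} (\<lambda>_. borel))" by measurable
  have "indep_var borel ((\<lambda>u. P (\<lambda>i. if i < j then u i else 0)) \<circ> (\<lambda>\<omega>. restrict (\<lambda>i. Y i \<omega>) {..<j}))
      borel ((\<lambda>u. Q (u j)) \<circ> (\<lambda>\<omega>. restrict (\<lambda>i. Y i \<omega>) {j}))"
    by (rule indep_var_compose[OF ind m1' m2])
  moreover have "((\<lambda>u. P (\<lambda>i. if i < j then u i else 0)) \<circ> (\<lambda>\<omega>. restrict (\<lambda>i. Y i \<omega>) {..<j})) = (\<lambda>\<omega>. P (\<lambda>i. if i < j then Y i \<omega> else 0))"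
    by (auto simp: fun_eq_iff intro!: arg_cong[where f = P])
  moreover have "((\<lambda>u. Q (u j)) \<circ> (\<lambda>\<omega>. restrict (\<lambda>i. Y i \<omega>) {j})) = (\<lambda>\<omega>. Q (Y j \<omega>))"
    by (auto simp: fun_eq_iff)
  ultimately show ?thesis by simp
qed

text \<open>A weak law by truncation. If some functional had mean m > 0, its sums would exceed n m /
  4 with probability above 1/2; but along powers of two \<open>C * Psi h (real n)\<close> is
  eventually below n m / 4, and the norm stays below it with probability at least 3/4.\<close>

lemma mean_zero:
  assumes int: "integrable M (\<lambda>\<omega>. norm (Y 0 \<omega>))" and h: "h \<in> class_H" and C: "0 \<le> C"
    and bd: "\<And>n. 1 \<le> n \<Longrightarrow> tail n (C * Psi h (real n)) \<le> 1/4"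
  shows "(\<forall>f :: 'b \<Rightarrow>\<^sub>L real. norm f \<le> 1 \<longrightarrow> (\<integral>\<omega>. blinfun_apply f (Y 0 \<omega>) \<partial>M) \<le> 0)"
proof (intro allI impI, rule ccontr)
  fix f :: "'b \<Rightarrow>\<^sub>L real" assume f: "norm f \<le> 1" and "\<not> (\<integral>\<omega>. blinfun_apply f (Y 0 \<omega>) \<partial>M) \<le> 0"
  define m where "m = (\<integral>\<omega>. blinfun_apply f (Y 0 \<omega>) \<partial>M)"
  have m: "0 < m" unfolding m_def using \<open>\<not> _ \<le> 0\<close> by simp
  have intf: "integrable M (\<lambda>\<omega>. blinfun_apply f (Y 0 \<omega>))"
    by (rule Bochner_Integration.integrable_bound[OF int]) (use blinfun_apply_le_norm[OF f] in auto)
  have "(\<lambda>L::nat. \<integral>\<omega>. (if real L < \<bar>blinfun_apply f (Y 0 \<omega>)\<bar> then \<bar>blinfun_apply f (Y 0 \<omega>)\<bar> else 0) \<partial>M) \<longlonglongrightarrow> (\<integral>\<omega>. 0 \<partial>M)"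
  proof (rule integral_dominated_convergence[where w = "\<lambda>\<omega>. \<bar>blinfun_apply f (Y 0 \<omega>)\<bar>"])
    show "AE \<omega> in M. (\<lambda>L::nat. if real L < \<bar>blinfun_apply f (Y 0 \<omega>)\<bar> then \<bar>blinfun_apply f (Y 0 \<omega>)\<bar> else 0) \<longlonglongrightarrow> 0"
    proof (rule AE_I2)
      fix \<omega>
      obtain L0 :: nat where L0: "\<bar>blinfun_apply f (Y 0 \<omega>)\<bar> \<le> real L0" using real_arch_simple by blast
      have "eventually (\<lambda>L. (if real L < \<bar>blinfun_apply f (Y 0 \<omega>)\<bar> then \<bar>blinfun_apply f (Y 0 \<omega>)\<bar> else 0) = 0) sequentially"
        using eventually_ge_at_top[of L0] by eventually_elim (use L0 in auto)
      then show "(\<lambda>L::nat. if real L < \<bar>blinfun_apply f (Y 0 \<omega>)\<bar> then \<bar>blinfun_apply f (Y 0 \<omega>)\<bar> else 0) \<longlonglongrightarrow> 0"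
        by (rule tendsto_eventually)
    qed
  qed (use intf in auto)
  then have "eventually (\<lambda>L::nat. (\<integral>\<omega>. (if real L < \<bar>blinfun_apply f (Y 0 \<omega>)\<bar> then \<bar>blinfun_apply f (Y 0 \<omega>)\<bar> else 0) \<partial>M) < m / 8) sequentially"
    using m by (intro order_tendstoD(2)) auto
  then obtain L :: nat where L: "(\<integral>\<omega>. (if real L < \<bar>blinfun_apply f (Y 0 \<omega>)\<bar> then \<bar>blinfun_apply f (Y 0 \<omega>)\<bar> else 0) \<partial>M) < m / 8"
    by (auto simp: eventually_sequentially)
  \<comment> \<open>The sign is reversed: \<open>?g\<close> is minus the bounded part of the
    functional, with mean at most - (7/8) m and concentrated by Efron-Stein, while \<open>?r\<close>
    is the size of the unbounded part, with mean below m / 8 and controlled by Markov's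
    inequality.\<close>
  let ?r = "\<lambda>y. if real L < \<bar>blinfun_apply f y\<bar> then \<bar>blinfun_apply f y\<bar> else 0"
  let ?g = "\<lambda>y. if real L < \<bar>blinfun_apply f y\<bar> then 0 else - blinfun_apply f y"
  have rm [measurable]: "?r \<in> borel_measurable borel" and gm [measurable]: "?g \<in> borel_measurable borel" by measurable
  have ir: "integrable M (\<lambda>\<omega>. ?r (Y 0 \<omega>))"
    by (rule Bochner_Integration.integrable_bound[OF intf]) auto
  have iri: "integrable M (\<lambda>\<omega>. ?r (Y i \<omega>))" for i using integrable_same_law(1)[OF rm, of i] ir by simp
  interpret R: iid_seq M "\<lambda>i \<omega>. ?g (Y i \<omega>)" by (rule iid_compose[OF gm])
  have ig: "integrable M (\<lambda>\<omega>. ?g (Y i \<omega>))" for i by (rule integrable_const_bound[of _ "real L"]) auto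
  have mg: "(\<integral>\<omega>. ?g (Y i \<omega>) \<partial>M) \<le> - (7/8) * m" for i
  proof -
    have "(\<integral>\<omega>. ?g (Y i \<omega>) \<partial>M) = (\<integral>\<omega>. ?g (Y 0 \<omega>) \<partial>M)" by (rule integrable_same_law(2)[OF gm])
    also have "\<dots> \<le> (\<integral>\<omega>. ?r (Y 0 \<omega>) - blinfun_apply f (Y 0 \<omega>) \<partial>M)"
      by (rule integral_mono) (use ig ir intf in auto)
    also have "\<dots> = (\<integral>\<omega>. ?r (Y 0 \<omega>) \<partial>M) - m" unfolding m_def by (rule Bochner_Integration.integral_diff[OF ir intf])
    finally show ?thesis using L by linarith
  qed
  define \<tau> where "\<tau> x = (if \<bar>x\<bar> \<le> real L then x else 0)" for x :: real
  have [measurable]: "\<tau> \<in> borel_measurable borel" unfolding \<tau>_def[abs_def] by measurable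
  have tail_g: "prob {\<omega>\<in>space M. - (3/4) * (real n * m) < (\<Sum>i<n. ?g (Y i \<omega>))} \<le> real n * (real L)\<^sup>2 / (real n * m / 8)\<^sup>2"
    if n: "1 \<le> n" for n
  proof -
    define \<Phi> where "\<Phi> u = (\<Sum>i<n. \<tau> (u i))" for u :: "nat \<Rightarrow> real"
    have Pm: "\<Phi> \<in> borel_measurable seq_space" unfolding \<Phi>_def[abs_def] by measurable
    have Pb: "\<bar>\<Phi> u\<bar> \<le> real n * real L" for u
    proof -
      have "\<bar>\<Phi> u\<bar> \<le> (\<Sum>i<n. \<bar>\<tau> (u i)\<bar>)" unfolding \<Phi>_def by (rule sum_abs)
      also have "\<dots> \<le> (\<Sum>i<n. real L)" by (rule sum_mono) (auto simp: \<tau>_def)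
      finally show ?thesis by simp
    qed
    have Pi: "\<Phi> (R.initial n \<omega>) = (\<Sum>i<n. ?g (Y i \<omega>))" for \<omega>
      unfolding \<Phi>_def by (intro sum.cong) (auto simp: R.initial_def \<tau>_def)
    have d: "(\<Phi> u - \<Phi> (u(i := 0)))\<^sup>2 \<le> (real L)\<^sup>2" if i: "i < n" for u i
    proof -
      have "(\<Sum>k<n. \<tau> (u k)) = \<tau> (u i) + (\<Sum>k\<in>{..<n} - {i}. \<tau> (u k))"
        using i by (subst sum.remove[of _ i]) auto
      moreover have "(\<Sum>k<n. \<tau> ((u(i := 0)) k)) = (\<Sum>k\<in>{..<n} - {i}. \<tau> (u k))"
        using i by (subst sum.remove[of _ i]) (auto simp: \<tau>_def)
      ultimately have "\<Phi> u - \<Phi> (u(i := 0)) = \<tau> (u i)" unfolding \<Phi>_def by simp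
      moreover have "\<bar>\<tau> (u i)\<bar>\<^sup>2 \<le> (real L)\<^sup>2" by (intro power_mono) (auto simp: \<tau>_def)
      ultimately show ?thesis by simp
    qed
    have "(\<Sum>i<n. \<integral>\<omega>. (\<Phi> (R.initial n \<omega>) - \<Phi> ((R.initial n \<omega>)(i := 0)))\<^sup>2 \<partial>M) \<le> (\<Sum>i<n. (real L)\<^sup>2)"
    proof (rule sum_mono)
      fix i assume "i \<in> {..<n}"
      then have "(\<integral>\<omega>. (\<Phi> (R.initial n \<omega>) - \<Phi> ((R.initial n \<omega>)(i := 0)))\<^sup>2 \<partial>M) \<le> (\<integral>\<omega>. (real L)\<^sup>2 \<partial>M)"
        using d by (intro integral_mono') auto
      then show "(\<integral>\<omega>. (\<Phi> (R.initial n \<omega>) - \<Phi> ((R.initial n \<omega>)(i := 0)))\<^sup>2 \<partial>M) \<le> (real L)\<^sup>2"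
        by (simp add: prob_space)
    qed
    then have V: "(\<Sum>i<n. \<integral>\<omega>. (\<Phi> (R.initial n \<omega>) - \<Phi> ((R.initial n \<omega>)(i := 0)))\<^sup>2 \<partial>M) \<le> real n * (real L)\<^sup>2" by simp
    have t: "0 < real n * m / 8" using n m by simp
    have E: "(\<integral>\<omega>. \<Phi> (R.initial n \<omega>) \<partial>M) \<le> - (7/8) * (real n * m)"
    proof -
      have "(\<integral>\<omega>. \<Phi> (R.initial n \<omega>) \<partial>M) = (\<Sum>i<n. \<integral>\<omega>. ?g (Y i \<omega>) \<partial>M)"
        unfolding Pi by (rule Bochner_Integration.integral_sum) (rule ig)
      also have "\<dots> \<le> (\<Sum>i<n. - (7/8) * m)" by (rule sum_mono) (rule mg)
      finally show ?thesis by simp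
    qed
    have "prob {\<omega>\<in>space M. - (3/4) * (real n * m) < (\<Sum>i<n. ?g (Y i \<omega>))} \<le>
       prob {\<omega>\<in>space M. (\<integral>\<omega>. \<Phi> (R.initial n \<omega>) \<partial>M) + real n * m / 8 < \<Phi> (R.initial n \<omega>)}"
    proof (rule finite_measure_mono, safe)
      fix \<omega> assume "- (3/4) * (real n * m) < (\<Sum>i<n. ?g (Y i \<omega>))"
      then show "(\<integral>\<omega>. \<Phi> (R.initial n \<omega>) \<partial>M) + real n * m / 8 < \<Phi> (R.initial n \<omega>)"
        using E unfolding Pi by simp
    next
      have "(\<lambda>\<omega>. \<Phi> (R.initial n \<omega>)) \<in> borel_measurable M" unfolding Pi by measurable
      then show "{\<omega>\<in>space M. (\<integral>\<omega>. \<Phi> (R.initial n \<omega>) \<partial>M) + real n * m / 8 < \<Phi> (R.initial n \<omega>)} \<in> sets M"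
        by measurable
    qed
    also have "\<dots> \<le> real n * (real L)\<^sup>2 / (real n * m / 8)\<^sup>2"
      by (rule R.efron_stein_tail[OF Pm Pb V t])
    finally show ?thesis .
  qed
  have tail_r: "prob {\<omega>\<in>space M. real n * m / 2 \<le> (\<Sum>i<n. ?r (Y i \<omega>))} \<le> 1/4" if n: "1 \<le> n" for n
  proof -
    have "prob {\<omega>\<in>space M. real n * m / 2 \<le> (\<Sum>i<n. ?r (Y i \<omega>))} \<le> (\<integral>\<omega>. (\<Sum>i<n. ?r (Y i \<omega>)) \<partial>M) / (real n * m / 2)"
      by (rule integral_Markov_inequality_measure[where A = "{}"]) (use iri n m in \<open>auto intro!: sum_nonneg\<close>)
    also have "(\<integral>\<omega>. (\<Sum>i<n. ?r (Y i \<omega>)) \<partial>M) = (\<Sum>i<n. \<integral>\<omega>. ?r (Y i \<omega>) \<partial>M)"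
      by (rule Bochner_Integration.integral_sum) (rule iri)
    also have "\<dots> = (\<Sum>i<n. \<integral>\<omega>. ?r (Y 0 \<omega>) \<partial>M)" by (intro sum.cong refl integrable_same_law(2)[OF rm])
    also have "\<dots> = real n * (\<integral>\<omega>. ?r (Y 0 \<omega>) \<partial>M)" by simp
    also have "\<dots> / (real n * m / 2) \<le> real n * (m / 8) / (real n * m / 2)"
      using L n m by (intro divide_right_mono mult_left_mono) auto
    also have "\<dots> = 1/4" using n m by simp
    finally show ?thesis .
  qed
  have lim1: "(\<lambda>k. real (2 ^ k) * (real L)\<^sup>2 / (real (2 ^ k) * m / 8)\<^sup>2) \<longlonglongrightarrow> 0"
  proof -
    have "real (2 ^ k) * (real L)\<^sup>2 / (real (2 ^ k) * m / 8)\<^sup>2 = (64 * (real L)\<^sup>2 / m\<^sup>2) * (1/2) ^ k" for k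
      using m by (simp add: power2_eq_square power_divide field_simps)
    moreover have "(\<lambda>k. (64 * (real L)\<^sup>2 / m\<^sup>2) * (1/2) ^ k) \<longlonglongrightarrow> (64 * (real L)\<^sup>2 / m\<^sup>2) * 0"
      by (intro tendsto_intros LIMSEQ_power_zero) auto
    ultimately show ?thesis by simp
  qed
  have lim2: "(\<lambda>k. C * (Psi h (2 ^ k) / 2 ^ k)) \<longlonglongrightarrow> 0"
    using tendsto_mult_left[OF Psi_over_tendsto_0[OF h], of C] by simp
  have "eventually (\<lambda>k. real (2 ^ k) * (real L)\<^sup>2 / (real (2 ^ k) * m / 8)\<^sup>2 < 1/4 \<and> C * (Psi h (2 ^ k) / 2 ^ k) < m / 4) sequentially"
    using order_tendstoD(2)[OF lim1, of "1/4"] order_tendstoD(2)[OF lim2, of "m/4"] m by (simp add: eventually_conj)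
  then obtain k where k: "real (2 ^ k) * (real L)\<^sup>2 / (real (2 ^ k) * m / 8)\<^sup>2 < 1/4" "C * (Psi h (2 ^ k) / 2 ^ k) < m / 4"
    by (auto simp: eventually_sequentially)
  define n :: nat where "n = 2 ^ k"
  have n: "1 \<le> n" by (simp add: n_def)
  have k2: "C * Psi h (real n) < real n * m / 4" using k(2) by (simp add: n_def field_simps)
  let ?A = "{\<omega>\<in>space M. - (3/4) * (real n * m) < (\<Sum>i<n. ?g (Y i \<omega>))}"
  let ?B = "{\<omega>\<in>space M. real n * m / 2 \<le> (\<Sum>i<n. ?r (Y i \<omega>))}"
  let ?D = "{\<omega>\<in>space M. C * Psi h (real n) < norm (psum n \<omega>)}"
  have "space M \<subseteq> (?A \<union> ?B) \<union> ?D"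
  proof (rule subsetI, rule ccontr)
    fix \<omega> assume \<omega>: "\<omega> \<in> space M" "\<omega> \<notin> (?A \<union> ?B) \<union> ?D"
    then have 1: "(\<Sum>i<n. ?g (Y i \<omega>)) \<le> - (3/4) * (real n * m)" and 2: "(\<Sum>i<n. ?r (Y i \<omega>)) < real n * m / 2"
      and 3: "norm (psum n \<omega>) \<le> C * Psi h (real n)" by (auto simp: not_less not_le)
    have "- blinfun_apply f (psum n \<omega>) = (\<Sum>i<n. - blinfun_apply f (Y i \<omega>))"
      unfolding psum_def by (simp add: blinfun.sum_right sum_negf)
    also have "\<dots> \<le> (\<Sum>i<n. ?g (Y i \<omega>) + ?r (Y i \<omega>))" by (rule sum_mono) auto
    also have "\<dots> = (\<Sum>i<n. ?g (Y i \<omega>)) + (\<Sum>i<n. ?r (Y i \<omega>))" by (rule sum.distrib)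
    also have "\<dots> < - (real n * m / 4)" using 1 2 by linarith
    finally have "real n * m / 4 < norm (psum n \<omega>)" using blinfun_apply_le_norm[OF f, of "psum n \<omega>"] by linarith
    then show False using 3 k2 by linarith
  qed
  then have "prob (space M) \<le> prob ((?A \<union> ?B) \<union> ?D)" by (rule finite_measure_mono) measurable
  also have "\<dots> \<le> prob (?A \<union> ?B) + prob ?D" by (rule measure_Un_le) measurable
  also have "prob (?A \<union> ?B) \<le> prob ?A + prob ?B" by (rule measure_Un_le) measurable
  also have "prob ?A < 1/4" using tail_g[OF n] k(1) unfolding n_def by (rule le_less_trans)
  also have "prob ?B \<le> 1/4" by (rule tail_r[OF n])
  also have "prob ?D \<le> 1/4" using bd[OF n] unfolding tail_def .
  finally show False by (simp add: prob_space)
qed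

end

section \<open>Moments and lower tail bounds for bounded symmetric real sums\<close>

locale iid_sym_real = iid_sym M Y for M :: "'a measure" and Y :: "nat \<Rightarrow> 'a \<Rightarrow> real" +
  fixes b :: real
  assumes bounded: "\<And>i \<omega>. \<bar>Y i \<omega>\<bar> \<le> b"
begin

definition "v = (\<integral>\<omega>. (Y 0 \<omega>)\<^sup>2 \<partial>M)"
definition "v4 = (\<integral>\<omega>. (Y 0 \<omega>) ^ 4 \<partial>M)"

lemma psum_bounded: "\<bar>psum r \<omega>\<bar> \<le> real r * b"
  using norm_psum_le[of \<omega> b r] bounded by simp

lemma integrable_psum_power: "integrable M (\<lambda>\<omega>. (psum r \<omega>) ^ j)"
  by (rule integrable_const_bound[of _ "(real r * b) ^ j"])
     (use power_mono[OF psum_bounded, of _ _ j] in \<open>auto simp: power_abs\<close>)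

lemma integrable_Y_power: "integrable M (\<lambda>\<omega>. (Y i \<omega>) ^ j)"
  by (rule integrable_const_bound[of _ "b ^ j"])
     (use power_mono[OF bounded, of _ _ j] in \<open>auto simp: power_abs\<close>)

lemma
  shows integrable_product: "integrable M (\<lambda>\<omega>. (psum r \<omega>) ^ j * (Y r \<omega>) ^ l)"
    and expectation_product: "(\<integral>\<omega>. (psum r \<omega>) ^ j * (Y r \<omega>) ^ l \<partial>M) = (\<integral>\<omega>. (psum r \<omega>) ^ j \<partial>M) * (\<integral>\<omega>. (Y 0 \<omega>) ^ l \<partial>M)"
proof -
  have "indep_var borel (\<lambda>\<omega>. (\<Sum>i<r. if i < r then Y i \<omega> else 0) ^ j) borel (\<lambda>\<omega>. (Y r \<omega>) ^ l)"
    by (rule indep_var_split[where P = "\<lambda>u. (\<Sum>i<r. u i) ^ j" and Q = "\<lambda>y. y ^ l"]) measurable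
  moreover have "(\<Sum>i<r. if i < r then Y i \<omega> else 0) = psum r \<omega>" for \<omega>
    unfolding psum_def by (intro sum.cong) auto
  ultimately have ind: "indep_var borel (\<lambda>\<omega>. (psum r \<omega>) ^ j) borel (\<lambda>\<omega>. (Y r \<omega>) ^ l)" by simp
  show "integrable M (\<lambda>\<omega>. (psum r \<omega>) ^ j * (Y r \<omega>) ^ l)"
    by (rule indep_var_integrable[OF ind integrable_psum_power integrable_Y_power])
  have "(\<integral>\<omega>. (psum r \<omega>) ^ j * (Y r \<omega>) ^ l \<partial>M) = (\<integral>\<omega>. (psum r \<omega>) ^ j \<partial>M) * (\<integral>\<omega>. (Y r \<omega>) ^ l \<partial>M)"
    by (rule indep_var_lebesgue_integral[OF ind integrable_psum_power integrable_Y_power])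
  also have "(\<integral>\<omega>. (Y r \<omega>) ^ l \<partial>M) = (\<integral>\<omega>. (Y 0 \<omega>) ^ l \<partial>M)"
    by (rule integrable_same_law(2)) measurable
  finally show "(\<integral>\<omega>. (psum r \<omega>) ^ j * (Y r \<omega>) ^ l \<partial>M) = (\<integral>\<omega>. (psum r \<omega>) ^ j \<partial>M) * (\<integral>\<omega>. (Y 0 \<omega>) ^ l \<partial>M)" .
qed

lemma expectation_Y: "(\<integral>\<omega>. Y 0 \<omega> \<partial>M) = 0"
proof -
  have "(\<integral>\<omega>. Y 0 \<omega> \<partial>M) = (\<integral>y. y \<partial>distr M borel (Y 0))" by (subst integral_distr) auto
  also have "\<dots> = (\<integral>y. y \<partial>distr M borel (\<lambda>\<omega>. - Y 0 \<omega>))" unfolding sym ..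
  also have "\<dots> = - (\<integral>\<omega>. Y 0 \<omega> \<partial>M)" by (subst integral_distr) auto
  finally show ?thesis by simp
qed

lemma expectation_psum: "(\<integral>\<omega>. psum r \<omega> \<partial>M) = 0"
proof -
  have "(\<integral>\<omega>. psum r \<omega> \<partial>M) = (\<Sum>i<r. \<integral>\<omega>. Y i \<omega> \<partial>M)"
    unfolding psum_def using integrable_Y_power[of _ 1] by (intro Bochner_Integration.integral_sum) simp
  also have "\<dots> = (\<Sum>i<r. \<integral>\<omega>. Y 0 \<omega> \<partial>M)"
    by (intro sum.cong refl integrable_same_law(2)[where g = "\<lambda>y. y"]) simp
  finally show ?thesis by (simp add: expectation_Y)
qed

lemma psum_Suc: "psum (Suc r) \<omega> = psum r \<omega> + Y r \<omega>" by (simp add: psum_def)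

lemma second_moment: "(\<integral>\<omega>. (psum r \<omega>)\<^sup>2 \<partial>M) = real r * v"
proof (induction r)
  case 0
  show ?case by (simp add: psum_def)
next
  case (Suc r)
  have "(\<integral>\<omega>. (psum (Suc r) \<omega>)\<^sup>2 \<partial>M) =
      (\<integral>\<omega>. (psum r \<omega>)\<^sup>2 * (Y r \<omega>) ^ 0 + 2 * ((psum r \<omega>) ^ 1 * (Y r \<omega>) ^ 1) + (psum r \<omega>) ^ 0 * (Y r \<omega>)\<^sup>2 \<partial>M)"
    by (simp add: psum_Suc power2_sum algebra_simps)
  also have "\<dots> = (\<integral>\<omega>. (psum r \<omega>)\<^sup>2 * (Y r \<omega>) ^ 0 \<partial>M) + 2 * (\<integral>\<omega>. (psum r \<omega>) ^ 1 * (Y r \<omega>) ^ 1 \<partial>M)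
      + (\<integral>\<omega>. (psum r \<omega>) ^ 0 * (Y r \<omega>)\<^sup>2 \<partial>M)"
    by (simp only: Bochner_Integration.integral_add[OF Bochner_Integration.integrable_add integrable_product]
      Bochner_Integration.integral_add integrable_product integrable_mult_right Bochner_Integration.integrable_add integral_mult_right_zero)
  also have "\<dots> = real r * v + v"
    unfolding expectation_product using Suc by (simp add: expectation_psum v_def prob_space)
  finally show ?case by (simp add: algebra_simps)
qed

text \<open>In the binomial expansion the terms with exponents 3 and 1 vanish, because both the sum
  and the new summand have mean 0. The mixed term 6 r v^2 is absorbed by the growth of 3 (r
  v)^2.\<close>

lemma fourth_moment: "(\<integral>\<omega>. (psum r \<omega>) ^ 4 \<partial>M) \<le> real r * v4 + 3 * (real r * v)\<^sup>2"
proof (induction r)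
  case 0
  show ?case by (simp add: psum_def)
next
  case (Suc r)
  have "(\<integral>\<omega>. (psum (Suc r) \<omega>) ^ 4 \<partial>M) =
      (\<integral>\<omega>. (psum r \<omega>) ^ 4 * (Y r \<omega>) ^ 0 + (4 * ((psum r \<omega>) ^ 3 * (Y r \<omega>) ^ 1) + (6 * ((psum r \<omega>) ^ 2 * (Y r \<omega>) ^ 2)
        + (4 * ((psum r \<omega>) ^ 1 * (Y r \<omega>) ^ 3) + (psum r \<omega>) ^ 0 * (Y r \<omega>) ^ 4))) \<partial>M)"
    by (rule Bochner_Integration.integral_cong) (simp_all add: psum_Suc power4_eq_xxxx power3_eq_cube power2_eq_square algebra_simps)
  also have "\<dots> = (\<integral>\<omega>. (psum r \<omega>) ^ 4 * (Y r \<omega>) ^ 0 \<partial>M) + (4 * (\<integral>\<omega>. (psum r \<omega>) ^ 3 * (Y r \<omega>) ^ 1 \<partial>M)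
      + (6 * (\<integral>\<omega>. (psum r \<omega>) ^ 2 * (Y r \<omega>) ^ 2 \<partial>M) + (4 * (\<integral>\<omega>. (psum r \<omega>) ^ 1 * (Y r \<omega>) ^ 3 \<partial>M)
      + (\<integral>\<omega>. (psum r \<omega>) ^ 0 * (Y r \<omega>) ^ 4 \<partial>M))))"
    by (simp only: Bochner_Integration.integral_add integrable_product integrable_mult_right Bochner_Integration.integrable_add integral_mult_right_zero)
  also have "\<dots> = (\<integral>\<omega>. (psum r \<omega>) ^ 4 \<partial>M) + 6 * ((real r * v) * v) + v4"
    unfolding expectation_product by (simp add: expectation_psum expectation_Y second_moment v4_def prob_space) (simp add: v_def)
  also have "\<dots> \<le> real r * v4 + 3 * (real r * v)\<^sup>2 + 6 * ((real r * v) * v) + v4" using Suc by simp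
  also have "\<dots> \<le> real (Suc r) * v4 + 3 * (real (Suc r) * v)\<^sup>2"
    by (simp add: power2_eq_square algebra_simps)
  finally show ?case .
qed

text \<open>Put V = r v; the assumption on \<open>v4\<close> makes the fourth moment at most 4 V^2.
  The squared sum is at most V / 2 off the event, and on it x \<le> x^2 / (16 V) + 4 V, so V \<le> V
  / 2 + V / 4 + 4 V p. This gives p \<ge> 1/16 for the absolute value, and symmetry halves
  it.\<close>

lemma paley_zygmund:
  assumes r: "1 \<le> r" and v: "0 < v" and v4: "v4 \<le> real r * v\<^sup>2"
  shows "1/32 \<le> prob {\<omega>\<in>space M. sqrt (real r * v / 2) < psum r \<omega>}"
proof -
  define V where "V = real r * v"
  have V: "0 < V" using r v by (simp add: V_def)
  have m4: "(\<integral>\<omega>. (psum r \<omega>) ^ 4 \<partial>M) \<le> 4 * V\<^sup>2"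
  proof -
    have "real r * v4 \<le> real r * (real r * v\<^sup>2)" using v4 by (intro mult_left_mono) auto
    then show ?thesis using fourth_moment[of r] unfolding V_def by (simp add: power2_eq_square mult_ac)
  qed
  let ?A = "{\<omega>\<in>space M. V / 2 < (psum r \<omega>)\<^sup>2}"
  have "V = (\<integral>\<omega>. (psum r \<omega>)\<^sup>2 \<partial>M)" by (simp add: second_moment V_def)
  also have "\<dots> \<le> (\<integral>\<omega>. V / 2 + ((1 / (16 * V)) * (psum r \<omega>) ^ 4 + (4 * V) * indicator ?A \<omega>) \<partial>M)"
  proof (rule integral_mono)
    show "integrable M (\<lambda>\<omega>. V / 2 + ((1 / (16 * V)) * (psum r \<omega>) ^ 4 + (4 * V) * indicator ?A \<omega>))"
      by (intro Bochner_Integration.integrable_add integrable_mult_right integrable_psum_power integrable_real_indicator) (auto simp: less_top[symmetric])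
    fix \<omega> assume \<omega>: "\<omega> \<in> space M"
    define x where "x = (psum r \<omega>)\<^sup>2"
    have x4: "(psum r \<omega>) ^ 4 = x\<^sup>2" by (simp add: x_def power_mult[symmetric])
    have x2: "0 \<le> (1 / (16 * V)) * x\<^sup>2" using V by simp
    have "x \<le> (1 / (16 * V)) * x\<^sup>2 + 4 * V"
    proof -
      have "0 \<le> (x - 8 * V)\<^sup>2 / (16 * V)" using V by simp
      also have "\<dots> = (1 / (16 * V)) * x\<^sup>2 + 4 * V - x" using V by (simp add: power2_eq_square field_simps)
      finally show ?thesis by simp
    qed
    then show "(psum r \<omega>)\<^sup>2 \<le> V / 2 + ((1 / (16 * V)) * (psum r \<omega>) ^ 4 + (4 * V) * indicator ?A \<omega>)"
    proof (cases "V / 2 < x")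
      case True
      then have i: "indicator ?A \<omega> = (1::real)" using \<omega> by (simp add: x_def)
      show ?thesis unfolding x4 i unfolding x_def[symmetric] using \<open>x \<le> _\<close> V by linarith
    next
      case False
      then have i: "indicator ?A \<omega> = (0::real)" by (simp add: x_def)
      show ?thesis unfolding x4 i unfolding x_def[symmetric] using False x2 by linarith
    qed
  qed (rule integrable_psum_power)
  also have "\<dots> = V / 2 + ((1 / (16 * V)) * (\<integral>\<omega>. (psum r \<omega>) ^ 4 \<partial>M) + (4 * V) * prob ?A)"
    using integrable_psum_power[of r 4] by (simp add: prob_space less_top[symmetric])
  also have "\<dots> \<le> V / 2 + ((1 / (16 * V)) * (4 * V\<^sup>2) + (4 * V) * prob ?A)"
    using V m4 by (intro add_left_mono add_right_mono mult_left_mono) auto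
  also have "(1 / (16 * V)) * (4 * V\<^sup>2) = V / 4" using V by (simp add: power2_eq_square)
  finally have "V * 1 \<le> V * (16 * prob ?A)" by simp
  then have A: "1/16 \<le> prob ?A" using V by (simp add: mult_le_cancel_left_pos)
  let ?P = "{\<omega>\<in>space M. sqrt (V / 2) < psum r \<omega>}" and ?N = "{\<omega>\<in>space M. sqrt (V / 2) < - psum r \<omega>}"
  have "prob ?A \<le> prob (?P \<union> ?N)"
  proof (rule finite_measure_mono, safe)
    fix \<omega> assume a: "V / 2 < (psum r \<omega>)\<^sup>2" "\<not> sqrt (V / 2) < - psum r \<omega>"
    have "sqrt (V / 2) < \<bar>psum r \<omega>\<bar>" using real_sqrt_less_mono[OF a(1)] by simp
    then show "sqrt (V / 2) < psum r \<omega>" using a(2) by linarith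
  qed measurable
  also have "\<dots> \<le> prob ?P + prob ?N" by (rule measure_Un_le) measurable
  also have "prob ?N = prob ?P"
  proof -
    have "prob {\<omega>\<in>space M. sqrt (V / 2) < (\<Sum>i<r. - 1 *\<^sub>R Y i \<omega>)} = prob {\<omega>\<in>space M. sqrt (V / 2) < (\<Sum>i<r. Y i \<omega>)}"
      by (rule prob_seq_law[OF signs_iid[where e = "\<lambda>_. -1"], where P = "\<lambda>u. sqrt (V / 2) < (\<Sum>i<r. u i)"]) auto
    then show ?thesis unfolding psum_def by (simp add: sum_negf)
  qed
  finally show ?thesis using A by (simp add: V_def)
qed

lemma doubling: "(prob {\<omega>\<in>space M. s < psum r \<omega>})\<^sup>2 \<le> prob {\<omega>\<in>space M. 2 * s < psum (2 * r) \<omega>}"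
proof -
  let ?P = "\<lambda>u. s < (\<Sum>i<r. u i)"
  have Pm: "Measurable.pred (seq_space :: (nat \<Rightarrow> real) measure) ?P" by measurable
  have ini: "(\<Sum>i<r. if i < r then Y i \<omega> else 0) = psum r \<omega>" for \<omega>
    unfolding psum_def by (intro sum.cong) auto
  have "(prob {\<omega>\<in>space M. s < psum r \<omega>})\<^sup>2 = prob {\<omega>\<in>space M. s < psum r \<omega> \<and> s < (\<Sum>i<r. Y (r + i) \<omega>)}"
    using prob_split[OF Pm Pm, of r] unfolding ini by (simp add: psum_def power2_eq_square)
  also have "\<dots> \<le> prob {\<omega>\<in>space M. 2 * s < psum (2 * r) \<omega>}"
  proof (rule finite_measure_mono, safe)
    fix \<omega> assume "s < psum r \<omega>" "s < (\<Sum>i<r. Y (r + i) \<omega>)"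
    moreover have "psum (2 * r) \<omega> = psum r \<omega> + (\<Sum>i<r. Y (r + i) \<omega>)"
      using psum_add[of r r \<omega>] by (simp only: mult_2)
    ultimately show "2 * s < psum (2 * r) \<omega>" by linarith
  qed measurable
  finally show ?thesis .
qed

lemma iterated_doubling:
  "(prob {\<omega>\<in>space M. s < psum r \<omega>}) ^ (2 ^ j) \<le> prob {\<omega>\<in>space M. 2 ^ j * s < psum (2 ^ j * r) \<omega>}"
proof (induction j)
  case (Suc j)
  have "(prob {\<omega>\<in>space M. s < psum r \<omega>}) ^ (2 ^ Suc j) = ((prob {\<omega>\<in>space M. s < psum r \<omega>}) ^ (2 ^ j))\<^sup>2"
    by (simp add: power_mult[symmetric] mult.commute)
  also have "\<dots> \<le> (prob {\<omega>\<in>space M. 2 ^ j * s < psum (2 ^ j * r) \<omega>})\<^sup>2" by (intro power_mono Suc) simp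
  also have "\<dots> \<le> prob {\<omega>\<in>space M. 2 * (2 ^ j * s) < psum (2 * (2 ^ j * r)) \<omega>}" by (rule doubling)
  finally show ?case by (simp add: mult.assoc)
qed simp

text \<open>Splitting the sum into 2^j blocks trades a Gaussian tail for a product of block probabilities.\<close>
lemma gaussian_lower_bound:
  assumes v: "0 < v" and a: "0 < a" "a\<^sup>2 = 2 ^ k * g" and g: "0 < g" and C: "1 \<le> C"
  shows "exp (- (4 * ln 32 * C\<^sup>2 * (g / v))) \<le>
    32 * prob {\<omega>\<in>space M. C * a < psum (2 ^ k) \<omega>} + 2 ^ k * (v4 / a ^ 4) + (1/2) ^ k"
proof -
  define x where "x = g / v"
  have x: "0 < x" using v g by (simp add: x_def)
  define A where "A = 4 * ln 32 * C\<^sup>2"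
  have C2: "1 \<le> C\<^sup>2" using C by simp
  have ln32: "1 \<le> ln (32::real)"
  proof -
    have "exp 1 \<le> (32::real)" using exp_le by linarith
    then show ?thesis by (simp add: ln_ge_iff)
  qed
  have A4: "4 * C\<^sup>2 \<le> A" using mult_right_mono[OF ln32, of "4 * C\<^sup>2"] unfolding A_def by (simp add: mult_ac)
  have A0: "4 \<le> A" using A4 C2 by linarith
  have v4_0: "0 \<le> v4" unfolding v4_def by simp
  have nn: "0 \<le> prob {\<omega>\<in>space M. C * a < psum (2 ^ k) \<omega>}" "0 \<le> 2 ^ k * (v4 / a ^ 4)" "0 \<le> (1/2::real) ^ k"
    using v4_0 a by auto
  obtain j0 :: nat where "2 * C\<^sup>2 * x < 2 ^ j0" using real_arch_pow[of 2 "2 * C\<^sup>2 * x"] by auto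
  \<comment> \<open>The least number 2^j of blocks such that 2^j sums, each of size sqrt (r v / 2)
    with r = 2^(k - j), together reach C a. Minimality bounds 2^j linearly in x, hence the cost of
    the product.\<close>
  define j where "j = (LEAST j. 2 * C\<^sup>2 * x \<le> 2 ^ j)"
  have j: "2 * C\<^sup>2 * x \<le> 2 ^ j"
    using LeastI[of "\<lambda>j. 2 * C\<^sup>2 * x \<le> 2 ^ j" j0] \<open>_ < 2 ^ j0\<close> unfolding j_def by simp
  have jl: "\<not> 2 * C\<^sup>2 * x \<le> 2 ^ i" if "i < j" for i
    using not_less_Least[of i "\<lambda>j. 2 * C\<^sup>2 * x \<le> 2 ^ j"] that unfolding j_def by auto
  have ju: "2 ^ j \<le> 1 + 4 * C\<^sup>2 * x"
  proof (cases j)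
    case 0
    then show ?thesis using x by simp
  next
    case (Suc i)
    then show ?thesis using jl[of i] by simp
  qed
  have key: "exp (- (A * x)) \<le> 32 * prob {\<omega>\<in>space M. C * a < psum (2 ^ k) \<omega>} + 2 ^ k * (v4 / a ^ 4) + (1/2) ^ k"
  proof (cases "j \<le> k")
    \<comment> \<open>More blocks than summands would be needed. Then 2^k is at most A x, and the
      left side is below (1/2)^k.\<close>
    case False
    then have "\<not> 2 * C\<^sup>2 * x \<le> 2 ^ k" by (intro jl) simp
    moreover have "4 * C\<^sup>2 * x \<le> A * x" using A4 x by (intro mult_right_mono) auto
    moreover have "0 \<le> C\<^sup>2 * x" using x by simp
    ultimately have "2 ^ k \<le> A * x" by linarith
    moreover have "A * x \<le> exp (A * x)" using exp_ge_add_one_self[of "A * x"] by linarith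
    ultimately have "2 ^ k \<le> exp (A * x)" by linarith
    then have "exp (- (A * x)) \<le> 1 / 2 ^ k" by (simp add: exp_minus field_simps)
    then have "exp (- (A * x)) \<le> (1/2) ^ k" unfolding power_one_over .
    then show ?thesis using nn by linarith
  next
    case jk: True
    define r :: nat where "r = 2 ^ (k - j)"
    have rj: "2 ^ j * r = 2 ^ k" using jk by (simp add: r_def power_add[symmetric])
    have rj': "2 ^ j * real r = 2 ^ k" using rj by (metis of_nat_mult of_nat_numeral of_nat_power)
    show ?thesis
    proof (cases "v4 \<le> real r * v\<^sup>2")
      case True
      define s where "s = sqrt (real r * v / 2)"
      have "(1/32) ^ (2 ^ j) \<le> (prob {\<omega>\<in>space M. s < psum r \<omega>}) ^ (2 ^ j)"
        unfolding s_def by (intro power_mono paley_zygmund True v) (simp_all add: r_def)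
      also have "\<dots> \<le> prob {\<omega>\<in>space M. 2 ^ j * s < psum (2 ^ k) \<omega>}" using iterated_doubling[of s r j] unfolding rj .
      also have "\<dots> \<le> prob {\<omega>\<in>space M. C * a < psum (2 ^ k) \<omega>}"
      proof (rule finite_measure_mono)
        have "(C * a)\<^sup>2 = 2 ^ k * (C\<^sup>2 * x * v)" using v by (simp add: power_mult_distrib a(2) x_def)
        also have "\<dots> \<le> 2 ^ k * (2 ^ j / 2 * v)" using j v by (intro mult_left_mono mult_right_mono) auto
        also have "\<dots> = (2 ^ j * s)\<^sup>2"
        proof -
          have s2: "s\<^sup>2 = real r * v / 2" using v by (simp add: s_def)
          show ?thesis unfolding rj'[symmetric] power_mult_distrib s2 by (simp add: power2_eq_square)
        qed
        finally have "(C * a)\<^sup>2 \<le> (2 ^ j * s)\<^sup>2" .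
        then have "C * a \<le> 2 ^ j * s" by (rule power2_le_imp_le) (use v in \<open>simp add: s_def\<close>)
        then show "{\<omega>\<in>space M. 2 ^ j * s < psum (2 ^ k) \<omega>} \<subseteq> {\<omega>\<in>space M. C * a < psum (2 ^ k) \<omega>}" by auto
      qed measurable
      finally have 1: "(1/32) ^ (2 ^ j) \<le> prob {\<omega>\<in>space M. C * a < psum (2 ^ k) \<omega>}" .
      \<comment> \<open>The factor 32 pays for the additive 1 in the bound for 2^j, which matters
        when a single block is enough.\<close>
      have "exp (- (A * x)) = 32 * exp (- ln 32 * (1 + 4 * C\<^sup>2 * x))"
        unfolding A_def by (simp add: algebra_simps exp_add exp_minus exp_diff inverse_eq_divide)
      also have "\<dots> \<le> 32 * exp (- ln 32 * 2 ^ j)" using ju ln32 by simp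
      also have "exp (- ln 32 * 2 ^ j) = (1/32::real) ^ (2 ^ j)"
      proof -
        have "exp (- ln 32 * 2 ^ j) = exp (real (2 ^ j) * (- ln 32))" by (simp add: mult.commute)
        also have "\<dots> = exp (- ln 32) ^ (2 ^ j)" by (rule exp_of_nat_mult)
        also have "exp (- ln 32) = 1 / (32::real)" by (simp add: exp_minus inverse_eq_divide)
        finally show ?thesis .
      qed
      finally show ?thesis using 1 nn by linarith
    next
      case False
      \<comment> \<open>The fourth moment is too large for the block argument. Then the moment term
        alone dominates: it is at least 1 / (x^2 2^j), while the left side decays exponentially in
        x.\<close>
      have "a ^ 4 = (2 ^ k * g)\<^sup>2" unfolding a(2)[symmetric] by (simp add: power_mult[symmetric])
      then have a4: "a ^ 4 = (2 ^ k * (x * v))\<^sup>2" using v by (simp add: x_def)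
      have "1 / (x\<^sup>2 * (1 + 4 * C\<^sup>2 * x)) \<le> 1 / (x\<^sup>2 * 2 ^ j)"
        using ju x C2 by (intro divide_left_mono mult_left_mono mult_pos_pos add_pos_nonneg) auto
      also have "\<dots> = 2 ^ k * ((real r * v\<^sup>2) / a ^ 4)"
        unfolding a4 rj'[symmetric] using x v by (simp add: power2_eq_square r_def)
      also have "\<dots> \<le> 2 ^ k * (v4 / a ^ 4)" using False a by (intro mult_left_mono divide_right_mono) auto
      finally have 2: "1 / (x\<^sup>2 * (1 + 4 * C\<^sup>2 * x)) \<le> 2 ^ k * (v4 / a ^ 4)" .
      define y where "y = A * x"
      have y: "4 * C\<^sup>2 * x \<le> y" "4 * x \<le> y" "0 < y"
        unfolding y_def using mult_right_mono[OF A4, of x] mult_right_mono[OF A0, of x] x A0 by auto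
      have "x\<^sup>2 * (1 + 4 * C\<^sup>2 * x) \<le> (y/4)\<^sup>2 * (1 + y)"
        using y x C2 by (intro mult_mono power_mono) auto
      also have "\<dots> \<le> exp y"
      proof -
        have "(1 + y / 4) ^ 4 \<le> exp (y / 4) ^ 4" using y by (intro power_mono exp_ge_add_one_self) auto
        also have "\<dots> = exp y" by (simp add: exp_of_nat_mult[symmetric])
        finally have "(1 + y / 4) ^ 4 \<le> exp y" .
        moreover have "(y/4)\<^sup>2 * (1 + y) \<le> (1 + y / 4) ^ 4"
        proof -
          define z where "z = y / 4"
          have z: "0 \<le> z" using y(3) by (simp add: z_def)
          have "(1 + z) ^ 4 - z\<^sup>2 * (1 + 4 * z) = 1 + 4 * z + 5 * z\<^sup>2 + z ^ 4"
            by (simp add: power4_eq_xxxx power2_eq_square algebra_simps)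
          moreover have "0 \<le> 1 + 4 * z + 5 * z\<^sup>2 + z ^ 4" using z by simp
          ultimately have "z\<^sup>2 * (1 + 4 * z) \<le> (1 + z) ^ 4" by linarith
          then show ?thesis by (simp add: z_def)
        qed
        ultimately show ?thesis by linarith
      qed
      finally have le: "x\<^sup>2 * (1 + 4 * C\<^sup>2 * x) \<le> exp y" .
      have "0 < x\<^sup>2 * (1 + 4 * C\<^sup>2 * x)" using x C2 by (intro mult_pos_pos add_pos_nonneg) auto
      then have "exp (- y) \<le> 1 / (x\<^sup>2 * (1 + 4 * C\<^sup>2 * x))"
        unfolding exp_minus inverse_eq_divide by (intro divide_left_mono le) auto
      then show ?thesis using 2 nn unfolding y_def by linarith
    qed
  qed
  then show ?thesis unfolding A_def x_def .
qed

end

lemma (in prob_space) truncated_integral_tendsto_0: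
  fixes g R :: "'a \<Rightarrow> real" and a :: "nat \<Rightarrow> real"
  assumes g: "integrable M g" and R: "R \<in> borel_measurable M" and a: "filterlim a at_top sequentially"
  shows "(\<lambda>k. \<integral>\<omega>. (if a k < R \<omega> then \<bar>g \<omega>\<bar> else 0) \<partial>M) \<longlonglongrightarrow> 0"
proof -
  note [measurable] = R
  have "(\<lambda>k. \<integral>\<omega>. (if a k < R \<omega> then \<bar>g \<omega>\<bar> else 0) \<partial>M) \<longlonglongrightarrow> (\<integral>\<omega>. 0 \<partial>M)"
  proof (rule integral_dominated_convergence[where w = "\<lambda>\<omega>. \<bar>g \<omega>\<bar>"])
    show "AE \<omega> in M. (\<lambda>k. if a k < R \<omega> then \<bar>g \<omega>\<bar> else 0) \<longlonglongrightarrow> 0"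
    proof (rule AE_I2)
      fix \<omega>
      have "eventually (\<lambda>k. R \<omega> \<le> a k) sequentially" using a unfolding filterlim_at_top by blast
      then have "eventually (\<lambda>k. (if a k < R \<omega> then \<bar>g \<omega>\<bar> else 0) = 0) sequentially"
        by eventually_elim auto
      then show "(\<lambda>k. if a k < R \<omega> then \<bar>g \<omega>\<bar> else 0) \<longlonglongrightarrow> 0" by (rule tendsto_eventually)
    qed
    show "(\<lambda>\<omega>. if a k < R \<omega> then \<bar>g \<omega>\<bar> else 0) \<in> borel_measurable M" for k using g by measurable
  qed (use g in auto)
  then show ?thesis by simp
qed

lemma Psi_dyadic_at_top: assumes h: "h \<in> class_H" shows "filterlim (\<lambda>k. Psi h (2 ^ k)) at_top sequentially"
  unfolding filterlim_at_top
proof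
  fix Z :: real
  obtain x where x: "0 \<le> x" "Psi h x = max 0 Z" using Psi_surj[OF h, of "max 0 Z"] by auto
  obtain k0 :: nat where k0: "x < 2 ^ k0" using real_arch_pow[of 2 x] by auto
  show "eventually (\<lambda>k. Z \<le> Psi h (2 ^ k)) sequentially"
    using eventually_ge_at_top[of k0]
  proof eventually_elim
    case (elim k)
    then have "(2::real) ^ k0 \<le> 2 ^ k" by (intro power_increasing) auto
    then have "x \<le> 2 ^ k" using k0 by linarith
    then have "Psi h x \<le> Psi h (2 ^ k)" by (rule Psi_mono[OF h x(1)])
    then show ?case using x by simp
  qed
qed

section \<open>Consequences of almost sure boundedness\<close>

context iid_seq begin

text \<open>The events decrease as the constant grows and their intersection is null. All n are
  controlled on one event, which is stronger than a bound for each n and is what the avoidance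
  arguments need.\<close>

lemma bounded_in_probability:
  assumes h: "h \<in> class_H" and bd: "AE \<omega> in M. \<exists>C. \<forall>n\<ge>1. norm (psum n \<omega>) \<le> C * Psi h (real n)" and e: "0 < \<epsilon>"
  shows "\<exists>C\<ge>1. prob {\<omega>\<in>space M. \<exists>n\<ge>1. C * Psi h (real n) < norm (psum n \<omega>)} \<le> \<epsilon>"
proof -
  define A where "A m = {\<omega>\<in>space M. \<exists>n\<in>{1..}. real m * Psi h (real n) < norm (psum n \<omega>)}" for m :: nat
  have [measurable]: "A m \<in> sets M" for m unfolding A_def by measurable
  have "decseq A"
  proof (rule decseq_SucI, rule subsetI)
    fix m \<omega> assume "\<omega> \<in> A (Suc m)"
    then obtain n where n: "\<omega> \<in> space M" "1 \<le> n" "real (Suc m) * Psi h (real n) < norm (psum n \<omega>)" by (auto simp: A_def)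
    have "real m * Psi h (real n) \<le> real (Suc m) * Psi h (real n)" by (intro mult_right_mono Psi_nonneg[OF h]) auto
    then show "\<omega> \<in> A m" using n by (force simp: A_def)
  qed
  then have "(\<lambda>m. prob (A m)) \<longlonglongrightarrow> prob (\<Inter>m. A m)" by (intro finite_Lim_measure_decseq) auto
  moreover have "prob (\<Inter>m. A m) = 0"
  proof -
    have "AE \<omega> in M. \<omega> \<notin> (\<Inter>m. A m)"
      using bd
    proof eventually_elim
      case (elim \<omega>)
      then obtain C where C: "\<And>n. 1 \<le> n \<Longrightarrow> norm (psum n \<omega>) \<le> C * Psi h (real n)" by auto
      obtain m :: nat where m: "C \<le> real m" using real_arch_simple by blast
      have "\<omega> \<notin> A m"
      proof
        assume "\<omega> \<in> A m"
        then obtain n where n: "1 \<le> n" "real m * Psi h (real n) < norm (psum n \<omega>)" by (auto simp: A_def)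
        have "C * Psi h (real n) \<le> real m * Psi h (real n)" using m by (intro mult_right_mono Psi_nonneg[OF h]) auto
        then show False using C[OF n(1)] n(2) by linarith
      qed
      then show ?case by blast
    qed
    then have "(\<Inter>m. A m) \<in> null_sets M" by (subst AE_iff_null_sets) auto
    then show ?thesis by (simp add: measure_def null_sets_def)
  qed
  ultimately have "eventually (\<lambda>m. prob (A m) < \<epsilon>) sequentially" using e by (intro order_tendstoD(2)) auto
  then obtain m0 where m0: "\<And>m. m0 \<le> m \<Longrightarrow> prob (A m) < \<epsilon>" by (auto simp: eventually_sequentially)
  have "prob (A (Suc m0)) \<le> \<epsilon>" using m0[of "Suc m0"] by simp
  then show ?thesis unfolding A_def Bex_def atLeast_iff by (intro exI[of _ "real (Suc m0)"]) auto
qed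

lemma expectation_indep_pair:
  fixes P Q :: "'b \<Rightarrow> real"
  assumes [measurable]: "P \<in> borel_measurable borel" "Q \<in> borel_measurable borel"
    and i: "integrable M (\<lambda>\<omega>. P (Y 0 \<omega>))" "integrable M (\<lambda>\<omega>. Q (Y 0 \<omega>))"
  shows "integrable M (\<lambda>\<omega>. P (Y 0 \<omega>) * Q (Y 1 \<omega>))"
    and "(\<integral>\<omega>. P (Y 0 \<omega>) * Q (Y 1 \<omega>) \<partial>M) = (\<integral>\<omega>. P (Y 0 \<omega>) \<partial>M) * (\<integral>\<omega>. Q (Y 0 \<omega>) \<partial>M)"
proof -
  have ind: "indep_var borel (\<lambda>\<omega>. P (Y 0 \<omega>)) borel (\<lambda>\<omega>. Q (Y 1 \<omega>))"
    using indep_var_split[of "\<lambda>u. P (u 0)" Q 1] by simp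
  have i1: "integrable M (\<lambda>\<omega>. Q (Y 1 \<omega>))" using integrable_same_law(1)[OF assms(2), of 1] i(2) by simp
  show "integrable M (\<lambda>\<omega>. P (Y 0 \<omega>) * Q (Y 1 \<omega>))" by (rule indep_var_integrable[OF ind i(1) i1])
  have "(\<integral>\<omega>. P (Y 0 \<omega>) * Q (Y 1 \<omega>) \<partial>M) = (\<integral>\<omega>. P (Y 0 \<omega>) \<partial>M) * (\<integral>\<omega>. Q (Y 1 \<omega>) \<partial>M)"
    by (rule indep_var_lebesgue_integral[OF ind i(1) i1])
  then show "(\<integral>\<omega>. P (Y 0 \<omega>) * Q (Y 1 \<omega>) \<partial>M) = (\<integral>\<omega>. P (Y 0 \<omega>) \<partial>M) * (\<integral>\<omega>. Q (Y 0 \<omega>) \<partial>M)"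
    using integrable_same_law(2)[OF assms(2), of 1] by simp
qed

text \<open>Only the event that both components have norm at most a is kept. There the squared half
  difference expands into three products of a function of the first component and one of the second,
  which factor by independence.\<close>

lemma diffs_variance_lower:
  fixes f :: "'b \<Rightarrow>\<^sub>L real"
  assumes f: "norm f \<le> 1" and a: "0 \<le> a"
  shows "(1/2) * ((\<integral>\<omega>. (if norm (Y 0 \<omega>) \<le> a then (blinfun_apply f (Y 0 \<omega>))\<^sup>2 else 0) \<partial>M) * prob {\<omega>\<in>space M. norm (Y 0 \<omega>) \<le> a}
      - (\<integral>\<omega>. (if norm (Y 0 \<omega>) \<le> a then blinfun_apply f (Y 0 \<omega>) else 0) \<partial>M)\<^sup>2)
    \<le> (\<integral>\<omega>. (if norm (diffs 0 \<omega>) \<le> a then blinfun_apply f (diffs 0 \<omega>) else 0)\<^sup>2 \<partial>M)"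
proof -
  let ?S = "\<lambda>y. if norm y \<le> a then (blinfun_apply f y)\<^sup>2 else 0"
  let ?G = "\<lambda>y. if norm y \<le> a then blinfun_apply f y else 0"
  let ?q = "\<lambda>y::'b. if norm y \<le> a then 1 else 0 :: real"
  let ?D = "\<lambda>\<omega>. (?G (diffs 0 \<omega>))\<^sup>2"
  have Gb: "\<bar>?G y\<bar> \<le> a" for y using blinfun_apply_le_norm[OF f, of y] a by auto
  have G2: "(?G y)\<^sup>2 \<le> a\<^sup>2" for y using power_mono[OF Gb[of y], of 2] by simp
  have S: "?S y = (?G y)\<^sup>2" for y by simp
  have m [measurable]: "?S \<in> borel_measurable borel" "?G \<in> borel_measurable borel" "?q \<in> borel_measurable borel" by measurable
  have iS: "integrable M (\<lambda>\<omega>. ?S (Y 0 \<omega>))"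
    unfolding S by (rule integrable_const_bound[of _ "a\<^sup>2"]) (use G2 in auto)
  have iG: "integrable M (\<lambda>\<omega>. ?G (Y 0 \<omega>))" by (rule integrable_const_bound[of _ a]) (use Gb in auto)
  have iq: "integrable M (\<lambda>\<omega>. ?q (Y 0 \<omega>))" by (rule integrable_const_bound[of _ 1]) auto
  have iD: "integrable M ?D" by (rule integrable_const_bound[of _ "a\<^sup>2"]) (use G2 in auto)
  note e1 = expectation_indep_pair[OF m(1) m(3) iS iq]
  note e2 = expectation_indep_pair[OF m(3) m(1) iq iS]
  note e3 = expectation_indep_pair[OF m(2) m(2) iG iG]
  have q: "(\<integral>\<omega>. ?q (Y 0 \<omega>) \<partial>M) = prob {\<omega>\<in>space M. norm (Y 0 \<omega>) \<le> a}"
  proof -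
    have "(\<integral>\<omega>. ?q (Y 0 \<omega>) \<partial>M) = (\<integral>\<omega>. indicator {\<omega>\<in>space M. norm (Y 0 \<omega>) \<le> a} \<omega> \<partial>M)"
      by (rule Bochner_Integration.integral_cong) auto
    then show ?thesis by simp
  qed
  have "(\<integral>\<omega>. (1/4) * ((?S (Y 0 \<omega>) * ?q (Y 1 \<omega>) + ?q (Y 0 \<omega>) * ?S (Y 1 \<omega>)) - 2 * (?G (Y 0 \<omega>) * ?G (Y 1 \<omega>))) \<partial>M) \<le> (\<integral>\<omega>. ?D \<omega> \<partial>M)"
  proof (rule integral_mono)
    show "integrable M (\<lambda>\<omega>. (1/4) * ((?S (Y 0 \<omega>) * ?q (Y 1 \<omega>) + ?q (Y 0 \<omega>) * ?S (Y 1 \<omega>)) - 2 * (?G (Y 0 \<omega>) * ?G (Y 1 \<omega>))))"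
      by (intro integrable_mult_right Bochner_Integration.integrable_diff Bochner_Integration.integrable_add e1 e2 e3)
    fix \<omega>
    show "(1/4) * ((?S (Y 0 \<omega>) * ?q (Y 1 \<omega>) + ?q (Y 0 \<omega>) * ?S (Y 1 \<omega>)) - 2 * (?G (Y 0 \<omega>) * ?G (Y 1 \<omega>))) \<le> ?D \<omega>"
    proof (cases "norm (Y 0 \<omega>) \<le> a \<and> norm (Y 1 \<omega>) \<le> a")
      case True
      then have "norm (diffs 0 \<omega>) \<le> a" using norm_diffs_le[of \<omega>] by (auto simp: max_def split: if_splits)
      then have "?D \<omega> = ((1/2) * (blinfun_apply f (Y 0 \<omega>) - blinfun_apply f (Y 1 \<omega>)))\<^sup>2"
        by (simp add: diffs_def blinfun.scaleR_right blinfun.diff_right)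
      then show ?thesis using True by (simp add: power2_eq_square algebra_simps)
    qed auto
  qed (rule iD)
  also have "(\<integral>\<omega>. (1/4) * ((?S (Y 0 \<omega>) * ?q (Y 1 \<omega>) + ?q (Y 0 \<omega>) * ?S (Y 1 \<omega>)) - 2 * (?G (Y 0 \<omega>) * ?G (Y 1 \<omega>))) \<partial>M)
     = (1/4) * (((\<integral>\<omega>. ?S (Y 0 \<omega>) * ?q (Y 1 \<omega>) \<partial>M) + (\<integral>\<omega>. ?q (Y 0 \<omega>) * ?S (Y 1 \<omega>) \<partial>M)) - 2 * (\<integral>\<omega>. ?G (Y 0 \<omega>) * ?G (Y 1 \<omega>) \<partial>M))"
    by (simp only: integral_mult_right_zero
      Bochner_Integration.integral_diff[OF Bochner_Integration.integrable_add[OF e1(1) e2(1)] integrable_mult_right[OF e3(1)]]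
      Bochner_Integration.integral_add[OF e1(1) e2(1)])
  also have "\<dots> = (1/2) * ((\<integral>\<omega>. ?S (Y 0 \<omega>) \<partial>M) * prob {\<omega>\<in>space M. norm (Y 0 \<omega>) \<le> a} - (\<integral>\<omega>. ?G (Y 0 \<omega>) \<partial>M)\<^sup>2)"
    unfolding e1(2) e2(2) e3(2) q by (simp add: power2_eq_square)
  finally show ?thesis .
qed

context
  fixes h :: "real \<Rightarrow> real"
  assumes h: "h \<in> class_H" and bd: "AE \<omega> in M. \<exists>C. \<forall>n\<ge>1. norm (psum n \<omega>) \<le> C * Psi h (real n)"
begin

lemma bounded_event:
  obtains C where "1 \<le> C" "3/4 \<le> prob {\<omega>\<in>space M. \<forall>n\<ge>1. norm (psum n \<omega>) \<le> C * Psi h (real n)}"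
proof -
  obtain C where C: "1 \<le> C" "prob {\<omega>\<in>space M. \<exists>n\<ge>1. C * Psi h (real n) < norm (psum n \<omega>)} \<le> 1/4"
    using bounded_in_probability[OF h bd, of "1/4"] by auto
  have "{\<omega>\<in>space M. \<exists>n\<in>{1..}. C * Psi h (real n) < norm (psum n \<omega>)} \<in> sets M" by measurable
  then have m: "{\<omega>\<in>space M. \<exists>n\<ge>1. C * Psi h (real n) < norm (psum n \<omega>)} \<in> sets M" by (simp add: Bex_def)
  have "{\<omega>\<in>space M. \<forall>n\<ge>1. norm (psum n \<omega>) \<le> C * Psi h (real n)} = space M - {\<omega>\<in>space M. \<exists>n\<ge>1. C * Psi h (real n) < norm (psum n \<omega>)}"
    by (auto simp: not_less)
  then have "prob {\<omega>\<in>space M. \<forall>n\<ge>1. norm (psum n \<omega>) \<le> C * Psi h (real n)} = 1 - prob {\<omega>\<in>space M. \<exists>n\<ge>1. C * Psi h (real n) < norm (psum n \<omega>)}"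
    using m by (simp add: prob_compl)
  then show ?thesis using C by (intro that[of C]) auto
qed

text \<open>A summand is the difference of two consecutive sums, so with probability at least 3/4
  none of the independent events that \<open>Y n\<close> exceeds 2 C times Psi at n + 1
  occurs.\<close>

lemma bounded_integrable_Psi_inv: "integrable M (\<lambda>\<omega>. Psi_inv h (norm (Y 0 \<omega>)))"
proof -
  obtain C where C: "1 \<le> C" "3/4 \<le> prob {\<omega>\<in>space M. \<forall>n\<ge>1. norm (psum n \<omega>) \<le> C * Psi h (real n)}"
    by (rule bounded_event)
  define B where "B n = {y::'b. 2 * C * Psi h (real (Suc n)) < norm y}" for n
  have Bm: "B n \<in> sets borel" for n unfolding B_def by measurable
  have sm: "summable (\<lambda>n. prob {\<omega>\<in>space M. Y n \<omega> \<in> B n})"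
  proof (rule indep_avoid_summable[OF indep Bm, of "3/4"])
    have Am: "{\<omega>\<in>space M. \<forall>n. Y n \<omega> \<notin> B n} \<in> sets M" unfolding B_def by measurable
    have "prob {\<omega>\<in>space M. \<forall>n\<ge>1. norm (psum n \<omega>) \<le> C * Psi h (real n)} \<le> prob {\<omega>\<in>space M. \<forall>n. Y n \<omega> \<notin> B n}"
    proof (rule finite_measure_mono[OF _ Am], safe)
      fix \<omega> n assume a: "\<forall>n\<ge>1. norm (psum n \<omega>) \<le> C * Psi h (real n)" and Yn: "Y n \<omega> \<in> B n"
      have "Y n \<omega> = psum (Suc n) \<omega> - psum n \<omega>" by (simp add: psum_def)
      then have "norm (Y n \<omega>) \<le> norm (psum (Suc n) \<omega>) + norm (psum n \<omega>)" by (simp add: norm_triangle_ineq4)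
      moreover have "norm (psum (Suc n) \<omega>) \<le> C * Psi h (real (Suc n))" using a[rule_format, of "Suc n"] by simp
      moreover have "norm (psum n \<omega>) \<le> C * Psi h (real (Suc n))"
      proof (cases "n = 0")
        case True
        then show ?thesis using C Psi_nonneg[OF h] by (simp add: psum_def)
      next
        case False
        then have "norm (psum n \<omega>) \<le> C * Psi h (real n)" using a by simp
        also have "\<dots> \<le> C * Psi h (real (Suc n))" using C by (intro mult_left_mono Psi_mono[OF h]) auto
        finally show ?thesis .
      qed
      ultimately show False using Yn unfolding B_def by simp
    qed
    then show "3/4 \<le> prob {\<omega>\<in>space M. \<forall>n. Y n \<omega> \<notin> B n}" using C(2) by linarith
  qed simp
  have "prob {\<omega>\<in>space M. Y n \<omega> \<in> B n} = prob {\<omega>\<in>space M. 2 * C * Psi h (real (Suc n)) < norm (Y 0 \<omega>)}" for n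
    unfolding B_def mem_Collect_eq by (rule prob_same_law) measurable
  then have "summable (\<lambda>n. prob {\<omega>\<in>space M. 2 * C * Psi h (real (Suc n)) < norm (Y 0 \<omega>)})" using sm by simp
  then have "summable (\<lambda>n. prob {\<omega>\<in>space M. 2 * C * Psi h (real n) < norm (Y 0 \<omega>)})"
    by (rule summable_Suc_iff[THEN iffD1])
  then show ?thesis using C by (intro integrable_Psi_inv[OF h, where K = "2 * C"]) auto
qed

lemma bounded_integrable: "integrable M (\<lambda>\<omega>. norm (Y 0 \<omega>))"
proof -
  obtain C where C: "0 < C" "\<And>y. 0 \<le> y \<Longrightarrow> y \<le> C * (1 + Psi_inv h y)" using le_Psi_inv[OF h] by blast
  have "integrable M (\<lambda>\<omega>. C * (1 + Psi_inv h (norm (Y 0 \<omega>))))" using bounded_integrable_Psi_inv by simp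
  then show ?thesis
  proof (rule Bochner_Integration.integrable_bound)
    show "AE \<omega> in M. norm (norm (Y 0 \<omega>)) \<le> norm (C * (1 + Psi_inv h (norm (Y 0 \<omega>))))"
    proof (rule AE_I2)
      fix \<omega>
      have "norm (Y 0 \<omega>) \<le> C * (1 + Psi_inv h (norm (Y 0 \<omega>)))" by (rule C(2)) simp
      then show "norm (norm (Y 0 \<omega>)) \<le> norm (C * (1 + Psi_inv h (norm (Y 0 \<omega>))))" by simp
    qed
  qed simp
qed

lemma bounded_mean_zero: "norm (f :: 'b \<Rightarrow>\<^sub>L real) \<le> 1 \<Longrightarrow> (\<integral>\<omega>. blinfun_apply f (Y 0 \<omega>) \<partial>M) = 0"
proof -
  assume f: "norm f \<le> 1"
  obtain C where C: "1 \<le> C" "prob {\<omega>\<in>space M. \<exists>n\<ge>1. C * Psi h (real n) < norm (psum n \<omega>)} \<le> 1/4"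
    using bounded_in_probability[OF h bd, of "1/4"] by auto
  have "{\<omega>\<in>space M. \<exists>n\<in>{1..}. C * Psi h (real n) < norm (psum n \<omega>)} \<in> sets M" by measurable
  then have m: "{\<omega>\<in>space M. \<exists>n\<ge>1. C * Psi h (real n) < norm (psum n \<omega>)} \<in> sets M" by (simp add: Bex_def)
  have "tail n (C * Psi h (real n)) \<le> 1/4" if "1 \<le> n" for n
    unfolding tail_def by (rule order_trans[OF finite_measure_mono[OF _ m] C(2)]) (use that in auto)
  then have "\<forall>f :: 'b \<Rightarrow>\<^sub>L real. norm f \<le> 1 \<longrightarrow> (\<integral>\<omega>. blinfun_apply f (Y 0 \<omega>) \<partial>M) \<le> 0"
    using C by (intro mean_zero[OF bounded_integrable h, where C = C]) auto
  from this[rule_format, of f] this[rule_format, of "- f"] f show ?thesis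
    by (simp add: blinfun.minus_left)
qed

text \<open>Sums over the disjoint index blocks from 2^k to 2^(k+1) are independent, and each has
  the law of the sum of the first 2^k terms. Where sums are bounded by C Psi, doubling of Psi bounds
  the block sum by 3 C Psi (2^k) from \<open>k0\<close> on.\<close>

lemma bounded_dyadic_tail:
  obtains C where "1 \<le> C" "summable (\<lambda>k. tail (2 ^ k) (C * Psi h (2 ^ k)))"
proof -
  obtain C where C: "1 \<le> C" "3/4 \<le> prob {\<omega>\<in>space M. \<forall>n\<ge>1. norm (psum n \<omega>) \<le> C * Psi h (real n)}"
    by (rule bounded_event)
  obtain k0 where k0: "\<And>k. k0 \<le> k \<Longrightarrow> Psi h (2 ^ Suc k) \<le> 2 * Psi h (2 ^ k)" using Psi_doubling[OF h] by blast
  define Z where "Z k \<omega> = (\<Sum>i\<in>{2 ^ k..<2 ^ Suc k}. Y i \<omega>)" for k :: nat and \<omega>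
  have Zeq: "Z k \<omega> = (\<Sum>i<2 ^ k. Y (2 ^ k + i) \<omega>)" for k \<omega>
    unfolding Z_def by (rule sum.reindex_bij_witness[of _ "\<lambda>i. 2 ^ k + i" "\<lambda>i. i - 2 ^ k"]) auto
  have ind: "indep_vars (\<lambda>_. borel) Z UNIV"
  proof -
    have "{2 ^ i..<2 ^ Suc i} \<inter> {2 ^ j..<2 ^ Suc j} = ({} :: nat set)" if "i < j" for i j :: nat
    proof -
      have "(2::nat) ^ Suc i \<le> 2 ^ j" using that by (intro power_increasing) auto
      then show ?thesis by auto
    qed
    then have disj: "{2 ^ i..<2 ^ Suc i} \<inter> {2 ^ j..<2 ^ Suc j} = ({} :: nat set)" if "i \<noteq> j" for i j :: nat
      using that by (cases i j rule: linorder_cases) (auto simp: Int_commute)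
    define J :: "nat \<Rightarrow> nat set" where "J k = {2 ^ k..<2 ^ Suc k}" for k
    have "disjoint_family_on J UNIV"
      unfolding disjoint_family_on_def J_def by (intro ballI impI disj)
    then have "indep_vars (\<lambda>k. PiM (J k) (\<lambda>_. borel)) (\<lambda>k \<omega>. restrict (\<lambda>i. Y i \<omega>) (J k)) UNIV"
      by (intro indep_vars_restrict[OF indep] subset_UNIV)
    then have "indep_vars (\<lambda>_. borel) (\<lambda>k \<omega>. \<Sum>i\<in>J k. (restrict (\<lambda>i. Y i \<omega>) (J k)) i) UNIV"
      by (rule indep_vars_compose2[where Y = "\<lambda>k v. \<Sum>i\<in>J k. v i"]) (intro borel_measurable_sum measurable_component_singleton)
    moreover have "(\<Sum>i\<in>J k. (restrict (\<lambda>i. Y i \<omega>) (J k)) i) = Z k \<omega>" for k \<omega>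
      unfolding Z_def J_def[symmetric] by (intro sum.cong) auto
    ultimately show ?thesis by simp
  qed
  define B where "B k = (if k0 \<le> k then {y::'b. 3 * C * Psi h (2 ^ k) < norm y} else {})" for k
  have Bm: "B k \<in> sets borel" for k unfolding B_def by (cases "k0 \<le> k") (simp_all, measurable)
  have Zm [measurable]: "Z k \<in> borel_measurable M" for k unfolding Z_def[abs_def] by measurable
  have sm: "summable (\<lambda>k. prob {\<omega>\<in>space M. Z k \<omega> \<in> B k})"
  proof (rule indep_avoid_summable[OF ind Bm, of "3/4"])
    have "{\<omega>\<in>space M. Z k \<omega> \<notin> B k} \<in> sets M" for k using Bm by measurable
    then have Am: "{\<omega>\<in>space M. \<forall>k. Z k \<omega> \<notin> B k} \<in> sets M" by (rule sets.sets_Collect_countable_All)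
    have "prob {\<omega>\<in>space M. \<forall>n\<ge>1. norm (psum n \<omega>) \<le> C * Psi h (real n)} \<le> prob {\<omega>\<in>space M. \<forall>k. Z k \<omega> \<notin> B k}"
    proof (rule finite_measure_mono[OF _ Am], safe)
      fix \<omega> k assume a: "\<forall>n\<ge>1. norm (psum n \<omega>) \<le> C * Psi h (real n)" and Zk: "Z k \<omega> \<in> B k"
      then have k: "k0 \<le> k" and big: "3 * C * Psi h (2 ^ k) < norm (Z k \<omega>)" unfolding B_def by (auto split: if_splits)
      have "psum (2 ^ Suc k) \<omega> = psum (2 ^ k) \<omega> + Z k \<omega>" using psum_add[of "2 ^ k" "2 ^ k" \<omega>] unfolding Zeq by (simp add: mult_2)
      then have "norm (Z k \<omega>) \<le> norm (psum (2 ^ Suc k) \<omega>) + norm (psum (2 ^ k) \<omega>)"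
        using norm_triangle_ineq4[of "psum (2 ^ Suc k) \<omega>" "psum (2 ^ k) \<omega>"] by simp
      moreover have "norm (psum (2 ^ Suc k) \<omega>) \<le> C * Psi h (2 ^ Suc k)" using a[rule_format, of "2 ^ Suc k"] by simp
      moreover have "norm (psum (2 ^ k) \<omega>) \<le> C * Psi h (2 ^ k)" using a[rule_format, of "2 ^ k"] by simp
      moreover have "C * Psi h (2 ^ Suc k) \<le> C * (2 * Psi h (2 ^ k))" using C k0[OF k] by (intro mult_left_mono) auto
      ultimately show False using big by linarith
    qed
    then show "3/4 \<le> prob {\<omega>\<in>space M. \<forall>k. Z k \<omega> \<notin> B k}" using C(2) by linarith
  qed simp
  have "summable (\<lambda>k. tail (2 ^ k) (3 * C * Psi h (2 ^ k)))"
  proof (rule summable_comparison_test_ev[OF _ sm])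
    show "eventually (\<lambda>k. norm (tail (2 ^ k) (3 * C * Psi h (2 ^ k))) \<le> prob {\<omega>\<in>space M. Z k \<omega> \<in> B k}) sequentially"
      using eventually_ge_at_top[of k0]
    proof eventually_elim
      case (elim k)
      then have "prob {\<omega>\<in>space M. Z k \<omega> \<in> B k} = tail (2 ^ k) (3 * C * Psi h (2 ^ k))"
        unfolding B_def Zeq by (simp add: tail_shift)
      then show ?case by (simp add: tail_def)
    qed
  qed
  then show ?thesis using C by (intro that[of "3 * C"]) auto
qed

text \<open>The constant lower bound \<open>H0\<close> is there to make the centering negligible:
  far out, the squared truncated mean is at most H0 / 8 and the truncation keeps probability at
  least 1/2, so the symmetrized functional retains a variance of at least \<open>H k / 16\<close>. A
  nearly optimal functional, chosen anew for each k, then reduces the claim to real sums.\<close>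

theorem dyadic_lower_bound:
  assumes H0: "0 < H0" and H: "\<And>k. k1 \<le> k \<Longrightarrow> H0 \<le> H k"
    and Hf: "\<And>k. k1 \<le> k \<Longrightarrow> \<exists>f :: 'b \<Rightarrow>\<^sub>L real. norm f \<le> 1 \<and>
      H k / 2 \<le> (\<integral>\<omega>. (blinfun_apply f (Y 0 \<omega>))\<^sup>2 * indicator {\<omega>. norm (Y 0 \<omega>) \<le> Psi h (2 ^ k)} \<omega> \<partial>M)"
  shows "\<exists>A\<ge>0. summable (\<lambda>k. exp (- (A * h (2 ^ k) / H k)))"
proof -
  interpret D: iid_sym M diffs by (rule diffs_iid_sym)
  obtain C where C: "1 \<le> C" "summable (\<lambda>k. tail (2 ^ k) (C * Psi h (2 ^ k)))" by (rule bounded_dyadic_tail)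
  define a where "a k = Psi h (2 ^ k)" for k :: nat
  have a0: "0 < a k" for k unfolding a_def by (rule Psi_pos[OF h]) simp
  have a2: "(a k)\<^sup>2 = 2 ^ k * h (2 ^ k)" for k unfolding a_def by (rule Psi_square[OF h]) simp
  let ?mom = "\<lambda>k. \<integral>\<omega>. (if norm (diffs 0 \<omega>) \<le> a k then (norm (diffs 0 \<omega>) / a k) powr (9/4) else 0) \<partial>M"
  have s1: "summable (\<lambda>k. 2 ^ k * ?mom k)"
    using summable_Psi_moment[OF h _ _ diffs_integrable_Psi_inv[OF h bounded_integrable_Psi_inv]] unfolding a_def by simp
  define A where "A = 4 * ln 32 * C\<^sup>2"
  have A0: "0 \<le> A" unfolding A_def by simp
  have atop: "filterlim a at_top sequentially" unfolding a_def by (rule Psi_dyadic_at_top[OF h])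
  have l1: "(\<lambda>k. \<integral>\<omega>. (if a k < norm (Y 0 \<omega>) then \<bar>norm (Y 0 \<omega>)\<bar> else 0) \<partial>M) \<longlonglongrightarrow> 0"
    by (rule truncated_integral_tendsto_0[OF _ _ atop]) (use bounded_integrable in auto)
  have l2: "(\<lambda>k. \<integral>\<omega>. (if a k < norm (Y 0 \<omega>) then \<bar>1::real\<bar> else 0) \<partial>M) \<longlonglongrightarrow> 0"
    by (rule truncated_integral_tendsto_0[OF _ _ atop]) auto
  have "eventually (\<lambda>k. (\<integral>\<omega>. (if a k < norm (Y 0 \<omega>) then \<bar>norm (Y 0 \<omega>)\<bar> else 0) \<partial>M) < sqrt (H0 / 8)
      \<and> (\<integral>\<omega>. (if a k < norm (Y 0 \<omega>) then \<bar>1::real\<bar> else 0) \<partial>M) < 1/2) sequentially"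
    using order_tendstoD(2)[OF l1, of "sqrt (H0 / 8)"] order_tendstoD(2)[OF l2, of "1/2"] H0 by (simp add: eventually_conj)
  then obtain k2 where k2: "\<And>k. k2 \<le> k \<Longrightarrow> (\<integral>\<omega>. (if a k < norm (Y 0 \<omega>) then \<bar>norm (Y 0 \<omega>)\<bar> else 0) \<partial>M) < sqrt (H0 / 8)"
     "\<And>k. k2 \<le> k \<Longrightarrow> (\<integral>\<omega>. (if a k < norm (Y 0 \<omega>) then \<bar>1::real\<bar> else 0) \<partial>M) < 1/2"
    by (auto simp: eventually_sequentially)
  have main: "exp (- (16 * A * h (2 ^ k) / H k)) \<le> 128 * tail (2 ^ k) (C * a k) + 2 ^ k * ?mom k + (1/2) ^ k"
    if k: "max k1 k2 \<le> k" for k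
  proof -
    have Hk: "H0 \<le> H k" "0 < H k" using H[of k] k H0 by auto
    obtain f :: "'b \<Rightarrow>\<^sub>L real" where f: "norm f \<le> 1" and
      fH: "H k / 2 \<le> (\<integral>\<omega>. (blinfun_apply f (Y 0 \<omega>))\<^sup>2 * indicator {\<omega>. norm (Y 0 \<omega>) \<le> Psi h (2 ^ k)} \<omega> \<partial>M)"
      using Hf[of k] k by auto
    define \<sigma> where "\<sigma> = (\<integral>\<omega>. (if norm (Y 0 \<omega>) \<le> a k then (blinfun_apply f (Y 0 \<omega>))\<^sup>2 else 0) \<partial>M)"
    define p where "p = prob {\<omega>\<in>space M. norm (Y 0 \<omega>) \<le> a k}"
    define \<mu> where "\<mu> = (\<integral>\<omega>. (if norm (Y 0 \<omega>) \<le> a k then blinfun_apply f (Y 0 \<omega>) else 0) \<partial>M)"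
    have \<sigma>: "H k / 2 \<le> \<sigma>"
    proof -
      have "(\<integral>\<omega>. (blinfun_apply f (Y 0 \<omega>))\<^sup>2 * indicator {\<omega>. norm (Y 0 \<omega>) \<le> Psi h (2 ^ k)} \<omega> \<partial>M) = \<sigma>"
        unfolding \<sigma>_def a_def by (rule Bochner_Integration.integral_cong) auto
      then show ?thesis using fH by simp
    qed
    have p: "1/2 \<le> p"
    proof -
      have "(\<integral>\<omega>. (if a k < norm (Y 0 \<omega>) then \<bar>1::real\<bar> else 0) \<partial>M) = (\<integral>\<omega>. indicator {\<omega>\<in>space M. a k < norm (Y 0 \<omega>)} \<omega> \<partial>M)"
        by (rule Bochner_Integration.integral_cong) auto
      then have "prob {\<omega>\<in>space M. a k < norm (Y 0 \<omega>)} \<le> 1/2" using k2(2)[of k] k by simp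
      moreover have "{\<omega>\<in>space M. norm (Y 0 \<omega>) \<le> a k} = space M - {\<omega>\<in>space M. a k < norm (Y 0 \<omega>)}" by auto
      then have "p = 1 - prob {\<omega>\<in>space M. a k < norm (Y 0 \<omega>)}" unfolding p_def by (simp add: prob_compl)
      ultimately show ?thesis by simp
    qed
    have intf: "integrable M (\<lambda>\<omega>. blinfun_apply f (Y 0 \<omega>))"
      by (rule Bochner_Integration.integrable_bound[OF bounded_integrable]) (use blinfun_apply_le_norm[OF f] in auto)
    \<comment> \<open>The functional has mean 0, so its truncated mean is minus its mean over large
      norms, which tends to 0 uniformly over functionals of norm at most 1.\<close>
    have \<mu>: "\<mu>\<^sup>2 \<le> H0 / 8"
    proof -
      let ?g = "\<lambda>\<omega>. if a k < norm (Y 0 \<omega>) then blinfun_apply f (Y 0 \<omega>) else 0"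
      have ig: "integrable M ?g" by (rule Bochner_Integration.integrable_bound[OF intf]) auto
      have in1: "integrable M (\<lambda>\<omega>. if a k < norm (Y 0 \<omega>) then \<bar>norm (Y 0 \<omega>)\<bar> else 0)"
        by (rule Bochner_Integration.integrable_bound[OF bounded_integrable]) auto
      have "\<mu> = (\<integral>\<omega>. blinfun_apply f (Y 0 \<omega>) - ?g \<omega> \<partial>M)"
        unfolding \<mu>_def by (rule Bochner_Integration.integral_cong) auto
      also have "\<dots> = - (\<integral>\<omega>. ?g \<omega> \<partial>M)"
        using Bochner_Integration.integral_diff[OF intf ig] bounded_mean_zero[OF f] by simp
      finally have "\<bar>\<mu>\<bar> = \<bar>\<integral>\<omega>. ?g \<omega> \<partial>M\<bar>" by simp
      also have "\<dots> \<le> (\<integral>\<omega>. \<bar>?g \<omega>\<bar> \<partial>M)" by (rule integral_abs_bound)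
      also have "\<dots> \<le> (\<integral>\<omega>. (if a k < norm (Y 0 \<omega>) then \<bar>norm (Y 0 \<omega>)\<bar> else 0) \<partial>M)"
        by (rule integral_mono) (use ig in1 blinfun_apply_le_norm[OF f] in auto)
      also have "\<dots> \<le> sqrt (H0 / 8)" using k2(1)[of k] k by simp
      finally have "\<bar>\<mu>\<bar>\<^sup>2 \<le> (sqrt (H0 / 8))\<^sup>2" by (intro power_mono) auto
      then show ?thesis using H0 by simp
    qed
    define Zg where "Zg y = (if norm y \<le> a k then blinfun_apply f y else 0)" for y :: 'b
    have Zgm [measurable]: "Zg \<in> borel_measurable borel" unfolding Zg_def[abs_def] by measurable
    have Zgb: "\<bar>Zg y\<bar> \<le> a k" for y using blinfun_apply_le_norm[OF f, of y] a0[of k] by (auto simp: Zg_def)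
    interpret Z: iid_sym M "\<lambda>i \<omega>. Zg (diffs i \<omega>)"
      by (rule D.sym_compose[OF Zgm]) (simp add: Zg_def blinfun.minus_right)
    interpret Z: iid_sym_real M "\<lambda>i \<omega>. Zg (diffs i \<omega>)" "a k"
      by unfold_locales (rule Zgb)
    have v: "H k / 16 \<le> Z.v"
    proof -
      have "\<sigma> * (1/2) \<le> \<sigma> * p" using p \<sigma> Hk by (intro mult_left_mono) auto
      moreover have "H0 / 8 \<le> \<sigma> / 4" using \<sigma> Hk by simp
      moreover have "\<sigma> * (1/2) = \<sigma> / 4 + \<sigma> / 4" by simp
      ultimately have "\<sigma> / 4 \<le> \<sigma> * p - \<mu>\<^sup>2" using \<mu> by linarith
      then have "(1/2) * (\<sigma> / 4) \<le> (1/2) * (\<sigma> * p - \<mu>\<^sup>2)" by simp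
      also have "\<dots> \<le> Z.v"
        unfolding \<sigma>_def p_def \<mu>_def Z.v_def unfolding Zg_def by (rule diffs_variance_lower[OF f less_imp_le[OF a0]])
      finally show ?thesis using \<sigma> by simp
    qed
    have vp: "0 < Z.v" using v Hk by simp
    have "exp (- (16 * A * h (2 ^ k) / H k)) \<le> exp (- (A * (h (2 ^ k) / Z.v)))"
    proof -
      have "h (2 ^ k) / Z.v \<le> h (2 ^ k) / (H k / 16)"
        using v Hk vp h_pos[OF h, of "2 ^ k"] by (intro divide_left_mono) auto
      then have "A * (h (2 ^ k) / Z.v) \<le> A * (h (2 ^ k) / (H k / 16))" using A0 by (rule mult_left_mono)
      then show ?thesis by (simp add: mult_ac)
    qed
    also have "\<dots> \<le> 32 * prob {\<omega>\<in>space M. C * a k < Z.psum (2 ^ k) \<omega>} + 2 ^ k * (Z.v4 / a k ^ 4) + (1/2) ^ k"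
      unfolding A_def by (rule Z.gaussian_lower_bound[OF vp a0 a2 h_pos[OF h] C(1)]) simp
    \<comment> \<open>The real sum is the functional applied to a restricted vector sum. Restriction
      to a ball and pairing cost a factor 2 each.\<close>
    also have "prob {\<omega>\<in>space M. C * a k < Z.psum (2 ^ k) \<omega>} \<le> 4 * tail (2 ^ k) (C * a k)"
    proof -
      let ?I = "{y::'b. norm y \<le> a k}"
      have Im: "?I \<in> sets borel" by measurable
      have "prob {\<omega>\<in>space M. C * a k < Z.psum (2 ^ k) \<omega>} \<le>
          prob {\<omega>\<in>space M. C * a k < norm (\<Sum>i<2 ^ k. indicator ?I (diffs i \<omega>) *\<^sub>R diffs i \<omega>)}"
      proof (rule finite_measure_mono, safe)
        fix \<omega> assume "C * a k < Z.psum (2 ^ k) \<omega>"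
        also have "Z.psum (2 ^ k) \<omega> = blinfun_apply f (\<Sum>i<2 ^ k. indicator ?I (diffs i \<omega>) *\<^sub>R diffs i \<omega>)"
          unfolding Z.psum_def blinfun.sum_right by (intro sum.cong) (auto simp: Zg_def)
        also have "\<dots> \<le> norm (\<Sum>i<2 ^ k. indicator ?I (diffs i \<omega>) *\<^sub>R diffs i \<omega>)"
          using blinfun_apply_le_norm[OF f] abs_le_D1 by blast
        finally show "C * a k < norm (\<Sum>i<2 ^ k. indicator ?I (diffs i \<omega>) *\<^sub>R diffs i \<omega>)" .
      qed (use Im in measurable)
      also have "\<dots> \<le> 2 * D.tail (2 ^ k) (C * a k)"
        by (rule D.tail_restrict_le[OF Im]) simp
      also have "D.tail (2 ^ k) (C * a k) \<le> 2 * tail (2 ^ k) (C * a k)"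
        unfolding D.tail_def D.psum_def by (rule diffs_tail_le)
      finally show ?thesis by simp
    qed
    also have "2 ^ k * (Z.v4 / a k ^ 4) \<le> 2 ^ k * ?mom k"
    proof (intro mult_left_mono)
      \<comment> \<open>For x \<le> 1 the fourth power is below the power 9/4, so the moment already
        known to be summable also controls this error.\<close>
      have pt: "(Zg y) ^ 4 / a k ^ 4 \<le> (if norm y \<le> a k then (norm y / a k) powr (9/4) else 0)" for y
      proof (cases "norm y \<le> a k \<and> y \<noteq> 0")
        case True
        define x where "x = norm y / a k"
        have x: "0 < x" "x \<le> 1" using True a0[of k] by (auto simp: x_def)
        have "(Zg y) ^ 4 = \<bar>blinfun_apply f y\<bar> ^ 4" using True by (simp add: Zg_def)
        also have "\<dots> \<le> norm y ^ 4" by (intro power_mono blinfun_apply_le_norm[OF f]) simp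
        finally have "(Zg y) ^ 4 / a k ^ 4 \<le> norm y ^ 4 / a k ^ 4" using a0[of k] by (intro divide_right_mono) auto
        also have "\<dots> = x ^ 4" by (simp add: x_def power_divide)
        also have "\<dots> = x powr 4" using x by simp
        also have "\<dots> \<le> x powr (9/4)" by (rule powr_mono') (use x in auto)
        finally show ?thesis using True by (simp add: x_def)
      qed (auto simp: Zg_def)
      have "Z.v4 / a k ^ 4 = (\<integral>\<omega>. (Zg (diffs 0 \<omega>)) ^ 4 / a k ^ 4 \<partial>M)" unfolding Z.v4_def by simp
      also have "\<dots> \<le> ?mom k"
      proof (rule integral_mono)
        show "integrable M (\<lambda>\<omega>. (Zg (diffs 0 \<omega>)) ^ 4 / a k ^ 4)" using Z.integrable_Y_power[of 0 4] by simp
        show "integrable M (\<lambda>\<omega>. if norm (diffs 0 \<omega>) \<le> a k then (norm (diffs 0 \<omega>) / a k) powr (9/4) else 0)"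
        proof (rule integrable_const_bound[of _ 1])
          have "(norm y / a k) powr (9/4) \<le> 1" if "norm y \<le> a k" for y :: 'b using that a0[of k] by (intro powr_le1) auto
          then show "AE \<omega> in M. norm (if norm (diffs 0 \<omega>) \<le> a k then (norm (diffs 0 \<omega>) / a k) powr (9/4) else 0) \<le> 1" by auto
        qed measurable
      qed (rule pt)
      finally show "Z.v4 / a k ^ 4 \<le> ?mom k" .
    qed simp
    finally show ?thesis by simp
  qed
  have "summable (\<lambda>k. exp (- (16 * A * h (2 ^ k) / H k)))"
  proof (rule summable_comparison_test_ev)
    show "summable (\<lambda>k. 128 * tail (2 ^ k) (C * a k) + 2 ^ k * ?mom k + (1/2) ^ k)"
      using C(2) unfolding a_def[symmetric] by (intro summable_add summable_mult s1 summable_geometric) auto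
    show "eventually (\<lambda>k. norm (exp (- (16 * A * h (2 ^ k) / H k))) \<le> 128 * tail (2 ^ k) (C * a k) + 2 ^ k * ?mom k + (1/2) ^ k) sequentially"
      using eventually_ge_at_top[of "max k1 k2"] by eventually_elim (use main in auto)
  qed
  then show ?thesis using A0 by (intro exI[of _ "16 * A"]) auto
qed

end

end

section \<open>The characterization\<close>

lemma sum_dyadic_blocks:
  fixes s :: "nat \<Rightarrow> real"
  shows "(\<Sum>k<K. \<Sum>n\<in>{2 ^ k..<2 ^ Suc k}. s n) = (\<Sum>n\<in>{1..<2 ^ K}. s n)"
proof (induction K)
  case (Suc K)
  have "{1..<2 ^ Suc K} = {1..<2 ^ K} \<union> {2 ^ K..<(2 ^ Suc K :: nat)}" by auto
  then have "(\<Sum>n\<in>{1..<2 ^ Suc K}. s n) = (\<Sum>n\<in>{1..<2 ^ K}. s n) + (\<Sum>n\<in>{2 ^ K..<2 ^ Suc K}. s n)"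
    by (simp only:) (rule sum.union_disjoint, auto)
  then show ?case using Suc by simp
qed simp

lemma summable_dyadic_blocks:
  fixes s :: "nat \<Rightarrow> real"
  assumes "summable s" "\<And>n. 0 \<le> s n"
  shows "summable (\<lambda>k. \<Sum>n\<in>{2 ^ k..<2 ^ Suc k}. s n)"
proof (rule summableI_nonneg_bounded)
  show "(\<Sum>k<K. \<Sum>n\<in>{2 ^ k..<2 ^ Suc k}. s n) \<le> suminf s" for K
    unfolding sum_dyadic_blocks using assms by (intro sum_le_suminf) auto
qed (use assms in \<open>auto intro: sum_nonneg\<close>)

text \<open>The block from 2^k to 2^(k+1) has 2^k terms and contributes at most D k; index 0 belongs
  to no block and is added separately.\<close>

lemma summable_of_dyadic_bound:
  fixes s D :: "nat \<Rightarrow> real"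
  assumes s: "\<And>n. 0 \<le> s n" and le: "\<And>k n. 2 ^ k \<le> n \<Longrightarrow> n < 2 ^ Suc k \<Longrightarrow> s n \<le> D k / 2 ^ k"
    and D: "summable D" "\<And>k. 0 \<le> D k"
  shows "summable s"
proof (rule summableI_nonneg_bounded)
  fix N :: nat
  have "(\<Sum>n<N. s n) \<le> (\<Sum>n\<in>insert 0 {1..<2 ^ N}. s n)"
  proof (rule sum_mono2)
    show "{..<N} \<subseteq> insert 0 {1..<2 ^ N}"
    proof
      fix x assume "x \<in> {..<N}"
      then have "x < N" by simp
      also have "N < 2 ^ N" by (rule less_exp)
      finally have "x < 2 ^ N" .
      then show "x \<in> insert 0 {1..<2 ^ N}" by auto
    qed
  qed (use s in auto)
  also have "\<dots> = s 0 + (\<Sum>k<N. \<Sum>n\<in>{2 ^ k..<2 ^ Suc k}. s n)" unfolding sum_dyadic_blocks by simp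
  also have "\<dots> \<le> s 0 + (\<Sum>k<N. D k)"
  proof (intro add_left_mono sum_mono)
    fix k
    have "(\<Sum>n\<in>{2 ^ k..<2 ^ Suc k}. s n) \<le> (\<Sum>n\<in>{2 ^ k..<2 ^ Suc k :: nat}. D k / 2 ^ k)"
      using le by (intro sum_mono) auto
    also have "\<dots> = D k" by simp
    finally show "(\<Sum>n\<in>{2 ^ k..<2 ^ Suc k}. s n) \<le> D k" .
  qed
  also have "\<dots> \<le> s 0 + suminf D" using D by (intro add_left_mono sum_le_suminf) auto
  finally show "(\<Sum>n<N. s n) \<le> s 0 + suminf D" .
qed (rule s)

lemma dyadic_exponent:
  fixes n :: nat assumes "1 \<le> n" obtains k where "2 ^ k \<le> n" "n < 2 ^ Suc k"
  using ex_power_ivl1[of 2 n] assms by auto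

section \<open>Truncated weak moments and the function H\<close>

context prob_space begin

context
  fixes X :: "'a \<Rightarrow> 'b::{real_normed_vector, second_countable_topology}"
  assumes X [measurable]: "X \<in> borel_measurable M"
begin

abbreviation weak_moment :: "('b \<Rightarrow>\<^sub>L real) \<Rightarrow> real \<Rightarrow> real" where
  "weak_moment f t \<equiv> \<integral>\<omega>. (blinfun_apply f (X \<omega>))\<^sup>2 * indicator {\<omega>'. norm (X \<omega>') \<le> t} \<omega> \<partial>M"

lemma weak_moment_integrable:
  "norm f \<le> 1 \<Longrightarrow> integrable M (\<lambda>\<omega>. (blinfun_apply f (X \<omega>))\<^sup>2 * indicator {\<omega>'. norm (X \<omega>') \<le> t} \<omega>)"
  and weak_moment_le: "norm f \<le> 1 \<Longrightarrow> weak_moment f t \<le> t\<^sup>2"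
proof -
  assume f: "norm f \<le> 1"
  have le: "(blinfun_apply f (X \<omega>))\<^sup>2 * indicator {\<omega>'. norm (X \<omega>') \<le> t} \<omega> \<le> t\<^sup>2" for \<omega>
  proof (cases "norm (X \<omega>) \<le> t")
    case True
    then have "\<bar>blinfun_apply f (X \<omega>)\<bar>\<^sup>2 \<le> t\<^sup>2"
      using blinfun_apply_le_norm[OF f, of "X \<omega>"] by (intro power_mono) auto
    then show ?thesis using True by simp
  qed simp
  have m: "(\<lambda>\<omega>. (blinfun_apply f (X \<omega>))\<^sup>2 * indicator {\<omega>'. norm (X \<omega>') \<le> t} \<omega>) \<in> borel_measurable M"
  proof -
    have "(\<lambda>\<omega>. if norm (X \<omega>) \<le> t then (blinfun_apply f (X \<omega>))\<^sup>2 else 0) \<in> borel_measurable M" by measurable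
    then show ?thesis by (rule measurable_cong[THEN iffD1, rotated]) auto
  qed
  show i: "integrable M (\<lambda>\<omega>. (blinfun_apply f (X \<omega>))\<^sup>2 * indicator {\<omega>'. norm (X \<omega>') \<le> t} \<omega>)"
    by (rule integrable_const_bound[of _ "t\<^sup>2"]) (use le m in auto)
  have "weak_moment f t \<le> (\<integral>\<omega>. t\<^sup>2 \<partial>M)" by (rule integral_mono[OF i]) (use le in auto)
  then show "weak_moment f t \<le> t\<^sup>2" by (simp add: prob_space)
qed

lemma weak_moment_bdd: "bdd_above ((\<lambda>f. weak_moment f t) ` {f. norm f \<le> 1})"
  using weak_moment_le by (intro bdd_aboveI2[where M = "t\<^sup>2"]) auto

lemma weak_moment_le_H: "norm f \<le> 1 \<Longrightarrow> weak_moment f t \<le> H_fun M X t"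
  unfolding H_fun_def by (rule cSUP_upper[OF _ weak_moment_bdd]) simp

lemma H_nonneg: "0 \<le> H_fun M X t"
  using weak_moment_le_H[of 0 t] by simp

lemma H_mono: "s \<le> t \<Longrightarrow> H_fun M X s \<le> H_fun M X t"
proof -
  assume st: "s \<le> t"
  show ?thesis unfolding H_fun_def[of M X s]
  proof (rule cSUP_least)
    fix f :: "'b \<Rightarrow>\<^sub>L real" assume "f \<in> {f. norm f \<le> 1}"
    then have f: "norm f \<le> 1" by simp
    have "weak_moment f s \<le> weak_moment f t"
      by (intro integral_mono weak_moment_integrable f mult_left_mono) (use st in \<open>auto simp: indicator_def\<close>)
    also have "\<dots> \<le> H_fun M X t" by (rule weak_moment_le_H[OF f])
    finally show "weak_moment f s \<le> H_fun M X t" .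
  qed (auto intro!: exI[of _ "0 :: 'b \<Rightarrow>\<^sub>L real"])
qed

text \<open>Positivity leaves room below the supremum, so some functional reaches half of it even if
  none attains it.\<close>

lemma H_near_sup: assumes "0 < H_fun M X t" shows "\<exists>f. norm f \<le> 1 \<and> H_fun M X t / 2 \<le> weak_moment f t"
proof (rule ccontr)
  assume neg: "\<not> ?thesis"
  have "(SUP f\<in>{f. norm f \<le> 1}. weak_moment f t) \<le> H_fun M X t / 2"
  proof (rule cSUP_least)
    fix f :: "'b \<Rightarrow>\<^sub>L real" assume "f \<in> {f. norm f \<le> 1}"
    then show "weak_moment f t \<le> H_fun M X t / 2" using neg by (meson less_imp_le mem_Collect_eq not_le)
  qed (auto intro!: exI[of _ "0 :: 'b \<Rightarrow>\<^sub>L real"])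
  then have "H_fun M X t \<le> H_fun M X t / 2" unfolding H_fun_def[of M X t, symmetric] .
  then show False using assms by simp
qed

end

end

theorem theorem1:
  fixes M :: "'a measure"
    and X :: "'a \<Rightarrow> 'b :: {banach, second_countable_topology}"
    and Xs :: "nat \<Rightarrow> 'a \<Rightarrow> 'b"
    and h :: "real \<Rightarrow> real"
  assumes "prob_space M"
    and "X \<in> borel_measurable M"
    and "\<And>i. Xs i \<in> borel_measurable M"
    and "prob_space.indep_vars M (\<lambda>_. borel) Xs {1..}"
    and "\<And>i. i \<ge> 1 \<Longrightarrow> distr M borel (Xs i) = distr M borel X"
    and "h \<in> class_H"
  shows "(AE \<omega> in M. limsup (\<lambda>n. ereal (norm (\<Sum>i=1..n. Xs i \<omega>) / Psi h (real n))) < \<infinity>)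
    \<longleftrightarrow>
     ((integrable M X \<and> integral\<^sup>L M X = 0
        \<and> (\<integral>\<^sup>+ \<omega>. ennreal (Psi_inv h (norm (X \<omega>))) \<partial>M) < \<infinity>)
      \<and> (\<forall>\<epsilon>>0. \<exists>K. \<forall>n\<ge>1.
           measure M {\<omega> \<in> space M. norm ((1 / Psi h (real n)) *\<^sub>R (\<Sum>i=1..n. Xs i \<omega>)) > K} \<le> \<epsilon>)
      \<and> (\<exists>c\<ge>0. summable (\<lambda>n. series_term M X h c (Suc n))))"
proof -
  interpret prob_space M by fact
  note Xm [measurable] = assms(2) and Xsm [measurable] = assms(3) and indX = assms(4) and lawX = assms(5) and h = assms(6)
  \<comment> \<open>The given variables are numbered from 1, the sequences treated so far from 0;
    the shift by \<open>Suc\<close> reconciles the two.\<close>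
  interpret S: iid_seq M "\<lambda>i. Xs (Suc i)"
  proof
    have "indep_vars (\<lambda>j. PiM {Suc j} (\<lambda>_. borel)) (\<lambda>j \<omega>. restrict (\<lambda>i. Xs i \<omega>) {Suc j}) (UNIV :: nat set)"
      by (rule indep_vars_restrict[OF indX]) (auto simp: disjoint_family_on_def)
    then have "indep_vars (\<lambda>_. borel) (\<lambda>j x. (restrict (\<lambda>i. Xs i x) {Suc j}) (Suc j)) (UNIV :: nat set)"
      by (rule indep_vars_compose2[where Y = "\<lambda>j v. v (Suc j)"]) simp
    then show "indep_vars (\<lambda>_. borel) (\<lambda>i. Xs (Suc i)) UNIV" by simp
    show "distr M borel (Xs (Suc i)) = distr M borel (Xs (Suc 0))" for i using lawX by simp
  qed
  have sum_eq: "(\<Sum>i=1..n. Xs i \<omega>) = S.psum n \<omega>" for n \<omega>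
    by (simp add: S.psum_def sum.atLeast1_atMost_eq)
  have law0: "distr M borel (Xs (Suc 0)) = distr M borel X" using lawX by simp
  have int_law: "(\<integral>\<omega>. g (Xs (Suc 0) \<omega>) \<partial>M) = (\<integral>\<omega>. g (X \<omega>) \<partial>M)" if "g \<in> borel_measurable borel" for g :: "'b \<Rightarrow> real"
  proof -
    have "(\<integral>\<omega>. g (Xs (Suc 0) \<omega>) \<partial>M) = (\<integral>y. g y \<partial>distr M borel (Xs (Suc 0)))" using that by (subst integral_distr) auto
    also have "\<dots> = (\<integral>\<omega>. g (X \<omega>) \<partial>M)" unfolding law0 using that by (subst integral_distr) auto
    finally show ?thesis .
  qed
  have integrable_law: "integrable M (\<lambda>\<omega>. g (Xs (Suc 0) \<omega>)) \<longleftrightarrow> integrable M (\<lambda>\<omega>. g (X \<omega>))" if "g \<in> borel_measurable borel" for g :: "'b \<Rightarrow> real"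
  proof -
    have "integrable M (\<lambda>\<omega>. g (Xs (Suc 0) \<omega>)) \<longleftrightarrow> integrable (distr M borel (Xs (Suc 0))) g" using that by (subst integrable_distr_eq) auto
    also have "\<dots> \<longleftrightarrow> integrable M (\<lambda>\<omega>. g (X \<omega>))" unfolding law0 using that by (subst integrable_distr_eq) auto
    finally show ?thesis .
  qed
  have weak_law: "(\<integral>\<omega>. (blinfun_apply f (Xs (Suc 0) \<omega>))\<^sup>2 * indicator {\<omega>. norm (Xs (Suc 0) \<omega>) \<le> t} \<omega> \<partial>M) = weak_moment X f t" for f :: "'b \<Rightarrow>\<^sub>L real" and t
    using int_law[of "\<lambda>y. (blinfun_apply f y)\<^sup>2 * indicator {y. norm y \<le> t} y"] by (simp add: indicator_def)
  have Pm: "(\<lambda>y::'b. Psi_inv h (norm y)) \<in> borel_measurable borel" by (rule Psi_inv_measurable[OF h]) auto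
  have Psi_int: "integrable M (\<lambda>\<omega>. Psi_inv h (norm (X \<omega>))) \<longleftrightarrow> (\<integral>\<^sup>+ \<omega>. ennreal (Psi_inv h (norm (X \<omega>))) \<partial>M) < \<infinity>"
    using Psi_inv_nonneg[OF h] measurable_compose[OF Xm Pm] by (simp add: integrable_iff_bounded)
  have Psi_pos': "0 < Psi h (real n)" if "1 \<le> n" for n using that by (intro Psi_pos[OF h]) simp
  have ii_eq: "measure M {\<omega> \<in> space M. norm ((1 / Psi h (real n)) *\<^sub>R (\<Sum>i=1..n. Xs i \<omega>)) > K} = S.tail n (K * Psi h (real n))"
    if "1 \<le> n" for n K
    unfolding S.tail_def sum_eq using Psi_pos'[OF that] by (simp add: pos_less_divide_eq)
  define H where "H k = H_fun M X (Psi h (2 ^ k))" for k :: nat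
  have H0: "0 \<le> H k" for k unfolding H_def by (rule H_nonneg[OF Xm])
  have H_le: "H_fun M X (Psi h x) \<le> H k" if "0 \<le> x" "x \<le> 2 ^ k" for x k
    unfolding H_def by (intro H_mono[OF Xm] Psi_mono[OF h] that)
  have H_ge: "H k \<le> H_fun M X (Psi h x)" if "2 ^ k \<le> x" for x k
    unfolding H_def by (intro H_mono[OF Xm] Psi_mono[OF h] that) simp
  obtain k0 where k0: "\<And>k. k0 \<le> k \<Longrightarrow> h (2 ^ Suc k) \<le> 2 * h (2 ^ k)" using h_doubling[OF h, of 2] by auto
  have st0: "0 \<le> series_term M X h c n" for c n unfolding series_term_def by (simp add: Let_def)
  show ?thesis
  proof
    assume L: "AE \<omega> in M. limsup (\<lambda>n. ereal (norm (\<Sum>i=1..n. Xs i \<omega>) / Psi h (real n))) < \<infinity>"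
    have bd: "AE \<omega> in M. \<exists>C. \<forall>n\<ge>1. norm (S.psum n \<omega>) \<le> C * Psi h (real n)"
      using L
    proof eventually_elim
      case (elim \<omega>)
      let ?x = "\<lambda>n. norm (S.psum n \<omega>) / Psi h (real n)"
      obtain m :: nat where "limsup (\<lambda>n. ereal (?x n)) < ereal (real m)"
        using elim unfolding sum_eq by (metis less_PInf_Ex_of_nat less_irrefl)
      then have "eventually (\<lambda>n. ereal (?x n) < ereal (real m)) sequentially" by (rule Limsup_lessD)
      then obtain N where N: "\<And>n. N \<le> n \<Longrightarrow> ?x n < real m" by (auto simp: eventually_sequentially)
      have x0: "0 \<le> ?x n" for n using Psi_nonneg[OF h] by simp
      \<comment> \<open>Adding the finitely many early ratios to the eventual bound yields one that
        holds from n = 1 on.\<close>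
      define C where "C = real m + (\<Sum>n<N. ?x n)"
      have xC: "?x n \<le> C" for n
      proof (cases "n < N")
        case True
        then have "?x n \<le> (\<Sum>n<N. ?x n)" using x0 by (intro member_le_sum) auto
        then show ?thesis unfolding C_def by linarith
      next
        case False
        then have "?x n < real m" using N by simp
        moreover have "0 \<le> (\<Sum>n<N. ?x n)" using x0 by (intro sum_nonneg) auto
        ultimately show ?thesis unfolding C_def by linarith
      qed
      have "norm (S.psum n \<omega>) \<le> C * Psi h (real n)" if "1 \<le> n" for n
        using xC[of n] Psi_pos'[OF that] by (simp add: pos_divide_le_eq)
      then show ?case by blast
    qed
    have i1: "integrable M X"
      using S.bounded_integrable[OF h bd] integrable_law[of norm] by (simp add: integrable_norm_iff)
    \<comment> \<open>The vector-valued mean vanishes because a functional norming it has mean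
      0.\<close>
    have "\<exists>f :: 'b \<Rightarrow>\<^sub>L real. norm f \<le> 1 \<and> blinfun_apply f (integral\<^sup>L M X) = norm (integral\<^sup>L M X)"
      by (rule norming_functional)
    then obtain f :: "'b \<Rightarrow>\<^sub>L real" where f: "norm f \<le> 1" "blinfun_apply f (integral\<^sup>L M X) = norm (integral\<^sup>L M X)" by blast
    have "norm (integral\<^sup>L M X) = (\<integral>\<omega>. blinfun_apply f (X \<omega>) \<partial>M)"
      unfolding f(2)[symmetric] by (rule integral_bounded_linear[OF blinfun.bounded_linear_right i1, symmetric])
    also have "\<dots> = 0" using S.bounded_mean_zero[OF h bd f(1)] int_law[of "blinfun_apply f"] by simp
    finally have i2: "integral\<^sup>L M X = 0" by simp
    have i3: "(\<integral>\<^sup>+ \<omega>. ennreal (Psi_inv h (norm (X \<omega>))) \<partial>M) < \<infinity>"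
      using S.bounded_integrable_Psi_inv[OF h bd] integrable_law[OF Pm] Psi_int by simp
    have ii: "\<exists>K. \<forall>n\<ge>1. measure M {\<omega> \<in> space M. norm ((1 / Psi h (real n)) *\<^sub>R (\<Sum>i=1..n. Xs i \<omega>)) > K} \<le> \<epsilon>"
      if e: "0 < \<epsilon>" for \<epsilon>
    proof -
      obtain C where C: "prob {\<omega>\<in>space M. \<exists>n\<ge>1. C * Psi h (real n) < norm (S.psum n \<omega>)} \<le> \<epsilon>"
        using S.bounded_in_probability[OF h bd e] by auto
      have "{\<omega>\<in>space M. \<exists>n\<in>{1..}. C * Psi h (real n) < norm (S.psum n \<omega>)} \<in> sets M" by measurable
      then have m: "{\<omega>\<in>space M. \<exists>n\<ge>1. C * Psi h (real n) < norm (S.psum n \<omega>)} \<in> sets M" by (simp add: Bex_def)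
      have "S.tail n (C * Psi h (real n)) \<le> \<epsilon>" if "1 \<le> n" for n
        unfolding S.tail_def by (rule order_trans[OF finite_measure_mono[OF _ m] C]) (use that in auto)
      then show ?thesis using ii_eq by (intro exI[of _ C]) simp
    qed
    have iii: "\<exists>c\<ge>0. summable (\<lambda>n. series_term M X h c (Suc n))"
    proof (cases "\<exists>k1. 0 < H k1")
      case False
      \<comment> \<open>In this degenerate case every term of the series is 0 by convention, and c =
        0 works.\<close>
      have "H_fun M X (Psi h (real n)) = 0" for n
      proof -
        have "real n \<le> 2 ^ n" using less_exp[of n] by (metis of_nat_le_iff of_nat_numeral of_nat_power less_imp_le)
        then have "H_fun M X (Psi h (real n)) \<le> H n" by (intro H_le) auto
        moreover have "\<not> 0 < H n" using False by blast
        then have "H n = 0" using H0[of n] by linarith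
        ultimately show ?thesis using H_nonneg[OF Xm, of "Psi h (real n)"] by simp
      qed
      then have "series_term M X h 0 n = 0" for n unfolding series_term_def by simp
      then show ?thesis by (intro exI[of _ 0]) simp
    next
      case True
      then obtain k1 where k1: "0 < H k1" by blast
      have Hm: "H k1 \<le> H k" if "k1 \<le> k" for k
        unfolding H_def[of k] using that by (intro H_ge power_increasing) auto
      have "\<exists>A\<ge>0. summable (\<lambda>k. exp (- (A * h (2 ^ k) / H k)))"
      proof (rule S.dyadic_lower_bound[OF h bd k1 Hm])
        fix k assume "k1 \<le> k"
        then have "0 < H k" using k1 Hm[of k] by simp
        then show "\<exists>f :: 'b \<Rightarrow>\<^sub>L real. norm f \<le> 1 \<and> H k / 2 \<le>
           (\<integral>\<omega>. (blinfun_apply f (Xs (Suc 0) \<omega>))\<^sup>2 * indicator {\<omega>. norm (Xs (Suc 0) \<omega>) \<le> Psi h (2 ^ k)} \<omega> \<partial>M)"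
          unfolding weak_law H_def by (rule H_near_sup[OF Xm])
      qed
      then obtain A where A: "0 \<le> A" "summable (\<lambda>k. exp (- (A * h (2 ^ k) / H k)))" by blast
      \<comment> \<open>Half of c^2 is 2 A; the factor 2 compensates for h at the right end of a
        block being up to twice its value inside.\<close>
      define c where "c = 2 * sqrt A"
      have c: "0 \<le> c" "c\<^sup>2 = 4 * A" using A by (auto simp: c_def power_mult_distrib)
      define D where "D k = (if k < k0 then 1 else exp (- (A * h (2 ^ Suc k) / H (Suc k))))" for k
      have "summable (\<lambda>k. exp (- (A * h (2 ^ Suc k) / H (Suc k))))" using A(2) by (subst summable_Suc_iff)
      then have Ds: "summable D"
        by (rule summable_cong[THEN iffD1, rotated]) (auto simp: D_def eventually_sequentially intro!: exI[of _ k0])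
      have "summable (\<lambda>n. series_term M X h c n)"
      proof (rule summable_of_dyadic_bound[OF st0 _ Ds])
        show "0 \<le> D k" for k unfolding D_def by simp
        fix k n :: nat assume n: "2 ^ k \<le> n" "n < 2 ^ Suc k"
        have nr: "2 ^ k \<le> real n" "real n \<le> 2 ^ Suc k"
          using n by (metis of_nat_le_iff of_nat_numeral of_nat_power, metis of_nat_le_iff of_nat_numeral of_nat_power less_imp_le)
        have npos: "0 < real n" using nr(1) by (rule less_le_trans[rotated]) simp
        define Hn where "Hn = H_fun M X (Psi h (real n))"
        show "series_term M X h c n \<le> D k / 2 ^ k"
        proof (cases "Hn = 0")
          case True
          then show ?thesis unfolding series_term_def Hn_def[symmetric] by (simp add: D_def)
        next
          case False
          then have Hn: "0 < Hn" using H_nonneg[OF Xm, of "Psi h (real n)"] by (simp add: Hn_def)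
          have HS: "Hn \<le> H (Suc k)" unfolding Hn_def using nr by (intro H_le) auto
          have hn: "h (2 ^ k) \<le> h (real n)" using nr by (intro h_mono[OF h]) auto
          have "exp (- (c\<^sup>2 * h (real n)) / (2 * Hn)) \<le> D k"
          proof (cases "k < k0")
            case True
            then show ?thesis using Hn A h_pos[OF h, of "real n"] by (simp add: D_def c)
          next
            case False
            have "A * h (2 ^ Suc k) / H (Suc k) \<le> A * (2 * h (2 ^ k)) / Hn"
              using k0[of k] False A HS Hn h_pos[OF h, of "2 ^ Suc k"] h_pos[OF h, of "2 ^ k"]
              by (intro frac_le mult_left_mono mult_nonneg_nonneg) auto
            also have "\<dots> \<le> A * (2 * h (real n)) / Hn" using hn A Hn by (intro divide_right_mono mult_left_mono) auto
            also have "\<dots> = c\<^sup>2 * h (real n) / (2 * Hn)" using Hn by (simp add: c)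
            finally show ?thesis using False by (simp add: D_def)
          qed
          then have "series_term M X h c n \<le> (1 / real n) * D k"
            unfolding series_term_def Hn_def[symmetric] using False by (simp add: divide_right_mono)
          also have "\<dots> \<le> (1 / 2 ^ k) * D k" using nr npos by (intro mult_right_mono divide_left_mono) (auto simp: D_def)
          finally show ?thesis by simp
        qed
      qed
      then have "summable (\<lambda>n. series_term M X h c (Suc n))" by (subst summable_Suc_iff)
      then show ?thesis using c by blast
    qed
    show "(integrable M X \<and> integral\<^sup>L M X = 0
        \<and> (\<integral>\<^sup>+ \<omega>. ennreal (Psi_inv h (norm (X \<omega>))) \<partial>M) < \<infinity>)
      \<and> (\<forall>\<epsilon>>0. \<exists>K. \<forall>n\<ge>1.
           measure M {\<omega> \<in> space M. norm ((1 / Psi h (real n)) *\<^sub>R (\<Sum>i=1..n. Xs i \<omega>)) > K} \<le> \<epsilon>)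
      \<and> (\<exists>c\<ge>0. summable (\<lambda>n. series_term M X h c (Suc n)))"
      using i1 i2 i3 ii iii by blast
  next
    assume R: "(integrable M X \<and> integral\<^sup>L M X = 0
        \<and> (\<integral>\<^sup>+ \<omega>. ennreal (Psi_inv h (norm (X \<omega>))) \<partial>M) < \<infinity>)
      \<and> (\<forall>\<epsilon>>0. \<exists>K. \<forall>n\<ge>1.
           measure M {\<omega> \<in> space M. norm ((1 / Psi h (real n)) *\<^sub>R (\<Sum>i=1..n. Xs i \<omega>)) > K} \<le> \<epsilon>)
      \<and> (\<exists>c\<ge>0. summable (\<lambda>n. series_term M X h c (Suc n)))"
    have i: "integrable M (\<lambda>\<omega>. Psi_inv h (norm (Xs (Suc 0) \<omega>)))"
      using R Psi_int integrable_law[OF Pm] by simp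
    \<comment> \<open>Boundedness in probability is used at the single value 1/12: symmetrization
      and restriction double it to 1/6 and 1/3, where Ottaviani's inequality still leaves
      1/2.\<close>
    from R have "\<exists>K. \<forall>n\<ge>1. measure M {\<omega> \<in> space M. norm ((1 / Psi h (real n)) *\<^sub>R (\<Sum>i=1..n. Xs i \<omega>)) > K} \<le> 1/12"
      by (meson zero_less_divide_1_iff zero_less_numeral)
    then obtain K1 where K1: "\<And>n. 1 \<le> n \<Longrightarrow> S.tail n (K1 * Psi h (real n)) \<le> 1/12" using ii_eq by auto
    define K where "K = max K1 0"
    have K: "S.tail n (K * Psi h (real n)) \<le> 1/12" if "1 \<le> n" for n
    proof -
      have "K1 * Psi h (real n) \<le> K * Psi h (real n)" unfolding K_def by (intro mult_right_mono Psi_nonneg[OF h]) auto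
      then have "S.tail n (K * Psi h (real n)) \<le> S.tail n (K1 * Psi h (real n))" by (rule S.tail_antimono)
      then show ?thesis using K1[OF that] by linarith
    qed
    obtain c where c: "0 \<le> c" "summable (\<lambda>n. series_term M X h c (Suc n))" using R by blast
    have s: "summable (\<lambda>n. series_term M X h c n)" using c(2) by (subst (asm) summable_Suc_iff)
    \<comment> \<open>Here H at the left end is a lower bound for H in the block, and h at most
      doubles. Each of the 2^k terms of the block is at least \<open>E k / 2 ^ Suc k\<close>, so the
      block sum is at least half of \<open>E k\<close>; the missing factor 2 in the denominator of
      the exponent is the doubling of h.\<close>
    define E where "E k = (if H k = 0 then 0 else exp (- (c\<^sup>2 * h (2 ^ k) / H k)))" for k
    have "summable (\<lambda>k. 2 * (\<Sum>n\<in>{2 ^ k..<2 ^ Suc k}. series_term M X h c n))"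
      by (intro summable_mult summable_dyadic_blocks s st0)
    then have Es: "summable E"
    proof (rule summable_comparison_test_ev[rotated])
      show "eventually (\<lambda>k. norm (E k) \<le> 2 * (\<Sum>n\<in>{2 ^ k..<2 ^ Suc k}. series_term M X h c n)) sequentially"
        using eventually_ge_at_top[of k0]
      proof eventually_elim
        case (elim k)
        have "E k / 2 ^ Suc k \<le> series_term M X h c n" if "n \<in> {2 ^ k..<2 ^ Suc k}" for n
        proof (cases "H k = 0")
          case True
          then show ?thesis using st0 by (simp add: E_def)
        next
          case False
          have n: "2 ^ k \<le> n" "n < 2 ^ Suc k" using that by auto
          have nr: "2 ^ k \<le> real n" "real n \<le> 2 ^ Suc k"
            using n by (metis of_nat_le_iff of_nat_numeral of_nat_power, metis of_nat_le_iff of_nat_numeral of_nat_power less_imp_le)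
          have npos: "0 < real n" using nr(1) by (rule less_le_trans[rotated]) simp
          define Hn where "Hn = H_fun M X (Psi h (real n))"
          have Hk: "0 < H k" using False H0[of k] by simp
          have HH: "H k \<le> Hn" unfolding Hn_def by (rule H_ge[OF nr(1)])
          have "h (real n) \<le> h (2 ^ Suc k)" using nr by (intro h_mono[OF h]) auto
          also have "\<dots> \<le> 2 * h (2 ^ k)" by (rule k0[OF elim])
          finally have "c\<^sup>2 * h (real n) / (2 * Hn) \<le> c\<^sup>2 * (2 * h (2 ^ k)) / (2 * H k)"
            using HH Hk h_pos[OF h, of "real n"] h_pos[OF h, of "2 ^ k"] by (intro frac_le mult_left_mono mult_nonneg_nonneg) auto
          then have e: "E k \<le> exp (- (c\<^sup>2 * h (real n)) / (2 * Hn))" using False by (simp add: E_def)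
          have "E k / 2 ^ Suc k \<le> E k / real n" using nr npos by (intro divide_left_mono) (auto simp: E_def)
          also have "\<dots> \<le> exp (- (c\<^sup>2 * h (real n)) / (2 * Hn)) / real n" using e npos by (intro divide_right_mono) auto
          also have "\<dots> = series_term M X h c n" unfolding series_term_def Hn_def[symmetric] using Hk HH by simp
          finally show ?thesis .
        qed
        then have "(\<Sum>n\<in>{2 ^ k..<2 ^ Suc k :: nat}. E k / 2 ^ Suc k) \<le> (\<Sum>n\<in>{2 ^ k..<2 ^ Suc k}. series_term M X h c n)"
          by (intro sum_mono)
        moreover have "(\<Sum>n\<in>{2 ^ k..<2 ^ Suc k :: nat}. E k / 2 ^ Suc k) = E k / 2" by simp
        moreover have "0 \<le> E k" by (simp add: E_def)
        ultimately show ?case by simp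
      qed
    qed
    have "\<exists>C\<ge>0. AE \<omega> in M. \<exists>k0. \<forall>k\<ge>k0. \<forall>j\<le>2 ^ k. norm (S.psum j \<omega>) \<le> C * Psi h (2 ^ k)"
    proof (rule S.dyadic_upper_bound[OF h i _ K H0 _ c(1) Es[unfolded E_def[abs_def]]])
      show "0 \<le> K" by (simp add: K_def)
      show "(\<integral>\<omega>. (blinfun_apply f (Xs (Suc 0) \<omega>))\<^sup>2 * indicator {\<omega>. norm (Xs (Suc 0) \<omega>) \<le> Psi h (2 ^ k)} \<omega> \<partial>M) \<le> H k"
        if "norm f \<le> 1" for f :: "'b \<Rightarrow>\<^sub>L real" and k
        unfolding weak_law H_def by (rule weak_moment_le_H[OF Xm that])
    qed simp_all
    then obtain C where C: "0 \<le> C" and ae: "AE \<omega> in M. \<exists>k0. \<forall>k\<ge>k0. \<forall>j\<le>2 ^ k. norm (S.psum j \<omega>) \<le> C * Psi h (2 ^ k)" by blast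
    obtain k2 where k2: "\<And>k. k2 \<le> k \<Longrightarrow> Psi h (2 ^ Suc k) \<le> 2 * Psi h (2 ^ k)" using Psi_doubling[OF h] by blast
    show "AE \<omega> in M. limsup (\<lambda>n. ereal (norm (\<Sum>i=1..n. Xs i \<omega>) / Psi h (real n))) < \<infinity>"
      using ae
    proof eventually_elim
      case (elim \<omega>)
      then obtain k3 where k3: "\<And>k j. k3 \<le> k \<Longrightarrow> j \<le> 2 ^ k \<Longrightarrow> norm (S.psum j \<omega>) \<le> C * Psi h (2 ^ k)" by blast
      \<comment> \<open>For n between two powers of two the bound at the larger one is used, and
        doubling of Psi brings it back to n at the cost of a factor 2.\<close>
      have "norm (S.psum n \<omega>) / Psi h (real n) \<le> 2 * C" if n: "2 ^ max k2 k3 \<le> n" for n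
      proof -
        have n1: "1 \<le> n" using n by (rule order_trans[rotated]) simp
        obtain k where k: "2 ^ k \<le> n" "n < 2 ^ Suc k" using dyadic_exponent[OF n1] .
        have "(2::nat) ^ max k2 k3 < 2 ^ Suc k" using n k(2) by linarith
        then have "max k2 k3 < Suc k" by (rule power_less_imp_less_exp[rotated]) simp
        then have kk: "k2 \<le> k" "k3 \<le> Suc k" by auto
        have "norm (S.psum n \<omega>) \<le> C * Psi h (2 ^ Suc k)" using k3[OF kk(2), of n] k(2) by simp
        also have "\<dots> \<le> C * (2 * Psi h (2 ^ k))" by (intro mult_left_mono k2 kk C)
        also have "\<dots> \<le> C * (2 * Psi h (real n))"
        proof -
          have "2 ^ k \<le> real n" using k(1) by (metis of_nat_le_iff of_nat_numeral of_nat_power)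
          then show ?thesis by (intro mult_left_mono Psi_mono[OF h] C) auto
        qed
        finally show ?thesis using Psi_pos'[OF n1] by (simp add: pos_divide_le_eq)
      qed
      then have "eventually (\<lambda>n. ereal (norm (S.psum n \<omega>) / Psi h (real n)) \<le> ereal (2 * C)) sequentially"
        by (auto simp: eventually_sequentially)
      then have "limsup (\<lambda>n. ereal (norm (S.psum n \<omega>) / Psi h (real n))) \<le> ereal (2 * C)" by (rule Limsup_bounded)
      then show ?case unfolding sum_eq by (rule le_less_trans) simp
    qed
  qed
qed

end
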